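(* Let $(X,d,m,\mathcal{E},\mathcal{F})$ be an MMD space that satisfies the heat kernel estimate $\operatorname{HKE}(\Psi)$ for some scale function $\Psi$, and let $m$ be a doubling measure. Then for any uniform domain $U$ in $X$ and any $f\in\mathcal{F}$, $$\Gamma(f,f)(\partial U)=0,$$ where $\Gamma(f,f)$ denotes the energy measure of $f$ and $\partial U$ is the topological boundary of $U$ in $X$.
   Context: A metric measure space $(X,d,m)$ is a metric space in which every open ball $B(x,r)=\{y\in X:d(x,y)<r\}$, $x\in X$, $r>0$, is relatively compact, together with a Radon measure $m$ on $X$ of full support. An MMD space $(X,d,m,\mathcal{E},\mathcal{F})$ is a metric measure space with a regular symmetric Dirichlet form $(\mathcal{E},\mathcal{F})$ on $L^2(X,m)$ that is strongly local: $\mathcal{E}(f,g)=0$ whenever $f,g\in\mathcal{F}$ have compact $\operatorname{supp}_m[f],\operatorname{supp}_m[g]$ and $\operatorname{supp}_m[f-a\mathbf 1_X]\cap\operatorname{supp}_m[g]=\emptyset$ for some $a\in\mathbb{R}$, where $\operatorname{supp}_m[f]$ is the support of $|f|\,dm$. Doubling: there is $D_0\ge1$ with $m(B(x,2r))\le D_0\,m(B(x,r))$ for all $x\in X$, $r>0$. Energy measure: for $f\in\mathcal{F}\cap L^\infty(X,m)$, $\Gamma(f,f)$ is the unique Borel measure on $X$ with $\int g\,d\Gamma(f,f)=\mathcal{E}(f,fg)-\frac12\mathcal{E}(f^2,g)$ for all $g\in\mathcal{F}\cap C_c(X)$; for general $f\in\mathcal{F}$, $\Gamma(f,f)(A)=\lim_{n\to\infty}\Gamma(f_n,f_n)(A)$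 with $f_n=(-n)\vee(f\wedge n)$. Uniform domain: for open $U\subsetneq X$ let $\delta_U(z)=\inf\{d(z,y):y\in X\setminus U\}$. For $A\ge1$, a connected, non-empty, proper open set $U\subsetneq X$ is an $A$-uniform domain if for all $x,y\in U$ there is a curve (continuous image of an interval) $\gamma$ in $U$ from $x$ to $y$ with $\operatorname{diam}(\gamma)\le A\,d(x,y)$ and $\delta_U(z)\ge A^{-1}\min(d(x,z),d(y,z))$ for all $z\in\gamma$. A uniform domain is an $A$-uniform domain for some $A\ge1$. Scale function: a continuous increasing bijection $\Psi:(0,\infty)\to(0,\infty)$ for which there are $1<\beta_1<\beta_2$ and $C>1$ with $C^{-1}(R/r)^{\beta_1}\le\Psi(R)/\Psi(r)\le C(R/r)^{\beta_2}$ for all $0<r\le R$. Put $\Phi(s)=\sup_{r>0}\left(\frac sr-\frac1{\Psi(r)}\right)$. $\operatorname{HKE}(\Psi)$: there are $C_1,c_1,c_2,c_3,\delta\in(0,\infty)$ and a heat kernel $\{p_t\}_{t>0}$ (non-negative Borel integral kernels of the Markov semigroup $P_t$ associated with $(\mathcal{E},\mathcal{F})$) such that for every $t>0$: $p_t(x,y)\le\frac{C_1}{m(B(x,\Psi^{-1}(t)))}\exp\left(-c_1t\,\Phi\left(c_2\frac{d(x,y)}{t}\right)\right)$ for $m$-a.e. $x,y\in X$, and $p_t(x,y)\ge\frac{c_3}{m(B(x,\Psi^{-1}(t)))}$ for $m$-a.e. $x,y\in X$ with $d(x,y)\le\delta\Psi^{-1}(t)$. *)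

theory Defs
  imports "HOL-Analysis.Analysis"
begin

text \<open>The space \<open>X\<close> is the universe of a type of class \<^class>\<open>metric_space\<close>.\<close>

definition radon_measure :: "'a::topological_space measure \<Rightarrow> bool" where
  "radon_measure m \<longleftrightarrow>
     sets m = sets borel \<and>
     (\<forall>K. compact K \<longrightarrow> emeasure m K < \<infinity>) \<and>
     (\<forall>B\<in>sets borel. emeasure m B = (INF V\<in>{V. B \<subseteq> V \<and> open V}. emeasure m V)) \<and>
     (\<forall>V. open V \<longrightarrow> emeasure m V = (SUP K\<in>{K. K \<subseteq> V \<and> compact K}. emeasure m K))"

definition measure_support :: "'a::topological_space measure \<Rightarrow> 'a set" where
  "measure_support \<mu> = {x. \<forall>V. open V \<longrightarrow> x \<in> V \<longrightarrow> emeasure \<mu> V > 0}"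

definition supp_m :: "'a::topological_space measure \<Rightarrow> ('a \<Rightarrow> real) \<Rightarrow> 'a set" where
  "supp_m m f = measure_support (density m (\<lambda>x. ennreal \<bar>f x\<bar>))"

locale metric_measure_space =
  fixes m :: "'a::metric_space measure"
  assumes relatively_compact_ball: "\<And>(x::'a) r. r > 0 \<Longrightarrow> compact (closure (ball x r))"
    and radon: "radon_measure m"
    and full_support: "measure_support m = UNIV"

text \<open>
  Elements of \<open>L\<^sup>2(X,m)\<close> are represented by Borel functions. Equality in \<open>L\<^sup>2\<close> is equality
  almost everywhere, so everything built on these functions is required to respect it.
\<close>

definition L2 :: "'a measure \<Rightarrow> ('a \<Rightarrow> real) set" where
  "L2 m = {f \<in> borel_measurable m. integrable m (\<lambda>x. (f x)\<^sup>2)}"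

definition L2_inner :: "'a measure \<Rightarrow> ('a \<Rightarrow> real) \<Rightarrow> ('a \<Rightarrow> real) \<Rightarrow> real" where
  "L2_inner m f g = (\<integral>x. f x * g x \<partial>m)"

definition L2_norm :: "'a measure \<Rightarrow> ('a \<Rightarrow> real) \<Rightarrow> real" where
  "L2_norm m f = sqrt (L2_inner m f f)"

definition Linfty :: "'a measure \<Rightarrow> ('a \<Rightarrow> real) set" where
  "Linfty m = {f \<in> borel_measurable m. \<exists>C. AE x in m. \<bar>f x\<bar> \<le> C}"

definition C_c :: "('a::topological_space \<Rightarrow> real) set" where
  "C_c = {f. continuous_on UNIV f \<and> compact (closure {x. f x \<noteq> 0})}"

definition E1 :: "'a measure \<Rightarrow> (('a \<Rightarrow> real) \<Rightarrow> ('a \<Rightarrow> real) \<Rightarrow> real) \<Rightarrow> ('a \<Rightarrow> real) \<Rightarrow> ('a \<Rightarrow> real) \<Rightarrow> real" where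
  "E1 m E f g = E f g + L2_inner m f g"

text \<open>The form \<open>E\<close> is a total function; only its values on \<open>F \<times> F\<close> are meaningful.\<close>

locale dirichlet_form =
  fixes m :: "'a measure"
    and E :: "('a \<Rightarrow> real) \<Rightarrow> ('a \<Rightarrow> real) \<Rightarrow> real"
    and F :: "('a \<Rightarrow> real) set"
  assumes F_subset_L2: "F \<subseteq> L2 m"
    and F_cong_AE: "\<And>f g. f \<in> F \<Longrightarrow> g \<in> borel_measurable m \<Longrightarrow> (AE x in m. f x = g x) \<Longrightarrow> g \<in> F"
    and E_cong_AE: "\<And>f f' g. f \<in> F \<Longrightarrow> f' \<in> F \<Longrightarrow> g \<in> F \<Longrightarrow> (AE x in m. f x = f' x) \<Longrightarrow> E f g = E f' g"
    and F_add: "\<And>f g. f \<in> F \<Longrightarrow> g \<in> F \<Longrightarrow> (\<lambda>x. f x + g x) \<in> F"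
    and F_scale: "\<And>f a. f \<in> F \<Longrightarrow> (\<lambda>x. a * f x) \<in> F"
    and F_dense: "\<And>f \<epsilon>. f \<in> L2 m \<Longrightarrow> \<epsilon> > 0 \<Longrightarrow> \<exists>g\<in>F. L2_norm m (\<lambda>x. f x - g x) < \<epsilon>"
    and E_add: "\<And>f g h. f \<in> F \<Longrightarrow> g \<in> F \<Longrightarrow> h \<in> F \<Longrightarrow> E (\<lambda>x. f x + g x) h = E f h + E g h"
    and E_scale: "\<And>f g a. f \<in> F \<Longrightarrow> g \<in> F \<Longrightarrow> E (\<lambda>x. a * f x) g = a * E f g"
    and E_sym: "\<And>f g. f \<in> F \<Longrightarrow> g \<in> F \<Longrightarrow> E f g = E g f"
    and E_nonneg: "\<And>f. f \<in> F \<Longrightarrow> E f f \<ge> 0"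
    and closed_form: "\<And>u. (\<And>n::nat. u n \<in> F) \<Longrightarrow>
        (\<And>\<epsilon>. \<epsilon> > 0 \<Longrightarrow> \<exists>N. \<forall>i\<ge>N. \<forall>j\<ge>N. E1 m E (\<lambda>x. u i x - u j x) (\<lambda>x. u i x - u j x) < \<epsilon>) \<Longrightarrow>
        \<exists>f\<in>F. (\<lambda>n. E1 m E (\<lambda>x. u n x - f x) (\<lambda>x. u n x - f x)) \<longlonglongrightarrow> 0"
    and unit_contraction_F: "\<And>f. f \<in> F \<Longrightarrow> (\<lambda>x. min (max (f x) 0) 1) \<in> F"
    and unit_contraction_E: "\<And>f. f \<in> F \<Longrightarrow>
        E (\<lambda>x. min (max (f x) 0) 1) (\<lambda>x. min (max (f x) 0) 1) \<le> E f f"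

locale mmd_space = metric_measure_space m + dirichlet_form m E F
  for m :: "'a::metric_space measure"
    and E :: "('a \<Rightarrow> real) \<Rightarrow> ('a \<Rightarrow> real) \<Rightarrow> real"
    and F :: "('a \<Rightarrow> real) set" +
  assumes regular_dense_F: "\<And>f \<epsilon>. f \<in> F \<Longrightarrow> \<epsilon> > 0 \<Longrightarrow>
        \<exists>g \<in> F \<inter> C_c. E1 m E (\<lambda>x. f x - g x) (\<lambda>x. f x - g x) < \<epsilon>"
    and regular_dense_C_c: "\<And>f \<epsilon>. f \<in> C_c \<Longrightarrow> \<epsilon> > 0 \<Longrightarrow>
        \<exists>g \<in> F \<inter> C_c. \<forall>x. \<bar>f x - g x\<bar> < \<epsilon>"
    and strongly_local: "\<And>f g a. f \<in> F \<Longrightarrow> g \<in> F \<Longrightarrow>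
        compact (supp_m m f) \<Longrightarrow> compact (supp_m m g) \<Longrightarrow>
        supp_m m (\<lambda>x. f x - a) \<inter> supp_m m g = {} \<Longrightarrow> E f g = 0"

definition doubling :: "'a::metric_space measure \<Rightarrow> bool" where
  "doubling m \<longleftrightarrow> (\<exists>D0::real. D0 \<ge> 1 \<and>
     (\<forall>x r. r > 0 \<longrightarrow> emeasure m (ball x (2 * r)) \<le> ennreal D0 * emeasure m (ball x r)))"

text \<open>
  The integrability requirement forces the measure to be locally finite; without it the
  convention that non-integrable functions have integral \<open>0\<close> would admit spurious measures.
\<close>

definition energy_measure_bounded ::
    "(('a::topological_space \<Rightarrow> real) \<Rightarrow> ('a \<Rightarrow> real) \<Rightarrow> real) \<Rightarrow> ('a \<Rightarrow> real) set \<Rightarrow> ('a \<Rightarrow> real) \<Rightarrow> 'a measure" where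
  "energy_measure_bounded E F f = (THE \<Gamma>. sets \<Gamma> = sets borel \<and>
     (\<forall>g \<in> F \<inter> C_c. integrable \<Gamma> g \<and>
        (\<integral>x. g x \<partial>\<Gamma>) = E f (\<lambda>x. f x * g x) - 1/2 * E (\<lambda>x. (f x)\<^sup>2) g))"

definition energy_measure ::
    "'a::topological_space measure \<Rightarrow> (('a \<Rightarrow> real) \<Rightarrow> ('a \<Rightarrow> real) \<Rightarrow> real) \<Rightarrow> ('a \<Rightarrow> real) set \<Rightarrow>
     ('a \<Rightarrow> real) \<Rightarrow> 'a set \<Rightarrow> ennreal" where
  "energy_measure m E F f A =
     (if f \<in> Linfty m then emeasure (energy_measure_bounded E F f) A
      else lim (\<lambda>n. emeasure (energy_measure_bounded E F (\<lambda>x. max (- real n) (min (f x) (real n)))) A))"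

definition A_uniform_domain :: "real \<Rightarrow> 'a::metric_space set \<Rightarrow> bool" where
  "A_uniform_domain A U \<longleftrightarrow>
     connected U \<and> U \<noteq> {} \<and> U \<noteq> UNIV \<and> open U \<and>
     (\<forall>x\<in>U. \<forall>y\<in>U. \<exists>\<gamma>. path \<gamma> \<and> path_image \<gamma> \<subseteq> U \<and> pathstart \<gamma> = x \<and> pathfinish \<gamma> = y \<and>
        diameter (path_image \<gamma>) \<le> A * dist x y \<and>
        (\<forall>z\<in>path_image \<gamma>. infdist z (- U) \<ge> inverse A * min (dist x z) (dist y z)))"

definition uniform_domain :: "'a::metric_space set \<Rightarrow> bool" where
  "uniform_domain U \<longleftrightarrow> (\<exists>A\<ge>1. A_uniform_domain A U)"

definition scale_function :: "(real \<Rightarrow> real) \<Rightarrow> bool" where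
  "scale_function \<Psi> \<longleftrightarrow>
     continuous_on {0<..} \<Psi> \<and> strict_mono_on {0<..} \<Psi> \<and> bij_betw \<Psi> {0<..} {0<..} \<and>
     (\<exists>\<beta>1 \<beta>2 C. 1 < \<beta>1 \<and> \<beta>1 < \<beta>2 \<and> C > 1 \<and>
        (\<forall>r R. 0 < r \<longrightarrow> r \<le> R \<longrightarrow>
           inverse C * (R / r) powr \<beta>1 \<le> \<Psi> R / \<Psi> r \<and> \<Psi> R / \<Psi> r \<le> C * (R / r) powr \<beta>2))"

abbreviation scale_inv :: "(real \<Rightarrow> real) \<Rightarrow> real \<Rightarrow> real" where
  "scale_inv \<Psi> \<equiv> inv_into {0<..} \<Psi>"

text \<open>For a scale function and \<open>s \<ge> 0\<close> the supremum is over a set that is bounded above.\<close>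

definition scale_Phi :: "(real \<Rightarrow> real) \<Rightarrow> real \<Rightarrow> real" where
  "scale_Phi \<Psi> s = (SUP r\<in>{0<..}. s / r - 1 / \<Psi> r)"

definition markov_semigroup :: "'a measure \<Rightarrow> (real \<Rightarrow> ('a \<Rightarrow> real) \<Rightarrow> 'a \<Rightarrow> real) \<Rightarrow> bool" where
  "markov_semigroup m P \<longleftrightarrow>
     (\<forall>t>0. \<forall>f\<in>L2 m. P t f \<in> L2 m) \<and>
     (\<forall>t>0. \<forall>f\<in>L2 m. \<forall>g\<in>L2 m. (AE x in m. f x = g x) \<longrightarrow> (AE x in m. P t f x = P t g x)) \<and>
     (\<forall>t>0. \<forall>f\<in>L2 m. \<forall>g\<in>L2 m. \<forall>a b.
        AE x in m. P t (\<lambda>z. a * f z + b * g z) x = a * P t f x + b * P t g x) \<and>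
     (\<forall>t>0. \<forall>f\<in>L2 m. \<forall>g\<in>L2 m. L2_inner m (P t f) g = L2_inner m f (P t g)) \<and>
     (\<forall>t>0. \<forall>f\<in>L2 m. L2_norm m (P t f) \<le> L2_norm m f) \<and>
     (\<forall>s>0. \<forall>t>0. \<forall>f\<in>L2 m. AE x in m. P (s + t) f x = P s (P t f) x) \<and>
     (\<forall>f\<in>L2 m. ((\<lambda>t. L2_norm m (\<lambda>x. P t f x - f x)) \<longlongrightarrow> 0) (at_right 0)) \<and>
     (\<forall>t>0. \<forall>f\<in>L2 m. (AE x in m. 0 \<le> f x \<and> f x \<le> 1) \<longrightarrow> (AE x in m. 0 \<le> P t f x \<and> P t f x \<le> 1))"

text \<open>
  A semigroup is associated with the form if its infinitesimal generator is the self-adjoint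
  operator \<open>L\<close> of the form, where \<open>L f = h\<close> means \<open>f \<in> F\<close> and \<open>E f g = - \<langle>h, g\<rangle>\<close> for all \<open>g \<in> F\<close>.
  This determines the semigroup up to equality almost everywhere.
\<close>

definition associated_semigroup ::
    "'a measure \<Rightarrow> (('a \<Rightarrow> real) \<Rightarrow> ('a \<Rightarrow> real) \<Rightarrow> real) \<Rightarrow> ('a \<Rightarrow> real) set \<Rightarrow>
     (real \<Rightarrow> ('a \<Rightarrow> real) \<Rightarrow> 'a \<Rightarrow> real) \<Rightarrow> bool" where
  "associated_semigroup m E F P \<longleftrightarrow>
     markov_semigroup m P \<and>
     (\<forall>f\<in>L2 m. \<forall>h\<in>L2 m.
        ((\<lambda>t. L2_norm m (\<lambda>x. (P t f x - f x) / t - h x)) \<longlongrightarrow> 0) (at_right 0) \<longleftrightarrow>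
        f \<in> F \<and> (\<forall>g\<in>F. E f g = - L2_inner m h g))"

definition heat_kernel ::
    "'a::topological_space measure \<Rightarrow> (('a \<Rightarrow> real) \<Rightarrow> ('a \<Rightarrow> real) \<Rightarrow> real) \<Rightarrow> ('a \<Rightarrow> real) set \<Rightarrow>
     (real \<Rightarrow> 'a \<Rightarrow> 'a \<Rightarrow> real) \<Rightarrow> bool" where
  "heat_kernel m E F p \<longleftrightarrow>
     (\<forall>t>0. (\<lambda>(x, y). p t x y) \<in> borel_measurable borel \<and> (\<forall>x y. p t x y \<ge> 0)) \<and>
     (\<exists>P. associated_semigroup m E F P \<and>
        (\<forall>t>0. \<forall>f\<in>L2 m. AE x in m.
           integrable m (\<lambda>y. p t x y * f y) \<and> P t f x = (\<integral>y. p t x y * f y \<partial>m)))"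

definition HKE ::
    "'a::metric_space measure \<Rightarrow> (('a \<Rightarrow> real) \<Rightarrow> ('a \<Rightarrow> real) \<Rightarrow> real) \<Rightarrow> ('a \<Rightarrow> real) set \<Rightarrow>
     (real \<Rightarrow> real) \<Rightarrow> bool" where
  "HKE m E F \<Psi> \<longleftrightarrow>
     (\<exists>C1 c1 c2 c3 \<delta> p. C1 > 0 \<and> c1 > 0 \<and> c2 > 0 \<and> c3 > 0 \<and> \<delta> > 0 \<and> heat_kernel m E F p \<and>
        (\<forall>t>0.
           (AE x in m. AE y in m.
              p t x y \<le> C1 / measure m (ball x (scale_inv \<Psi> t)) *
                        exp (- c1 * t * scale_Phi \<Psi> (c2 * (dist x y / t)))) \<and>
           (AE x in m. AE y in m. dist x y \<le> \<delta> * scale_inv \<Psi> t \<longrightarrow>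
              p t x y \<ge> c3 / measure m (ball x (scale_inv \<Psi> t)))))"

end

theory Submission
  imports Defs
begin

text \<open>
  Let \<open>p\<close> be the heat kernel. The functional \<open>Lf f g = E(f, f g) - E(f\<^sup>2, g) / 2\<close> is the limit of
  \<open>1/(2 t)\<close> times the integral of \<open>g x (f x - f y)\<^sup>2\<close> against \<open>p t x y dx dy\<close>, up to a killing term. By Riesz
  representation it is integration against the energy measure, so it is enough to find, for every
  compact \<open>K\<close> in the boundary of \<open>U\<close>, functions \<open>g \<ge> 1\<close> on \<open>K\<close> with \<open>Lf f g\<close> arbitrarily small.

  At scale \<open>r\<close> a continuous \<open>f\<close> is replaced by a combination \<open>u\<close> of cutoff functions whose coefficients
  are averages of \<open>f\<close>; near the boundary the averages are taken over balls around corkscrew points,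
  that is, points of \<open>U\<close> at depth comparable to \<open>r\<close>. Neighbouring coefficients are compared along uniform
  curves by a Poincare inequality, which the heat kernel bounds give with the discrete energy
  \<open>1/s \<integral>\<integral> (f x - f y)\<^sup>2 p s x y\<close> on the right-hand side for all \<open>s = \<Psi> r / 2 ^ n\<close>. Hence \<open>E(u, u) \<le> C E(f, f)\<close>,
  and close to the boundary the energy of \<open>u\<close> is bounded by the discrete energy of \<open>f\<close> in the
  layer of points at depth comparable to \<open>r\<close>. For sparse \<open>r\<close> these layers are disjoint, so their
  discrete energies at a common small \<open>s\<close> add up to at most \<open>E(f, f)\<close>, and along a subsequence the energy of
  \<open>u\<close> near \<open>K\<close> tends to \<open>0\<close>. Averages of the functions \<open>u\<close> converge to \<open>f\<close> in the form norm, and the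
  smallness passes to the limit.
\<close>

section \<open>Positive semidefinite forms on spaces of functions\<close>

text \<open>Energy measures may be singular to \<open>m\<close>, so knowing
  \<open>m (frontier U)\<close> would not help and the energy near the boundary has to be estimated
  directly. A uniform domain makes this possible because \<open>f\<close> near the boundary can be
  replaced by data from inside: averages around corkscrew points see only depth comparable to
  \<open>r\<close>. This moves the energy from the boundary to a layer away from it, and a finite
  total energy cannot load infinitely many disjoint layers.

  To add up layers for different \<open>r\<close>, their discrete energies must be taken at one time
  \<open>s\<close> far below every \<open>\<Psi> r\<close>. Monotonicity of the approximating forms
  under halving of \<open>s\<close> concerns the whole space and says nothing about a single layer.
  Hence the Poincare inequality is needed for every \<open>\<Psi> r / 2 ^ n\<close> with a constant
  independent of \<open>n\<close>; it comes from comparing \<open>P (\<Psi> r)\<close> with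
  \<open>2 ^ n\<close> steps of a walk confined to a ball.

  The existence of cutoff functions, the stability of \<open>F\<close> under contractions and
  products, and the existence of energy measures are all derived here; weak compactness is replaced
  by minimisation over midpoint-stable sets.\<close>

locale psd_form =
  fixes V :: "('a \<Rightarrow> real) set" and B :: "('a \<Rightarrow> real) \<Rightarrow> ('a \<Rightarrow> real) \<Rightarrow> real"
  assumes V_ne: "V \<noteq> {}"
    and V_add: "\<And>f g. f \<in> V \<Longrightarrow> g \<in> V \<Longrightarrow> (\<lambda>x. f x + g x) \<in> V"
    and V_scale: "\<And>f a. f \<in> V \<Longrightarrow> (\<lambda>x. a * f x) \<in> V"
    and B_add: "\<And>f g h. f \<in> V \<Longrightarrow> g \<in> V \<Longrightarrow> h \<in> V \<Longrightarrow> B (\<lambda>x. f x + g x) h = B f h + B g h"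
    and B_scale: "\<And>f g a. f \<in> V \<Longrightarrow> g \<in> V \<Longrightarrow> B (\<lambda>x. a * f x) g = a * B f g"
    and B_sym: "\<And>f g. f \<in> V \<Longrightarrow> g \<in> V \<Longrightarrow> B f g = B g f"
    and B_nonneg: "\<And>f. f \<in> V \<Longrightarrow> B f f \<ge> 0"
begin

lemma V_zero: "(\<lambda>x. 0) \<in> V"
proof -
  obtain f where "f \<in> V" using V_ne by blast
  from V_scale[OF this, of 0] show ?thesis by simp
qed

lemma V_uminus: "f \<in> V \<Longrightarrow> (\<lambda>x. - f x) \<in> V"
  using V_scale[of f "-1"] by simp

lemma V_diff: "f \<in> V \<Longrightarrow> g \<in> V \<Longrightarrow> (\<lambda>x. f x - g x) \<in> V"
  using V_add[OF _ V_uminus, of f g] by simp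

lemma V_sum: "(\<And>i. i \<in> I \<Longrightarrow> u i \<in> V) \<Longrightarrow> (\<lambda>x. \<Sum>i\<in>I. u i x) \<in> V"
  by (induction I rule: infinite_finite_induct) (auto intro: V_zero V_add)

lemma B_uminus: "f \<in> V \<Longrightarrow> g \<in> V \<Longrightarrow> B (\<lambda>x. - f x) g = - B f g"
  using B_scale[of f g "-1"] by simp

lemma B_diff: "f \<in> V \<Longrightarrow> g \<in> V \<Longrightarrow> h \<in> V \<Longrightarrow> B (\<lambda>x. f x - g x) h = B f h - B g h"
  using B_add[OF _ V_uminus, of f g h] B_uminus[of g h] by simp

lemma B_add_right: "f \<in> V \<Longrightarrow> g \<in> V \<Longrightarrow> h \<in> V \<Longrightarrow> B h (\<lambda>x. f x + g x) = B h f + B h g"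
  using B_add[of f g h] B_sym V_add by simp

lemma B_diff_right: "f \<in> V \<Longrightarrow> g \<in> V \<Longrightarrow> h \<in> V \<Longrightarrow> B h (\<lambda>x. f x - g x) = B h f - B h g"
  using B_diff[of f g h] B_sym V_diff by simp

lemma B_scale_right: "f \<in> V \<Longrightarrow> g \<in> V \<Longrightarrow> B f (\<lambda>x. a * g x) = a * B f g"
  using B_scale[of g f a] B_sym V_scale by simp

lemma B_zero: "f \<in> V \<Longrightarrow> B (\<lambda>x. 0) f = 0"
  using B_scale[OF V_zero, of f 0] by simp

lemma B_zero_right: "f \<in> V \<Longrightarrow> B f (\<lambda>x. 0) = 0"
  using B_zero B_sym V_zero by metis

lemma B_quad_add:
  assumes "f \<in> V" "g \<in> V"
  shows "B (\<lambda>x. f x + g x) (\<lambda>x. f x + g x) = B f f + 2 * B f g + B g g"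
  using assms V_add[of f g] by (simp add: B_add B_add_right B_sym[of g f])

lemma B_quad_diff:
  assumes "f \<in> V" "g \<in> V"
  shows "B (\<lambda>x. f x - g x) (\<lambda>x. f x - g x) = B f f - 2 * B f g + B g g"
  using assms V_diff[of f g] by (simp add: B_diff B_diff_right B_sym[of g f])

lemma B_quad_scale: "f \<in> V \<Longrightarrow> B (\<lambda>x. a * f x) (\<lambda>x. a * f x) = a\<^sup>2 * B f f"
  using V_scale[of f a] B_scale[of f "\<lambda>x. a * f x" a] B_scale_right[of f f a]
  by (simp add: power2_eq_square)

lemma B_diff_commute: "f \<in> V \<Longrightarrow> g \<in> V \<Longrightarrow>
    B (\<lambda>x. f x - g x) (\<lambda>x. f x - g x) = B (\<lambda>x. g x - f x) (\<lambda>x. g x - f x)"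
  by (simp add: B_quad_diff B_sym[of f g])

text \<open>The polynomial \<open>B f f - 2 * a * B f g + a\<^sup>2 * B g g\<close> in
  \<open>a\<close> is nonnegative. Definiteness is not assumed, so \<open>B g g = 0\<close> is a
  separate case: then the polynomial is affine and bounded below, which forces
  \<open>B f g = 0\<close>.\<close>

lemma Cauchy_Schwarz:
  assumes "f \<in> V" "g \<in> V"
  shows "(B f g)\<^sup>2 \<le> B f f * B g g"
proof -
  have q: "B f f - 2 * a * B f g + a\<^sup>2 * B g g \<ge> 0" for a
  proof -
    have "0 \<le> B (\<lambda>x. f x - a * g x) (\<lambda>x. f x - a * g x)"
      using assms V_scale V_diff B_nonneg by blast
    also have "\<dots> = B f f - 2 * a * B f g + a\<^sup>2 * B g g"
      using B_quad_diff[OF assms(1) V_scale[OF assms(2)], of a] B_scale_right[OF assms, of a]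
        B_quad_scale[OF assms(2), of a] by simp
    finally show ?thesis .
  qed
  show ?thesis
  proof (cases "B g g = 0")
    case True
    have "B f g = 0"
    proof (rule ccontr)
      assume "B f g \<noteq> 0"
      with q[of "(B f f + 1) / (2 * B f g)"] True show False by (simp add: field_simps)
    qed
    then show ?thesis using True by simp
  next
    case False
    then have "B g g > 0" using B_nonneg[OF assms(2)] by simp
    with q[of "B f g / B g g"] show ?thesis
      by (simp add: field_simps power2_eq_square)
  qed
qed

lemma Cauchy_Schwarz_abs:
  assumes "f \<in> V" "g \<in> V"
  shows "\<bar>B f g\<bar> \<le> sqrt (B f f) * sqrt (B g g)"
  using real_sqrt_le_mono[OF Cauchy_Schwarz[OF assms]] by (simp add: real_sqrt_mult)

lemma triangle_sqrt:
  assumes "f \<in> V" "g \<in> V"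
  shows "sqrt (B (\<lambda>x. f x + g x) (\<lambda>x. f x + g x)) \<le> sqrt (B f f) + sqrt (B g g)"
proof (rule real_le_lsqrt)
  show "B (\<lambda>x. f x + g x) (\<lambda>x. f x + g x) \<le> (sqrt (B f f) + sqrt (B g g))\<^sup>2"
    using B_quad_add[OF assms] Cauchy_Schwarz_abs[OF assms] B_nonneg[OF assms(1)] B_nonneg[OF assms(2)]
    by (simp add: power2_sum)
qed (use assms B_nonneg V_add in auto)

lemma triangle_sqrt_diff:
  assumes "f \<in> V" "g \<in> V"
  shows "sqrt (B f f) \<le> sqrt (B g g) + sqrt (B (\<lambda>x. f x - g x) (\<lambda>x. f x - g x))"
  using triangle_sqrt[OF assms(2) V_diff[OF assms]] by simp

lemma abs_sqrt_diff:
  assumes "f \<in> V" "g \<in> V"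
  shows "\<bar>sqrt (B f f) - sqrt (B g g)\<bar> \<le> sqrt (B (\<lambda>x. f x - g x) (\<lambda>x. f x - g x))"
  using triangle_sqrt_diff[OF assms] triangle_sqrt_diff[OF assms(2,1)] B_diff_commute[OF assms] by simp

lemma B_quad_add_le:
  assumes "f \<in> V" "g \<in> V"
  shows "B (\<lambda>x. f x + g x) (\<lambda>x. f x + g x) \<le> 2 * B f f + 2 * B g g"
  using B_quad_add[OF assms] B_quad_diff[OF assms] B_nonneg[OF V_diff[OF assms]] by simp

lemma B_quad_diff_le:
  assumes "f \<in> V" "g \<in> V"
  shows "B (\<lambda>x. f x - g x) (\<lambda>x. f x - g x) \<le> 2 * B f f + 2 * B g g"
  using B_quad_add[OF assms] B_quad_diff[OF assms] B_nonneg[OF V_add[OF assms]] by simp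

lemma V_midpoint: "f \<in> V \<Longrightarrow> g \<in> V \<Longrightarrow> (\<lambda>x. (f x + g x) / 2) \<in> V"
  using V_scale[OF V_add, of f g "1/2"] by simp

text \<open>The parallelogram law; its last term is what forces near-minimisers of the form to be
  close to each other.\<close>

lemma B_midpoint:
  assumes "f \<in> V" "g \<in> V"
  shows "B (\<lambda>x. (f x + g x) / 2) (\<lambda>x. (f x + g x) / 2)
    = B f f / 2 + B g g / 2 - B (\<lambda>x. f x - g x) (\<lambda>x. f x - g x) / 4"
  using B_quad_scale[OF V_add[OF assms], of "1/2"] B_quad_add[OF assms] B_quad_diff[OF assms]
  by (simp add: power2_eq_square field_simps)

lemma B_midpoint_le:
  assumes "f \<in> V" "g \<in> V"
  shows "B (\<lambda>x. (f x + g x) / 2) (\<lambda>x. (f x + g x) / 2) \<le> B f f / 2 + B g g / 2"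
  using B_midpoint[OF assms] B_nonneg[OF V_diff[OF assms]] by simp

definition form_Cauchy :: "(nat \<Rightarrow> 'a \<Rightarrow> real) \<Rightarrow> bool" where
  "form_Cauchy u \<longleftrightarrow>
    (\<forall>\<epsilon>>0. \<exists>N. \<forall>i\<ge>N. \<forall>j\<ge>N. B (\<lambda>x. u i x - u j x) (\<lambda>x. u i x - u j x) < \<epsilon>)"

text \<open>The parallelogram law makes near-minimizers of the form on decreasing convex sets a Cauchy
  sequence; this replaces weak compactness.\<close>

lemma midpoint_selection:
  assumes KV: "\<And>n. K n \<subseteq> V" and dec: "\<And>n. K (Suc n) \<subseteq> K n"
    and mid: "\<And>n f g. f \<in> K n \<Longrightarrow> g \<in> K n \<Longrightarrow> (\<lambda>x. (f x + g x) / 2) \<in> K n"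
    and bd: "\<And>n. \<exists>f\<in>K n. B f f \<le> C"
  obtains v where "\<And>n. v n \<in> K n" "form_Cauchy v"
    "\<And>n w. w \<in> K n \<Longrightarrow> B (v n) (v n) \<le> B w w + 1 / (real n + 1)"
proof -
  \<comment> \<open>The infima \<open>d n\<close> grow with \<open>n\<close> because the sets
    shrink, and they stay below \<open>C\<close>, so they form a Cauchy sequence; the distance of
    \<open>v i\<close> and \<open>v j\<close> is controlled by their increments.\<close>
  define d where "d n = (INF w\<in>K n. B w w)" for n
  have ne: "K n \<noteq> {}" for n using bd by blast
  have bb: "bdd_below ((\<lambda>w. B w w) ` K n)" for n
    using KV B_nonneg by (intro bdd_belowI[of _ 0]) auto
  have d_le: "d n \<le> B w w" if "w \<in> K n" for n w
    unfolding d_def by (rule cINF_lower[OF bb that])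
  have "\<exists>v\<in>K n. B v v < d n + 1 / (real n + 1)" for n
    using cINF_less_iff[OF ne[of n] bb[of n], of "d n + 1 / (real n + 1)"] by (auto simp: d_def)
  then obtain v where v: "\<And>n. v n \<in> K n" "\<And>n. B (v n) (v n) < d n + 1 / (real n + 1)"
    by metis
  have dec': "K m \<subseteq> K n" if "n \<le> m" for n m
    using that by (induction rule: dec_induct) (use dec in auto)
  have inc: "incseq d"
    unfolding incseq_def d_def using dec' ne bb by (intro allI impI cINF_superset_mono) auto
  have dC: "d n \<le> C" for n using bd[of n] d_le order_trans by blast
  have "convergent d"
    using incseq_convergent[OF inc, of C] dC by (metis convergentI)
  then have Cd: "Cauchy d" by (rule convergent_Cauchy)
  have est: "B (\<lambda>x. v i x - v j x) (\<lambda>x. v i x - v j x) \<le> 2 * \<bar>d i - d j\<bar> + 4 / (real N + 1)"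
    if ij: "i \<ge> N" "j \<ge> N" for i j N
  proof -
    have main: "B (\<lambda>x. v i x - v j x) (\<lambda>x. v i x - v j x) \<le> 2 * \<bar>d i - d j\<bar> + 4 / (real N + 1)"
      if le: "i \<le> j" and ij: "i \<ge> N" "j \<ge> N" for i j
    proof -
      have vV: "v i \<in> V" "v j \<in> V" using v KV by auto
      \<comment> \<open>For \<open>i \<le> j\<close> both functions lie in \<open>K i\<close>, so
        their midpoint has form at least \<open>d i\<close>; the parallelogram law turns the
        remaining slack into a bound on the difference.\<close>
      have "v j \<in> K i" using v(1)[of j] dec'[OF le] by blast
      then have "d i \<le> B (\<lambda>x. (v i x + v j x) / 2) (\<lambda>x. (v i x + v j x) / 2)"
        using mid v(1) d_le by blast
      then have "d i \<le> B (v i) (v i) / 2 + B (v j) (v j) / 2 - B (\<lambda>x. v i x - v j x) (\<lambda>x. v i x - v j x) / 4"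
        using B_midpoint[OF vV] by simp
      moreover define a where "a = 1 / (real N + 1)"
      have "1 / (real i + 1) \<le> a" "1 / (real j + 1) \<le> a"
        using ij by (auto simp: a_def intro!: divide_left_mono)
      then have "B (v i) (v i) < d i + a" "B (v j) (v j) < d j + a"
        using v(2)[of i] v(2)[of j] by linarith+
      moreover have "4 / (real N + 1) = 4 * a" by (simp add: a_def)
      moreover have "d j - d i \<le> \<bar>d i - d j\<bar>" by simp
      moreover have "X \<le> 2 * e + b" if "p \<le> P / 2 + Q / 2 - X / 4" "P < p + a" "Q < q + a" "b = 4 * a" "q - p \<le> e"
        for X P Q p q e b a :: real
        using that by linarith
      ultimately show ?thesis by blast
    qed
    have vV: "v i \<in> V" "v j \<in> V" using v KV by auto
    show ?thesis
      using main[of i j] main[of j i] ij B_diff_commute[OF vV] abs_minus_commute[of "d i" "d j"] by (cases "i \<le> j") auto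
  qed
  have "form_Cauchy v"
    unfolding form_Cauchy_def
  proof (intro allI impI)
    fix \<epsilon> :: real assume e: "\<epsilon> > 0"
    obtain N1 where N1: "\<And>i j. i \<ge> N1 \<Longrightarrow> j \<ge> N1 \<Longrightarrow> \<bar>d i - d j\<bar> < \<epsilon> / 4"
      using CauchyD[OF Cd, of "\<epsilon>/4"] e by auto
    obtain N2 :: nat where N2: "real N2 > 8 / \<epsilon>" using reals_Archimedean2 by blast
    show "\<exists>N. \<forall>i\<ge>N. \<forall>j\<ge>N. B (\<lambda>x. v i x - v j x) (\<lambda>x. v i x - v j x) < \<epsilon>"
    proof (intro exI allI impI)
      fix i j assume ij: "i \<ge> max N1 N2" "j \<ge> max N1 N2"
      have "4 / (real N2 + 1) < \<epsilon> / 2"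
        using N2 e by (simp add: field_simps)
      then show "B (\<lambda>x. v i x - v j x) (\<lambda>x. v i x - v j x) < \<epsilon>"
        using est[of N2 i j] N1[of i j] ij by auto
    qed
  qed
  moreover have "B (v n) (v n) \<le> B w w + 1 / (real n + 1)" if "w \<in> K n" for n w
    using v(2)[of n] d_le[OF that] by simp
  ultimately show thesis using that v(1) by blast
qed

end

section \<open>Complete forms and Riesz representation of bounded functionals\<close>

locale complete_form = psd_form +
  assumes complete: "\<And>u. (\<And>n. u n \<in> V) \<Longrightarrow> form_Cauchy u \<Longrightarrow>
    \<exists>f\<in>V. (\<lambda>n. B (\<lambda>x. u n x - f x) (\<lambda>x. u n x - f x)) \<longlonglongrightarrow> 0"
begin

lemma tendsto_B_quad:
  assumes u: "\<And>n. u n \<in> V" "f \<in> V"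
    and lim: "(\<lambda>n. B (\<lambda>x. u n x - f x) (\<lambda>x. u n x - f x)) \<longlonglongrightarrow> 0"
  shows "(\<lambda>n. B (u n) (u n)) \<longlonglongrightarrow> B f f"
proof -
  have z: "(\<lambda>n. sqrt (B (\<lambda>x. u n x - f x) (\<lambda>x. u n x - f x))) \<longlonglongrightarrow> 0"
    using tendsto_real_sqrt[OF lim] by simp
  have "(\<lambda>n. sqrt (B (u n) (u n)) - sqrt (B f f)) \<longlonglongrightarrow> 0"
    by (rule Lim_null_comparison[OF _ z]) (simp add: abs_sqrt_diff[OF u])
  then have "(\<lambda>n. (sqrt (B (u n) (u n)))\<^sup>2) \<longlonglongrightarrow> (sqrt (B f f))\<^sup>2"
    by (intro tendsto_power) (simp add: LIM_zero_iff)
  then show ?thesis using u B_nonneg by simp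
qed

text \<open>A minimiser of \<open>B\<close> on the hyperplane \<open>\<phi> = 1\<close> is
  \<open>B\<close>-orthogonal to the kernel of \<open>\<phi>\<close>, so a multiple of it represents
  \<open>\<phi>\<close>. The minimising sequence comes from \<open>midpoint_selection\<close> with a
  constant sequence of sets, and \<open>bd\<close> keeps its limit on the hyperplane.\<close>

lemma Riesz_representation:
  assumes add: "\<And>f g. f \<in> V \<Longrightarrow> g \<in> V \<Longrightarrow> \<phi> (\<lambda>x. f x + g x) = \<phi> f + \<phi> g"
    and scale: "\<And>f a. f \<in> V \<Longrightarrow> \<phi> (\<lambda>x. a * f x) = a * \<phi> f"
    and bd: "\<And>f. f \<in> V \<Longrightarrow> (\<phi> f)\<^sup>2 \<le> C * B f f"
  shows "\<exists>u\<in>V. \<forall>g\<in>V. \<phi> g = B u g"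
proof (cases "\<forall>g\<in>V. \<phi> g = 0")
  case True
  then show ?thesis using V_zero B_zero by (intro bexI[of _ "\<lambda>x. 0"]) auto
next
  case False
  then obtain g0 where g0: "g0 \<in> V" "\<phi> g0 \<noteq> 0" by blast
  define K where "K = {f\<in>V. \<phi> f = 1}"
  have g1: "(\<lambda>x. (1 / \<phi> g0) * g0 x) \<in> K"
    using g0 scale[OF g0(1), of "1 / \<phi> g0"] V_scale[OF g0(1), of "1 / \<phi> g0"] by (simp add: K_def)
  have mid: "(\<lambda>x. (f x + g x) / 2) \<in> K" if "f \<in> K" "g \<in> K" for f g
    using that V_midpoint[of f g] scale[OF V_add, of f g "1/2"] add[of f g] by (auto simp: K_def)
  obtain v where v: "\<And>n. v n \<in> K" "form_Cauchy v"
    and vmin: "\<And>n w. w \<in> K \<Longrightarrow> B (v n) (v n) \<le> B w w + 1 / (real n + 1)"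
  proof (rule midpoint_selection[of "\<lambda>_. K" "B (\<lambda>x. (1 / \<phi> g0) * g0 x) (\<lambda>x. (1 / \<phi> g0) * g0 x)"])
    show "\<exists>f\<in>K. B f f \<le> B (\<lambda>x. (1 / \<phi> g0) * g0 x) (\<lambda>x. (1 / \<phi> g0) * g0 x)"
      using g1 by blast
  qed (use mid in \<open>auto simp: K_def\<close>)
  have vV: "v n \<in> V" for n using v(1) by (simp add: K_def)
  obtain f where f: "f \<in> V" and lim: "(\<lambda>n. B (\<lambda>x. v n x - f x) (\<lambda>x. v n x - f x)) \<longlonglongrightarrow> 0"
    using complete[OF vV v(2)] by blast
  have ldiff: "\<phi> (\<lambda>x. g x - h x) = \<phi> g - \<phi> h" if "g \<in> V" "h \<in> V" for g h
    using add[OF that(1) V_uminus[OF that(2)]] scale[OF that(2), of "-1"] by simp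
  have "(\<lambda>n. C * B (\<lambda>x. v n x - f x) (\<lambda>x. v n x - f x)) \<longlonglongrightarrow> C * 0"
    by (intro tendsto_intros lim)
  moreover have "(1 - \<phi> f)\<^sup>2 \<le> C * B (\<lambda>x. v n x - f x) (\<lambda>x. v n x - f x)" for n
    using bd[OF V_diff[OF vV f], of n] ldiff[OF vV f, of n] v(1)[of n] by (simp add: K_def)
  ultimately have "(1 - \<phi> f)\<^sup>2 \<le> 0"
    by (metis (no_types, lifting) LIMSEQ_le_const mult_zero_right)
  then have lf: "\<phi> f = 1" by simp
  have fmin: "B f f \<le> B w w" if "w \<in> K" for w
  proof -
    have "(\<lambda>n. B w w + 1 / (real n + 1)) \<longlonglongrightarrow> B w w + 0"
      by (intro tendsto_intros) (use LIMSEQ_inverse_real_of_nat in \<open>simp add: inverse_eq_divide add.commute\<close>)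
    with tendsto_B_quad[OF vV f lim] show ?thesis
      using vmin[OF that] by (metis (no_types, lifting) LIMSEQ_le add.right_neutral)
  qed
  have "B f f > 0" using bd[OF f] lf B_nonneg[OF f] by (cases "B f f = 0") auto
  have orth: "B f h = 0" if h: "h \<in> V" "\<phi> h = 0" for h
  proof -
    have q: "0 \<le> 2 * a * B f h + a\<^sup>2 * B h h" for a
    proof -
      have "(\<lambda>x. f x + a * h x) \<in> K"
        using f h lf V_add V_scale add[OF f V_scale[OF h(1)]] scale[OF h(1)] by (auto simp: K_def)
      from fmin[OF this] show ?thesis
        using B_quad_add[OF f V_scale[OF h(1), of a]] B_quad_scale[OF h(1), of a] B_scale_right[OF f h(1), of a]
        by simp
    qed
    show ?thesis
    proof (rule ccontr)
      assume ne: "B f h \<noteq> 0"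
      \<comment> \<open>The strict bound \<open>B h h < c\<close> keeps the second-order term below
        the first-order gain, also when \<open>B h h = 0\<close>.\<close>
      define c where "c = B h h + 1"
      have c: "c > 0" "B h h < c" using B_nonneg[OF h(1)] by (auto simp: c_def)
      have "0 \<le> 2 * (- B f h / c) * B f h + (- B f h / c)\<^sup>2 * B h h" by (rule q)
      also have "\<dots> = (B f h)\<^sup>2 / c * (B h h / c - 2)"
        using c by (simp add: field_simps power2_eq_square)
      also have "\<dots> < 0"
        using c ne by (intro mult_pos_neg) (auto simp: field_simps)
      finally show False by simp
    qed
  qed
  show ?thesis
  proof (intro bexI ballI)
    fix g assume g: "g \<in> V"
    have h: "(\<lambda>x. g x - \<phi> g * f x) \<in> V" using V_diff[OF g V_scale[OF f]] .
    have "B f (\<lambda>x. g x - \<phi> g * f x) = 0"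
      using orth[OF h] ldiff[OF g V_scale[OF f]] scale[OF f] lf by simp
    then have "B f g = \<phi> g * B f f"
      using B_diff_right[OF g V_scale[OF f] f] B_scale_right[OF f f] by simp
    then show "\<phi> g = B (\<lambda>x. (1 / B f f) * f x) g"
      using B_scale[OF f g, of "1 / B f f"] \<open>B f f > 0\<close> by simp
  qed (use V_scale[OF f] in blast)
qed

end

section \<open>Dirichlet forms and their semigroups\<close>

lemma L2_measurable: "f \<in> L2 m \<Longrightarrow> f \<in> borel_measurable m"
  by (simp add: L2_def)

lemma L2_mult_integrable:
  assumes "f \<in> L2 m" "g \<in> L2 m"
  shows "integrable m (\<lambda>x. f x * g x)"
proof (rule Bochner_Integration.integrable_bound)
  show "integrable m (\<lambda>x. (f x)\<^sup>2 + (g x)\<^sup>2)"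
    using assms by (auto simp: L2_def)
  show "AE x in m. norm (f x * g x) \<le> norm ((f x)\<^sup>2 + (g x)\<^sup>2)"
  proof (rule AE_I2)
    fix x
    have "0 \<le> (\<bar>f x\<bar> - \<bar>g x\<bar>)\<^sup>2" by simp
    then have "2 * (\<bar>f x\<bar> * \<bar>g x\<bar>) \<le> (f x)\<^sup>2 + (g x)\<^sup>2" by (simp add: power2_diff)
    moreover have "0 \<le> \<bar>f x\<bar> * \<bar>g x\<bar>" by simp
    ultimately have "\<bar>f x\<bar> * \<bar>g x\<bar> \<le> (f x)\<^sup>2 + (g x)\<^sup>2" by linarith
    then show "norm (f x * g x) \<le> norm ((f x)\<^sup>2 + (g x)\<^sup>2)" by (simp add: abs_mult)
  qed
qed (use assms in \<open>auto simp: L2_def\<close>)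

lemma L2_sq_integrable: "f \<in> L2 m \<Longrightarrow> integrable m (\<lambda>x. (f x)\<^sup>2)"
  by (simp add: L2_def)

lemma L2_bound:
  assumes "g \<in> L2 m" "f \<in> borel_measurable m" "AE x in m. \<bar>f x\<bar> \<le> \<bar>g x\<bar>"
  shows "f \<in> L2 m"
  unfolding L2_def
proof (intro CollectI conjI)
  show "integrable m (\<lambda>x. (f x)\<^sup>2)"
    by (rule Bochner_Integration.integrable_bound[OF L2_sq_integrable[OF assms(1)]])
      (use assms(2,3) in \<open>auto simp: abs_le_square_iff\<close>)
qed fact

lemma L2_add:
  assumes "f \<in> L2 m" "g \<in> L2 m" shows "(\<lambda>x. f x + g x) \<in> L2 m"
proof -
  have "integrable m (\<lambda>x. (f x)\<^sup>2 + (g x)\<^sup>2 + 2 * (f x * g x))"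
    using assms L2_mult_integrable[OF assms] by (auto simp: L2_def)
  then show ?thesis using assms by (auto simp: L2_def power2_sum algebra_simps)
qed

lemma L2_scale: "f \<in> L2 m \<Longrightarrow> (\<lambda>x. a * f x) \<in> L2 m"
  by (auto simp: L2_def power_mult_distrib)

interpretation L2: psd_form "L2 m" "L2_inner m" for m :: "'a measure"
proof
  show "L2 m \<noteq> {}" by (auto simp: L2_def intro!: exI[of _ "\<lambda>x. 0"])
  fix f g h :: "'a \<Rightarrow> real" and a :: real
  assume f: "f \<in> L2 m"
  show "L2_inner m f f \<ge> 0" by (simp add: L2_inner_def)
  show "(\<lambda>x. a * f x) \<in> L2 m" by (rule L2_scale[OF f])
  assume g: "g \<in> L2 m"
  show "(\<lambda>x. f x + g x) \<in> L2 m" by (rule L2_add[OF f g])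
  show "L2_inner m f g = L2_inner m g f" by (simp add: L2_inner_def mult.commute)
  show "L2_inner m (\<lambda>x. a * f x) g = a * L2_inner m f g" by (simp add: L2_inner_def mult.assoc)
  assume h: "h \<in> L2 m"
  show "L2_inner m (\<lambda>x. f x + g x) h = L2_inner m f h + L2_inner m g h"
    using L2_mult_integrable[OF f h] L2_mult_integrable[OF g h]
    by (simp add: L2_inner_def distrib_right)
qed

lemma L2_inner_self: "L2_inner m f f = (\<integral>x. (f x)\<^sup>2 \<partial>m)"
  by (simp add: L2_inner_def power2_eq_square)

lemma L2_inner_self_nonneg: "L2_inner m f f \<ge> 0"
  by (simp add: L2_inner_def)

lemma L2_inner_cong_AE:
  assumes "AE x in m. f x = f' x" "AE x in m. g x = g' x"
    "f \<in> borel_measurable m" "f' \<in> borel_measurable m" "g \<in> borel_measurable m" "g' \<in> borel_measurable m"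
  shows "L2_inner m f g = L2_inner m f' g'"
  unfolding L2_inner_def by (rule integral_cong_AE) (use assms in auto)

lemma L2_inner_zero_AE:
  assumes "f \<in> L2 m" "L2_inner m f f = 0"
  shows "AE x in m. f x = 0"
  using integral_nonneg_eq_0_iff_AE[OF L2_sq_integrable[OF assms(1)]] assms(2)
  by (simp add: L2_inner_self)

lemma L2_limit_unique:
  assumes u: "\<And>n. u n \<in> L2 m" "f \<in> L2 m" "g \<in> L2 m"
    and f: "(\<lambda>n. L2_inner m (\<lambda>x. u n x - f x) (\<lambda>x. u n x - f x)) \<longlonglongrightarrow> 0"
    and g: "(\<lambda>n. L2_inner m (\<lambda>x. u n x - g x) (\<lambda>x. u n x - g x)) \<longlonglongrightarrow> 0"
  shows "AE x in m. f x = g x"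
proof -
  have le: "L2_inner m (\<lambda>x. g x - f x) (\<lambda>x. g x - f x) \<le>
      2 * L2_inner m (\<lambda>x. u n x - f x) (\<lambda>x. u n x - f x) + 2 * L2_inner m (\<lambda>x. u n x - g x) (\<lambda>x. u n x - g x)" for n
    using L2.B_quad_diff_le[OF L2.V_diff[OF u(1)[of n] u(2)] L2.V_diff[OF u(1)[of n] u(3)]] by simp
  have "(\<lambda>n. 2 * L2_inner m (\<lambda>x. u n x - f x) (\<lambda>x. u n x - f x) + 2 * L2_inner m (\<lambda>x. u n x - g x) (\<lambda>x. u n x - g x)) \<longlonglongrightarrow> 2 * 0 + 2 * 0"
    by (intro tendsto_intros f g)
  then have "L2_inner m (\<lambda>x. g x - f x) (\<lambda>x. g x - f x) \<le> 0"
    using le by (intro LIMSEQ_le_const[where X = "\<lambda>n. 2 * L2_inner m (\<lambda>x. u n x - f x) (\<lambda>x. u n x - f x) + 2 * L2_inner m (\<lambda>x. u n x - g x) (\<lambda>x. u n x - g x)"]) auto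
  then have "L2_inner m (\<lambda>x. g x - f x) (\<lambda>x. g x - f x) = 0"
    using L2_inner_self_nonneg[of m "\<lambda>x. g x - f x"] by linarith
  from L2_inner_zero_AE[OF L2.V_diff[OF u(3,2)] this] show ?thesis by auto
qed

lemma L2_midpoint_near:
  assumes "g \<in> L2 m" "h \<in> L2 m" "f \<in> L2 m"
    and "L2_inner m (\<lambda>x. g x - f x) (\<lambda>x. g x - f x) \<le> c" "L2_inner m (\<lambda>x. h x - f x) (\<lambda>x. h x - f x) \<le> c"
  shows "L2_inner m (\<lambda>x. (g x + h x) / 2 - f x) (\<lambda>x. (g x + h x) / 2 - f x) \<le> c"
proof -
  have "(\<lambda>x. (g x + h x) / 2 - f x) = (\<lambda>x. ((g x - f x) + (h x - f x)) / 2)"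
    by (auto simp: field_simps)
  then have "L2_inner m (\<lambda>x. (g x + h x) / 2 - f x) (\<lambda>x. (g x + h x) / 2 - f x)
    \<le> L2_inner m (\<lambda>x. g x - f x) (\<lambda>x. g x - f x) / 2 + L2_inner m (\<lambda>x. h x - f x) (\<lambda>x. h x - f x) / 2"
    using L2.B_midpoint_le[OF L2.V_diff[OF assms(1,3)] L2.V_diff[OF assms(2,3)]] by simp
  also have "\<dots> \<le> c" using assms(4,5) by linarith
  finally show ?thesis .
qed

section \<open>Resolvents and weak closure for a closed form\<close>

context dirichlet_form
begin

lemma F_L2: "f \<in> F \<Longrightarrow> f \<in> L2 m"
  using F_subset_L2 by blast

lemma F_measurable: "f \<in> F \<Longrightarrow> f \<in> borel_measurable m"
  using F_L2 L2_measurable by blast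

lemma F_nonempty: "F \<noteq> {}"
  using F_dense[of "\<lambda>x. 0" 1] L2.V_zero[of m] by auto

sublocale E: psd_form F E
  by unfold_locales (use F_nonempty F_add F_scale E_add E_scale E_sym E_nonneg in auto)

definition Ea :: "real \<Rightarrow> ('a \<Rightarrow> real) \<Rightarrow> ('a \<Rightarrow> real) \<Rightarrow> real" where
  "Ea a f g = E f g + a * L2_inner m f g"

lemma Ea_psd: "a \<ge> 0 \<Longrightarrow> psd_form F (Ea a)"
  by unfold_locales
    (use F_nonempty F_add F_scale E_sym E_nonneg in \<open>auto simp: Ea_def E_add E_scale F_L2 L2.B_add L2.B_scale
        L2.B_sym L2_inner_self_nonneg algebra_simps\<close>)

lemma E1_Ea: "E1 m E = Ea 1"
  by (simp add: Ea_def E1_def fun_eq_iff)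

text \<open>For \<open>a \<ge> 1\<close> the norms are equivalent: on the diagonal
  \<open>E1 m E\<close> is at most \<open>Ea a\<close>, which is at most \<open>a\<close> times
  \<open>E1 m E\<close>. So completeness is inherited from \<open>closed_form\<close>.\<close>

lemma Ea_complete:
  assumes a: "a \<ge> 1" shows "complete_form F (Ea a)"
proof -
  interpret A: psd_form F "Ea a" using a by (intro Ea_psd) auto
  show ?thesis
  proof
    fix u assume u: "\<And>n::nat. u n \<in> F" and C: "A.form_Cauchy u"
    have le: "E1 m E f f \<le> Ea a f f" for f
      using mult_right_mono[OF a L2_inner_self_nonneg[of m f]] by (simp add: E1_def Ea_def)
    have "\<exists>N. \<forall>i\<ge>N. \<forall>j\<ge>N. E1 m E (\<lambda>x. u i x - u j x) (\<lambda>x. u i x - u j x) < \<epsilon>" if "\<epsilon> > 0" for \<epsilon>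
      using C that le unfolding A.form_Cauchy_def by (meson order_le_less_trans)
    from closed_form[OF u this] obtain f where f: "f \<in> F"
      and lim: "(\<lambda>n. E1 m E (\<lambda>x. u n x - f x) (\<lambda>x. u n x - f x)) \<longlonglongrightarrow> 0" by blast
    have le2: "Ea a g g \<le> a * E1 m E g g" if "g \<in> F" for g
      using mult_right_mono[OF a E_nonneg[OF that]] by (simp add: E1_def Ea_def algebra_simps)
    have "(\<lambda>n. Ea a (\<lambda>x. u n x - f x) (\<lambda>x. u n x - f x)) \<longlonglongrightarrow> 0"
    proof (rule tendsto_sandwich[OF _ _ tendsto_const])
      show "(\<lambda>n. a * E1 m E (\<lambda>x. u n x - f x) (\<lambda>x. u n x - f x)) \<longlonglongrightarrow> 0"
        using tendsto_mult[OF tendsto_const[of a] lim] by simp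
    qed (use le2 E.V_diff[OF u f] A.B_nonneg in auto)
    then show "\<exists>f\<in>F. (\<lambda>n. Ea a (\<lambda>x. u n x - f x) (\<lambda>x. u n x - f x)) \<longlonglongrightarrow> 0" using f by blast
  qed
qed

sublocale E1: complete_form F "E1 m E"
  unfolding E1_Ea by (rule Ea_complete) simp

text \<open>Riesz representation of the functional \<open>L2_inner m h\<close> with respect to
  \<open>Ea a\<close>. Taking \<open>a \<ge> 1\<close> makes the \<open>L2\<close> norm at most the
  \<open>Ea a\<close> norm, so the functional is bounded.\<close>

lemma resolvent_exists:
  assumes h: "h \<in> L2 m" and a: "a \<ge> 1"
  shows "\<exists>u\<in>F. \<forall>g\<in>F. E u g + a * L2_inner m u g = L2_inner m h g"
proof -
  interpret A: complete_form F "Ea a" using a by (rule Ea_complete)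
  have "\<exists>u\<in>F. \<forall>g\<in>F. L2_inner m h g = Ea a u g"
  proof (rule A.Riesz_representation)
    fix g assume g: "g \<in> F"
    have "(L2_inner m h g)\<^sup>2 \<le> L2_inner m h h * L2_inner m g g"
      by (rule L2.Cauchy_Schwarz[OF h F_L2[OF g]])
    also have "\<dots> \<le> L2_inner m h h * Ea a g g"
      using E_nonneg[OF g] mult_right_mono[OF a L2_inner_self_nonneg[of m g]]
      by (intro mult_left_mono) (auto simp: Ea_def L2_inner_self_nonneg)
    finally show "(L2_inner m h g)\<^sup>2 \<le> L2_inner m h h * Ea a g g" .
  next
    fix f g assume "f \<in> F" "g \<in> F"
    then show "L2_inner m h (\<lambda>x. f x + g x) = L2_inner m h f + L2_inner m h g"
      using L2.B_add_right[OF F_L2 F_L2 h] by blast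
  next
    fix f a assume "f \<in> F"
    then show "L2_inner m h (\<lambda>x. a * f x) = a * L2_inner m h f"
      using L2.B_scale_right[OF h F_L2] by blast
  qed
  then show ?thesis by (auto simp: Ea_def)
qed

lemma E1_convergence:
  assumes "\<And>n. u n \<in> F" "f \<in> F"
    and lim: "(\<lambda>n. E1 m E (\<lambda>x. u n x - f x) (\<lambda>x. u n x - f x)) \<longlonglongrightarrow> 0"
  shows "(\<lambda>n. E (\<lambda>x. u n x - f x) (\<lambda>x. u n x - f x)) \<longlonglongrightarrow> 0"
    and "(\<lambda>n. L2_inner m (\<lambda>x. u n x - f x) (\<lambda>x. u n x - f x)) \<longlonglongrightarrow> 0"
  using assms E.V_diff[OF assms(1,2)] E_nonneg
  by (auto intro!: tendsto_sandwich[OF _ _ tendsto_const lim] simp: E1_def L2_inner_self_nonneg)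

lemma E_tendsto_quad:
  assumes u: "\<And>n. u n \<in> F" "f \<in> F"
    and lim: "(\<lambda>n. E1 m E (\<lambda>x. u n x - f x) (\<lambda>x. u n x - f x)) \<longlonglongrightarrow> 0"
  shows "(\<lambda>n. E (u n) (u n)) \<longlonglongrightarrow> E f f"
proof -
  have z: "(\<lambda>n. sqrt (E (\<lambda>x. u n x - f x) (\<lambda>x. u n x - f x))) \<longlonglongrightarrow> 0"
    using tendsto_real_sqrt[OF E1_convergence(1)[OF u lim]] by simp
  have "(\<lambda>n. sqrt (E (u n) (u n)) - sqrt (E f f)) \<longlonglongrightarrow> 0"
    by (rule Lim_null_comparison[OF _ z]) (simp add: E.abs_sqrt_diff[OF u])
  then have "(\<lambda>n. (sqrt (E (u n) (u n)))\<^sup>2) \<longlonglongrightarrow> (sqrt (E f f))\<^sup>2"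
    by (intro tendsto_power) (simp add: LIM_zero_iff)
  then show ?thesis using u E_nonneg by simp
qed

text \<open>Replaces the Banach-Saks argument for sequences that are bounded in energy and converge
  in \<open>L2\<close>: near-minimisers of \<open>E1\<close> on the shrinking sets are Cauchy in the
  form norm, and \<open>near\<close> identifies their limit with \<open>f\<close>. Whatever else the
  sets encode survives as long as it is stable under midpoints; being in the domain of the generator
  and having small energy near the boundary are treated this way later.\<close>

lemma weak_closure:
  assumes f: "f \<in> L2 m"
    and KF: "\<And>n v. v \<in> K n \<Longrightarrow> v \<in> F"
    and dec: "\<And>n. K (Suc n) \<subseteq> K n" and ne: "\<And>n. K n \<noteq> {}"
    and mid: "\<And>n f g. f \<in> K n \<Longrightarrow> g \<in> K n \<Longrightarrow> (\<lambda>x. (f x + g x) / 2) \<in> K n"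
    and bd: "\<And>n v. v \<in> K n \<Longrightarrow> E v v \<le> C"
    and near: "\<And>n v. v \<in> K n \<Longrightarrow> L2_inner m (\<lambda>x. v x - f x) (\<lambda>x. v x - f x) \<le> 1 / (real n + 1)"
  shows "f \<in> F \<and> (\<exists>v. (\<forall>n. v n \<in> K n) \<and> (\<lambda>n. E1 m E (\<lambda>x. v n x - f x) (\<lambda>x. v n x - f x)) \<longlonglongrightarrow> 0)"
proof -
  have b: "E1 m E v v \<le> C + 2 + 2 * L2_inner m f f" if "v \<in> K n" for v n
  proof -
    have "v \<in> L2 m" using that KF F_L2 by blast
    from L2.B_quad_add_le[OF L2.V_diff[OF this f] f]
    have "L2_inner m v v \<le> 2 * L2_inner m (\<lambda>x. v x - f x) (\<lambda>x. v x - f x) + 2 * L2_inner m f f" by simp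
    also have "L2_inner m (\<lambda>x. v x - f x) (\<lambda>x. v x - f x) \<le> 1 / (real n + 1)" by (rule near[OF that])
    also have "1 / (real n + 1) \<le> 1" by simp
    finally show ?thesis using bd[OF that] by (simp add: E1_def)
  qed
  obtain v where v: "\<And>n. v n \<in> K n" "E1.form_Cauchy v"
  proof (rule E1.midpoint_selection[of K "C + 2 + 2 * L2_inner m f f"])
    show "\<exists>f'\<in>K n. E1 m E f' f' \<le> C + 2 + 2 * L2_inner m f f" for n
      using b ne by blast
  qed (use KF dec mid in auto)
  have vF: "v n \<in> F" for n using v KF by blast
  obtain g where g: "g \<in> F" and lim: "(\<lambda>n. E1 m E (\<lambda>x. v n x - g x) (\<lambda>x. v n x - g x)) \<longlonglongrightarrow> 0"
    using E1.complete[OF vF v(2)] by blast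
  have "(\<lambda>n. 1 / (real n + 1)) \<longlonglongrightarrow> 0"
    using LIMSEQ_inverse_real_of_nat by (simp add: inverse_eq_divide add.commute)
  then have "(\<lambda>n. L2_inner m (\<lambda>x. v n x - f x) (\<lambda>x. v n x - f x)) \<longlonglongrightarrow> 0"
    by (rule tendsto_sandwich[OF _ _ tendsto_const, rotated 2]) (use near v in \<open>auto simp: L2_inner_self_nonneg\<close>)
  with E1_convergence(2)[OF vF g lim] have ae: "AE x in m. g x = f x"
    using L2_limit_unique[OF F_L2[OF vF] F_L2[OF g] f] by auto
  have fF: "f \<in> F" by (rule F_cong_AE[OF g L2_measurable[OF f] ae])
  \<comment> \<open>Completeness gives a limit \<open>g\<close> that agrees with \<open>f\<close>
    only almost everywhere, so the convergence is carried over through both arguments of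
    \<open>E\<close>.\<close>
  have "E1 m E (\<lambda>x. v n x - f x) (\<lambda>x. v n x - f x) = E1 m E (\<lambda>x. v n x - g x) (\<lambda>x. v n x - g x)" for n
  proof -
    have d: "(\<lambda>x. v n x - f x) \<in> F" "(\<lambda>x. v n x - g x) \<in> F" using E.V_diff vF fF g by auto
    have ae': "AE x in m. v n x - f x = v n x - g x" using ae by auto
    have "E (\<lambda>x. v n x - f x) (\<lambda>x. v n x - f x) = E (\<lambda>x. v n x - g x) (\<lambda>x. v n x - g x)"
      using E_cong_AE[OF d d(1) ae'] E_cong_AE[OF d d(2) ae'] E_sym[OF d] by simp
    moreover have "L2_inner m (\<lambda>x. v n x - f x) (\<lambda>x. v n x - f x) = L2_inner m (\<lambda>x. v n x - g x) (\<lambda>x. v n x - g x)"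
      by (rule L2_inner_cong_AE[OF ae' ae']) (use d F_measurable in auto)
    ultimately show ?thesis by (simp add: E1_def)
  qed
  with lim have "(\<lambda>n. E1 m E (\<lambda>x. v n x - f x) (\<lambda>x. v n x - f x)) \<longlonglongrightarrow> 0" by simp
  with v(1) fF show ?thesis by blast
qed

text \<open>Lower semicontinuity of the energy: functions of energy at most \<open>C\<close> that
  are \<open>L2\<close>-close to \<open>f\<close> are stable under midpoints, so
  \<open>weak_closure\<close> yields a sequence that converges in the form norm and still has energy
  at most \<open>C\<close>.\<close>

lemma weak_limit:
  assumes f: "f \<in> L2 m" and u: "\<And>n. u n \<in> F" "\<And>n. E (u n) (u n) \<le> C"
    and lim: "(\<lambda>n. L2_inner m (\<lambda>x. u n x - f x) (\<lambda>x. u n x - f x)) \<longlonglongrightarrow> 0"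
  shows "f \<in> F" "E f f \<le> C"
proof -
  define K where "K n = {v\<in>F. E v v \<le> C \<and> L2_inner m (\<lambda>x. v x - f x) (\<lambda>x. v x - f x) \<le> 1 / (real n + 1)}" for n :: nat
  have L: "f \<in> F \<and> (\<exists>v. (\<forall>n. v n \<in> K n) \<and> (\<lambda>n. E1 m E (\<lambda>x. v n x - f x) (\<lambda>x. v n x - f x)) \<longlonglongrightarrow> 0)"
  proof (rule weak_closure[OF f])
    show "K (Suc n) \<subseteq> K n" for n
    proof -
      have "1 / (real (Suc n) + 1) \<le> 1 / (real n + 1)" by (simp add: field_simps)
      then show ?thesis by (auto simp: K_def)
    qed
    show "K n \<noteq> {}" for n
    proof -
      have "eventually (\<lambda>k. L2_inner m (\<lambda>x. u k x - f x) (\<lambda>x. u k x - f x) < 1 / (real n + 1)) sequentially"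
        using order_tendstoD(2)[OF lim, of "1 / (real n + 1)"] by simp
      then obtain k where "L2_inner m (\<lambda>x. u k x - f x) (\<lambda>x. u k x - f x) < 1 / (real n + 1)"
        using eventually_happens'[OF sequentially_bot] by blast
      then have "u k \<in> K n" using u by (auto simp: K_def)
      then show ?thesis by blast
    qed
    show "(\<lambda>x. (g x + h x) / 2) \<in> K n" if "g \<in> K n" "h \<in> K n" for g h n
    proof -
      have gh: "g \<in> F" "h \<in> F" using that by (auto simp: K_def)
      have "E (\<lambda>x. (g x + h x) / 2) (\<lambda>x. (g x + h x) / 2) \<le> C"
        using E.B_midpoint_le[OF gh] that by (auto simp: K_def)
      moreover have "L2_inner m (\<lambda>x. (g x + h x) / 2 - f x) (\<lambda>x. (g x + h x) / 2 - f x) \<le> 1 / (real n + 1)"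
        by (rule L2_midpoint_near) (use that gh F_L2 f in \<open>auto simp: K_def\<close>)
      ultimately show ?thesis using E.V_midpoint[OF gh] by (simp add: K_def)
    qed
  qed (auto simp: K_def)
  then show fF: "f \<in> F" by blast
  from L obtain v where v: "\<And>n. v n \<in> K n" and vl: "(\<lambda>n. E1 m E (\<lambda>x. v n x - f x) (\<lambda>x. v n x - f x)) \<longlonglongrightarrow> 0"
    by blast
  have vF: "v n \<in> F" "E (v n) (v n) \<le> C" for n using v[of n] by (auto simp: K_def)
  have "(\<lambda>n. sqrt C + sqrt (E (\<lambda>x. v n x - f x) (\<lambda>x. v n x - f x))) \<longlonglongrightarrow> sqrt C + sqrt 0"
    by (intro tendsto_intros E1_convergence(1)[OF vF(1) fF vl])
  moreover have "sqrt (E f f) \<le> sqrt C + sqrt (E (\<lambda>x. v n x - f x) (\<lambda>x. v n x - f x))" for n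
    using order_trans[OF E.triangle_sqrt_diff[OF fF vF(1)] add_right_mono[OF real_sqrt_le_mono[OF vF(2)[of n]]]]
      E.B_diff_commute[OF fF vF(1), of n] by simp
  ultimately have "sqrt (E f f) \<le> sqrt C" by (intro LIMSEQ_le_const) auto
  then show "E f f \<le> C" by simp
qed

end

section \<open>The approximating forms of the semigroup and their limit\<close>

locale dirichlet_semigroup = dirichlet_form m E F
  for m :: "'a measure" and E :: "('a \<Rightarrow> real) \<Rightarrow> ('a \<Rightarrow> real) \<Rightarrow> real" and F :: "('a \<Rightarrow> real) set" +
  fixes P :: "real \<Rightarrow> ('a \<Rightarrow> real) \<Rightarrow> 'a \<Rightarrow> real"
  assumes assoc: "associated_semigroup m E F P"
begin

lemma markov: "markov_semigroup m P"
  using assoc by (simp add: associated_semigroup_def)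

lemma P_L2: "t > 0 \<Longrightarrow> f \<in> L2 m \<Longrightarrow> P t f \<in> L2 m"
  using markov by (simp add: markov_semigroup_def)

lemma P_cong_AE: "t > 0 \<Longrightarrow> f \<in> L2 m \<Longrightarrow> g \<in> L2 m \<Longrightarrow> AE x in m. f x = g x \<Longrightarrow> AE x in m. P t f x = P t g x"
  using markov[unfolded markov_semigroup_def, THEN conjunct2, THEN conjunct1] by blast

lemma P_lin: "t > 0 \<Longrightarrow> f \<in> L2 m \<Longrightarrow> g \<in> L2 m \<Longrightarrow>
    AE x in m. P t (\<lambda>z. a * f z + b * g z) x = a * P t f x + b * P t g x"
  using markov[unfolded markov_semigroup_def, THEN conjunct2, THEN conjunct2, THEN conjunct1] by blast

lemma P_sym: "t > 0 \<Longrightarrow> f \<in> L2 m \<Longrightarrow> g \<in> L2 m \<Longrightarrow> L2_inner m (P t f) g = L2_inner m f (P t g)"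
  using markov[unfolded markov_semigroup_def, THEN conjunct2, THEN conjunct2, THEN conjunct2, THEN conjunct1] by blast

lemma P_semigroup: "s > 0 \<Longrightarrow> t > 0 \<Longrightarrow> f \<in> L2 m \<Longrightarrow> AE x in m. P (s + t) f x = P s (P t f) x"
  using markov[unfolded markov_semigroup_def, THEN conjunct2, THEN conjunct2, THEN conjunct2, THEN conjunct2, THEN conjunct2, THEN conjunct1] by blast

lemma P_Markov: "t > 0 \<Longrightarrow> f \<in> L2 m \<Longrightarrow> AE x in m. 0 \<le> f x \<and> f x \<le> 1 \<Longrightarrow>
    AE x in m. 0 \<le> P t f x \<and> P t f x \<le> 1"
  using markov[unfolded markov_semigroup_def, THEN conjunct2, THEN conjunct2, THEN conjunct2, THEN conjunct2, THEN conjunct2, THEN conjunct2, THEN conjunct2] by blast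

lemma P_contraction:
  assumes "t > 0" "f \<in> L2 m" shows "L2_inner m (P t f) (P t f) \<le> L2_inner m f f"
proof -
  have "L2_norm m (P t f) \<le> L2_norm m f"
    using assms markov[unfolded markov_semigroup_def, THEN conjunct2, THEN conjunct2, THEN conjunct2, THEN conjunct2, THEN conjunct1] by blast
  then show ?thesis by (simp add: L2_norm_def)
qed

lemma P_add:
  assumes "t > 0" "f \<in> L2 m" "g \<in> L2 m" "h \<in> L2 m"
  shows "L2_inner m (P t (\<lambda>x. f x + g x)) h = L2_inner m (P t f) h + L2_inner m (P t g) h"
  using P_sym[OF assms(1) L2_add[OF assms(2,3)] assms(4)] P_sym[OF assms(1,2,4)] P_sym[OF assms(1,3,4)]
    L2.B_add[OF assms(2,3) P_L2[OF assms(1,4)]] by simp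

lemma P_scale:
  assumes "t > 0" "f \<in> L2 m" "h \<in> L2 m"
  shows "L2_inner m (P t (\<lambda>x. a * f x)) h = a * L2_inner m (P t f) h"
  using P_sym[OF assms(1) L2_scale[OF assms(2)] assms(3), of a] P_sym[OF assms(1,2,3)]
    L2.B_scale[OF assms(2) P_L2[OF assms(1,3)]] by simp

lemma P_diff:
  assumes "t > 0" "f \<in> L2 m" "g \<in> L2 m" "h \<in> L2 m"
  shows "L2_inner m (P t (\<lambda>x. f x - g x)) h = L2_inner m (P t f) h - L2_inner m (P t g) h"
  using P_sym[OF assms(1) L2.V_diff[OF assms(2,3)] assms(4)] P_sym[OF assms(1,2,4)] P_sym[OF assms(1,3,4)]
    L2.B_diff[OF assms(2,3) P_L2[OF assms(1,4)]] by simp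

lemma P_semigroup_inner:
  assumes "s > 0" "t > 0" "f \<in> L2 m" "g \<in> L2 m"
  shows "L2_inner m (P (s + t) f) g = L2_inner m (P s f) (P t g)"
proof -
  have "L2_inner m (P (t + s) f) g = L2_inner m (P t (P s f)) g"
    by (rule L2_inner_cong_AE) (use assms P_semigroup[of t s f] in \<open>auto intro!: L2_measurable P_L2\<close>)
  also have "\<dots> = L2_inner m (P s f) (P t g)"
    by (rule P_sym) (use assms P_L2 in auto)
  finally show ?thesis by (simp add: add.commute)
qed

lemma P_double:
  assumes "t > 0" "f \<in> L2 m"
  shows "L2_inner m (P (2 * t) f) f = L2_inner m (P t f) (P t f)"
  using P_semigroup_inner[OF assms(1,1,2,2)] unfolding mult_2 .

text \<open>\<open>P t\<close> is the square of the symmetric operator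
  \<open>P (t / 2)\<close>.\<close>

lemma P_psd: "t > 0 \<Longrightarrow> f \<in> L2 m \<Longrightarrow> L2_inner m (P t f) f \<ge> 0"
  using P_double[of "t/2" f] L2_inner_self_nonneg[of m "P (t/2) f"] by simp

lemma P_inner_le: "t > 0 \<Longrightarrow> f \<in> L2 m \<Longrightarrow> L2_inner m (P t f) f \<le> L2_inner m f f"
  using P_double[of "t/2" f] P_contraction[of "t/2" f] by simp

text \<open>The approximating form of the semigroup, which tends to \<open>E\<close> on
  \<open>F\<close> as \<open>t\<close> tends to 0. Its monotonicity in \<open>t\<close> enters only
  along halving, see \<open>step_form_dyadic\<close>.\<close>

definition step_form :: "real \<Rightarrow> ('a \<Rightarrow> real) \<Rightarrow> ('a \<Rightarrow> real) \<Rightarrow> real" where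
  "step_form t f g = (L2_inner m f g - L2_inner m (P t f) g) / t"

lemma step_form_psd: assumes "t > 0" shows "psd_form (L2 m) (step_form t)"
proof
  fix f g h :: "'a \<Rightarrow> real" and a :: real
  assume f: "f \<in> L2 m"
  show "step_form t f f \<ge> 0" using P_inner_le[OF assms f] assms by (simp add: step_form_def)
  assume g: "g \<in> L2 m"
  show "step_form t f g = step_form t g f"
    using P_sym[OF assms f g] L2.B_sym[OF f P_L2[OF assms g]] L2.B_sym[OF f g] by (simp add: step_form_def)
  show "step_form t (\<lambda>x. a * f x) g = a * step_form t f g"
    using L2.B_scale[OF f g] P_scale[OF assms f g] by (simp add: step_form_def field_simps)
  assume h: "h \<in> L2 m"
  show "step_form t (\<lambda>x. f x + g x) h = step_form t f h + step_form t g h"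
    using L2.B_add[OF f g h] P_add[OF assms f g h] assms by (simp add: step_form_def field_simps)
qed (use L2.V_ne L2_add L2_scale in auto)

lemma step_form_le: "t > 0 \<Longrightarrow> f \<in> L2 m \<Longrightarrow> step_form t f f \<le> L2_inner m f f / t"
  using P_psd[of t f] by (simp add: step_form_def divide_right_mono)

text \<open>Expanding the squared norm of \<open>f - P (t / 2) f\<close>, with
  \<open>P_double\<close> for the last term, gives a discrete convexity of
  \<open>L2_inner m (P t f) f\<close> in \<open>t\<close>, which is the claim.\<close>

lemma step_form_half:
  assumes t: "t > 0" and f: "f \<in> L2 m" shows "step_form t f f \<le> step_form (t / 2) f f"
proof -
  have t2: "t / 2 > 0" using t by simp
  have "0 \<le> L2_inner m (\<lambda>x. f x - P (t/2) f x) (\<lambda>x. f x - P (t/2) f x)" by (rule L2_inner_self_nonneg)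
  also have "\<dots> = L2_inner m f f - 2 * L2_inner m f (P (t/2) f) + L2_inner m (P (t/2) f) (P (t/2) f)"
    by (rule L2.B_quad_diff[OF f P_L2[OF t2 f]])
  finally have "L2_inner m f f - L2_inner m (P t f) f \<le> 2 * (L2_inner m f f - L2_inner m (P (t/2) f) f)"
    using P_double[OF t2 f] L2.B_sym[OF f P_L2[OF t2 f]] by simp
  from divide_right_mono[OF this, of t] t show ?thesis by (simp add: step_form_def mult.commute)
qed

lemma step_form_dyadic:
  assumes t: "t > 0" and f: "f \<in> L2 m" shows "step_form t f f \<le> step_form (t / 2 ^ n) f f"
proof (induction n)
  case (Suc n)
  have "step_form (t / 2 ^ n) f f \<le> step_form (t / 2 ^ n / 2) f f" by (rule step_form_half) (use t f in auto)
  then show ?case using Suc by (simp add: mult.commute)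
qed simp

lemma dyadic_at_right: 
  assumes "t > (0::real)" shows "filterlim (\<lambda>n. t / 2 ^ n) (at_right 0) sequentially"
proof -
  have "(\<lambda>n. t * (1/2) ^ n) \<longlonglongrightarrow> t * 0"
    by (intro tendsto_intros LIMSEQ_realpow_zero) auto
  then have "(\<lambda>n. t / 2 ^ n) \<longlonglongrightarrow> 0" by (simp add: power_divide)
  then show ?thesis using assms by (auto intro!: tendsto_imp_filterlim_at_right)
qed

definition generator :: "('a \<Rightarrow> real) \<Rightarrow> ('a \<Rightarrow> real) \<Rightarrow> bool" where
  "generator u h \<longleftrightarrow> u \<in> F \<and> h \<in> L2 m \<and> (\<forall>g\<in>F. E u g = - L2_inner m h g)"

text \<open>\<open>- step_form t u g\<close> is the inner product of \<open>g\<close> with the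
  difference quotient of the semigroup at \<open>u\<close>, and \<open>associated_semigroup\<close>
  says that this quotient converges to \<open>h\<close> in \<open>L2\<close>.\<close>

lemma generator_tendsto:
  assumes "generator u h" and g: "g \<in> L2 m"
  shows "((\<lambda>t. step_form t u g) \<longlongrightarrow> - L2_inner m h g) (at_right 0)"
proof -
  have u: "u \<in> F" "u \<in> L2 m" and h: "h \<in> L2 m" using assms F_L2 by (auto simp: generator_def)
  have "((\<lambda>t. L2_norm m (\<lambda>x. (P t u x - u x) / t - h x)) \<longlongrightarrow> 0) (at_right 0)"
    using assoc assms(1) u h unfolding associated_semigroup_def generator_def by blast
  from tendsto_mult[OF this tendsto_const[of "L2_norm m g"]]
  have z: "((\<lambda>t. L2_norm m (\<lambda>x. (P t u x - u x) / t - h x) * L2_norm m g) \<longlongrightarrow> 0) (at_right 0)" by simp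
  have "((\<lambda>t. step_form t u g + L2_inner m h g) \<longlongrightarrow> 0) (at_right 0)"
  proof (rule Lim_null_comparison[OF _ z])
    have "norm (step_form t u g + L2_inner m h g) \<le> L2_norm m (\<lambda>x. (P t u x - u x) / t - h x) * L2_norm m g"
      if t: "t > 0" for t
    proof -
      have v: "(\<lambda>x. 1 / t * (P t u x - u x)) \<in> L2 m" by (intro L2_scale L2.V_diff P_L2 t u)
      then have w: "(\<lambda>x. 1 / t * (P t u x - u x) - h x) \<in> L2 m" by (intro L2.V_diff h)
      have "L2_inner m (\<lambda>x. 1 / t * (P t u x - u x) - h x) g
          = 1 / t * (L2_inner m (P t u) g - L2_inner m u g) - L2_inner m h g"
        unfolding L2.B_diff[OF v h g] L2.B_scale[OF L2.V_diff[OF P_L2[OF t u(2)] u(2)] g, of "1/t"]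
          L2.B_diff[OF P_L2[OF t u(2)] u(2) g] ..
      also have "\<dots> = - (step_form t u g + L2_inner m h g)"
        by (simp add: step_form_def diff_divide_distrib)
      finally have "L2_inner m (\<lambda>x. 1 / t * (P t u x - u x) - h x) g = - (step_form t u g + L2_inner m h g)" .
      then show ?thesis using L2.Cauchy_Schwarz_abs[OF w g] by (simp add: L2_norm_def)
    qed
    then show "\<forall>\<^sub>F t in at_right 0. norm (step_form t u g + L2_inner m h g)
        \<le> L2_norm m (\<lambda>x. (P t u x - u x) / t - h x) * L2_norm m g"
      by (simp add: eventually_at_right_less eventually_mono[OF eventually_at_right_less])
  qed
  then show ?thesis using LIM_zero_iff[of "\<lambda>t. step_form t u g" "- L2_inner m h g"] by simp
qed

text \<open>The resolvent equation \<open>E u g + a * L2_inner m u g = a * L2_inner m f g\<close>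
  says exactly that the generator maps \<open>u\<close> to \<open>a * (u - f)\<close>.\<close>

lemma resolvent:
  assumes f: "f \<in> L2 m" and a: "a \<ge> 1"
  obtains u where "generator u (\<lambda>x. a * u x - a * f x)"
proof -
  obtain u where u: "u \<in> F" and eq: "\<And>g. g \<in> F \<Longrightarrow> E u g + a * L2_inner m u g = L2_inner m (\<lambda>x. a * f x) g"
    using resolvent_exists[OF L2_scale[OF f] a] by blast
  have uL: "u \<in> L2 m" using u F_L2 by blast
  have "generator u (\<lambda>x. a * u x - a * f x)"
    unfolding generator_def
  proof (intro conjI ballI)
    fix g assume g: "g \<in> F"
    show "E u g = - L2_inner m (\<lambda>x. a * u x - a * f x) g"
      using eq[OF g] L2.B_diff[OF L2_scale[OF uL] L2_scale[OF f] F_L2[OF g], of a a]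
        L2.B_scale[OF uL F_L2[OF g]] by simp
  qed (use u uL f in \<open>auto intro: L2.V_diff L2_scale\<close>)
  then show thesis by (rule that)
qed

lemma generator_step_form_le:
  assumes "generator u h" and t: "t > 0" shows "step_form t u u \<le> E u u"
proof -
  have u: "u \<in> F" "u \<in> L2 m" using assms F_L2 by (auto simp: generator_def)
  have "(\<lambda>n. step_form (t / 2 ^ n) u u) \<longlonglongrightarrow> - L2_inner m h u"
    by (rule filterlim_compose[OF generator_tendsto[OF assms(1) u(2)] dyadic_at_right[OF t]])
  then have "step_form t u u \<le> - L2_inner m h u"
    by (rule LIMSEQ_le_const) (use step_form_dyadic[OF t u(2)] in blast)
  moreover have "E u u = - L2_inner m h u" using assms(1) u by (auto simp: generator_def)
  ultimately show ?thesis by simp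
qed

lemma generator_lincomb:
  assumes "generator u h" "generator v k" shows "generator (\<lambda>x. (u x + v x) / 2) (\<lambda>x. (h x + k x) / 2)"
  unfolding generator_def
proof (intro conjI ballI)
  have uv: "u \<in> F" "v \<in> F" "h \<in> L2 m" "k \<in> L2 m" using assms by (auto simp: generator_def)
  show "(\<lambda>x. (u x + v x) / 2) \<in> F" "(\<lambda>x. (h x + k x) / 2) \<in> L2 m"
    using uv E.V_midpoint L2.V_midpoint by auto
  fix g assume g: "g \<in> F"
  show "E (\<lambda>x. (u x + v x) / 2) g = - L2_inner m (\<lambda>x. (h x + k x) / 2) g"
    using E.B_scale[OF E.V_add[OF uv(1,2)] g, of "1/2"] E.B_add[OF uv(1,2) g] g assms
      L2.B_scale[OF L2.V_add[OF uv(3,4)] F_L2[OF g], of "1/2"] L2.B_add[OF uv(3,4) F_L2[OF g]]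
    by (simp add: generator_def)
qed

text \<open>The resolvents of \<open>f\<close> approach it in \<open>L2\<close> and have energy at
  most \<open>4 * E f f\<close>; \<open>weak_closure\<close> turns this into approximation in the
  form norm by functions on which the generator is defined.\<close>

lemma generator_dense:
  assumes f: "f \<in> F"
  obtains v where "\<And>n. v n \<in> F" "\<And>n. \<exists>h. generator (v n) h"
    "(\<lambda>n. E1 m E (\<lambda>x. v n x - f x) (\<lambda>x. v n x - f x)) \<longlonglongrightarrow> 0"
proof -
  have fL: "f \<in> L2 m" using f F_L2 by blast
  define K where "K n = {v. (\<exists>h. generator v h) \<and> E v v \<le> 4 * E f f \<and>
    L2_inner m (\<lambda>x. v x - f x) (\<lambda>x. v x - f x) \<le> 1 / (real n + 1)}" for n :: nat
  have L: "f \<in> F \<and> (\<exists>v. (\<forall>n. v n \<in> K n) \<and> (\<lambda>n. E1 m E (\<lambda>x. v n x - f x) (\<lambda>x. v n x - f x)) \<longlonglongrightarrow> 0)"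
  proof (rule weak_closure[OF fL])
    show "K (Suc n) \<subseteq> K n" for n
    proof -
      have "1 / (real (Suc n) + 1) \<le> 1 / (real n + 1)" by (simp add: field_simps)
      then show ?thesis by (auto simp: K_def)
    qed
    show "v \<in> F" if "v \<in> K n" for v n using that by (auto simp: K_def generator_def)
    show "K n \<noteq> {}" for n
    proof -
      \<comment> \<open>With this \<open>a\<close>, the bound
        \<open>2 * (a * L2_inner m g g) \<le> E f f\<close> for the error \<open>g = f - u\<close>
        gives squared distance at most \<open>1 / (n + 1)\<close>; the case \<open>E f f = 0\<close>
        gets its own argument below.\<close>
      define a where "a = max 1 ((real n + 1) * E f f)"
      have a: "a \<ge> 1" "a \<ge> (real n + 1) * E f f" by (auto simp: a_def)
      obtain u where gu: "generator u (\<lambda>x. a * u x - a * f x)" using resolvent[OF fL a(1)] .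
      have u: "u \<in> F" "u \<in> L2 m" using gu F_L2 by (auto simp: generator_def)
      define g where "g = (\<lambda>x. f x - u x)"
      have g: "g \<in> F" "g \<in> L2 m" using u f F_L2 E.V_diff unfolding g_def by auto
      have "E u g = - L2_inner m (\<lambda>x. a * u x - a * f x) g"
        using gu g by (auto simp: generator_def)
      also have "(\<lambda>x. a * u x - a * f x) = (\<lambda>x. - a * g x)" by (auto simp: g_def algebra_simps)
      also have "- L2_inner m (\<lambda>x. - a * g x) g = a * L2_inner m g g"
        using L2.B_scale[OF g(2) g(2), of "-a"] by simp
      finally have "E g g + a * L2_inner m g g = E f g"
        using E.B_diff[OF f u(1) g(1)] by (simp add: g_def)
      moreover have "2 * E f g \<le> E f f + E g g"
        using E.B_quad_diff[OF f g(1)] E.B_nonneg[OF E.V_diff[OF f g(1)]] by simp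
      moreover have "a * L2_inner m g g \<ge> 0" using a by (simp add: L2_inner_self_nonneg)
      ultimately have 1: "E g g \<le> E f f" "2 * (a * L2_inner m g g) \<le> E f f" using E_nonneg[OF g(1)] by linarith+
      have "E u u \<le> 2 * E f f + 2 * E g g"
        using E.B_quad_diff_le[OF f g(1)] by (simp add: g_def)
      then have 2: "E u u \<le> 4 * E f f" using 1 by simp
      have 3: "L2_inner m g g \<le> 1 / (real n + 1)"
      proof (cases "E f f = 0")
        case True
        then have "a * L2_inner m g g \<le> 0" using 1 by simp
        then have "L2_inner m g g \<le> 0" using a by (simp add: mult_le_0_iff)
        then show ?thesis by (meson divide_nonneg_nonneg of_nat_0_le_iff order_trans zero_le_one add_nonneg_nonneg)
      next
        case False
        then have Ef: "E f f > 0" using E_nonneg[OF f] by simp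
        have "(real n + 1) * E f f * L2_inner m g g \<le> a * L2_inner m g g"
          using a by (intro mult_right_mono) (auto simp: L2_inner_self_nonneg)
        also have "\<dots> \<le> E f f" using 1(2) \<open>a * L2_inner m g g \<ge> 0\<close> by linarith
        finally have "E f f * ((real n + 1) * L2_inner m g g) \<le> E f f * 1" by (simp add: algebra_simps)
        then have "(real n + 1) * L2_inner m g g \<le> 1" using Ef by (simp only: mult_le_cancel_left_pos)
        then show ?thesis by (simp add: field_simps)
      qed
      have "u \<in> K n" using gu 2 3 L2.B_diff_commute[OF fL u(2)] by (auto simp: K_def g_def)
      then show ?thesis by blast
    qed
    show "(\<lambda>x. (g x + h x) / 2) \<in> K n" if "g \<in> K n" "h \<in> K n" for g h n
    proof -
      have gh: "g \<in> F" "h \<in> F" using that by (auto simp: K_def generator_def)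
      have "E (\<lambda>x. (g x + h x) / 2) (\<lambda>x. (g x + h x) / 2) \<le> 4 * E f f"
        using E.B_midpoint_le[OF gh] that by (auto simp: K_def)
      moreover have "L2_inner m (\<lambda>x. (g x + h x) / 2 - f x) (\<lambda>x. (g x + h x) / 2 - f x) \<le> 1 / (real n + 1)"
        by (rule L2_midpoint_near) (use that gh F_L2 fL in \<open>auto simp: K_def\<close>)
      moreover have "\<exists>k. generator (\<lambda>x. (g x + h x) / 2) k"
        using that generator_lincomb unfolding K_def by blast
      ultimately show ?thesis by (simp add: K_def)
    qed
  qed (auto simp: K_def)
  then obtain v where v: "\<And>n. v n \<in> K n" "(\<lambda>n. E1 m E (\<lambda>x. v n x - f x) (\<lambda>x. v n x - f x)) \<longlonglongrightarrow> 0" by blast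
  show thesis
    by (rule that[of v]) (use v in \<open>auto simp: K_def generator_def\<close>)
qed

text \<open>In the domain of the generator this is dyadic monotonicity. In general, for fixed
  \<open>t\<close>, \<open>step_form t\<close> is bounded by \<open>1 / t\<close> times the squared
  \<open>L2\<close> norm, so both sides pass to the limit along
  \<open>generator_dense\<close>.\<close>

lemma step_form_le_E:
  assumes f: "f \<in> F" and t: "t > 0" shows "step_form t f f \<le> E f f"
proof -
  interpret T: psd_form "L2 m" "step_form t" by (rule step_form_psd[OF t])
  obtain v where v: "\<And>n. v n \<in> F" "\<And>n. \<exists>h. generator (v n) h"
    and lim: "(\<lambda>n. E1 m E (\<lambda>x. v n x - f x) (\<lambda>x. v n x - f x)) \<longlonglongrightarrow> 0" by (rule generator_dense[OF f]) blast
  have L: "v n \<in> L2 m" "f \<in> L2 m" for n using v f F_L2 by auto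
  have le: "sqrt (step_form t f f) \<le> sqrt (E (v n) (v n)) + sqrt (L2_inner m (\<lambda>x. v n x - f x) (\<lambda>x. v n x - f x) / t)" for n
  proof -
    have "sqrt (step_form t f f) \<le> sqrt (step_form t (v n) (v n)) + sqrt (step_form t (\<lambda>x. f x - v n x) (\<lambda>x. f x - v n x))"
      by (rule T.triangle_sqrt_diff[OF L(2,1)])
    also have "step_form t (\<lambda>x. f x - v n x) (\<lambda>x. f x - v n x) = step_form t (\<lambda>x. v n x - f x) (\<lambda>x. v n x - f x)"
      by (rule T.B_diff_commute[OF L(2,1)])
    also have "sqrt (step_form t (v n) (v n)) + sqrt (step_form t (\<lambda>x. v n x - f x) (\<lambda>x. v n x - f x))
      \<le> sqrt (E (v n) (v n)) + sqrt (L2_inner m (\<lambda>x. v n x - f x) (\<lambda>x. v n x - f x) / t)"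
      using generator_step_form_le v(2)[of n] t step_form_le[OF t L2.V_diff[OF L(1,2)]]
      by (intro add_mono real_sqrt_le_mono) auto
    finally show ?thesis .
  qed
  have "(\<lambda>n. sqrt (E (v n) (v n)) + sqrt (L2_inner m (\<lambda>x. v n x - f x) (\<lambda>x. v n x - f x) / t)) \<longlonglongrightarrow> sqrt (E f f) + sqrt (0 / t)"
    by (intro tendsto_intros E_tendsto_quad[OF v(1) f] E1_convergence[OF v(1) f] lim) (use t in auto)
  then have "sqrt (step_form t f f) \<le> sqrt (E f f) + sqrt (0 / t)"
    by (rule LIMSEQ_le_const) (use le in auto)
  then show ?thesis by simp
qed

text \<open>The bound by \<open>E\<close> is uniform in \<open>t\<close>, so replacing
  \<open>f\<close> by a nearby \<open>v n\<close> in the domain of the generator costs the same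
  small error for every \<open>t\<close> in the seminorms
  \<open>sqrt (step_form t f f)\<close>.\<close>

lemma step_form_tendsto_quad:
  assumes f: "f \<in> F" shows "((\<lambda>t. step_form t f f) \<longlongrightarrow> E f f) (at_right 0)"
proof -
  obtain v where v: "\<And>n. v n \<in> F" "\<And>n. \<exists>h. generator (v n) h"
    and lim: "(\<lambda>n. E1 m E (\<lambda>x. v n x - f x) (\<lambda>x. v n x - f x)) \<longlonglongrightarrow> 0" by (rule generator_dense[OF f]) blast
  have "((\<lambda>t. sqrt (step_form t f f)) \<longlongrightarrow> sqrt (E f f)) (at_right 0)"
  proof (rule tendstoI)
    fix \<epsilon> :: real assume e: "\<epsilon> > 0"
    have "(\<lambda>n. sqrt (E (\<lambda>x. v n x - f x) (\<lambda>x. v n x - f x))) \<longlonglongrightarrow> sqrt 0"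
      by (intro tendsto_intros E1_convergence(1)[OF v(1) f lim])
    from order_tendstoD(2)[OF this, of "\<epsilon>/3"] e
    obtain n where n: "sqrt (E (\<lambda>x. v n x - f x) (\<lambda>x. v n x - f x)) < \<epsilon> / 3"
      using eventually_happens'[OF sequentially_bot] by auto
    obtain h where h: "generator (v n) h" using v(2) by blast
    have "((\<lambda>t. sqrt (step_form t (v n) (v n))) \<longlongrightarrow> sqrt (E (v n) (v n))) (at_right 0)"
      using generator_tendsto[OF h F_L2[OF v(1)[of n]]] h v(1) by (auto simp: generator_def intro!: tendsto_intros)
    from tendstoD[OF this, of "\<epsilon>/3"] e
    have "\<forall>\<^sub>F t in at_right 0. dist (sqrt (step_form t (v n) (v n))) (sqrt (E (v n) (v n))) < \<epsilon> / 3" by simp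
    moreover have "\<forall>\<^sub>F t::real in at_right 0. t > 0" by (rule eventually_at_right_less)
    ultimately show "\<forall>\<^sub>F t in at_right 0. dist (sqrt (step_form t f f)) (sqrt (E f f)) < \<epsilon>"
    proof eventually_elim
      case (elim t)
      interpret T: psd_form "L2 m" "step_form t" by (rule step_form_psd[OF elim(2)])
      have "\<bar>sqrt (step_form t (v n) (v n)) - sqrt (step_form t f f)\<bar> \<le> sqrt (step_form t (\<lambda>x. v n x - f x) (\<lambda>x. v n x - f x))"
        using T.abs_sqrt_diff F_L2 v f by blast
      also have "\<dots> \<le> sqrt (E (\<lambda>x. v n x - f x) (\<lambda>x. v n x - f x))"
        by (intro real_sqrt_le_mono step_form_le_E E.V_diff v f elim)
      finally show ?case
        using n elim(1) E.abs_sqrt_diff[OF v(1)[of n] f] unfolding dist_real_def by argo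
    qed
  qed
  from tendsto_power[OF this, of 2] have "((\<lambda>t. (sqrt (step_form t f f))\<^sup>2) \<longlongrightarrow> E f f) (at_right 0)"
    using E_nonneg[OF f] by simp
  then show ?thesis
  proof (rule Lim_transform_eventually)
    show "\<forall>\<^sub>F t in at_right 0. (sqrt (step_form t f f))\<^sup>2 = step_form t f f"
      using eventually_at_right_less
      by (rule eventually_mono) (use psd_form.B_nonneg[OF step_form_psd F_L2[OF f]] in simp)
  qed
qed

lemma step_form_tendsto:
  assumes f: "f \<in> F" and g: "g \<in> F" shows "((\<lambda>t. step_form t f g) \<longlongrightarrow> E f g) (at_right 0)"
proof -
  have "((\<lambda>t. (step_form t (\<lambda>x. f x + g x) (\<lambda>x. f x + g x) - step_form t f f - step_form t g g) / 2) \<longlongrightarrow>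
      (E (\<lambda>x. f x + g x) (\<lambda>x. f x + g x) - E f f - E g g) / 2) (at_right 0)"
    by (intro tendsto_intros step_form_tendsto_quad E.V_add f g) auto
  also have "(E (\<lambda>x. f x + g x) (\<lambda>x. f x + g x) - E f f - E g g) / 2 = E f g"
    using E.B_quad_add[OF f g] by simp
  finally show ?thesis
  proof (rule Lim_transform_eventually)
    have "(step_form t (\<lambda>x. f x + g x) (\<lambda>x. f x + g x) - step_form t f f - step_form t g g) / 2 = step_form t f g" if "t > 0" for t
      using psd_form.B_quad_add[OF step_form_psd[OF that] F_L2[OF f] F_L2[OF g]] by simp
    then show "\<forall>\<^sub>F t in at_right 0. (step_form t (\<lambda>x. f x + g x) (\<lambda>x. f x + g x) - step_form t f f - step_form t g g) / 2 = step_form t f g"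
      using eventually_at_right_less by (rule eventually_mono[rotated])
  qed
qed

text \<open>Converse to \<open>step_form_le_E\<close>. For the resolvent \<open>u\<close> of
  \<open>f\<close>, the sum of \<open>E u u\<close> and \<open>2 * a\<close> times the squared
  distance of \<open>u\<close> to \<open>f\<close> is at most \<open>C\<close>; so the resolvents
  converge to \<open>f\<close> in \<open>L2\<close> with bounded energy and
  \<open>weak_limit\<close> applies.\<close>

lemma step_form_bounded_F:
  assumes f: "f \<in> L2 m" and s: "filterlim s (at_right 0) sequentially"
    and bd: "\<And>n. s n > 0" "\<And>n. step_form (s n) f f \<le> C"
  shows "f \<in> F" "E f f \<le> C"
proof -
  have C: "C \<ge> 0" using bd psd_form.B_nonneg[OF step_form_psd f] order_trans by blast
  have ex: "\<exists>u\<in>F. E u u \<le> C \<and> 2 * a * L2_inner m (\<lambda>x. u x - f x) (\<lambda>x. u x - f x) \<le> C" if a: "a \<ge> 1" for a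
  proof -
    obtain u where gu: "generator u (\<lambda>x. a * u x - a * f x)" using resolvent[OF f a] .
    have u: "u \<in> F" "u \<in> L2 m" using gu F_L2 by (auto simp: generator_def)
    have ip: "- L2_inner m (\<lambda>x. a * u x - a * f x) g = a * L2_inner m (\<lambda>x. f x - u x) g" if "g \<in> L2 m" for g
      unfolding L2.B_diff[OF L2_scale[OF u(2)] L2_scale[OF f] that, of a a] L2.B_scale[OF u(2) that, of a]
        L2.B_scale[OF f that, of a] L2.B_diff[OF f u(2) that] by (simp add: algebra_simps)
    have Eu: "E u u = a * L2_inner m (\<lambda>x. f x - u x) u"
      using gu u ip[OF u(2)] by (auto simp: generator_def)
    have "(\<lambda>n. step_form (s n) u f) \<longlonglongrightarrow> a * L2_inner m (\<lambda>x. f x - u x) f"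
      using filterlim_compose[OF generator_tendsto[OF gu f] s] ip[OF f] by simp
    \<comment> \<open>Cauchy-Schwarz for \<open>step_form (s n)\<close> uses the bound on
      \<open>f\<close> only along the sequence, while \<open>u\<close> is controlled by its own
      energy.\<close>
    moreover have "step_form (s n) u f \<le> sqrt (E u u) * sqrt C" for n
    proof -
      have "step_form (s n) u f \<le> sqrt (step_form (s n) u u) * sqrt (step_form (s n) f f)"
        using psd_form.Cauchy_Schwarz_abs[OF step_form_psd[OF bd(1)] u(2) f] by (simp add: abs_le_iff)
      also have "\<dots> \<le> sqrt (E u u) * sqrt C"
        using step_form_le_E[OF u(1) bd(1)] bd(2) E_nonneg[OF u(1)] psd_form.B_nonneg[OF step_form_psd[OF bd(1)] f]
        by (intro mult_mono real_sqrt_le_mono) auto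
      finally show ?thesis .
    qed
    ultimately have "a * L2_inner m (\<lambda>x. f x - u x) f \<le> sqrt (E u u) * sqrt C"
      by (intro LIMSEQ_le_const2) auto
    moreover have "2 * (sqrt (E u u) * sqrt C) \<le> E u u + C"
      using sum_squares_bound[of "sqrt (E u u)" "sqrt C"] C E_nonneg[OF u(1)] by (simp add: mult.assoc)
    moreover have "L2_inner m (\<lambda>x. f x - u x) (\<lambda>x. f x - u x) = L2_inner m (\<lambda>x. f x - u x) f - L2_inner m (\<lambda>x. f x - u x) u"
      by (rule L2.B_diff_right[OF f u(2) L2.V_diff[OF f u(2)]])
    then have "a * L2_inner m (\<lambda>x. f x - u x) f = E u u + a * L2_inner m (\<lambda>x. f x - u x) (\<lambda>x. f x - u x)"
      using Eu by (simp add: right_diff_distrib)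
    moreover have "0 \<le> a * L2_inner m (\<lambda>x. f x - u x) (\<lambda>x. f x - u x)"
      using a by (simp add: L2_inner_self_nonneg)
    ultimately have "E u u \<le> C" "2 * (a * L2_inner m (\<lambda>x. f x - u x) (\<lambda>x. f x - u x)) \<le> C"
      using E_nonneg[OF u(1)] by linarith+
    then show ?thesis using u(1) L2.B_diff_commute[OF f u(2)] by (auto simp: mult.assoc)
  qed
  have "\<exists>u. u \<in> F \<and> E u u \<le> C \<and> 2 * (real n + 1) * L2_inner m (\<lambda>x. u x - f x) (\<lambda>x. u x - f x) \<le> C" for n
    using ex[of "real n + 1"] by auto
  then obtain u where u: "\<And>n. u n \<in> F" "\<And>n. E (u n) (u n) \<le> C"
      "\<And>n. 2 * (real n + 1) * L2_inner m (\<lambda>x. u n x - f x) (\<lambda>x. u n x - f x) \<le> C" by metis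
  have "(\<lambda>n. C / 2 * (1 / (real n + 1))) \<longlonglongrightarrow> C / 2 * 0"
    using LIMSEQ_inverse_real_of_nat by (intro tendsto_intros) (simp add: inverse_eq_divide add.commute)
  then have "(\<lambda>n. C / 2 * (1 / (real n + 1))) \<longlonglongrightarrow> 0" by simp
  then have "(\<lambda>n. L2_inner m (\<lambda>x. u n x - f x) (\<lambda>x. u n x - f x)) \<longlonglongrightarrow> 0"
    by (rule tendsto_sandwich[OF _ _ tendsto_const, rotated 2])
      (use u(3) in \<open>auto simp: L2_inner_self_nonneg field_simps intro!: always_eventually\<close>)
  from weak_limit[OF f u(1,2) this] show "f \<in> F" "E f f \<le> C" by auto
qed

text \<open>The sequence \<open>L2_inner m (P (k * s) f) f\<close> is convex in \<open>k\<close>, so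
  its decrement at \<open>N\<close> is at most the mean of the first \<open>N\<close> decrements.
  With \<open>N * s = 2 * t\<close> the decrement at \<open>N\<close> is
  \<open>s * step_form s (P t f) (P t f)\<close>.\<close>

lemma P_energy:
  assumes t: "t > 0" and f: "f \<in> L2 m"
  shows "P t f \<in> F" "E (P t f) (P t f) \<le> L2_inner m f f / (2 * t)"
proof -
  have key: "step_form (2 * t / (real n + 1)) (P t f) (P t f) \<le> L2_inner m f f / (2 * t)" for n
  proof -
    define N where "N = Suc n"
    define s where "s = 2 * t / real N"
    have s: "s > 0" using t by (simp add: s_def N_def)
    \<comment> \<open>\<open>P\<close> is specified for positive times only, so the value at index 0
      is set by hand to the squared norm.\<close>
    define e where "e k = (if k = 0 then L2_inner m f f else L2_inner m (P (real k * s) f) f)" for k :: nat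
    have sL: "P s f \<in> L2 m" by (rule P_L2[OF s f])
    \<comment> \<open>The second difference is \<open>L2_inner m (P r g) g\<close> with
      \<open>g = f - P s f\<close>, which is nonnegative; for \<open>k = 0\<close> the squared norm
      of \<open>g\<close> takes its place.\<close>
    have conv: "e (Suc k) - e (Suc (Suc k)) \<le> e k - e (Suc k)" for k
    proof (cases "k = 0")
      case True
      have "0 \<le> L2_inner m (\<lambda>x. f x - P s f x) (\<lambda>x. f x - P s f x)" by (rule L2_inner_self_nonneg)
      also have "\<dots> = L2_inner m f f - 2 * L2_inner m f (P s f) + L2_inner m (P s f) (P s f)"
        by (rule L2.B_quad_diff[OF f sL])
      finally show ?thesis using P_double[OF s f] L2.B_sym[OF f sL] True by (simp add: e_def)
    next
      case False
      define r where "r = real k * s"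
      have r: "r > 0" using False s by (simp add: r_def)
      have gL: "(\<lambda>x. f x - P s f x) \<in> L2 m" by (rule L2.V_diff[OF f sL])
      have "0 \<le> L2_inner m (P r (\<lambda>x. f x - P s f x)) (\<lambda>x. f x - P s f x)" by (rule P_psd[OF r gL])
      also have "\<dots> = L2_inner m (P r f) (\<lambda>x. f x - P s f x) - L2_inner m (P r (P s f)) (\<lambda>x. f x - P s f x)"
        by (rule P_diff[OF r f sL gL])
      also have "\<dots> = L2_inner m (P r f) f - L2_inner m (P r f) (P s f)
          - L2_inner m (P r (P s f)) f + L2_inner m (P r (P s f)) (P s f)"
        using L2.B_diff_right[OF f sL P_L2[OF r f]] L2.B_diff_right[OF f sL P_L2[OF r sL]] by simp
      also have "L2_inner m (P r f) (P s f) = L2_inner m (P (r + s) f) f"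
        using P_semigroup_inner[OF r s f f] by simp
      also have "L2_inner m (P r (P s f)) f = L2_inner m (P (r + s) f) f"
        using P_sym[OF r sL f] L2.B_sym[OF sL P_L2[OF r f]] P_semigroup_inner[OF r s f f] by simp
      also have "L2_inner m (P r (P s f)) (P s f) = L2_inner m (P (r + s + s) f) f"
      proof -
        have "L2_inner m (P r (P s f)) (P s f) = L2_inner m (P (s + r) f) (P s f)"
        proof (rule L2_inner_cong_AE)
          show "AE x in m. P r (P s f) x = P (s + r) f x"
            using P_semigroup[OF r s f] by (auto simp: add.commute)
        qed (use P_L2 r s f in \<open>auto intro!: L2_measurable\<close>)
        also have "\<dots> = L2_inner m (P ((s + r) + s) f) f"
          using P_semigroup_inner[of "s + r" s f f] r s f by simp
        finally show ?thesis by (simp add: add.commute)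
      qed
      finally show ?thesis using False s by (simp add: e_def r_def algebra_simps)
    qed
    have dec: "e N - e (Suc N) \<le> e k - e (Suc k)" if "k \<le> N" for k
      using that
    proof (induction "N - k" arbitrary: k)
      case (Suc j)
      then have "e N - e (Suc N) \<le> e (Suc k) - e (Suc (Suc k))" by (intro Suc.hyps) auto
      then show ?case using conv[of k] by linarith
    qed auto
    have "real N * (e N - e (Suc N)) = (\<Sum>k<N. e N - e (Suc N))" by simp
    also have "\<dots> \<le> (\<Sum>k<N. e k - e (Suc k))" by (intro sum_mono dec) auto
    also have "\<dots> = e 0 - e N" by (rule sum_lessThan_telescope')
    also have "\<dots> \<le> L2_inner m f f" using P_psd[of "real N * s" f] f s by (simp add: e_def N_def)
    finally have 1: "real N * (e N - e (Suc N)) \<le> L2_inner m f f" .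
    have Ns: "real N * s = 2 * t" by (simp add: s_def N_def)
    have "L2_inner m (P t f) (P t f) = e N" using P_double[OF t f] Ns by (simp add: e_def N_def)
    moreover have "L2_inner m (P s (P t f)) (P t f) = e (Suc N)"
    proof -
      have "L2_inner m (P s (P t f)) (P t f) = L2_inner m (P (s + t) f) (P t f)"
        using P_semigroup[OF s t f]
        by (intro L2_inner_cong_AE) (use P_L2 s t f in \<open>auto intro!: L2_measurable\<close>)
      also have "\<dots> = L2_inner m (P ((s + t) + t) f) f"
        using P_semigroup_inner[of "s + t" t f f] s t f by simp
      also have "(s + t) + t = real (Suc N) * s" using Ns by (simp add: algebra_simps)
      finally show ?thesis by (simp add: e_def)
    qed
    ultimately have "step_form s (P t f) (P t f) = (e N - e (Suc N)) / s" by (simp add: step_form_def)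
    also have "\<dots> = real N * (e N - e (Suc N)) / (2 * t)" using Ns s t by (simp add: s_def N_def field_simps)
    also have "\<dots> \<le> L2_inner m f f / (2 * t)" using 1 t by (simp add: divide_right_mono)
    finally show ?thesis by (simp add: s_def N_def add.commute)
  qed
  have "(\<lambda>n. 2 * t * (1 / (real n + 1))) \<longlonglongrightarrow> 2 * t * 0"
    using LIMSEQ_inverse_real_of_nat by (intro tendsto_intros) (simp add: inverse_eq_divide add.commute)
  then have "filterlim (\<lambda>n. 2 * t / (real n + 1)) (at_right 0) sequentially"
    using t by (intro tendsto_imp_filterlim_at_right) (auto intro!: always_eventually)
  from step_form_bounded_F[OF P_L2[OF t f] this _ key] t
  show "P t f \<in> F" "E (P t f) (P t f) \<le> L2_inner m f f / (2 * t)" by (auto simp: divide_pos_pos)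
qed

end

section \<open>Heat kernels and the energy functional\<close>

context metric_measure_space
begin

lemma sets_m [measurable_cong]: "sets m = sets borel"
  using radon by (simp add: radon_measure_def)

lemma space_m: "space m = UNIV"
  using sets_eq_imp_space_eq[OF sets_m] by simp

lemma emeasure_bounded:
  assumes "bounded A" shows "emeasure m A < \<infinity>"
proof -
  obtain x e where "A \<subseteq> cball x e" using assms bounded_subset_cball by blast
  then have "A \<subseteq> closure (ball x (\<bar>e\<bar> + 1))"
    using closure_subset[of "ball x (\<bar>e\<bar> + 1)"] by (auto simp: subset_eq)
  then have "emeasure m A \<le> emeasure m (closure (ball x (\<bar>e\<bar> + 1)))"
    by (rule emeasure_mono) (simp add: sets_m)
  also have "\<dots> < \<infinity>"
    using radon[unfolded radon_measure_def, THEN conjunct2, THEN conjunct1] relatively_compact_ball[of "\<bar>e\<bar> + 1" x] by auto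
  finally show ?thesis .
qed

lemma compact_bounded_closed: "bounded (A :: 'a set) \<Longrightarrow> closed A \<Longrightarrow> compact A"
proof -
  assume "bounded A" "closed A"
  then obtain x e where "A \<subseteq> cball x e" using bounded_subset_cball by blast
  then have "A \<subseteq> closure (ball x (\<bar>e\<bar> + 1))"
    using closure_subset[of "ball x (\<bar>e\<bar> + 1)"] by (auto simp: subset_eq)
  then show "compact A"
    using compact_Int_closed[OF relatively_compact_ball[of "\<bar>e\<bar> + 1" x] \<open>closed A\<close>] by (simp add: Int_absorb1)
qed

lemma ball_sets: "ball x r \<in> sets m" "cball x r \<in> sets m"
  by (auto simp: sets_m)

lemma emeasure_ball: "emeasure m (ball x r) = ennreal (measure m (ball x r))"
  using emeasure_bounded[of "ball x r"] by (simp add: emeasure_eq_ennreal_measure)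

lemma measure_ball_pos: "r > 0 \<Longrightarrow> measure m (ball x r) > 0"
proof -
  assume "r > 0"
  moreover have "x \<in> measure_support m" using full_support by simp
  ultimately have "0 < emeasure m (ball x r)"
    unfolding measure_support_def by (metis (mono_tags, lifting) centre_in_ball mem_Collect_eq open_ball)
  then show ?thesis by (simp add: emeasure_ball)
qed

lemma measure_mono_bounded:
  assumes "A \<subseteq> B" "bounded B" "B \<in> sets borel" shows "measure m A \<le> measure m B"
  using measure_mono_fmeasurable[of A B m] assms emeasure_bounded[OF assms(2)]
  by (cases "A \<in> sets m") (auto simp: sets_m fmeasurable_def measure_notin_sets)

lemma sigma_finite: "sigma_finite_measure m"
proof
  show "\<exists>A. countable A \<and> A \<subseteq> sets m \<and> \<Union> A = space m \<and> (\<forall>a\<in>A. emeasure m a \<noteq> \<infinity>)"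
  proof (intro exI conjI)
    fix x0 :: 'a
    show "countable (range (\<lambda>n::nat. ball x0 (real n)))" by simp
    show "\<Union> (range (\<lambda>n::nat. ball x0 (real n))) = space m"
      using reals_Archimedean2 by (auto simp: space_m)
    show "\<forall>a\<in>range (\<lambda>n::nat. ball x0 (real n)). emeasure m a \<noteq> \<infinity>"
      using emeasure_bounded[OF bounded_ball] by (auto simp: less_top)
  qed (auto simp: sets_m)
qed

sublocale sigma_finite_measure m by (rule sigma_finite)
sublocale pair: pair_sigma_finite m m by unfold_locales

lemma integrable_indicator_bounded: "A \<in> sets borel \<Longrightarrow> bounded A \<Longrightarrow> integrable m (indicat_real A)"
  using emeasure_bounded[of A] by (simp add: integrable_indicator_iff sets_m)

lemma L2_indicator:
  assumes "A \<in> sets borel" "bounded A" shows "indicat_real A \<in> L2 m"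
proof -
  have "(\<lambda>x. (indicat_real A x)\<^sup>2) = indicat_real A" by (auto simp: indicator_def fun_eq_iff)
  then show ?thesis using integrable_indicator_bounded[OF assms] assms by (simp add: L2_def sets_m)
qed

lemma countable_dense:
  obtains D :: "'a set" where "countable D" "\<And>x r. r > 0 \<Longrightarrow> \<exists>d\<in>D. dist x d < r"
proof -
  fix x0 :: 'a
  have "\<exists>k. finite k \<and> closure (ball x0 (real n + 1)) \<subseteq> (\<Union>x\<in>k. ball x (1 / (real j + 1)))" for n j :: nat
    using relatively_compact_ball[of "real n + 1" x0] unfolding compact_eq_totally_bounded by auto
  then obtain k where k: "\<And>n j. finite (k n j)"
    "\<And>n j. closure (ball x0 (real n + 1)) \<subseteq> (\<Union>x\<in>k n j. ball x (1 / (real j + 1)))" by metis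
  show thesis
  proof (rule that[of "\<Union>n j. k n j"])
    show "countable (\<Union>n j. k n j)" using k(1) by (intro countable_UN) (auto intro: countable_finite)
    fix x :: 'a and r :: real assume r: "r > 0"
    obtain n :: nat where "dist x0 x < real n" using reals_Archimedean2 by blast
    then have "x \<in> closure (ball x0 (real n + 1))" using closure_subset by fastforce
    moreover obtain j :: nat where j: "1 / (real j + 1) < r"
      using r reals_Archimedean[OF r] by (auto simp: inverse_eq_divide add.commute)
    ultimately obtain d where "d \<in> k n j" "dist d x < 1 / (real j + 1)" using k(2)[of n j] by auto
    with j show "\<exists>d\<in>\<Union>n j. k n j. dist x d < r"
      by (intro bexI[of _ d]) (auto simp: dist_commute)
  qed
qed

text \<open>Balls are totally bounded, hence the space is separable and an open set of pairs is a
  countable union of rectangles. So the kernel, which is Borel for the product topology, is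
  measurable for \<open>m \<Otimes>\<^sub>M m\<close> and Fubini applies.\<close>

lemma open_in_pair_sets:
  assumes "open S" shows "S \<in> sets (m \<Otimes>\<^sub>M m)"
proof -
  obtain D :: "'a set" where D: "countable D" "\<And>x r. r > 0 \<Longrightarrow> \<exists>d\<in>D. dist x d < r" using countable_dense by blast
  define I where "I = {(d, q, e, r) \<in> D \<times> \<rat> \<times> D \<times> \<rat>. ball d q \<times> ball e r \<subseteq> S}"
  have "I \<subseteq> D \<times> \<rat> \<times> D \<times> \<rat>" by (auto simp: I_def)
  moreover have "countable (D \<times> (\<rat>::real set) \<times> D \<times> (\<rat>::real set))"
    using D(1) countable_rat by (intro countable_SIGMA) auto
  ultimately have cI: "countable I" by (rule countable_subset)
  have near: "\<exists>d\<in>D. \<exists>q\<in>\<rat>. x \<in> ball d q \<and> ball d q \<subseteq> A" if "open A" "x \<in> A" for x and A :: "'a set"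
  proof -
    obtain r where r: "r > 0" "ball x r \<subseteq> A" using \<open>open A\<close> \<open>x \<in> A\<close> open_contains_ball by blast
    obtain q where q: "q \<in> \<rat>" "0 < q" "q < r / 2" using Rats_dense_in_real[of 0 "r/2"] r by auto
    obtain d where d: "d \<in> D" "dist x d < q" using D(2)[OF q(2)] by blast
    have "ball d q \<subseteq> ball x r"
    proof
      fix y assume "y \<in> ball d q"
      then show "y \<in> ball x r" using d(2) q dist_triangle[of x y d] by auto
    qed
    then show ?thesis using d q r by (intro bexI[of _ d] bexI[of _ q]) (auto simp: dist_commute)
  qed
  have "S = (\<Union>(d, q, e, r)\<in>I. ball d q \<times> ball e r)"
  proof (intro equalityI subsetI)
    fix z assume "z \<in> S"
    then obtain A B where AB: "open A" "open B" "z \<in> A \<times> B" "A \<times> B \<subseteq> S"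
      by (rule open_prod_elim[OF assms])
    obtain d q where d: "d \<in> D" "q \<in> \<rat>" "fst z \<in> ball d q" "ball d q \<subseteq> A" using near[OF AB(1), of "fst z"] AB(3) by auto
    obtain e r where e: "e \<in> D" "r \<in> \<rat>" "snd z \<in> ball e r" "ball e r \<subseteq> B" using near[OF AB(2), of "snd z"] AB(3) by auto
    have "(d, q, e, r) \<in> I" using d e AB(4) by (auto simp: I_def)
    moreover have "z \<in> ball d q \<times> ball e r" using d e by (simp add: mem_Times_iff)
    ultimately show "z \<in> (\<Union>(d, q, e, r)\<in>I. ball d q \<times> ball e r)" by blast
  qed (auto simp: I_def)
  also have "\<dots> \<in> sets (m \<Otimes>\<^sub>M m)"
    by (rule sets.countable_UN'[OF cI]) (auto simp: sets_m intro!: pair_measureI)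
  finally show ?thesis .
qed

lemma pair_measurable_of_borel:
  assumes f: "f \<in> borel_measurable (borel :: ('a \<times> 'a) measure)"
  shows "f \<in> borel_measurable (m \<Otimes>\<^sub>M m)"
proof -
  have "sigma_sets UNIV {S :: ('a \<times> 'a) set. open S} \<subseteq> sigma_sets (space (m \<Otimes>\<^sub>M m)) (sets (m \<Otimes>\<^sub>M m))"
    using open_in_pair_sets by (simp add: space_pair_measure space_m) (intro sigma_sets_mono', auto)
  then have "sets (borel :: ('a \<times> 'a) measure) \<subseteq> sets (m \<Otimes>\<^sub>M m)"
    by (simp add: borel_def sets.sigma_sets_eq)
  then show ?thesis using f
    by (auto simp: measurable_def space_pair_measure space_m)
qed

end

section \<open>The symmetric measure on pairs given by the heat kernel\<close>

locale heat_space = mmd_space m E F + dirichlet_semigroup m E F P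
  for m :: "'a::metric_space measure"
    and E :: "('a \<Rightarrow> real) \<Rightarrow> ('a \<Rightarrow> real) \<Rightarrow> real"
    and F :: "('a \<Rightarrow> real) set"
    and P :: "real \<Rightarrow> ('a \<Rightarrow> real) \<Rightarrow> 'a \<Rightarrow> real" +
  fixes p :: "real \<Rightarrow> 'a \<Rightarrow> 'a \<Rightarrow> real"
  assumes p_borel: "\<And>t. t > 0 \<Longrightarrow> (\<lambda>(x, y). p t x y) \<in> borel_measurable borel"
    and p_nonneg: "\<And>t x y. t > 0 \<Longrightarrow> p t x y \<ge> 0"
    and p_kernel: "\<And>t f. t > 0 \<Longrightarrow> f \<in> L2 m \<Longrightarrow> AE x in m.
           integrable m (\<lambda>y. p t x y * f y) \<and> P t f x = (\<integral>y. p t x y * f y \<partial>m)"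
begin

lemma p_measurable: "t > 0 \<Longrightarrow> (\<lambda>z. p t (fst z) (snd z)) \<in> borel_measurable (m \<Otimes>\<^sub>M m)"
  using pair_measurable_of_borel[OF p_borel] by (simp add: case_prod_beta')

lemma p_measurable_section: "t > 0 \<Longrightarrow> (\<lambda>y. p t x y) \<in> borel_measurable m"
  using measurable_compose[OF measurable_Pair1'[of x m m] p_measurable[of t]] by (simp add: space_m)

text \<open>The law of one step, as a pair of start and end point, of the walk with kernel
  \<open>p t\<close> started from \<open>m\<close>.\<close>

definition M :: "real \<Rightarrow> ('a \<times> 'a) measure" where
  "M t = density (m \<Otimes>\<^sub>M m) (\<lambda>z. ennreal (p t (fst z) (snd z)))"

lemma sets_M [measurable_cong]: "sets (M t) = sets (m \<Otimes>\<^sub>M m)"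
  by (simp add: M_def)

lemma space_M: "space (M t) = UNIV"
  by (simp add: M_def space_pair_measure space_m)

lemma nn_integral_M:
  assumes "t > 0" "u \<in> borel_measurable (m \<Otimes>\<^sub>M m)"
  shows "(\<integral>\<^sup>+z. u z \<partial>M t) = (\<integral>\<^sup>+x. \<integral>\<^sup>+y. ennreal (p t x y) * u (x, y) \<partial>m \<partial>m)"
proof -
  have "(\<integral>\<^sup>+z. u z \<partial>M t) = (\<integral>\<^sup>+z. ennreal (p t (fst z) (snd z)) * u z \<partial>(m \<Otimes>\<^sub>M m))"
    unfolding M_def by (rule nn_integral_density) (use assms p_measurable in auto)
  also have "\<dots> = (\<integral>\<^sup>+x. \<integral>\<^sup>+y. ennreal (p t (fst (x, y)) (snd (x, y))) * u (x, y) \<partial>m \<partial>m)"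
    by (rule nn_integral_fst[symmetric]) (use assms p_measurable[OF assms(1)] in measurable)
  finally show ?thesis by simp
qed

lemma P_positive:
  assumes t: "t > 0" and f: "f \<in> L2 m" "AE x in m. f x \<ge> 0"
  shows "AE x in m. P t f x \<ge> 0"
  using p_kernel[OF t f(1)]
proof eventually_elim
  case (elim x)
  have "0 \<le> (\<integral>y. p t x y * f y \<partial>m)"
    by (rule integral_nonneg_AE) (use f(2) p_nonneg[OF t] in auto)
  then show ?case using elim by simp
qed

lemma P_nn_integral:
  assumes t: "t > 0" and f: "f \<in> L2 m" "\<And>x. f x \<ge> 0"
  shows "AE x in m. (\<integral>\<^sup>+y. ennreal (p t x y * f y) \<partial>m) = ennreal (P t f x)"
  using p_kernel[OF t f(1)]
  by eventually_elim (use f p_nonneg[OF t] in \<open>simp add: nn_integral_eq_integral\<close>)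

lemma M_rectangle_bounded:
  assumes t: "t > 0" and A: "A \<in> sets borel" "bounded A" and B: "B \<in> sets borel" "bounded B"
  shows "emeasure (M t) (A \<times> B) = ennreal (L2_inner m (P t (indicator B)) (indicator A))"
proof -
  have AB: "A \<times> B \<in> sets (m \<Otimes>\<^sub>M m)" using A B by (auto simp: sets_m)
  have iA: "indicat_real A \<in> L2 m" "indicat_real B \<in> L2 m" using L2_indicator A B by auto
  have "emeasure (M t) (A \<times> B) = (\<integral>\<^sup>+z. indicator (A \<times> B) z \<partial>M t)" using AB by (simp add: sets_M)
  also have "\<dots> = (\<integral>\<^sup>+x. \<integral>\<^sup>+y. ennreal (p t x y) * indicator (A \<times> B) (x, y) \<partial>m \<partial>m)"
    by (rule nn_integral_M[OF t]) (use AB in auto)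
  also have "\<dots> = (\<integral>\<^sup>+x. ennreal (P t (indicator B) x * indicator A x) \<partial>m)"
  proof (rule nn_integral_cong_AE)
    show "AE x in m. (\<integral>\<^sup>+y. ennreal (p t x y) * indicator (A \<times> B) (x, y) \<partial>m) = ennreal (P t (indicator B) x * indicator A x)"
      using P_nn_integral[OF t iA(2) indicator_pos_le]
    proof (eventually_elim)
      case (elim x)
      have "(\<integral>\<^sup>+y. ennreal (p t x y) * indicator (A \<times> B) (x, y) \<partial>m) = (\<integral>\<^sup>+y. ennreal (p t x y * indicator B y) * indicator A x \<partial>m)"
        by (rule nn_integral_cong) (auto simp: indicator_def)
      also have "\<dots> = (\<integral>\<^sup>+y. ennreal (p t x y * indicator B y) \<partial>m) * indicator A x"
        using p_measurable_section[OF t] B by (intro nn_integral_multc) (auto simp: sets_m)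
      finally have "(\<integral>\<^sup>+y. ennreal (p t x y) * indicator (A \<times> B) (x, y) \<partial>m)
          = ennreal (P t (indicator B) x) * indicator A x" unfolding elim .
      then show ?case by (cases "x \<in> A") simp_all
    qed
  qed
  also have "\<dots> = ennreal (\<integral>x. P t (indicator B) x * indicator A x \<partial>m)"
    using P_positive[OF t iA(2)] L2_mult_integrable[OF P_L2[OF t iA(2)] iA(1)]
    by (intro nn_integral_eq_integral) (auto simp: indicator_def)
  finally show ?thesis by (simp add: L2_inner_def)
qed

text \<open>Indicators of unbounded sets need not lie in \<open>L2\<close>, so symmetry is proved on
  bounded parts and passes to the limit.\<close>

lemma M_rectangle_swap:
  assumes t: "t > 0" and A: "A \<in> sets borel" and B: "B \<in> sets borel"
  shows "emeasure (M t) (A \<times> B) = emeasure (M t) (B \<times> A)"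
proof -
  fix x0 :: 'a
  have cont: "emeasure (M t) (A \<times> B) = (SUP n. emeasure (M t) ((A \<inter> ball x0 (real n)) \<times> (B \<inter> ball x0 (real n))))"
    if A: "A \<in> sets borel" and B: "B \<in> sets borel" for A B
  proof -
    have "(\<Union>n. (A \<inter> ball x0 (real n)) \<times> (B \<inter> ball x0 (real n))) = A \<times> B"
    proof (intro equalityI subsetI)
      fix z assume z: "z \<in> A \<times> B"
      obtain n :: nat where "max (dist x0 (fst z)) (dist x0 (snd z)) < real n" using reals_Archimedean2 by blast
      then show "z \<in> (\<Union>n. (A \<inter> ball x0 (real n)) \<times> (B \<inter> ball x0 (real n)))" using z by (auto intro!: exI[of _ n])
    qed auto
    moreover have "(SUP n. emeasure (M t) ((A \<inter> ball x0 (real n)) \<times> (B \<inter> ball x0 (real n))))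
        = emeasure (M t) (\<Union>n. (A \<inter> ball x0 (real n)) \<times> (B \<inter> ball x0 (real n)))"
      by (rule SUP_emeasure_incseq) (use A B in \<open>auto simp: sets_M sets_m incseq_def intro!: pair_measureI\<close>)
    ultimately show ?thesis by simp
  qed
  have "emeasure (M t) ((A \<inter> ball x0 (real n)) \<times> (B \<inter> ball x0 (real n))) =
      emeasure (M t) ((B \<inter> ball x0 (real n)) \<times> (A \<inter> ball x0 (real n)))" for n
  proof -
    have iA: "A \<inter> ball x0 (real n) \<in> sets borel" "bounded (A \<inter> ball x0 (real n))"
      "B \<inter> ball x0 (real n) \<in> sets borel" "bounded (B \<inter> ball x0 (real n))" using A B by auto
    show ?thesis
      using P_sym[OF t L2_indicator[OF iA(1,2)] L2_indicator[OF iA(3,4)]]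
      by (simp add: M_rectangle_bounded[OF t] iA L2_inner_def mult.commute)
  qed
  with cont[OF A B] cont[OF B A] show ?thesis by simp
qed

text \<open>Symmetry of \<open>p t\<close> is known only through the operator \<open>P t\<close>;
  tested on indicators it gives the claim for rectangles, and these generate the product
  sigma-algebra.\<close>

lemma M_swap:
  assumes t: "t > 0" shows "distr (M t) (m \<Otimes>\<^sub>M m) (\<lambda>z. (snd z, fst z)) = M t"
proof (rule measure_eqI_generator_eq)
  fix x0 :: 'a
  let ?E = "{A \<times> B | A B. A \<in> sets m \<and> B \<in> sets m}"
  show "Int_stable ?E" by (rule Int_stable_pair_measure_generator)
  show "?E \<subseteq> Pow (space m \<times> space m)" by (rule pair_measure_closed)
  show "sets (distr (M t) (m \<Otimes>\<^sub>M m) (\<lambda>z. (snd z, fst z))) = sigma_sets (space m \<times> space m) ?E"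
    by (simp add: sets_pair_measure)
  show "sets (M t) = sigma_sets (space m \<times> space m) ?E" by (simp add: sets_M sets_pair_measure)
  have em: "emeasure (distr (M t) (m \<Otimes>\<^sub>M m) (\<lambda>z. (snd z, fst z))) (A \<times> B) = emeasure (M t) (B \<times> A)"
    if "A \<in> sets m" "B \<in> sets m" for A B
  proof -
    have "(\<lambda>z. (snd z, fst z)) -` (A \<times> B) \<inter> space (M t) = B \<times> A" by (auto simp: space_M)
    then show ?thesis using that by (subst emeasure_distr) auto
  qed
  show "emeasure (distr (M t) (m \<Otimes>\<^sub>M m) (\<lambda>z. (snd z, fst z))) X = emeasure (M t) X" if "X \<in> ?E" for X
    using that em M_rectangle_swap[OF t] by (auto simp: sets_m)
  let ?A = "\<lambda>n::nat. ball x0 (real n) \<times> ball x0 (real n)"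
  show "range ?A \<subseteq> ?E" using ball_sets by blast
  show "(\<Union>n. ?A n) = space m \<times> space m"
  proof (intro equalityI subsetI)
    fix z :: "'a \<times> 'a"
    obtain n :: nat where "max (dist x0 (fst z)) (dist x0 (snd z)) < real n" using reals_Archimedean2 by blast
    then show "z \<in> (\<Union>n. ?A n)" by (cases z) (auto intro!: exI[of _ n])
  qed (auto simp: space_m)
  show "emeasure (distr (M t) (m \<Otimes>\<^sub>M m) (\<lambda>z. (snd z, fst z))) (?A n) \<noteq> \<infinity>" for n
    using em[of "ball x0 (real n)" "ball x0 (real n)"] ball_sets by (simp add: M_rectangle_bounded[OF t])
qed

lemma swap_measurable: "(\<lambda>z. (snd z, fst z)) \<in> measurable (M t) (m \<Otimes>\<^sub>M m)"
  by measurable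

lemma nn_integral_M_swap:
  assumes "t > 0" "u \<in> borel_measurable (m \<Otimes>\<^sub>M m)"
  shows "(\<integral>\<^sup>+z. u (snd z, fst z) \<partial>M t) = (\<integral>\<^sup>+z. u z \<partial>M t)"
  using nn_integral_distr[OF swap_measurable, of u t] assms(2) M_swap[OF assms(1)] by simp

lemma integral_M_swap:
  fixes u :: "'a \<times> 'a \<Rightarrow> real"
  assumes "t > 0" "u \<in> borel_measurable (m \<Otimes>\<^sub>M m)"
  shows "(\<integral>z. u (snd z, fst z) \<partial>M t) = (\<integral>z. u z \<partial>M t)"
  using integral_distr[OF swap_measurable, of u t] assms(2) M_swap[OF assms(1)] by simp

lemma integrable_M_swap:
  fixes u :: "'a \<times> 'a \<Rightarrow> real"
  assumes "t > 0" "u \<in> borel_measurable (m \<Otimes>\<^sub>M m)"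
  shows "integrable (M t) (\<lambda>z. u (snd z, fst z)) \<longleftrightarrow> integrable (M t) u"
  using integrable_distr_eq[OF swap_measurable, of u t] assms(2) M_swap[OF assms(1)] by simp

text \<open>The constant 1 need not lie in \<open>L2\<close>, so the Markov property is applied to
  indicators of growing balls and passes to the limit monotonically.\<close>

lemma kernel_mass_le_1:
  assumes t: "t > 0" shows "AE x in m. (\<integral>\<^sup>+y. ennreal (p t x y) \<partial>m) \<le> 1"
proof -
  fix x0 :: 'a
  have "AE x in m. (\<integral>\<^sup>+y. ennreal (p t x y * indicator (ball x0 (real n)) y) \<partial>m) \<le> 1" for n :: nat
  proof -
    have i: "indicat_real (ball x0 (real n)) \<in> L2 m" by (rule L2_indicator) auto
    have "AE x in m. 0 \<le> P t (indicat_real (ball x0 (real n))) x \<and> P t (indicat_real (ball x0 (real n))) x \<le> 1"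
      by (rule P_Markov[OF t i]) (auto simp: indicator_def)
    with P_nn_integral[OF t i] show ?thesis
      by (auto simp: ennreal_le_1)
  qed
  then have "AE x in m. \<forall>n. (\<integral>\<^sup>+y. ennreal (p t x y * indicator (ball x0 (real n)) y) \<partial>m) \<le> 1"
    by (simp add: AE_all_countable)
  then show ?thesis
  proof eventually_elim
    case (elim x)
    have "(\<integral>\<^sup>+y. ennreal (p t x y) \<partial>m) = (\<integral>\<^sup>+y. (SUP n. ennreal (p t x y * indicator (ball x0 (real n)) y)) \<partial>m)"
    proof (rule nn_integral_cong)
      fix y
      obtain N :: nat where N: "dist x0 y < real N" using reals_Archimedean2 by blast
      show "ennreal (p t x y) = (SUP n. ennreal (p t x y * indicator (ball x0 (real n)) y))"
      proof (rule antisym)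
        show "ennreal (p t x y) \<le> (SUP n. ennreal (p t x y * indicator (ball x0 (real n)) y))"
          by (rule SUP_upper2[of N]) (use N in auto)
        show "(SUP n. ennreal (p t x y * indicator (ball x0 (real n)) y)) \<le> ennreal (p t x y)"
          by (rule SUP_least) (auto simp: indicator_def p_nonneg[OF t] intro!: ennreal_leI)
      qed
    qed
    also have "\<dots> = (SUP n. (\<integral>\<^sup>+y. ennreal (p t x y * indicator (ball x0 (real n)) y) \<partial>m))"
      by (rule nn_integral_monotone_convergence_SUP)
        (use p_measurable_section[OF t] in \<open>auto simp: incseq_def le_fun_def ball_sets p_nonneg[OF t]
          intro!: borel_measurable_times borel_measurable_indicator ennreal_leI mult_left_mono split: split_indicator\<close>)
    also have "\<dots> \<le> 1" using elim by (intro SUP_least) auto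
    finally show ?case .
  qed
qed

lemma nn_integral_M_fst_le:
  assumes t: "t > 0" and u: "u \<in> borel_measurable m"
  shows "(\<integral>\<^sup>+z. u (fst z) \<partial>M t) \<le> (\<integral>\<^sup>+x. u x \<partial>m)"
proof -
  have "(\<integral>\<^sup>+z. u (fst z) \<partial>M t) = (\<integral>\<^sup>+x. \<integral>\<^sup>+y. ennreal (p t x y) * u (fst (x, y)) \<partial>m \<partial>m)"
    by (rule nn_integral_M[OF t]) (use u in measurable)
  also have "\<dots> = (\<integral>\<^sup>+x. (\<integral>\<^sup>+y. ennreal (p t x y) \<partial>m) * u x \<partial>m)"
    using p_measurable_section[OF t] by (intro nn_integral_cong) (auto intro!: nn_integral_multc)
  also have "\<dots> \<le> (\<integral>\<^sup>+x. 1 * u x \<partial>m)"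
  proof (rule nn_integral_mono_AE)
    show "AE x in m. (\<integral>\<^sup>+y. ennreal (p t x y) \<partial>m) * u x \<le> 1 * u x"
      using kernel_mass_le_1[OF t] by eventually_elim (rule mult_right_mono, auto)
  qed
  finally show ?thesis by simp
qed

lemma integrable_M_fst:
  fixes u :: "'a \<Rightarrow> real"
  assumes t: "t > 0" and u: "integrable m u"
  shows "integrable (M t) (\<lambda>z. u (fst z))"
proof (rule integrableI_bounded)
  have "(\<integral>\<^sup>+z. ennreal (norm (u (fst z))) \<partial>M t) \<le> (\<integral>\<^sup>+x. ennreal (norm (u x)) \<partial>m)"
    by (rule nn_integral_M_fst_le[OF t]) (use u in auto)
  then show "(\<integral>\<^sup>+z. ennreal (norm (u (fst z))) \<partial>M t) < \<infinity>"
    using u by (auto simp: integrable_iff_bounded intro: order_le_less_trans)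
qed (use u in measurable)

lemma integrable_M_snd:
  fixes u :: "'a \<Rightarrow> real"
  assumes t: "t > 0" and u: "integrable m u"
  shows "integrable (M t) (\<lambda>z. u (snd z))"
  using integrable_M_fst[OF t u] integrable_M_swap[OF t, of "\<lambda>z. u (snd z)"] u by simp

lemma integral_M_snd:
  fixes u :: "'a \<Rightarrow> real"
  assumes t: "t > 0" and u: "u \<in> borel_measurable m"
  shows "(\<integral>z. u (snd z) \<partial>M t) = (\<integral>z. u (fst z) \<partial>M t)"
  using integral_M_swap[OF t, of "\<lambda>z. u (fst z)"] u by simp

lemma integral_M_fst_le:
  fixes u :: "'a \<Rightarrow> real"
  assumes t: "t > 0" and u: "integrable m u" "\<And>x. u x \<ge> 0"
  shows "(\<integral>z. u (fst z) \<partial>M t) \<le> (\<integral>x. u x \<partial>m)"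
proof -
  have "ennreal (\<integral>z. u (fst z) \<partial>M t) = (\<integral>\<^sup>+z. u (fst z) \<partial>M t)"
    using integrable_M_fst[OF t u(1)] u(2) by (simp add: nn_integral_eq_integral)
  also have "\<dots> \<le> (\<integral>\<^sup>+x. u x \<partial>m)" by (rule nn_integral_M_fst_le[OF t]) (use u in auto)
  also have "\<dots> = ennreal (\<integral>x. u x \<partial>m)" using u by (simp add: nn_integral_eq_integral)
  finally show ?thesis using u by (simp add: ennreal_le_iff)
qed

lemma integrable_M_mult:
  assumes t: "t > 0" and f: "f \<in> L2 m" and g: "g \<in> L2 m"
  shows "integrable (M t) (\<lambda>z. g (fst z) * f (snd z))"
proof (rule Bochner_Integration.integrable_bound)
  show "integrable (M t) (\<lambda>z. (g (fst z))\<^sup>2 + (f (snd z))\<^sup>2)"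
    using integrable_M_fst[OF t L2_sq_integrable[OF g]] integrable_M_snd[OF t L2_sq_integrable[OF f]] by simp
  show "AE z in M t. norm (g (fst z) * f (snd z)) \<le> norm ((g (fst z))\<^sup>2 + (f (snd z))\<^sup>2)"
  proof (rule AE_I2)
    fix z
    have "0 \<le> (\<bar>g (fst z)\<bar> - \<bar>f (snd z)\<bar>)\<^sup>2" by simp
    then have "2 * (\<bar>g (fst z)\<bar> * \<bar>f (snd z)\<bar>) \<le> (g (fst z))\<^sup>2 + (f (snd z))\<^sup>2" by (simp add: power2_diff)
    moreover have "0 \<le> \<bar>g (fst z)\<bar> * \<bar>f (snd z)\<bar>" by simp
    ultimately have "\<bar>g (fst z)\<bar> * \<bar>f (snd z)\<bar> \<le> (g (fst z))\<^sup>2 + (f (snd z))\<^sup>2" by linarith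
    then show "norm (g (fst z) * f (snd z)) \<le> norm ((g (fst z))\<^sup>2 + (f (snd z))\<^sup>2)" by (simp add: abs_mult)
  qed
qed (use f g in \<open>auto simp: L2_def\<close>)

lemma inner_P:
  assumes t: "t > 0" and f: "f \<in> L2 m" and g: "g \<in> L2 m"
  shows "L2_inner m (P t f) g = (\<integral>z. g (fst z) * f (snd z) \<partial>M t)"
proof -
  have [measurable]: "f \<in> borel_measurable m" "g \<in> borel_measurable m" using f g L2_measurable by auto
  note [measurable] = p_measurable[OF t]
  have "(\<integral>z. g (fst z) * f (snd z) \<partial>M t) = (\<integral>z. p t (fst z) (snd z) * (g (fst z) * f (snd z)) \<partial>(m \<Otimes>\<^sub>M m))"
    unfolding M_def by (subst integral_density) (use p_nonneg[OF t] in auto)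
  also have "\<dots> = (\<integral>x. \<integral>y. p t x y * (g x * f y) \<partial>m \<partial>m)"
  proof -
    have "integrable (m \<Otimes>\<^sub>M m) (\<lambda>z. p t (fst z) (snd z) * (g (fst z) * f (snd z)))"
      using integrable_M_mult[OF t f g] unfolding M_def
      by (subst (asm) integrable_density) (use p_nonneg[OF t] in auto)
    from pair.integral_fst'[OF this] show ?thesis by simp
  qed
  also have "\<dots> = (\<integral>x. P t f x * g x \<partial>m)"
  proof (rule integral_cong_AE)
    show "AE x in m. (\<integral>y. p t x y * (g x * f y) \<partial>m) = P t f x * g x"
      using p_kernel[OF t f]
    proof eventually_elim
      case (elim x)
      have "(\<integral>y. p t x y * (g x * f y) \<partial>m) = (\<integral>y. g x * (p t x y * f y) \<partial>m)"
        by (simp add: ac_simps)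
      then show ?case using elim by (simp add: mult.commute)
    qed
    show "(\<lambda>x. P t f x * g x) \<in> borel_measurable m" using L2_measurable[OF P_L2[OF t f]] by simp
    show "(\<lambda>x. \<integral>y. p t x y * (g x * f y) \<partial>m) \<in> borel_measurable m"
      by (rule borel_measurable_lebesgue_integral) (simp add: case_prod_beta')
  qed
  finally show ?thesis by (simp add: L2_inner_def)
qed

lemma integrable_M_sq_diff:
  assumes t: "t > 0" and f: "f \<in> L2 m"
  shows "integrable (M t) (\<lambda>z. (f (fst z) - f (snd z))\<^sup>2)"
proof -
  have "integrable (M t) (\<lambda>z. (f (fst z))\<^sup>2 + (f (snd z))\<^sup>2 - 2 * (f (fst z) * f (snd z)))"
    using integrable_M_fst[OF t L2_sq_integrable[OF f]] integrable_M_snd[OF t L2_sq_integrable[OF f]]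
      integrable_M_mult[OF t f f] by simp
  then show ?thesis by (simp add: power2_diff mult.assoc)
qed

section \<open>Jump and killing parts of the approximating forms; contractions operate on
  \<open>F\<close>\<close>

definition jump :: "real \<Rightarrow> ('a \<Rightarrow> real) \<Rightarrow> real" where
  "jump t f = (\<integral>z. (f (fst z) - f (snd z))\<^sup>2 \<partial>M t)"

text \<open>The integral of \<open>u\<close> against the mass that the kernel loses in time
  \<open>t\<close>; the semigroup is not supposed to be conservative.\<close>

definition killing :: "real \<Rightarrow> ('a \<Rightarrow> real) \<Rightarrow> real" where
  "killing t u = (\<integral>x. u x \<partial>m) - (\<integral>z. u (fst z) \<partial>M t)"

lemma killing_nonneg: "t > 0 \<Longrightarrow> integrable m u \<Longrightarrow> (\<And>x. u x \<ge> 0) \<Longrightarrow> killing t u \<ge> 0"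
  using integral_M_fst_le by (simp add: killing_def)

lemma killing_add: "t > 0 \<Longrightarrow> integrable m u \<Longrightarrow> integrable m v \<Longrightarrow> killing t (\<lambda>x. u x + v x) = killing t u + killing t v"
  by (simp add: killing_def integrable_M_fst)

lemma killing_diff: "t > 0 \<Longrightarrow> integrable m u \<Longrightarrow> integrable m v \<Longrightarrow> killing t (\<lambda>x. u x - v x) = killing t u - killing t v"
  by (simp add: killing_def integrable_M_fst)

lemma killing_scale: "killing t (\<lambda>x. a * u x) = a * killing t u"
  by (simp add: killing_def right_diff_distrib)

lemma killing_mono:
  assumes "t > 0" "integrable m u" "integrable m v" "\<And>x. u x \<le> v x"
  shows "killing t u \<le> killing t v"
  using killing_nonneg[OF assms(1), of "\<lambda>x. v x - u x"] killing_diff[OF assms(1) assms(3,2)] assms by simp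

text \<open>Expand the square in \<open>jump\<close>: symmetry of \<open>M t\<close> identifies the
  two square terms, and the defect of its marginal against \<open>m\<close> is the killing
  term.\<close>

lemma step_form_jump:
  assumes t: "t > 0" and f: "f \<in> L2 m"
  shows "step_form t f f = (jump t f / 2 + killing t (\<lambda>x. (f x)\<^sup>2)) / t"
proof -
  have "jump t f = (\<integral>z. (f (fst z))\<^sup>2 + (f (snd z))\<^sup>2 - 2 * (f (fst z) * f (snd z)) \<partial>M t)"
    by (simp add: jump_def power2_diff mult.assoc)
  also have "\<dots> = (\<integral>z. (f (fst z))\<^sup>2 \<partial>M t) + (\<integral>z. (f (snd z))\<^sup>2 \<partial>M t) - 2 * (\<integral>z. f (fst z) * f (snd z) \<partial>M t)"
    using integrable_M_fst[OF t L2_sq_integrable[OF f]] integrable_M_snd[OF t L2_sq_integrable[OF f]]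
      integrable_M_mult[OF t f f] by simp
  also have "(\<integral>z. (f (snd z))\<^sup>2 \<partial>M t) = (\<integral>z. (f (fst z))\<^sup>2 \<partial>M t)"
    using L2_measurable[OF f] by (intro integral_M_snd[OF t] borel_measurable_power)
  also have "(\<integral>z. f (fst z) * f (snd z) \<partial>M t) = L2_inner m (P t f) f" by (simp add: inner_P[OF t f f])
  finally have j: "jump t f / 2 = (\<integral>z. (f (fst z))\<^sup>2 \<partial>M t) - L2_inner m (P t f) f"
    by (simp add: diff_divide_distrib)
  have "jump t f / 2 + killing t (\<lambda>x. (f x)\<^sup>2) = L2_inner m f f - L2_inner m (P t f) f"
    unfolding j killing_def L2_inner_self by simp
  then show ?thesis by (simp only: step_form_def)
qed

lemma dyadic_tendsto: "filterlim (\<lambda>n. 1 / 2 ^ n) (at_right (0::real)) sequentially"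
  by (rule dyadic_at_right) simp

lemma jump_le_sum:
  assumes t: "t > 0" and J: "finite J" and u: "\<And>j. j \<in> J \<Longrightarrow> u j \<in> L2 m" and g: "g \<in> L2 m"
    and lip: "\<And>x y. \<bar>g x - g y\<bar> \<le> (\<Sum>j\<in>J. \<bar>u j x - u j y\<bar>)"
  shows "jump t g \<le> real (card J) * (\<Sum>j\<in>J. jump t (u j))"
proof -
  have "jump t g \<le> (\<integral>z. real (card J) * (\<Sum>j\<in>J. (u j (fst z) - u j (snd z))\<^sup>2) \<partial>M t)"
    unfolding jump_def
  proof (rule integral_mono)
    fix z
    have "(g (fst z) - g (snd z))\<^sup>2 \<le> (\<Sum>j\<in>J. \<bar>u j (fst z) - u j (snd z)\<bar>)\<^sup>2"
      using lip[of "fst z" "snd z"] by (metis abs_ge_zero power2_abs power_mono)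
    also have "\<dots> \<le> real (card J) * (\<Sum>j\<in>J. (u j (fst z) - u j (snd z))\<^sup>2)"
      using sum_squared_le_sum_of_squares[of "\<lambda>j. \<bar>u j (fst z) - u j (snd z)\<bar>" J] by (simp add: mult.commute)
    finally show "(g (fst z) - g (snd z))\<^sup>2 \<le> real (card J) * (\<Sum>j\<in>J. (u j (fst z) - u j (snd z))\<^sup>2)" .
  qed (use integrable_M_sq_diff[OF t] u g in auto)
  also have "\<dots> = real (card J) * (\<Sum>j\<in>J. jump t (u j))"
    using integrable_M_sq_diff[OF t u] by (simp add: jump_def)
  finally show ?thesis .
qed

text \<open>The jump part and the killing part of \<open>step_form\<close> obey the bound
  separately, so \<open>step_form_bounded_F\<close> applies to \<open>g\<close>. Allowing a family
  \<open>u\<close> on the right covers products, maxima and functions built from several cutoffs in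
  one statement.\<close>

lemma F_contraction:
  assumes J: "finite J" and u: "\<And>j. j \<in> J \<Longrightarrow> u j \<in> F" and g: "g \<in> borel_measurable m"
    and lip: "\<And>x y. \<bar>g x - g y\<bar> \<le> (\<Sum>j\<in>J. \<bar>u j x - u j y\<bar>)"
    and bd: "\<And>x. \<bar>g x\<bar> \<le> (\<Sum>j\<in>J. \<bar>u j x\<bar>)"
  shows "g \<in> F" "E g g \<le> real (card J) * (\<Sum>j\<in>J. E (u j) (u j))"
proof -
  have uL: "u j \<in> L2 m" if "j \<in> J" for j using u that F_L2 by blast
  have sq: "(g x)\<^sup>2 \<le> real (card J) * (\<Sum>j\<in>J. (u j x)\<^sup>2)" for x
  proof -
    have "(g x)\<^sup>2 \<le> (\<Sum>j\<in>J. \<bar>u j x\<bar>)\<^sup>2"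
      using bd[of x] by (metis abs_ge_zero power2_abs power_mono)
    also have "\<dots> \<le> real (card J) * (\<Sum>j\<in>J. (u j x)\<^sup>2)"
      using sum_squared_le_sum_of_squares[of "\<lambda>j. \<bar>u j x\<bar>" J] by (simp add: mult.commute)
    finally show ?thesis .
  qed
  have int: "integrable m (\<lambda>x. real (card J) * (\<Sum>j\<in>J. (u j x)\<^sup>2))"
    by (intro integrable_mult_right Bochner_Integration.integrable_sum L2_sq_integrable uL)
  have gL: "g \<in> L2 m"
    unfolding L2_def
  proof (intro CollectI conjI)
    show "integrable m (\<lambda>x. (g x)\<^sup>2)"
      by (rule Bochner_Integration.integrable_bound[OF int]) (use g in \<open>auto intro!: AE_I2 order_trans[OF sq]\<close>)
  qed fact
  have step_form_le: "step_form t g g \<le> real (card J) * (\<Sum>j\<in>J. E (u j) (u j))" if t: "t > 0" for t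
  proof -
    have "killing t (\<lambda>x. (g x)\<^sup>2) \<le> killing t (\<lambda>x. real (card J) * (\<Sum>j\<in>J. (u j x)\<^sup>2))"
      by (rule killing_mono[OF t L2_sq_integrable[OF gL] int sq])
    also have "\<dots> = real (card J) * (\<Sum>j\<in>J. killing t (\<lambda>x. (u j x)\<^sup>2))"
    proof -
      have "(\<integral>x. (\<Sum>j\<in>J. (u j x)\<^sup>2) \<partial>m) = (\<Sum>j\<in>J. \<integral>x. (u j x)\<^sup>2 \<partial>m)"
        by (rule Bochner_Integration.integral_sum) (rule L2_sq_integrable[OF uL])
      moreover have "(\<integral>z. (\<Sum>j\<in>J. (u j (fst z))\<^sup>2) \<partial>M t) = (\<Sum>j\<in>J. \<integral>z. (u j (fst z))\<^sup>2 \<partial>M t)"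
        by (rule Bochner_Integration.integral_sum) (rule integrable_M_fst[OF t L2_sq_integrable[OF uL]])
      ultimately show ?thesis unfolding killing_scale by (simp add: killing_def sum_subtractf)
    qed
    finally have k: "killing t (\<lambda>x. (g x)\<^sup>2) \<le> real (card J) * (\<Sum>j\<in>J. killing t (\<lambda>x. (u j x)\<^sup>2))" .
    have "step_form t g g = (jump t g / 2 + killing t (\<lambda>x. (g x)\<^sup>2)) / t" by (rule step_form_jump[OF t gL])
    also have "\<dots> \<le> (real (card J) * (\<Sum>j\<in>J. jump t (u j)) / 2 + real (card J) * (\<Sum>j\<in>J. killing t (\<lambda>x. (u j x)\<^sup>2))) / t"
      using jump_le_sum[OF t J uL gL lip] k t by (intro divide_right_mono add_mono) auto
    also have "\<dots> = real (card J) * ((\<Sum>j\<in>J. jump t (u j) / 2 + killing t (\<lambda>x. (u j x)\<^sup>2)) / t)"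
      by (simp add: sum.distrib sum_divide_distrib[symmetric] distrib_left)
    also have "\<dots> = real (card J) * (\<Sum>j\<in>J. step_form t (u j) (u j))"
      using step_form_jump[OF t uL] by (simp add: sum_divide_distrib)
    also have "\<dots> \<le> real (card J) * (\<Sum>j\<in>J. E (u j) (u j))"
      by (intro mult_left_mono sum_mono step_form_le_E u t) auto
    finally show ?thesis .
  qed
  show "g \<in> F" "E g g \<le> real (card J) * (\<Sum>j\<in>J. E (u j) (u j))"
    using step_form_bounded_F[OF gL dyadic_tendsto _ step_form_le] by simp_all
qed

lemma F_contraction1:
  assumes "u \<in> F" "g \<in> borel_measurable m"
    "\<And>x y. \<bar>g x - g y\<bar> \<le> \<bar>u x - u y\<bar>" "\<And>x. \<bar>g x\<bar> \<le> \<bar>u x\<bar>"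
  shows "g \<in> F" "E g g \<le> E u u"
  using F_contraction[of "{()}" "\<lambda>_. u" g] assms by auto

lemma F_contraction2:
  assumes "u \<in> F" "v \<in> F" "g \<in> borel_measurable m"
    "\<And>x y. \<bar>g x - g y\<bar> \<le> \<bar>u x - u y\<bar> + \<bar>v x - v y\<bar>" "\<And>x. \<bar>g x\<bar> \<le> \<bar>u x\<bar> + \<bar>v x\<bar>"
  shows "g \<in> F"
  using F_contraction(1)[of "UNIV :: bool set" "\<lambda>b. if b then u else v" g] assms
  by (simp add: UNIV_bool add.commute)

lemma F_max:
  assumes "f \<in> F" "g \<in> F" shows "(\<lambda>x. max (f x) (g x)) \<in> F"
  by (rule F_contraction2[OF assms borel_measurable_max[OF F_measurable F_measurable]]) (use assms in auto)

lemma F_min: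
  assumes "f \<in> F" "g \<in> F" shows "(\<lambda>x. min (f x) (g x)) \<in> F"
  by (rule F_contraction2[OF assms borel_measurable_min[OF F_measurable F_measurable]]) (use assms in auto)

lemma F_min_const: "f \<in> F \<Longrightarrow> c \<ge> 0 \<Longrightarrow> (\<lambda>x. min (f x) c) \<in> F"
  by (rule F_contraction1[of f]) (auto dest: F_measurable)

lemma F_pos_part: "f \<in> F \<Longrightarrow> c \<ge> 0 \<Longrightarrow> (\<lambda>x. max (f x - c) 0) \<in> F"
  by (rule F_contraction1[of f]) (auto dest: F_measurable)

lemma F_truncate: "f \<in> F \<Longrightarrow> c \<ge> 0 \<Longrightarrow> (\<lambda>x. max (- c) (min (f x) c)) \<in> F"
  by (rule F_contraction1[of f]) (auto dest: F_measurable)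

definition bdd :: "('a \<Rightarrow> real) \<Rightarrow> bool" where
  "bdd f \<longleftrightarrow> (\<exists>C. \<forall>x. \<bar>f x\<bar> \<le> C)"

lemma bddE: assumes "bdd f" obtains C where "C \<ge> 0" "\<And>x. \<bar>f x\<bar> \<le> C"
proof -
  obtain C where "\<And>x. \<bar>f x\<bar> \<le> C" using assms by (auto simp: bdd_def)
  then show thesis using that[of C] by (meson abs_ge_zero order_trans)
qed

lemma bddI: "(\<And>x. \<bar>f x\<bar> \<le> C) \<Longrightarrow> bdd f" by (auto simp: bdd_def)

lemma bdd_mult:
  assumes "bdd f" "bdd g" shows "bdd (\<lambda>x. f x * g x)"
proof -
  obtain C D where "C \<ge> 0" "\<And>x. \<bar>f x\<bar> \<le> C" "\<And>x. \<bar>g x\<bar> \<le> D" using assms bddE by metis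
  then show ?thesis by (intro bddI[of _ "C * D"]) (simp add: abs_mult mult_mono)
qed

lemma bdd_scale: "bdd f \<Longrightarrow> bdd (\<lambda>x. a * f x)"
  using bdd_mult[OF bddI[of "\<lambda>_. a" "\<bar>a\<bar>"], of f] by simp

lemma bdd_add:
  assumes "bdd f" "bdd g" shows "bdd (\<lambda>x. f x + g x)"
proof -
  obtain C D where "\<And>x. \<bar>f x\<bar> \<le> C" "\<And>x. \<bar>g x\<bar> \<le> D" using assms bddE by metis
  then show ?thesis by (intro bddI[of _ "C + D"]) (rule order_trans[OF abs_triangle_ineq add_mono])
qed

lemma bdd_diff: "bdd f \<Longrightarrow> bdd g \<Longrightarrow> bdd (\<lambda>x. f x - g x)"
  using bdd_add[OF _ bdd_scale[of g "-1"], of f] by simp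

lemma bdd_sum: "(\<And>i. i \<in> I \<Longrightarrow> bdd (u i)) \<Longrightarrow> bdd (\<lambda>x. \<Sum>i\<in>I. u i x)"
  by (induction I rule: infinite_finite_induct) (auto intro: bdd_add bddI[of _ 0])

text \<open>If \<open>C\<close> and \<open>D\<close> bound \<open>f\<close> and \<open>g\<close>,
  the increments of the product are controlled by those of \<open>D * f\<close> and
  \<open>C * g\<close>.\<close>

lemma F_mult:
  assumes f: "f \<in> F" "bdd f" and g: "g \<in> F" "bdd g"
  shows "(\<lambda>x. f x * g x) \<in> F"
proof -
  obtain C where C: "C \<ge> 0" "\<And>x. \<bar>f x\<bar> \<le> C" using f bddE by blast
  obtain D where D: "D \<ge> 0" "\<And>x. \<bar>g x\<bar> \<le> D" using g bddE by blast
  show ?thesis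
  proof (rule F_contraction2[OF F_scale[OF f(1), of D] F_scale[OF g(1), of C]])
    fix x y
    have "\<bar>f x * g x - f y * g y\<bar> = \<bar>g x * (f x - f y) + f y * (g x - g y)\<bar>" by (simp add: algebra_simps)
    also have "\<dots> \<le> \<bar>g x\<bar> * \<bar>f x - f y\<bar> + \<bar>f y\<bar> * \<bar>g x - g y\<bar>"
      by (rule order_trans[OF abs_triangle_ineq]) (simp add: abs_mult)
    also have "\<dots> \<le> D * \<bar>f x - f y\<bar> + C * \<bar>g x - g y\<bar>"
      by (intro add_mono mult_right_mono C D) auto
    also have "\<dots> = \<bar>D * f x - D * f y\<bar> + \<bar>C * g x - C * g y\<bar>"
      using C D by (simp add: right_diff_distrib[symmetric] abs_mult)
    finally show "\<bar>f x * g x - f y * g y\<bar> \<le> \<bar>D * f x - D * f y\<bar> + \<bar>C * g x - C * g y\<bar>" .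
    have "\<bar>f x * g x\<bar> \<le> \<bar>f x\<bar> * D" unfolding abs_mult by (intro mult_left_mono D) auto
    also have "\<dots> \<le> \<bar>D * f x\<bar> + \<bar>C * g x\<bar>" using D by (simp add: abs_mult mult.commute)
    finally show "\<bar>f x * g x\<bar> \<le> \<bar>D * f x\<bar> + \<bar>C * g x\<bar>" .
  qed (use f g F_measurable in auto)
qed

lemma F_sq: "f \<in> F \<Longrightarrow> bdd f \<Longrightarrow> (\<lambda>x. (f x)\<^sup>2) \<in> F"
  using F_mult[of f f] by (simp add: power2_eq_square)

text \<open>\<open>Lf f g\<close> is the integral of \<open>g\<close> against the energy measure of \<open>f\<close>.\<close>

definition Lf :: "('a \<Rightarrow> real) \<Rightarrow> ('a \<Rightarrow> real) \<Rightarrow> real" where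
  "Lf f g = E f (\<lambda>x. f x * g x) - 1/2 * E (\<lambda>x. (f x)\<^sup>2) g"

text \<open>Approximates \<open>Lf\<close>. Monotonicity in \<open>g\<close> and, for
  \<open>g \<ge> 0\<close>, convexity in \<open>f\<close> can be read off here because the integrand
  is \<open>g\<close> times a square; the limit inherits both.\<close>

definition energy_t :: "real \<Rightarrow> ('a \<Rightarrow> real) \<Rightarrow> ('a \<Rightarrow> real) \<Rightarrow> real" where
  "energy_t t f g =
    ((\<integral>z. g (fst z) * (f (fst z) - f (snd z))\<^sup>2 \<partial>M t) + killing t (\<lambda>x. (f x)\<^sup>2 * g x)) / (2 * t)"

lemma L2_mult_bdd:
  assumes "f \<in> L2 m" "g \<in> borel_measurable m" "bdd g" shows "(\<lambda>x. f x * g x) \<in> L2 m"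
proof -
  obtain C where C: "C \<ge> 0" "\<And>x. \<bar>g x\<bar> \<le> C" using assms bddE by blast
  have f: "f \<in> borel_measurable m" using assms(1) by (rule L2_measurable)
  show ?thesis
    by (rule L2_bound[OF L2_scale[OF assms(1), of C]])
      (use f assms(2) C in \<open>auto simp: abs_mult mult.commute[of C] intro!: mult_left_mono AE_I2\<close>)
qed

lemma integrable_M_bdd_mult:
  assumes "integrable (M t) (u :: _ \<Rightarrow> real)" "g \<in> borel_measurable m" "bdd g"
  shows "integrable (M t) (\<lambda>z. g (fst z) * u z)"
proof -
  obtain C where C: "C \<ge> 0" "\<And>x. \<bar>g x\<bar> \<le> C" using assms bddE by blast
  have [measurable]: "u \<in> borel_measurable (M t)" "g \<in> borel_measurable m" using assms by auto
  have g': "(\<lambda>z. g (fst z)) \<in> borel_measurable (M t)"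
    using assms(2) by (simp add: measurable_cong_sets[OF sets_M refl])
  show ?thesis
    by (rule Bochner_Integration.integrable_bound[OF integrable_mult_right[OF assms(1), of C]])
      (use C g' in \<open>auto simp: abs_mult intro!: mult_right_mono AE_I2\<close>)
qed

text \<open>Expanding the square gives exactly the combination of step forms of which
  \<open>Lf\<close> is the limit.\<close>

lemma energy_t_eq:
  assumes t: "t > 0" and f: "f \<in> L2 m" "bdd f" and g: "g \<in> L2 m" "bdd g"
  shows "energy_t t f g = step_form t f (\<lambda>x. f x * g x) - 1/2 * step_form t (\<lambda>x. (f x)\<^sup>2) g"
proof -
  have meas: "f \<in> borel_measurable m" "g \<in> borel_measurable m" using f g L2_measurable by auto
  have fg: "(\<lambda>x. f x * g x) \<in> L2 m" by (rule L2_mult_bdd[OF f(1) meas(2) g(2)])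
  have ff: "(\<lambda>x. (f x)\<^sup>2) \<in> L2 m" using L2_mult_bdd[OF f(1) meas(1) f(2)] by (simp add: power2_eq_square)
  have i1: "integrable (M t) (\<lambda>z. (f (fst z))\<^sup>2 * g (fst z))"
    using integrable_M_fst[OF t L2_mult_integrable[OF ff g(1)]] .
  have i2: "integrable (M t) (\<lambda>z. f (fst z) * g (fst z) * f (snd z))"
    using integrable_M_mult[OF t f(1) fg] .
  have i3: "integrable (M t) (\<lambda>z. g (fst z) * (f (snd z))\<^sup>2)"
    using integrable_M_mult[OF t ff g(1)] .
  have "(\<integral>z. g (fst z) * (f (fst z) - f (snd z))\<^sup>2 \<partial>M t)
      = (\<integral>z. (f (fst z))\<^sup>2 * g (fst z) - 2 * (f (fst z) * g (fst z) * f (snd z)) + g (fst z) * (f (snd z))\<^sup>2 \<partial>M t)"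
    by (rule Bochner_Integration.integral_cong) (auto simp: power2_eq_square algebra_simps)
  also have "\<dots> = (\<integral>z. (f (fst z))\<^sup>2 * g (fst z) \<partial>M t) - 2 * L2_inner m (P t f) (\<lambda>x. f x * g x)
      + L2_inner m (P t (\<lambda>x. (f x)\<^sup>2)) g"
    using i1 i2 i3 by (simp add: inner_P[OF t f(1) fg] inner_P[OF t ff g(1)])
  finally have S: "(\<integral>z. g (fst z) * (f (fst z) - f (snd z))\<^sup>2 \<partial>M t) + killing t (\<lambda>x. (f x)\<^sup>2 * g x)
      = L2_inner m (\<lambda>x. (f x)\<^sup>2) g - 2 * L2_inner m (P t f) (\<lambda>x. f x * g x) + L2_inner m (P t (\<lambda>x. (f x)\<^sup>2)) g"
    by (simp add: killing_def L2_inner_def)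
  have fgf: "L2_inner m f (\<lambda>x. f x * g x) = L2_inner m (\<lambda>x. (f x)\<^sup>2) g"
    by (simp add: L2_inner_def power2_eq_square mult.assoc)
  have "(c - 2 * b + d) / (2 * t) = (c - b) / t - 1/2 * ((c - d) / t)" for b c d :: real
    using t by (simp add: field_simps)
  then show ?thesis unfolding energy_t_def step_form_def S fgf .
qed

lemma energy_t_tendsto:
  assumes f: "f \<in> F" "bdd f" and g: "g \<in> F" "bdd g"
  shows "((\<lambda>t. energy_t t f g) \<longlongrightarrow> Lf f g) (at_right 0)"
proof -
  have "((\<lambda>t. step_form t f (\<lambda>x. f x * g x) - 1/2 * step_form t (\<lambda>x. (f x)\<^sup>2) g) \<longlongrightarrow> Lf f g) (at_right 0)"
    unfolding Lf_def using f g by (intro tendsto_intros step_form_tendsto F_mult F_sq)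
  then show ?thesis
  proof (rule Lim_transform_eventually)
    show "\<forall>\<^sub>F t in at_right 0. step_form t f (\<lambda>x. f x * g x) - 1/2 * step_form t (\<lambda>x. (f x)\<^sup>2) g = energy_t t f g"
      using eventually_at_right_less by (rule eventually_mono) (use energy_t_eq f g F_L2 in auto)
  qed
qed

lemma Lf_le_from_energy:
  assumes "f \<in> F" "bdd f" "g \<in> F" "bdd g" "((\<lambda>t. B t) \<longlongrightarrow> c) (at_right 0)"
    and "\<And>t. t > 0 \<Longrightarrow> energy_t t f g \<le> B t"
  shows "Lf f g \<le> c"
proof (rule tendsto_le[OF trivial_limit_at_right_real assms(5) energy_t_tendsto[OF assms(1-4)]])
  show "\<forall>\<^sub>F t in at_right 0. energy_t t f g \<le> B t"
    using eventually_at_right_less by (rule eventually_mono) (use assms(6) in auto)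
qed

lemma energy_t_mono:
  assumes t: "t > 0" and f: "f \<in> L2 m" "bdd f" and g: "g \<in> L2 m" "bdd g" and h: "h \<in> borel_measurable m" "bdd h"
    and le: "\<And>x. g x \<le> h x"
  shows "energy_t t f g \<le> energy_t t f h"
proof -
  have meas: "f \<in> borel_measurable m" "g \<in> borel_measurable m" using f g L2_measurable by auto
  have i: "integrable (M t) (\<lambda>z. (f (fst z) - f (snd z))\<^sup>2)" by (rule integrable_M_sq_diff[OF t f(1)])
  have i2: "integrable m (\<lambda>x. (f x)\<^sup>2 * k x)" if "k \<in> borel_measurable m" "bdd k" for k
    using L2_mult_integrable[OF f(1) L2_mult_bdd[OF f(1) that]] by (simp add: power2_eq_square mult.assoc)
  have "(\<integral>z. g (fst z) * (f (fst z) - f (snd z))\<^sup>2 \<partial>M t) \<le> (\<integral>z. h (fst z) * (f (fst z) - f (snd z))\<^sup>2 \<partial>M t)"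
    by (rule integral_mono) (use integrable_M_bdd_mult[OF i] meas g h le in \<open>auto intro: mult_right_mono\<close>)
  moreover have "killing t (\<lambda>x. (f x)\<^sup>2 * g x) \<le> killing t (\<lambda>x. (f x)\<^sup>2 * h x)"
    by (rule killing_mono[OF t i2 i2]) (use meas g h le in \<open>auto intro: mult_left_mono\<close>)
  ultimately show ?thesis using t by (simp add: energy_t_def divide_right_mono)
qed

text \<open>An inequality only, because killing enters \<open>energy_t\<close> with half the weight
  it has in \<open>step_form\<close>.\<close>

lemma energy_t_const:
  assumes t: "t > 0" and f: "f \<in> L2 m" and c: "c \<ge> 0"
  shows "energy_t t f (\<lambda>x. c) \<le> c * step_form t f f"
proof -
  have K: "killing t (\<lambda>x. (f x)\<^sup>2 * c) = c * killing t (\<lambda>x. (f x)\<^sup>2)"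
    using killing_scale[of t c "\<lambda>x. (f x)\<^sup>2"] by (simp add: mult.commute)
  have "energy_t t f (\<lambda>x. c) = (c * jump t f + c * killing t (\<lambda>x. (f x)\<^sup>2)) / (2 * t)"
    unfolding energy_t_def K by (simp add: jump_def)
  also have "\<dots> \<le> (c * jump t f + 2 * (c * killing t (\<lambda>x. (f x)\<^sup>2))) / (2 * t)"
    using t c killing_nonneg[OF t L2_sq_integrable[OF f]] by (intro divide_right_mono) auto
  also have "\<dots> = c * step_form t f f"
    unfolding step_form_jump[OF t f] using t by (simp add: field_simps)
  finally show ?thesis .
qed

lemma Lf_mono:
  assumes f: "f \<in> F" "bdd f" and g: "g \<in> F" "bdd g" and h: "h \<in> F" "bdd h" and le: "\<And>x. g x \<le> h x"
  shows "Lf f g \<le> Lf f h"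
  by (rule Lf_le_from_energy[OF f g energy_t_tendsto[OF f h]])
    (rule energy_t_mono, use f g h le F_L2 F_measurable in auto)

lemma Lf_zero: "f \<in> F \<Longrightarrow> bdd f \<Longrightarrow> Lf f (\<lambda>x. 0) = 0"
  by (simp add: Lf_def E.B_zero_right F_sq)

lemma Lf_nonneg:
  assumes f: "f \<in> F" "bdd f" and g: "g \<in> F" "bdd g" and "\<And>x. g x \<ge> 0"
  shows "Lf f g \<ge> 0"
  using Lf_mono[OF f E.V_zero bddI[of _ 0] g] assms Lf_zero[OF f] by simp

lemma Lf_le:
  assumes f: "f \<in> F" "bdd f" and g: "g \<in> F" "bdd g" and le: "\<And>x. g x \<le> c" and c: "c \<ge> 0"
  shows "Lf f g \<le> c * E f f"
proof (rule Lf_le_from_energy[OF f g])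
  show "((\<lambda>t. c * step_form t f f) \<longlongrightarrow> c * E f f) (at_right 0)"
    by (intro tendsto_intros step_form_tendsto f)
  show "energy_t t f g \<le> c * step_form t f f" if t: "t > 0" for t
    using energy_t_mono[OF t F_L2[OF f(1)] f(2) F_L2[OF g(1)] g(2), of "\<lambda>_. c"] le
      bddI[of "\<lambda>_. c" "\<bar>c\<bar>"] energy_t_const[OF t F_L2[OF f(1)] c] by simp
qed

lemma Lf_add:
  assumes f: "f \<in> F" "bdd f" and g: "g \<in> F" "bdd g" and h: "h \<in> F" "bdd h"
  shows "Lf f (\<lambda>x. g x + h x) = Lf f g + Lf f h"
  using E.B_add_right[OF F_mult[OF f g] F_mult[OF f h] f(1)] E.B_add_right[OF g(1) h(1) F_sq[OF f]]
  by (simp add: Lf_def distrib_left)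

lemma Lf_scale:
  assumes f: "f \<in> F" "bdd f" and g: "g \<in> F" "bdd g"
  shows "Lf f (\<lambda>x. a * g x) = a * Lf f g"
proof -
  have "(\<lambda>x. f x * (a * g x)) = (\<lambda>x. a * (f x * g x))" by (simp add: ac_simps)
  then show ?thesis
    using E.B_scale_right[OF f(1) F_mult[OF f g], of a] E.B_scale_right[OF F_sq[OF f] g(1), of a]
    by (simp add: Lf_def right_diff_distrib)
qed

lemma Lf_sum:
  assumes f: "f \<in> F" "bdd f" and g: "\<And>i. i \<in> I \<Longrightarrow> g i \<in> F" "\<And>i. i \<in> I \<Longrightarrow> bdd (g i)"
  shows "Lf f (\<lambda>x. \<Sum>i\<in>I. g i x) = (\<Sum>i\<in>I. Lf f (g i))"
  using g by (induction I rule: infinite_finite_induct)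
    (simp_all add: Lf_zero[OF f] Lf_add[OF f] E.V_sum bdd_sum)

lemma energy_t_midpoint:
  assumes t: "t > 0" and f: "f \<in> L2 m" "bdd f" and h: "h \<in> L2 m" "bdd h" and g: "g \<in> L2 m" "bdd g" and ge: "\<And>x. g x \<ge> 0"
  shows "energy_t t (\<lambda>x. (f x + h x) / 2) g \<le> energy_t t f g / 2 + energy_t t h g / 2"
proof -
  have meas: "g \<in> borel_measurable m" using g L2_measurable by auto
  have fh: "(\<lambda>x. (f x + h x) / 2) \<in> L2 m" by (rule L2.V_midpoint[OF f(1) h(1)])
  have sq: "((a + b) / 2)\<^sup>2 \<le> a\<^sup>2 / 2 + b\<^sup>2 / 2" for a b :: real
    using sum_squares_bound[of a b] by (simp add: power2_eq_square field_simps)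
  have i: "integrable (M t) (\<lambda>z. g (fst z) * (k (fst z) - k (snd z))\<^sup>2)" if "k \<in> L2 m" for k
    by (rule integrable_M_bdd_mult[OF integrable_M_sq_diff[OF t that] meas g(2)])
  have i2: "integrable m (\<lambda>x. (k x)\<^sup>2 * g x)" if "k \<in> L2 m" for k
    using L2_mult_integrable[OF that L2_mult_bdd[OF that meas g(2)]] by (simp add: power2_eq_square mult.assoc)
  have "(\<integral>z. g (fst z) * ((f (fst z) + h (fst z)) / 2 - (f (snd z) + h (snd z)) / 2)\<^sup>2 \<partial>M t)
    \<le> (\<integral>z. g (fst z) * (f (fst z) - f (snd z))\<^sup>2 / 2 + g (fst z) * (h (fst z) - h (snd z))\<^sup>2 / 2 \<partial>M t)"
  proof (rule integral_mono)
    fix z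
    have eq: "(f (fst z) + h (fst z)) / 2 - (f (snd z) + h (snd z)) / 2 = ((f (fst z) - f (snd z)) + (h (fst z) - h (snd z))) / 2"
      by (simp add: field_simps)
    show "g (fst z) * ((f (fst z) + h (fst z)) / 2 - (f (snd z) + h (snd z)) / 2)\<^sup>2
      \<le> g (fst z) * (f (fst z) - f (snd z))\<^sup>2 / 2 + g (fst z) * (h (fst z) - h (snd z))\<^sup>2 / 2"
      using mult_left_mono[OF sq[of "f (fst z) - f (snd z)" "h (fst z) - h (snd z)"] ge[of "fst z"]]
      by (simp only: eq distrib_left times_divide_eq_right)
  qed (use i[OF fh] i[OF f(1)] i[OF h(1)] in auto)
  also have "\<dots> = (\<integral>z. g (fst z) * (f (fst z) - f (snd z))\<^sup>2 \<partial>M t) / 2 + (\<integral>z. g (fst z) * (h (fst z) - h (snd z))\<^sup>2 \<partial>M t) / 2"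
    using i f(1) h(1) by simp
  finally have 1: "(\<integral>z. g (fst z) * ((f (fst z) + h (fst z)) / 2 - (f (snd z) + h (snd z)) / 2)\<^sup>2 \<partial>M t)
    \<le> (\<integral>z. g (fst z) * (f (fst z) - f (snd z))\<^sup>2 \<partial>M t) / 2 + (\<integral>z. g (fst z) * (h (fst z) - h (snd z))\<^sup>2 \<partial>M t) / 2" .
  have "killing t (\<lambda>x. ((f x + h x) / 2)\<^sup>2 * g x) \<le> killing t (\<lambda>x. 1/2 * ((f x)\<^sup>2 * g x) + 1/2 * ((h x)\<^sup>2 * g x))"
  proof (rule killing_mono[OF t i2[OF fh]])
    show "((f x + h x) / 2)\<^sup>2 * g x \<le> 1/2 * ((f x)\<^sup>2 * g x) + 1/2 * ((h x)\<^sup>2 * g x)" for x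
      using mult_right_mono[OF sq[of "f x" "h x"] ge[of x]] by (simp add: distrib_right)
  qed (use i2 f h in auto)
  also have "\<dots> = 1/2 * killing t (\<lambda>x. (f x)\<^sup>2 * g x) + 1/2 * killing t (\<lambda>x. (h x)\<^sup>2 * g x)"
    using i2[OF f(1)] i2[OF h(1)] by (subst killing_add[OF t]) (auto simp only: killing_scale)
  finally have 2: "killing t (\<lambda>x. ((f x + h x) / 2)\<^sup>2 * g x) \<le> 1/2 * killing t (\<lambda>x. (f x)\<^sup>2 * g x) + 1/2 * killing t (\<lambda>x. (h x)\<^sup>2 * g x)" .
  have "energy_t t (\<lambda>x. (f x + h x) / 2) g \<le> (((\<integral>z. g (fst z) * (f (fst z) - f (snd z))\<^sup>2 \<partial>M t) / 2 + (\<integral>z. g (fst z) * (h (fst z) - h (snd z))\<^sup>2 \<partial>M t) / 2)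
     + (1/2 * killing t (\<lambda>x. (f x)\<^sup>2 * g x) + 1/2 * killing t (\<lambda>x. (h x)\<^sup>2 * g x))) / (2 * t)"
    unfolding energy_t_def using t by (intro divide_right_mono add_mono 1 2) auto
  also have "\<dots> = energy_t t f g / 2 + energy_t t h g / 2"
    using t by (simp add: energy_t_def field_simps)
  finally show ?thesis .
qed

text \<open>Convexity of the square at the level of \<open>energy_t\<close>. It lets smallness of
  the energy survive the midpoints demanded by \<open>weak_closure\<close>.\<close>

lemma Lf_midpoint:
  assumes f: "f \<in> F" "bdd f" and h: "h \<in> F" "bdd h" and g: "g \<in> F" "bdd g" and ge: "\<And>x. g x \<ge> 0"
  shows "Lf (\<lambda>x. (f x + h x) / 2) g \<le> Lf f g / 2 + Lf h g / 2"
proof (rule Lf_le_from_energy[OF E.V_midpoint[OF f(1) h(1)] _ g])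
  show "bdd (\<lambda>x. (f x + h x) / 2)" using bdd_scale[OF bdd_add[OF f(2) h(2)], of "1/2"] by simp
  show "((\<lambda>t. energy_t t f g / 2 + energy_t t h g / 2) \<longlongrightarrow> Lf f g / 2 + Lf h g / 2) (at_right 0)"
    by (intro tendsto_intros energy_t_tendsto f g h) auto
qed (rule energy_t_midpoint, use f g h ge F_L2 in auto)

lemma Lf_scale_left:
  assumes f: "f \<in> F" "bdd f" and g: "g \<in> F" "bdd g"
  shows "Lf (\<lambda>x. a * f x) g = a\<^sup>2 * Lf f g"
proof -
  have af: "(\<lambda>x. a * f x) \<in> F" "bdd (\<lambda>x. a * f x)" using F_scale bdd_scale f by auto
  have "E (\<lambda>x. a * f x) (\<lambda>x. a * f x * g x) = a * E f (\<lambda>x. a * f x * g x)"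
    by (rule E.B_scale[OF f(1) F_mult[OF af g]])
  also have "(\<lambda>x. a * f x * g x) = (\<lambda>x. a * (f x * g x))" by (simp add: mult.assoc)
  also have "E f (\<lambda>x. a * (f x * g x)) = a * E f (\<lambda>x. f x * g x)" by (rule E.B_scale_right[OF f(1) F_mult[OF f g]])
  finally have 1: "E (\<lambda>x. a * f x) (\<lambda>x. a * f x * g x) = a\<^sup>2 * E f (\<lambda>x. f x * g x)"
    by (simp only: power2_eq_square mult.assoc)
  have 2: "E (\<lambda>x. (a * f x)\<^sup>2) g = a\<^sup>2 * E (\<lambda>x. (f x)\<^sup>2) g"
    using E.B_scale[OF F_sq[OF f] g(1), of "a\<^sup>2"] by (simp add: power_mult_distrib)
  show ?thesis unfolding Lf_def 1 2 by (simp add: algebra_simps)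
qed

text \<open>This is \<open>Lf_midpoint\<close> for \<open>2 * f\<close> and
  \<open>2 * h\<close>.\<close>

lemma Lf_add_le:
  assumes f: "f \<in> F" "bdd f" and h: "h \<in> F" "bdd h" and g: "g \<in> F" "bdd g" and ge: "\<And>x. g x \<ge> 0"
  shows "Lf (\<lambda>x. f x + h x) g \<le> 2 * Lf f g + 2 * Lf h g"
proof -
  have "Lf (\<lambda>x. (2 * f x + 2 * h x) / 2) g \<le> Lf (\<lambda>x. 2 * f x) g / 2 + Lf (\<lambda>x. 2 * h x) g / 2"
    by (rule Lf_midpoint) (use f g h ge F_scale bdd_scale in auto)
  moreover have "(\<lambda>x. (2 * f x + 2 * h x) / 2) = (\<lambda>x. f x + h x)" by auto
  ultimately show ?thesis using Lf_scale_left[OF f g, of 2] Lf_scale_left[OF h g, of 2] by simp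
qed

section \<open>Strong locality of the energy functional\<close>

lemma supp_m_subset:
  assumes f: "f \<in> borel_measurable m" and V: "open V" "\<And>x. x \<in> V \<Longrightarrow> f x = 0"
  shows "supp_m m f \<subseteq> - V"
proof
  fix x assume x: "x \<in> supp_m m f"
  have Vm: "V \<in> sets m" using V by (simp add: sets_m)
  have "emeasure (density m (\<lambda>x. ennreal \<bar>f x\<bar>)) V = (\<integral>\<^sup>+y. ennreal \<bar>f y\<bar> * indicator V y \<partial>m)"
    using f Vm by (intro emeasure_density) auto
  also have "\<dots> = (\<integral>\<^sup>+y. 0 \<partial>m)"
    by (rule nn_integral_cong) (use V in \<open>auto simp: indicator_def\<close>)
  finally have "emeasure (density m (\<lambda>x. ennreal \<bar>f x\<bar>)) V = 0" by simp
  then show "x \<in> - V" using x V(1) unfolding supp_m_def measure_support_def by force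
qed

lemma closed_supp_m: "closed (supp_m m f)"
proof -
  have "- supp_m m f = \<Union>{V. open V \<and> \<not> emeasure (density m (\<lambda>x. ennreal \<bar>f x\<bar>)) V > 0}"
    unfolding supp_m_def measure_support_def by auto
  moreover have "open (\<Union>{V. open V \<and> \<not> emeasure (density m (\<lambda>x. ennreal \<bar>f x\<bar>)) V > 0})"
    by (rule open_Union) auto
  ultimately show ?thesis by (simp add: closed_def)
qed

lemma compact_supp_m:
  assumes f: "f \<in> borel_measurable m" and A: "bounded A" "\<And>x. x \<notin> A \<Longrightarrow> f x = 0"
  shows "compact (supp_m m f)"
proof (rule compact_bounded_closed[OF _ closed_supp_m])
  have "supp_m m f \<subseteq> - (- closure A)"
    using A(2) closure_subset[of A] by (intro supp_m_subset[OF f]) auto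
  then show "bounded (supp_m m f)" using bounded_subset[OF bounded_closure[OF A(1)]] by simp
qed

text \<open>\<open>strongly_local\<close> asks for compact supports. Bounded closed sets are compact
  here, so boundedness of the set where the function is nonzero suffices and is easier to
  propagate.\<close>

definition bsupp :: "('a \<Rightarrow> real) \<Rightarrow> bool" where
  "bsupp f \<longleftrightarrow> bounded {x. f x \<noteq> 0}"

text \<open>Strong locality without \<open>supp_m\<close>: the open set \<open>V\<close> misses the
  support of \<open>f - a\<close> and the closed set \<open>C\<close> contains that of
  \<open>g\<close>, so \<open>C \<subseteq> V\<close> separates them.\<close>

lemma E_local:
  assumes f: "f \<in> F" "bsupp f" and g: "g \<in> F" "bsupp g"
    and V: "open V" "\<And>x. x \<in> V \<Longrightarrow> f x = a" and C: "closed C" "C \<subseteq> V" "\<And>x. x \<notin> C \<Longrightarrow> g x = 0"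
  shows "E f g = 0"
proof (rule strongly_local[OF f(1) g(1)])
  show "compact (supp_m m f)" "compact (supp_m m g)"
    using compact_supp_m[OF F_measurable[OF f(1)] f(2)[unfolded bsupp_def]]
      compact_supp_m[OF F_measurable[OF g(1)] g(2)[unfolded bsupp_def]] by simp_all
  have "supp_m m (\<lambda>x. f x - a) \<subseteq> - V"
    by (rule supp_m_subset) (use V F_measurable[OF f(1)] in auto)
  moreover have "supp_m m g \<subseteq> - (- C)"
    by (rule supp_m_subset) (use C F_measurable[OF g(1)] in \<open>auto simp: open_Compl\<close>)
  ultimately show "supp_m m (\<lambda>x. f x - a) \<inter> supp_m m g = {}" using C by auto
qed

lemma bsupp_mult: "bsupp f \<Longrightarrow> bsupp (\<lambda>x. g x * f x)" "bsupp f \<Longrightarrow> bsupp (\<lambda>x. f x * g x)"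
  by (auto simp: bsupp_def elim!: bounded_subset)

lemma bsupp_sq: "bsupp f \<Longrightarrow> bsupp (\<lambda>x. (f x)\<^sup>2)"
  by (auto simp: bsupp_def elim!: bounded_subset)

lemma bsupp_diff: "bsupp f \<Longrightarrow> bsupp g \<Longrightarrow> bsupp (\<lambda>x. f x - g x)"
  unfolding bsupp_def by (rule bounded_subset[of "{x. f x \<noteq> 0} \<union> {x. g x \<noteq> 0}"]) auto

lemma bsupp_add: "bsupp f \<Longrightarrow> bsupp g \<Longrightarrow> bsupp (\<lambda>x. f x + g x)"
  unfolding bsupp_def by (rule bounded_subset[of "{x. f x \<noteq> 0} \<union> {x. g x \<noteq> 0}"]) auto

lemma bsupp_zero: "bsupp (\<lambda>x. 0)" by (simp add: bsupp_def)

lemma bsupp_sum: "(\<And>i. i \<in> I \<Longrightarrow> bsupp (u i)) \<Longrightarrow> bsupp (\<lambda>x. \<Sum>i\<in>I. u i x)"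
  by (induction I rule: infinite_finite_induct) (auto intro: bsupp_add simp: bsupp_zero)

text \<open>Here \<open>f * g = h * g + a * g\<close>, and on \<open>V\<close> also
  \<open>f^2 = h^2 + 2 * a * h + a^2\<close>; after strong locality the two contributions
  \<open>a * E h g\<close> cancel. So the energy near the support of \<open>g\<close> does not see
  additive constants.\<close>

lemma Lf_local:
  assumes f: "f \<in> F" "bdd f" "bsupp f" and h: "h \<in> F" "bdd h" "bsupp h" and g: "g \<in> F" "bdd g" "bsupp g"
    and V: "open V" "\<And>x. x \<in> V \<Longrightarrow> f x = h x + a" and C: "closed C" "C \<subseteq> V" "\<And>x. x \<notin> C \<Longrightarrow> g x = 0"
  shows "Lf f g = Lf h g"
proof -
  have fg: "(\<lambda>x. f x * g x) \<in> F" and hg: "(\<lambda>x. h x * g x) \<in> F" using F_mult f h g by auto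
  have loc: "E (\<lambda>x. f x - h x) k = 0" if "k \<in> F" "bsupp k" "\<And>x. x \<notin> C \<Longrightarrow> k x = 0" for k
    by (rule E_local[OF E.V_diff[OF f(1) h(1)] bsupp_diff[OF f(3) h(3)] that(1,2) V(1) _ C(1,2) that(3)]) (use V in auto)
  have "E f (\<lambda>x. f x * g x) = E h (\<lambda>x. f x * g x)"
    using loc[OF fg bsupp_mult(1)[OF g(3)]] C E.B_diff[OF f(1) h(1) fg] by simp
  moreover have "(\<lambda>x. f x * g x) = (\<lambda>x. h x * g x + a * g x)"
  proof
    fix x show "f x * g x = h x * g x + a * g x"
      using V(2)[of x] C(2) C(3)[of x] by (cases "x \<in> C") (auto simp: distrib_right)
  qed
  ultimately have 1: "E f (\<lambda>x. f x * g x) = E h (\<lambda>x. h x * g x) + a * E h g"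
    using E.B_add_right[OF hg F_scale[OF g(1)] h(1), of a] E.B_scale_right[OF h(1) g(1), of a] by simp
  have sq: "(\<lambda>x. (f x)\<^sup>2) \<in> F" "(\<lambda>x. (h x)\<^sup>2) \<in> F" using F_sq f h by auto
  have "E (\<lambda>x. ((f x)\<^sup>2 - (h x)\<^sup>2) - 2 * a * h x) g = 0"
  proof (rule E_local[OF _ _ g(1,3) V(1) _ C])
    show "(\<lambda>x. ((f x)\<^sup>2 - (h x)\<^sup>2) - 2 * a * h x) \<in> F"
      by (intro E.V_diff sq F_scale h)
    show "bsupp (\<lambda>x. ((f x)\<^sup>2 - (h x)\<^sup>2) - 2 * a * h x)"
      by (intro bsupp_diff bsupp_sq bsupp_mult(1) f h)
    show "((f x)\<^sup>2 - (h x)\<^sup>2) - 2 * a * h x = a\<^sup>2" if "x \<in> V" for x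
      using V(2)[OF that] by (simp add: power2_eq_square algebra_simps)
  qed
  then have 2: "E (\<lambda>x. (f x)\<^sup>2) g = E (\<lambda>x. (h x)\<^sup>2) g + 2 * a * E h g"
    using E.B_diff[OF E.V_diff[OF sq] F_scale[OF h(1)] g(1), of "2 * a"] E.B_diff[OF sq g(1)]
      E.B_scale[OF h(1) g(1), of "2 * a"] by (simp add: mult.assoc)
  show ?thesis unfolding Lf_def 1 2 by (simp add: add_divide_distrib)
qed

text \<open>Since \<open>w\<close> is constant near the support of \<open>f\<close>, the term
  \<open>E w (f^2)\<close> vanishes by locality, and \<open>f * w = f\<close>. This recovers the
  full energy from the functional.\<close>

lemma E_eq_Lf:
  assumes f: "f \<in> F" "bdd f" "bsupp f" and c: "w \<in> F" "bdd w" "bsupp w"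
    and V: "open V" "\<And>x. x \<in> V \<Longrightarrow> w x = 1" and C: "closed C" "C \<subseteq> V" "\<And>x. x \<notin> C \<Longrightarrow> f x = 0"
  shows "E f f = Lf f w"
proof -
  have "(\<lambda>x. f x * w x) = f"
  proof
    fix x show "f x * w x = f x" using V(2)[of x] C(2) C(3)[of x] by (cases "x \<in> C") auto
  qed
  moreover have "E w (\<lambda>x. (f x)\<^sup>2) = 0"
    by (rule E_local[OF c(1,3) F_sq[OF f(1,2)] bsupp_sq[OF f(3)] V C(1,2)]) (use C(3) in auto)
  ultimately show ?thesis using E_sym[OF c(1) F_sq[OF f(1,2)]] by (simp add: Lf_def)
qed

end

section \<open>Riesz representation on a lattice of functions\<close>

text \<open>The functional \<open>Lf f\<close> is given on \<open>F \<inter> C_c\<close>, a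
  uniformly dense lattice, rather than on all of \<open>C_c\<close>. The truncations in
  \<open>H_pos\<close> serve to push supports into open sets.\<close>

locale riesz_lattice =
  fixes H :: "('a::metric_space \<Rightarrow> real) set" and L :: "('a \<Rightarrow> real) \<Rightarrow> real"
  assumes proper: "\<And>(x::'a) r. r > 0 \<Longrightarrow> compact (closure (ball x r))"
    and H_C_c: "\<And>f. f \<in> H \<Longrightarrow> f \<in> C_c"
    and H_add: "\<And>f g. f \<in> H \<Longrightarrow> g \<in> H \<Longrightarrow> (\<lambda>x. f x + g x) \<in> H"
    and H_scale: "\<And>f a. f \<in> H \<Longrightarrow> (\<lambda>x. a * f x) \<in> H"
    and H_max: "\<And>f g. f \<in> H \<Longrightarrow> g \<in> H \<Longrightarrow> (\<lambda>x. max (f x) (g x)) \<in> H"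
    and H_pos: "\<And>f c. f \<in> H \<Longrightarrow> c \<ge> 0 \<Longrightarrow> (\<lambda>x. max (f x - c) 0) \<in> H"
    and H_dense: "\<And>f \<epsilon>. f \<in> C_c \<Longrightarrow> \<epsilon> > 0 \<Longrightarrow> \<exists>g\<in>H. \<forall>x. \<bar>f x - g x\<bar> < \<epsilon>"
    and L_add: "\<And>f g. f \<in> H \<Longrightarrow> g \<in> H \<Longrightarrow> L (\<lambda>x. f x + g x) = L f + L g"
    and L_scale: "\<And>f a. f \<in> H \<Longrightarrow> L (\<lambda>x. a * f x) = a * L f"
    and L_nonneg: "\<And>f. f \<in> H \<Longrightarrow> (\<And>x. f x \<ge> 0) \<Longrightarrow> L f \<ge> 0"
begin

lemma H_zero: "(\<lambda>x. 0) \<in> H"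
proof -
  have "(\<lambda>x::'a. 0::real) \<in> C_c" by (simp add: C_c_def)
  then obtain g where "g \<in> H" using H_dense[of "\<lambda>x. 0" 1] by auto
  from H_scale[OF this, of 0] show ?thesis by simp
qed

lemma H_diff: "f \<in> H \<Longrightarrow> g \<in> H \<Longrightarrow> (\<lambda>x. f x - g x) \<in> H"
  using H_add[OF _ H_scale[of g "-1"], of f] by simp

lemma L_diff: "f \<in> H \<Longrightarrow> g \<in> H \<Longrightarrow> L (\<lambda>x. f x - g x) = L f - L g"
  using L_add[OF _ H_scale[of g "-1"], of f] L_scale[of g "-1"] by simp

lemma L_zero: "L (\<lambda>x. 0) = 0"
  using L_scale[OF H_zero, of 0] by simp

lemma L_mono: "f \<in> H \<Longrightarrow> g \<in> H \<Longrightarrow> (\<And>x. f x \<le> g x) \<Longrightarrow> L f \<le> L g"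
  using L_nonneg[OF H_diff[of g f]] L_diff[of g f] by simp

lemma H_sum: "(\<And>i. i \<in> I \<Longrightarrow> u i \<in> H) \<Longrightarrow> (\<lambda>x. \<Sum>i\<in>I. u i x) \<in> H"
  by (induction I rule: infinite_finite_induct) (auto intro: H_zero H_add)

lemma L_sum: "(\<And>i. i \<in> I \<Longrightarrow> u i \<in> H) \<Longrightarrow> L (\<lambda>x. \<Sum>i\<in>I. u i x) = (\<Sum>i\<in>I. L (u i))"
  by (induction I rule: infinite_finite_induct) (auto simp: L_zero L_add H_sum)

lemma H_min_const: assumes "f \<in> H" "c \<ge> 0" shows "(\<lambda>x. min (f x) c) \<in> H"
proof -
  have "(\<lambda>x. min (f x) c) = (\<lambda>x. f x - max (f x - c) 0)" by (auto simp: fun_eq_iff)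
  then show ?thesis using H_diff[OF assms(1) H_pos[OF assms]] by simp
qed

lemma H_continuous: "f \<in> H \<Longrightarrow> continuous_on UNIV f"
  using H_C_c by (auto simp: C_c_def)

lemma H_borel: "f \<in> H \<Longrightarrow> f \<in> borel_measurable borel"
  using H_continuous borel_measurable_continuous_onI by blast

lemma bounded_closed_compact: "bounded (A::'a set) \<Longrightarrow> closed A \<Longrightarrow> compact A"
proof -
  assume "bounded A" "closed A"
  then obtain x e where "A \<subseteq> cball x e" using bounded_subset_cball by blast
  then have "A \<subseteq> closure (ball x (\<bar>e\<bar> + 1))"
    using closure_subset[of "ball x (\<bar>e\<bar> + 1)"] by (auto simp: subset_eq)
  then show "compact A"
    using compact_Int_closed[OF proper[of "\<bar>e\<bar> + 1" x] \<open>closed A\<close>] by (simp add: Int_absorb1)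
qed

lemma C_cI:
  assumes "continuous_on UNIV f" "bounded A" "\<And>x. x \<notin> A \<Longrightarrow> f x = 0"
  shows "(f :: 'a \<Rightarrow> real) \<in> C_c"
proof -
  have "bounded {x. f x \<noteq> 0}" using assms(2) by (rule bounded_subset) (use assms(3) in auto)
  then show ?thesis using assms(1) by (simp add: C_c_def bounded_closed_compact[OF bounded_closure])
qed

lemma H_bounded_support: "f \<in> H \<Longrightarrow> bounded {x. f x \<noteq> 0}"
  using H_C_c[of f] compact_imp_bounded bounded_subset closure_subset unfolding C_c_def by blast

definition bump :: "'a \<Rightarrow> real \<Rightarrow> 'a \<Rightarrow> real" where
  "bump x0 R x = max 0 (min 1 (R + 1 - dist x0 x))"

lemma bump_props:
  "0 \<le> bump x0 R x" "bump x0 R x \<le> 1" "dist x0 x \<le> R \<Longrightarrow> bump x0 R x = 1"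
  by (auto simp: bump_def)

lemma bump_cont: "continuous_on UNIV (bump x0 R)"
  unfolding bump_def by (intro continuous_intros)

lemma bump_C_c: "bump x0 R \<in> C_c"
  by (rule C_cI[OF bump_cont, of "cball x0 (R + 1)"]) (auto simp: bump_def)

text \<open>Constants need not be in \<open>H\<close>; such a \<open>w\<close> replaces the constant
  1 on a bounded set, so that a uniform error \<open>\<epsilon>\<close> there costs at most
  \<open>\<epsilon> * L w\<close>.\<close>

lemma dominating:
  assumes "bounded (A :: 'a set)"
  obtains w where "w \<in> H" "\<And>x. w x \<ge> 0" "\<And>x. x \<in> A \<Longrightarrow> w x \<ge> 1"
proof -
  obtain x0 e where e: "A \<subseteq> cball x0 e" using assms bounded_subset_cball by blast
  obtain g where g: "g \<in> H" "\<And>x. \<bar>bump x0 e x - g x\<bar> < 1/2" using H_dense[OF bump_C_c[of x0 e], of "1/2"] by auto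
  have "g x \<ge> 1/2" if "x \<in> A" for x
  proof -
    have "bump x0 e x = 1" using that e by (intro bump_props(3)) auto
    then show ?thesis using g(2)[of x] by linarith
  qed
  then show thesis
    using g(1) by (intro that[of "\<lambda>x. 2 * max (g x - 0) 0"] H_scale H_pos) fastforce+
qed

text \<open>Dini's theorem: the pointwise convergence is uniform on the compact support of the first function.\<close>

lemma L_Dini:
  assumes g: "\<And>n. g n \<in> H" and dec: "\<And>n x. g (Suc n) x \<le> g n x" and ge: "\<And>n x. g n x \<ge> 0"
    and lim: "\<And>x. (\<lambda>n. g n x) \<longlonglongrightarrow> 0"
  shows "(\<lambda>n. L (g n)) \<longlonglongrightarrow> 0"
proof -
  define K where "K = closure {x. g 0 x \<noteq> 0}"
  have K: "compact K" using H_C_c[OF g[of 0]] by (simp add: C_c_def K_def)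
  obtain w where w: "w \<in> H" "\<And>x. w x \<ge> 0" "\<And>x. x \<in> K \<Longrightarrow> w x \<ge> 1"
    using dominating[OF compact_imp_bounded[OF K]] by blast
  have dec': "g n x \<le> g k x" if "k \<le> n" for k n x
    using that by (induction rule: dec_induct) (auto intro: order_trans[OF dec])
  show ?thesis
  proof (rule LIMSEQ_I)
    fix r :: real assume r: "r > 0"
    define \<epsilon> where "\<epsilon> = r / (L w + 1)"
    have Lw: "L w \<ge> 0" using L_nonneg w by blast
    then have e: "\<epsilon> > 0" using r by (simp add: \<epsilon>_def)
    have op: "open {x. g n x < \<epsilon>}" for n
      using open_Collect_less[OF H_continuous[OF g] continuous_on_const] by simp
    have "K \<subseteq> (\<Union>n\<in>UNIV. {x. g n x < \<epsilon>})"
    proof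
      fix x
      show "x \<in> (\<Union>n\<in>UNIV. {x. g n x < \<epsilon>})"
        using order_tendstoD(2)[OF lim[of x] e] eventually_happens'[OF sequentially_bot] by auto
    qed
    then obtain C where C: "finite C" "K \<subseteq> (\<Union>n\<in>C. {x. g n x < \<epsilon>})"
      by (rule compactE_image[OF K op]) blast
    define N where "N = Max (insert 0 C)"
    have "norm (L (g n) - 0) < r" if n: "n \<ge> N" for n
    proof -
      have "g n x \<le> \<epsilon> * w x" for x
      proof (cases "x \<in> K")
        case True
        then obtain k where k: "k \<in> C" "g k x < \<epsilon>" using C by auto
        then have "k \<le> n" using C n Max_ge[of "insert 0 C" k] by (auto simp: N_def)
        then have "g n x \<le> \<epsilon>" using dec' k by (meson less_imp_le order_trans)
        also have "\<dots> \<le> \<epsilon> * w x" using w(3)[OF True] e by simp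
        finally show ?thesis .
      next
        case False
        then have "g 0 x = 0" using closure_subset by (force simp: K_def)
        then have "g n x \<le> 0" using dec'[of 0 n x] by simp
        also have "0 \<le> \<epsilon> * w x" using e w by simp
        finally show ?thesis .
      qed
      then have "L (g n) \<le> L (\<lambda>x. \<epsilon> * w x)" by (intro L_mono g H_scale w)
      also have "\<dots> = \<epsilon> * L w" by (rule L_scale[OF w(1)])
      also have "\<dots> < r" using r Lw by (simp add: \<epsilon>_def field_simps)
      finally show ?thesis using L_nonneg[OF g ge] by simp
    qed
    then show "\<exists>no. \<forall>n\<ge>no. norm (L (g n) - 0) < r" by blast
  qed
qed

section \<open>The outer measure of a positive functional\<close>

definition adm :: "'a set \<Rightarrow> ('a \<Rightarrow> real) set" where
  "adm V = {g\<in>H. (\<forall>x. 0 \<le> g x \<and> g x \<le> 1) \<and> (\<forall>x. x \<notin> V \<longrightarrow> g x = 0)}"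

definition \<nu> :: "'a set \<Rightarrow> ennreal" where
  "\<nu> V = (SUP g\<in>adm V. ennreal (L g))"

lemma adm_zero: "(\<lambda>x. 0) \<in> adm V" by (simp add: adm_def H_zero)

lemma adm_mono: "V \<subseteq> W \<Longrightarrow> adm V \<subseteq> adm W" by (auto simp: adm_def)

lemma \<nu>_mono: "V \<subseteq> W \<Longrightarrow> \<nu> V \<le> \<nu> W"
  unfolding \<nu>_def by (rule SUP_subset_mono[OF adm_mono]) auto

lemma \<nu>_ge: "g \<in> adm V \<Longrightarrow> ennreal (L g) \<le> \<nu> V"
  unfolding \<nu>_def by (rule SUP_upper)

lemma \<nu>_empty: "\<nu> {} = 0"
proof -
  have "adm {} = {\<lambda>x. 0}" by (auto simp: adm_def H_zero fun_eq_iff)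
  then show ?thesis by (simp add: \<nu>_def L_zero)
qed

text \<open>Elements of \<open>H\<close> only approximate the continuous cutoffs \<open>d k\<close>.
  Subtracting the error \<open>1 / (k + 1)\<close> and cutting at 0 makes them vanish off
  \<open>V\<close> again, and running maxima make the sequence increase.\<close>

lemma exhaustion:
  assumes "open V"
  obtains h where "\<And>k::nat. h k \<in> adm V" "\<And>k x. h k x \<le> h (Suc k) x" "\<And>x. x \<in> V \<Longrightarrow> (\<lambda>k. h k x) \<longlonglongrightarrow> 1"
proof -
  fix x0 :: 'a
  \<comment> \<open>\<open>infdist\<close> to the empty set is 0, hence the separate value for
    \<open>V = UNIV\<close>.\<close>
  define q where "q x = (if V = UNIV then 1 else infdist x (- V))" for x
  have q0: "q x = 0" if "x \<notin> V" for x using that by (auto simp: q_def)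
  have qpos: "q x > 0" if "x \<in> V" for x
  proof (cases "V = UNIV")
    case False
    then have "- V \<noteq> {}" by auto
    then have "infdist x (- V) \<noteq> 0"
      using in_closed_iff_infdist_zero[of "- V" x] assms that by (auto simp: closed_def)
    then show ?thesis using infdist_nonneg[of x "- V"] False by (simp add: q_def)
  qed (simp add: q_def)
  have qcont: "continuous_on UNIV q"
    by (cases "V = UNIV") (auto simp: q_def intro!: continuous_intros)
  define d where "d k x = min 1 (real k * q x) * bump x0 (real k) x" for k x
  have qge: "q x \<ge> 0" for x using q0[of x] qpos[of x] by (cases "x \<in> V") auto
  have d: "0 \<le> d k x" "d k x \<le> 1" "x \<notin> V \<Longrightarrow> d k x = 0" for k x
    using bump_props(1,2)[of x0 "real k" x] qge[of x] q0[of x] by (auto simp: d_def intro!: mult_le_one)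
  have dC: "d k \<in> C_c" for k
  proof (rule C_cI[of _ "cball x0 (real k + 1)"])
    show "continuous_on UNIV (d k)" unfolding d_def by (intro continuous_intros qcont bump_cont)
  qed (auto simp: d_def bump_def)
  have "\<exists>g\<in>H. \<forall>x. \<bar>d k x - g x\<bar> < 1 / (real k + 1)" for k using H_dense[OF dC, of "1 / (real k + 1)"] by simp
  then obtain g where g: "\<And>k. g k \<in> H" "\<And>k x. \<bar>d k x - g k x\<bar> < 1 / (real k + 1)" by metis
  define h' where "h' k x = min (max (g k x - 1 / (real k + 1)) 0) 1" for k x
  have h'H: "h' k \<in> H" for k unfolding h'_def by (intro H_min_const H_pos g) auto
  have h'0: "h' k x = 0" if "x \<notin> V" for k x
    using g(2)[of k x] d(3)[OF that, of k] by (auto simp: h'_def)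
  have h'lo: "h' k x \<ge> d k x - 2 / (real k + 1)" for k x
  proof -
    have "2 / (real k + 1) = 1 / (real k + 1) + 1 / (real k + 1)" by simp
    then have "g k x - 1 / (real k + 1) \<ge> d k x - 2 / (real k + 1)" using g(2)[of k x] by linarith
    moreover have "d k x - 2 / (real k + 1) \<le> 1" using d(2)[of k x] by (smt (verit) divide_nonneg_nonneg of_nat_0_le_iff)
    ultimately show ?thesis by (auto simp: h'_def)
  qed
  define h where "h = rec_nat (h' 0) (\<lambda>k f x. max (f x) (h' (Suc k) x))"
  have h_Suc: "h (Suc k) x = max (h k x) (h' (Suc k) x)" for k x by (simp add: h_def)
  have hH: "h k \<in> H" for k
  proof (induction k)
    case (Suc k)
    have "h (Suc k) = (\<lambda>x. max (h k x) (h' (Suc k) x))" by (simp add: h_Suc fun_eq_iff)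
    then show ?case using H_max[OF Suc h'H] by simp
  qed (simp add: h_def h'H)
  have hb: "0 \<le> h k x \<and> h k x \<le> 1 \<and> (x \<notin> V \<longrightarrow> h k x = 0) \<and> h' k x \<le> h k x" for k x
  proof (induction k)
    case 0
    have "h 0 x = h' 0 x" by (simp add: h_def)
    then show ?case using h'0[of x 0] by (auto simp: h'_def)
  next
    case (Suc k)
    have "h' (Suc k) x \<le> 1" by (simp add: h'_def)
    then show ?case using Suc h'0[of x "Suc k"] by (auto simp: h_Suc)
  qed
  have lim: "(\<lambda>k. h k x) \<longlonglongrightarrow> 1" if x: "x \<in> V" for x
  proof (rule tendsto_sandwich[of "\<lambda>k. 1 - 2 * (1 / (real k + 1))"])
    obtain N :: nat where N: "real N > max (1 / q x) (dist x0 x)" using reals_Archimedean2 by blast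
    show "\<forall>\<^sub>F k in sequentially. 1 - 2 * (1 / (real k + 1)) \<le> h k x"
      using eventually_ge_at_top[of N]
    proof eventually_elim
      case (elim k)
      then have k: "real k > 1 / q x" "real k > dist x0 x" using N by auto
      then have "real k * q x \<ge> 1" using qpos[OF x] by (simp add: field_simps)
      then have "d k x = 1" using bump_props(3)[of x0 x "real k"] k by (simp add: d_def)
      then show ?case using h'lo[of k x] hb[of k x] by auto
    qed
    have "(\<lambda>k. 1 - 2 * (1 / (real k + 1))) \<longlonglongrightarrow> 1 - 2 * 0"
      using LIMSEQ_inverse_real_of_nat by (intro tendsto_intros) (simp add: inverse_eq_divide add.commute)
    then show "(\<lambda>k. 1 - 2 * (1 / (real k + 1))) \<longlonglongrightarrow> 1" by simp
  qed (use hb in auto)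
  show thesis
    by (rule that[of h]) (use hH hb lim in \<open>auto simp: adm_def h_Suc\<close>)
qed

text \<open>The part of \<open>g\<close> not covered by the first \<open>k\<close> exhausting
  functions decreases to 0 pointwise, so \<open>L_Dini\<close> makes it negligible; the covered part
  is estimated by the sum.\<close>

lemma \<nu>_countably_subadditive:
  assumes V: "\<And>n::nat. open (V n)"
  shows "\<nu> (\<Union>n. V n) \<le> (\<Sum>n. \<nu> (V n))"
  unfolding \<nu>_def[of "\<Union>n. V n"]
proof (rule SUP_least)
  fix g assume g: "g \<in> adm (\<Union>n. V n)"
  then have gH: "g \<in> H" by (simp add: adm_def)
  have "\<exists>h. (\<forall>k. h k \<in> adm (V n)) \<and> (\<forall>k x. h k x \<le> h (Suc k) x) \<and> (\<forall>x\<in>V n. (\<lambda>k. h k x) \<longlonglongrightarrow> 1)" for n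
    using exhaustion[OF V[of n]] by metis
  then obtain h where h: "\<And>n k. h n k \<in> adm (V n)" "\<And>n k x. h n k x \<le> h n (Suc k) x"
    "\<And>n x. x \<in> V n \<Longrightarrow> (\<lambda>k. h n k x) \<longlonglongrightarrow> 1" by metis
  have hH: "h n k \<in> H" and hb: "0 \<le> h n k x" "h n k x \<le> 1" for n k x using h(1)[of n k] by (auto simp: adm_def)
  define s where "s k x = (\<Sum>n<k. h n k x)" for k x
  have sH: "s k \<in> H" for k unfolding s_def by (rule H_sum[OF hH])
  define r where "r k x = max (g x - s k x - 0) 0" for k x
  have rH: "r k \<in> H" for k unfolding r_def by (intro H_pos H_diff gH sH) auto
  have smono: "s k x \<le> s (Suc k) x" for k x
  proof -
    have "s k x \<le> (\<Sum>n<k. h n (Suc k) x)" unfolding s_def by (intro sum_mono h(2))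
    also have "\<dots> \<le> s (Suc k) x" by (simp add: s_def hb)
    finally show ?thesis .
  qed
  have "(\<lambda>k. L (r k)) \<longlonglongrightarrow> 0"
  proof (rule L_Dini[OF rH])
    show "r (Suc k) x \<le> r k x" for k x using smono[of k x] by (auto simp: r_def)
    show "0 \<le> r k x" for k x by (simp add: r_def)
    show "(\<lambda>k. r k x) \<longlonglongrightarrow> 0" for x
    proof (cases "x \<in> (\<Union>n. V n)")
      case True
      then obtain n where n: "x \<in> V n" by blast
      have "(\<lambda>k. 1 - h n k x) \<longlonglongrightarrow> 1 - 1" by (intro tendsto_intros h(3) n)
      then have l: "(\<lambda>k. 1 - h n k x) \<longlonglongrightarrow> 0" by simp
      show ?thesis
      proof (rule tendsto_sandwich[OF _ _ tendsto_const l])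
        show "\<forall>\<^sub>F k in sequentially. r k x \<le> 1 - h n k x"
          using eventually_gt_at_top[of n]
        proof eventually_elim
          case (elim k)
          have "h n k x \<le> s k x" unfolding s_def
            using elim hb by (intro member_le_sum) auto
          then show ?case using g hb[of n k x] by (auto simp: r_def adm_def intro: order_trans) (smt (verit))
        qed
      qed (simp add: r_def)
    next
      case False
      then have "g x = 0" using g by (auto simp: adm_def)
      moreover have "s k x \<ge> 0" for k unfolding s_def by (intro sum_nonneg hb)
      ultimately have "r k x = 0" for k by (simp add: r_def)
      then show ?thesis by simp
    qed
  qed
  then have lim: "(\<lambda>k. (\<Sum>n. \<nu> (V n)) + ennreal (L (r k))) \<longlonglongrightarrow> (\<Sum>n. \<nu> (V n)) + ennreal 0"
    by (intro tendsto_add tendsto_const tendsto_ennrealI)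
  have "ennreal (L g) \<le> (\<Sum>n. \<nu> (V n)) + ennreal (L (r k))" for k
  proof -
    have "L g \<le> L (\<lambda>x. s k x + r k x)"
      by (intro L_mono gH H_add sH rH) (auto simp: r_def)
    also have "\<dots> = (\<Sum>n<k. L (h n k)) + L (r k)"
      using L_add[OF sH rH] L_sum[OF hH] unfolding s_def by simp
    finally have "ennreal (L g) \<le> ennreal ((\<Sum>n<k. L (h n k)) + L (r k))" by (rule ennreal_leI)
    also have "\<dots> = (\<Sum>n<k. ennreal (L (h n k))) + ennreal (L (r k))"
      using L_nonneg[OF hH hb(1)] L_nonneg[OF rH] by (simp add: ennreal_plus sum_nonneg sum_ennreal r_def)
    also have "\<dots> \<le> (\<Sum>n<k. \<nu> (V n)) + ennreal (L (r k))"
      by (intro add_right_mono sum_mono \<nu>_ge h)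
    also have "\<dots> \<le> (\<Sum>n. \<nu> (V n)) + ennreal (L (r k))"
      by (intro add_right_mono sum_le_suminf) auto
    finally show ?thesis .
  qed
  then show "ennreal (L g) \<le> (\<Sum>n. \<nu> (V n))"
    using LIMSEQ_le_const[OF lim] by simp
qed

definition \<mu>o :: "'a set \<Rightarrow> ennreal" where
  "\<mu>o A = (INF V\<in>{V. open V \<and> A \<subseteq> V}. \<nu> V)"

lemma \<mu>o_open: "open V \<Longrightarrow> \<mu>o V = \<nu> V"
  unfolding \<mu>o_def by (intro antisym INF_greatest INF_lower) (auto intro: \<nu>_mono)

lemma \<mu>o_le: "open V \<Longrightarrow> A \<subseteq> V \<Longrightarrow> \<mu>o A \<le> \<nu> V"
  unfolding \<mu>o_def by (intro INF_lower) auto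

lemma \<mu>o_outer: "outer_measure_space (Pow UNIV) \<mu>o"
  unfolding outer_measure_space_def
proof (intro conjI)
  show "positive (Pow UNIV) \<mu>o" using \<mu>o_open[of "{}"] by (simp add: positive_def \<nu>_empty)
  show "increasing (Pow UNIV) \<mu>o"
    unfolding increasing_def \<mu>o_def by (auto intro!: INF_superset_mono)
  show "countably_subadditive (Pow UNIV) \<mu>o"
    unfolding countably_subadditive_def
  proof (intro allI impI)
    fix A :: "nat \<Rightarrow> 'a set"
    show "\<mu>o (\<Union>i. A i) \<le> (\<Sum>i. \<mu>o (A i))"
    proof (rule ennreal_le_epsilon)
      fix e :: real assume e: "0 < e" and fin: "(\<Sum>n. \<mu>o (A n)) < top"
      then have *: "\<mu>o (A n) < \<mu>o (A n) + e * (1/2)^Suc n" for n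
        by (auto simp add: less_top dest!: ennreal_suminf_lessD)
      have "\<exists>V. open V \<and> A n \<subseteq> V \<and> \<nu> V \<le> \<mu>o (A n) + e * (1/2)^Suc n" for n
        using *[of n] unfolding \<mu>o_def[of "A n"] INF_less_iff by (auto intro: less_imp_le)
      then obtain V where V: "\<And>n. open (V n)" "\<And>n. A n \<subseteq> V n" "\<And>n. \<nu> (V n) \<le> \<mu>o (A n) + e * (1/2)^Suc n"
        by metis
      have "\<mu>o (\<Union>i. A i) \<le> \<nu> (\<Union>i. V i)" by (rule \<mu>o_le) (use V in auto)
      also have "\<dots> \<le> (\<Sum>n. \<nu> (V n))" by (rule \<nu>_countably_subadditive[OF V(1)])
      also have "\<dots> \<le> (\<Sum>n. \<mu>o (A n) + e * (1/2) ^ Suc n)"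
        by (intro suminf_le allI V) auto
      also have "\<dots> = (\<Sum>n. \<mu>o (A n)) + (\<Sum>n. ennreal e * ennreal ((1/2) ^ Suc n))"
        using e by (subst suminf_add[symmetric]) (auto simp del: ennreal_suminf_cmult simp add: ennreal_mult[symmetric])
      also have "\<dots> = (\<Sum>n. \<mu>o (A n)) + e"
        unfolding ennreal_suminf_cmult
        by (subst suminf_ennreal_eq[OF zero_le_power power_half_series]) auto
      finally show "\<mu>o (\<Union>i. A i) \<le> (\<Sum>n. \<mu>o (A n)) + e" .
    qed
  qed
qed

text \<open>For \<open>g\<close> admissible in \<open>W \<inter> V\<close>, its truncation at height
  \<open>\<eta>\<close> lives on the closed set \<open>{x. g x \<ge> \<eta>}\<close> inside
  \<open>V\<close>. It can be added to any function admissible in the rest of \<open>W\<close>,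
  which is an open set containing \<open>W - V\<close>.\<close>

lemma open_Caratheodory:
  assumes V: "open V"
  shows "\<mu>o (A \<inter> V) + \<mu>o (A - V) \<le> \<mu>o A"
proof -
  have main: "\<mu>o (A \<inter> V) + \<mu>o (A - V) \<le> \<nu> W" if W: "open W" "A \<subseteq> W" for W
  proof -
    have step: "ennreal (L g) + \<mu>o (W - V) \<le> \<nu> W" if g: "g \<in> adm (W \<inter> V)" for g
    proof (rule ennreal_le_epsilon)
      fix e :: real assume e: "e > 0"
      have gH: "g \<in> H" using g by (simp add: adm_def)
      obtain w where w: "w \<in> H" "\<And>x. w x \<ge> 0" "\<And>x. x \<in> {x. g x \<noteq> 0} \<Longrightarrow> w x \<ge> 1"
        using dominating[OF H_bounded_support[OF gH]] by blast
      define \<eta> where "\<eta> = e / (L w + 1)"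
      have Lw: "L w \<ge> 0" using L_nonneg w by blast
      then have eta: "\<eta> > 0" using e by (simp add: \<eta>_def)
      define g' where "g' x = max (g x - \<eta>) 0" for x
      have g'H: "g' \<in> H" unfolding g'_def using eta by (intro H_pos gH) auto
      have "L g \<le> L (\<lambda>x. g' x + \<eta> * w x)"
      proof (intro L_mono gH H_add H_scale g'H w)
        fix x show "g x \<le> g' x + \<eta> * w x"
        proof (cases "g x = 0")
          case True
          then show ?thesis using w(2)[of x] eta by (simp add: g'_def)
        next
          case False
          then have "\<eta> \<le> \<eta> * w x" using w(3)[of x] eta by simp
          then show ?thesis by (simp add: g'_def)
        qed
      qed
      also have "\<dots> = L g' + \<eta> * L w" using L_add[OF g'H H_scale[OF w(1)]] L_scale[OF w(1)] by simp
      also have "\<dots> \<le> L g' + e" using e Lw by (simp add: \<eta>_def field_simps)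
      finally have Lg: "ennreal (L g) \<le> ennreal (L g') + ennreal e"
        using L_nonneg[OF g'H] e by (simp add: g'_def ennreal_plus[symmetric] del: ennreal_plus)
      define K where "K = {x. g x \<ge> \<eta>}"
      have "closed K" unfolding K_def
        using closed_Collect_le[OF continuous_on_const H_continuous[OF gH]] by simp
      then have opW: "open (W - K)" using W(1) by (simp add: open_Diff)
      have "W - V \<subseteq> W - K"
        using g eta by (auto simp: K_def adm_def)
      then have "\<mu>o (W - V) \<le> \<nu> (W - K)" by (rule \<mu>o_le[OF opW])
      moreover have "ennreal (L g') + \<nu> (W - K) \<le> \<nu> W"
      proof -
        have "ennreal (L g') + \<nu> (W - K) = (SUP h\<in>adm (W - K). ennreal (L g') + ennreal (L h))"
          unfolding \<nu>_def using adm_zero by (intro ennreal_SUP_add_right) auto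
        also have "\<dots> \<le> \<nu> W"
        proof (rule SUP_least)
          fix h assume h: "h \<in> adm (W - K)"
          have hH: "h \<in> H" using h by (simp add: adm_def)
          have "(\<lambda>x. g' x + h x) \<in> adm W"
          proof -
            have "0 \<le> g' x + h x \<and> g' x + h x \<le> 1 \<and> (x \<notin> W \<longrightarrow> g' x + h x = 0)" for x
            proof (cases "x \<in> K")
              case True
              then have "h x = 0" using h by (auto simp: adm_def)
              moreover have "0 \<le> g x" "g x \<le> 1" "x \<notin> W \<Longrightarrow> g x = 0" using g by (auto simp: adm_def)
              ultimately show ?thesis using eta by (auto simp: g'_def)
            next
              case False
              then have "g' x = 0" by (auto simp: g'_def K_def)
              moreover have "0 \<le> h x" "h x \<le> 1" "x \<notin> W \<Longrightarrow> h x = 0" using h by (auto simp: adm_def)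
              ultimately show ?thesis by auto
            qed
            then show ?thesis using H_add[OF g'H hH] by (simp add: adm_def)
          qed
          from \<nu>_ge[OF this] show "ennreal (L g') + ennreal (L h) \<le> \<nu> W"
            using L_add[OF g'H hH] L_nonneg[OF g'H] L_nonneg[OF hH] h by (simp add: g'_def adm_def ennreal_plus)
        qed
        finally show ?thesis .
      qed
      ultimately have "ennreal (L g') + \<mu>o (W - V) \<le> \<nu> W"
        using add_left_mono order_trans by blast
      then have "ennreal (L g') + \<mu>o (W - V) + ennreal e \<le> \<nu> W + ennreal e" by (rule add_right_mono)
      moreover have "ennreal (L g) + \<mu>o (W - V) \<le> ennreal (L g') + ennreal e + \<mu>o (W - V)"
        using Lg by (rule add_right_mono)
      moreover have "ennreal (L g') + ennreal e + \<mu>o (W - V) = ennreal (L g') + \<mu>o (W - V) + ennreal e"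
        by (simp only: ac_simps)
      ultimately show "ennreal (L g) + \<mu>o (W - V) \<le> \<nu> W + ennreal e"
        by (metis order_trans)
    qed
    have "\<mu>o (A \<inter> V) + \<mu>o (A - V) \<le> \<nu> (W \<inter> V) + \<mu>o (W - V)"
    proof (rule add_mono)
      show "\<mu>o (A \<inter> V) \<le> \<nu> (W \<inter> V)" using W V by (intro \<mu>o_le) auto
      show "\<mu>o (A - V) \<le> \<mu>o (W - V)"
      proof -
        have "A - V \<subseteq> W - V" using W(2) by blast
        then show ?thesis using \<mu>o_outer unfolding outer_measure_space_def increasing_def by blast
      qed
    qed
    also have "\<dots> = (SUP g\<in>adm (W \<inter> V). ennreal (L g) + \<mu>o (W - V))"
      unfolding \<nu>_def using adm_zero by (intro ennreal_SUP_add_left[symmetric]) auto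
    also have "\<dots> \<le> \<nu> W" using step by (rule SUP_least)
    finally show ?thesis .
  qed
  then show ?thesis unfolding \<mu>o_def[of A] by (intro INF_greatest) auto
qed

definition \<mu> :: "'a measure" where
  "\<mu> = measure_of UNIV (sets borel) \<mu>o"

lemma measure_space_\<mu>o: "measure_space UNIV (sets borel) \<mu>o"
proof -
  interpret P: sigma_algebra "UNIV :: 'a set" "Pow UNIV" by (rule sigma_algebra_Pow)
  let ?S = "lambda_system UNIV (Pow UNIV) \<mu>o"
  have ms: "measure_space UNIV ?S \<mu>o" by (rule P.caratheodory_lemma[OF \<mu>o_outer])
  then interpret S: sigma_algebra UNIV ?S by (simp add: measure_space_def)
  have "V \<in> ?S" if "open V" for V
  proof -
    have sub: "\<mu>o X \<le> \<mu>o (X \<inter> V) + \<mu>o (X - V)" for X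
    proof -
      have "subadditive (Pow UNIV) \<mu>o"
        using \<mu>o_outer P.countably_subadditive_subadditive unfolding outer_measure_space_def by blast
      from subadditiveD[OF this, of "X \<inter> V" "X - V"] show ?thesis
        by (auto simp: Int_Diff_Un)
    qed
    show ?thesis
      unfolding P.lambda_system_eq using open_Caratheodory[OF that] sub by (auto intro: antisym)
  qed
  then have "sigma_sets UNIV {S. open S} \<subseteq> ?S" by (intro S.sigma_sets_subset) auto
  then have sub: "sets borel \<subseteq> ?S" by (simp add: borel_def)
  show ?thesis
    unfolding measure_space_def
  proof (intro conjI)
    show "sigma_algebra UNIV (sets (borel :: 'a measure))"
      using sets.sigma_algebra_axioms[of "borel :: 'a measure"] by simp
    show "positive (sets borel) \<mu>o" using \<mu>o_outer by (simp add: outer_measure_space_def positive_def)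
    show "countably_additive (sets borel) \<mu>o"
      using ms sub unfolding measure_space_def countably_additive_def by (meson subset_trans subsetD)
  qed
qed

lemma sets_\<mu> [measurable_cong]: "sets \<mu> = sets borel"
  using sets.sigma_sets_eq[of "borel :: 'a measure"] by (simp add: \<mu>_def)

lemma emeasure_\<mu>: "A \<in> sets borel \<Longrightarrow> emeasure \<mu> A = \<mu>o A"
  unfolding \<mu>_def
  using measure_space_\<mu>o sets.sigma_sets_eq[of "borel :: 'a measure"] 
  by (intro emeasure_measure_of_sigma) (auto simp: measure_space_def)

lemma emeasure_\<mu>_open: "open V \<Longrightarrow> emeasure \<mu> V = \<nu> V"
  by (simp add: emeasure_\<mu> \<mu>o_open)

lemma \<nu>_finite: assumes "w \<in> H" "\<And>x. x \<in> V \<Longrightarrow> w x \<ge> 1" "\<And>x. w x \<ge> 0" shows "\<nu> V \<le> ennreal (L w)"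
  unfolding \<nu>_def
proof (rule SUP_least)
  fix g assume g: "g \<in> adm V"
  have "g x \<le> w x" for x
  proof (cases "x \<in> V")
    case True
    have "g x \<le> 1" using g by (auto simp: adm_def)
    then show ?thesis using assms(2)[OF True] by simp
  next
    case False
    then have "g x = 0" using g by (auto simp: adm_def)
    then show ?thesis using assms(3) by simp
  qed
  then show "ennreal (L g) \<le> ennreal (L w)"
    using g assms by (intro ennreal_leI L_mono) (auto simp: adm_def)
qed

text \<open>Slice \<open>g\<close> horizontally into pieces \<open>pc k\<close> of height
  \<open>1 / n\<close>. Both \<open>L\<close> and the integral of slice \<open>k\<close> lie between
  \<open>1 / n\<close> times the measures of \<open>V (Suc k)\<close> and \<open>V k\<close>, so the
  two sums differ by at most the first term, \<open>1 / n\<close> times the measure of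
  \<open>V 0\<close>.\<close>

lemma integral_eq_nonneg:
  assumes g: "g \<in> H" "\<And>x. g x \<ge> 0"
  shows "(\<integral>\<^sup>+x. ennreal (g x) \<partial>\<mu>) = ennreal (L g)"
proof -
  have gm: "g \<in> borel_measurable \<mu>" using H_borel[OF g(1)] by (simp add: measurable_cong_sets[OF sets_\<mu> refl])
  obtain w where w: "w \<in> H" "\<And>x. w x \<ge> 0" "\<And>x. x \<in> {x. g x \<noteq> 0} \<Longrightarrow> w x \<ge> 1"
    using dominating[OF H_bounded_support[OF g(1)]] by blast
  obtain B where B: "\<And>x. g x \<le> B"
  proof -
    have "compact (g ` closure {x. g x \<noteq> 0})"
      using H_C_c[OF g(1)] by (intro compact_continuous_image) (auto simp: C_c_def intro: continuous_on_subset)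
    then obtain B where B: "\<And>y. y \<in> g ` closure {x. g x \<noteq> 0} \<Longrightarrow> norm y \<le> B"
      using compact_imp_bounded bounded_iff by metis
    have "g x \<le> max B 0" for x
      using B[of "g x"] closure_subset[of "{x. g x \<noteq> 0}"] by (cases "g x = 0") (auto simp: abs_le_iff le_max_iff_disj)
    then show thesis by (rule that)
  qed
  have approx: "(\<integral>\<^sup>+x. ennreal (g x) \<partial>\<mu>) \<le> ennreal (L g) + ennreal (1 / real n) * ennreal (L w) \<and>
      ennreal (L g) \<le> (\<integral>\<^sup>+x. ennreal (g x) \<partial>\<mu>) + ennreal (1 / real n) * ennreal (L w)" if n: "n > 0" for n :: nat
  proof -
    define pc where "pc k x = min (g x) (real (Suc k) / real n) - min (g x) (real k / real n)" for k x
    have pcH: "pc k \<in> H" for k unfolding pc_def by (intro H_diff H_min_const g) auto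
    have pc0: "pc k x \<ge> 0" and pc1: "pc k x \<le> 1 / real n" for k x
      using n by (auto simp: pc_def field_simps min_def)
    have pcm: "pc k \<in> borel_measurable \<mu>" for k using H_borel[OF pcH] by (simp add: measurable_cong_sets[OF sets_\<mu> refl])
    define V where "V k = {x. g x > real k / real n}" for k
    have Vo: "open (V k)" for k unfolding V_def
      using open_Collect_less[OF continuous_on_const H_continuous[OF g(1)]] by simp
    have pcV: "pc k x = 0" if "x \<notin> V k" for k x
      using that n by (auto simp: pc_def V_def min_def field_simps)
    have pcV': "pc k x = 1 / real n" if "x \<in> V (Suc k)" for k x
    proof -
      have "real k / real n \<le> real (Suc k) / real n" using n by (simp add: field_simps)
      then show ?thesis using that by (auto simp: pc_def V_def min_def diff_divide_distrib[symmetric])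
    qed
    obtain K :: nat where K: "real K > B * real n" using reals_Archimedean2 by blast
    have gsum: "g x = (\<Sum>k<Suc K. pc k x)" for x
    proof -
      have "(\<Sum>k<Suc K. pc k x) = min (g x) (real (Suc K) / real n) - min (g x) (real 0 / real n)"
        unfolding pc_def by (rule sum_lessThan_telescope)
      also have "min (g x) (real (Suc K) / real n) = g x"
      proof -
        have "g x * real n \<le> B * real n" using B[of x] by (intro mult_right_mono) auto
        also have "\<dots> \<le> real (Suc K)" using K by simp
        finally show ?thesis using n by (simp add: min_def field_simps)
      qed
      also have "min (g x) (real 0 / real n) = 0" using g(2)[of x] by simp
      finally show ?thesis by simp
    qed
    have Lsum: "L g = (\<Sum>k<Suc K. L (pc k))"
    proof -
      have "L g = L (\<lambda>x. \<Sum>k<Suc K. pc k x)" using gsum by (intro arg_cong[of _ _ L]) auto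
      also have "\<dots> = (\<Sum>k<Suc K. L (pc k))" by (rule L_sum[OF pcH])
      finally show ?thesis .
    qed
    have Isum: "(\<integral>\<^sup>+x. ennreal (g x) \<partial>\<mu>) = (\<Sum>k<Suc K. \<integral>\<^sup>+x. ennreal (pc k x) \<partial>\<mu>)"
    proof -
      have "(\<integral>\<^sup>+x. ennreal (g x) \<partial>\<mu>) = (\<integral>\<^sup>+x. (\<Sum>k<Suc K. ennreal (pc k x)) \<partial>\<mu>)"
        using pc0 by (intro nn_integral_cong) (simp only: gsum sum_ennreal)
      also have "\<dots> = (\<Sum>k<Suc K. \<integral>\<^sup>+x. ennreal (pc k x) \<partial>\<mu>)"
        by (rule nn_integral_sum) (use pcm in auto)
      finally show ?thesis .
    qed
    have c1: "ennreal (L (pc k)) \<le> ennreal (1 / real n) * \<nu> (V k)" for k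
    proof -
      have "(\<lambda>x. real n * pc k x) \<in> adm (V k)"
        using pc0[of k] pc1[of k] pcV[of _ k] H_scale[OF pcH] n by (auto simp: adm_def field_simps)
      from \<nu>_ge[OF this] have "ennreal (1 / real n) * ennreal (real n * L (pc k)) \<le> ennreal (1 / real n) * \<nu> (V k)"
        unfolding L_scale[OF pcH] by (rule mult_left_mono) simp
      then show ?thesis using n by (simp add: ennreal_mult[symmetric] L_nonneg[OF pcH pc0])
    qed
    have c2: "ennreal (1 / real n) * \<nu> (V (Suc k)) \<le> ennreal (L (pc k))" for k
    proof -
      have "\<nu> (V (Suc k)) \<le> ennreal (L (\<lambda>x. real n * pc k x))"
        by (rule \<nu>_finite[OF H_scale[OF pcH]]) (use pcV' pc0 n in auto)
      then have "ennreal (1 / real n) * \<nu> (V (Suc k)) \<le> ennreal (1 / real n) * ennreal (real n * L (pc k))"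
        unfolding L_scale[OF pcH] by (rule mult_left_mono) simp
      then show ?thesis using n by (simp add: ennreal_mult[symmetric] L_nonneg[OF pcH pc0])
    qed
    have c3: "(\<integral>\<^sup>+x. ennreal (pc k x) \<partial>\<mu>) \<le> ennreal (1 / real n) * \<nu> (V k)" for k
    proof -
      have "(\<integral>\<^sup>+x. ennreal (pc k x) \<partial>\<mu>) \<le> (\<integral>\<^sup>+x. ennreal (1 / real n) * indicator (V k) x \<partial>\<mu>)"
        using pc1 pcV by (intro nn_integral_mono) (auto simp: indicator_def intro!: ennreal_leI)
      also have "\<dots> = ennreal (1 / real n) * \<nu> (V k)"
        using Vo by (subst nn_integral_cmult_indicator) (auto simp: sets_\<mu> emeasure_\<mu>_open)
      finally show ?thesis .
    qed
    have c4: "ennreal (1 / real n) * \<nu> (V (Suc k)) \<le> (\<integral>\<^sup>+x. ennreal (pc k x) \<partial>\<mu>)" for k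
    proof -
      have "ennreal (1 / real n) * \<nu> (V (Suc k)) = (\<integral>\<^sup>+x. ennreal (1 / real n) * indicator (V (Suc k)) x \<partial>\<mu>)"
        using Vo by (subst nn_integral_cmult_indicator) (auto simp: sets_\<mu> emeasure_\<mu>_open)
      also have "\<dots> \<le> (\<integral>\<^sup>+x. ennreal (pc k x) \<partial>\<mu>)"
        using pcV' by (intro nn_integral_mono) (auto simp: indicator_def)
      finally show ?thesis .
    qed
    have v0: "\<nu> (V 0) \<le> ennreal (L w)"
      by (rule \<nu>_finite[OF w(1) _ w(2)]) (use w(3) in \<open>auto simp: V_def\<close>)
    \<comment> \<open>Shifting the index by one pairs the upper bound of a slice with the lower
      bound of the slice beneath it.\<close>
    have compare: "(\<Sum>k<Suc K. a k) \<le> (\<Sum>k<Suc K. b k) + ennreal (1 / real n) * ennreal (L w)"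
      if "\<And>k. a k \<le> ennreal (1 / real n) * \<nu> (V k)" "\<And>k. ennreal (1 / real n) * \<nu> (V (Suc k)) \<le> b k"
      for a b :: "nat \<Rightarrow> ennreal"
    proof -
      have "(\<Sum>k<Suc K. a k) \<le> (\<Sum>k<Suc K. ennreal (1 / real n) * \<nu> (V k))" by (intro sum_mono that)
      also have "\<dots> = ennreal (1 / real n) * \<nu> (V 0) + (\<Sum>k<K. ennreal (1 / real n) * \<nu> (V (Suc k)))"
        by (rule sum.lessThan_Suc_shift)
      also have "\<dots> \<le> ennreal (1 / real n) * ennreal (L w) + (\<Sum>k<K. b k)"
        by (intro add_mono mult_left_mono v0 sum_mono that) auto
      also have "\<dots> \<le> ennreal (1 / real n) * ennreal (L w) + (\<Sum>k<Suc K. b k)"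
        by (intro add_left_mono) simp
      finally show ?thesis by (simp add: add.commute)
    qed
    have Le: "ennreal (L g) = (\<Sum>k<Suc K. ennreal (L (pc k)))"
      unfolding Lsum using L_nonneg[OF pcH pc0] by (intro sum_ennreal[symmetric]) auto
    show ?thesis
      unfolding Le Isum using compare[OF c3 c2] compare[OF c1 c4] by blast
  qed
  have lim: "(\<lambda>n. c + ennreal (1 / real n) * ennreal (L w)) \<longlonglongrightarrow> c" for c
  proof -
    have "(\<lambda>n. 1 / real n * L w) \<longlonglongrightarrow> 0 * L w" by (intro tendsto_intros lim_1_over_n)
    then have "(\<lambda>n. c + ennreal (1 / real n * L w)) \<longlonglongrightarrow> c + ennreal (0 * L w)"
      by (intro tendsto_add tendsto_const tendsto_ennrealI)
    moreover have "ennreal (1 / real n * L w) = ennreal (1 / real n) * ennreal (L w)" for n :: nat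
      using L_nonneg[OF w(1,2)] by (intro ennreal_mult) auto
    ultimately show ?thesis by simp
  qed
  show ?thesis
  proof (rule antisym)
    show "(\<integral>\<^sup>+x. ennreal (g x) \<partial>\<mu>) \<le> ennreal (L g)"
      by (rule LIMSEQ_le_const[OF lim]) (use approx in \<open>auto intro!: exI[of _ 1]\<close>)
    show "ennreal (L g) \<le> (\<integral>\<^sup>+x. ennreal (g x) \<partial>\<mu>)"
      by (rule LIMSEQ_le_const[OF lim]) (use approx in \<open>auto intro!: exI[of _ 1]\<close>)
  qed
qed

lemma representation_\<mu>:
  assumes g: "g \<in> H"
  shows "integrable \<mu> g" "(\<integral>x. g x \<partial>\<mu>) = L g"
proof -
  have nn: "integrable \<mu> h \<and> (\<integral>x. h x \<partial>\<mu>) = L h" if h: "h \<in> H" "\<And>x. h x \<ge> 0" for h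
  proof -
    have hm: "h \<in> borel_measurable \<mu>" using H_borel[OF h(1)] by (simp add: measurable_cong_sets[OF sets_\<mu> refl])
    have i: "integrable \<mu> h"
      using hm h integral_eq_nonneg[OF h] by (intro integrableI_nonneg) auto
    moreover have "ennreal (\<integral>x. h x \<partial>\<mu>) = ennreal (L h)"
      using integral_eq_nonneg[OF h] nn_integral_eq_integral[OF i] h by simp
    ultimately show ?thesis using h L_nonneg[OF h] by simp
  qed
  define p where "p x = max (g x - 0) 0" for x
  define q where "q x = max (-1 * g x - 0) 0" for x
  have pq: "p \<in> H" "q \<in> H" unfolding p_def q_def by (intro H_pos H_scale g; simp)+
  have geq: "g = (\<lambda>x. p x - q x)" by (auto simp: p_def q_def fun_eq_iff)
  have P: "integrable \<mu> p \<and> (\<integral>x. p x \<partial>\<mu>) = L p" and Q: "integrable \<mu> q \<and> (\<integral>x. q x \<partial>\<mu>) = L q"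
    by (intro nn pq; simp add: p_def q_def)+
  have "integrable \<mu> (\<lambda>x. p x - q x)" "(\<integral>x. p x - q x \<partial>\<mu>) = L (\<lambda>x. p x - q x)"
    using P Q L_diff[OF pq] by auto
  then show "integrable \<mu> g" "(\<integral>x. g x \<partial>\<mu>) = L g" using geq by simp_all
qed

text \<open>Exhausting functions determine the measure of every open set by monotone convergence;
  open sets generate, and dominating functions make balls finite.\<close>

lemma representation_unique:
  assumes sM: "sets M = sets borel" and sN: "sets N = sets borel"
    and M: "\<And>g. g \<in> H \<Longrightarrow> integrable M g \<and> (\<integral>x. g x \<partial>M) = L g"
    and N: "\<And>g. g \<in> H \<Longrightarrow> integrable N g \<and> (\<integral>x. g x \<partial>N) = L g"
  shows "M = N"
proof -
  have em: "emeasure M V = (SUP k. ennreal (L (h k)))"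
    if sM: "sets M = sets borel" and M: "\<And>g. g \<in> H \<Longrightarrow> integrable M g \<and> (\<integral>x. g x \<partial>M) = L g"
      and V: "open V" and h: "\<And>k::nat. h k \<in> adm V" "\<And>k x. h k x \<le> h (Suc k) x" "\<And>x. x \<in> V \<Longrightarrow> (\<lambda>k. h k x) \<longlonglongrightarrow> 1"
    for M V h
  proof -
    have inc: "incseq (\<lambda>k. ennreal (h k x))" for x
      by (intro incseq_SucI ennreal_leI h)
    have hH: "h k \<in> H" "\<And>x. 0 \<le> h k x" "\<And>x. x \<notin> V \<Longrightarrow> h k x = 0" for k using h(1)[of k] by (auto simp: adm_def)
    have "emeasure M V = (\<integral>\<^sup>+x. indicator V x \<partial>M)" using V sM by simp
    also have "\<dots> = (\<integral>\<^sup>+x. (SUP k. ennreal (h k x)) \<partial>M)"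
    proof (rule nn_integral_cong)
      fix x
      show "indicator V x = (SUP k. ennreal (h k x))"
      proof (cases "x \<in> V")
        case True
        have "(\<lambda>k. ennreal (h k x)) \<longlonglongrightarrow> ennreal 1" by (intro tendsto_ennrealI h True)
        from LIMSEQ_unique[OF LIMSEQ_SUP[OF inc] this] show ?thesis using True by simp
      qed (use hH in simp)
    qed
    also have "\<dots> = (SUP k. \<integral>\<^sup>+x. ennreal (h k x) \<partial>M)"
      using H_borel[OF hH(1)] sM
      by (intro nn_integral_monotone_convergence_SUP)
        (auto simp: incseq_def le_fun_def measurable_cong_sets[OF sM refl] intro!: incseqD[OF inc])
    also have "\<dots> = (SUP k. ennreal (L (h k)))"
      using M[OF hH(1)] hH(2) by (intro SUP_cong refl) (simp add: nn_integral_eq_integral)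
    finally show ?thesis .
  qed
  have eq: "emeasure M V = emeasure N V" if V: "open V" for V
  proof -
    obtain h where h: "\<And>k::nat. h k \<in> adm V" "\<And>k x. h k x \<le> h (Suc k) x" "\<And>x. x \<in> V \<Longrightarrow> (\<lambda>k. h k x) \<longlonglongrightarrow> 1"
      using exhaustion[OF V] by metis
    show ?thesis using em[OF sM M V h] em[OF sN N V h] by simp
  qed
  fix x0 :: 'a
  show ?thesis
  proof (rule measure_eqI_generator_eq[where A = "\<lambda>n::nat. ball x0 (real n)"])
    show "Int_stable {S :: 'a set. open S}" by (auto simp: Int_stable_def)
    show "{S :: 'a set. open S} \<subseteq> Pow UNIV" by simp
    show "sets M = sigma_sets UNIV {S. open S}" "sets N = sigma_sets UNIV {S. open S}"
      using sM sN by (simp_all add: borel_def)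
    show "(\<Union>n::nat. ball x0 (real n)) = UNIV" using reals_Archimedean2 by auto
    show "emeasure M (ball x0 (real n)) \<noteq> \<infinity>" for n :: nat
    proof -
      obtain w where w: "w \<in> H" "\<And>x. w x \<ge> 0" "\<And>x. x \<in> ball x0 (real n) \<Longrightarrow> w x \<ge> 1"
        using dominating[OF bounded_ball] by blast
      have "emeasure M (ball x0 (real n)) = (\<integral>\<^sup>+x. indicator (ball x0 (real n)) x \<partial>M)" using sM by simp
      also have "\<dots> \<le> (\<integral>\<^sup>+x. ennreal (w x) \<partial>M)"
        using w by (intro nn_integral_mono) (auto simp: indicator_def)
      also have "\<dots> = ennreal (L w)" using M[OF w(1)] w by (simp add: nn_integral_eq_integral)
      finally show ?thesis by (auto simp: top_unique)
    qed
  qed (use eq in auto)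
qed

end

lemma C_c_bounded:
  assumes "f \<in> C_c" obtains B where "B \<ge> 0" "\<And>x. \<bar>f x\<bar> \<le> B"
proof -
  have "compact (f ` closure {x. f x \<noteq> 0})"
    using assms by (intro compact_continuous_image) (auto simp: C_c_def intro: continuous_on_subset)
  then obtain B where B: "\<And>y. y \<in> f ` closure {x. f x \<noteq> 0} \<Longrightarrow> norm y \<le> B"
    using compact_imp_bounded bounded_iff by metis
  have "\<bar>f x\<bar> \<le> max B 0" for x
    using B[of "f x"] closure_subset[of "{x. f x \<noteq> 0}"] by (cases "f x = 0") (auto simp: le_max_iff_disj)
  then show thesis using that[of "max B 0"] by simp
qed

lemma C_c_combine:
  assumes f: "f \<in> C_c" and g: "g \<in> C_c" and h: "continuous_on UNIV h" "\<And>x. f x = 0 \<Longrightarrow> g x = 0 \<Longrightarrow> h x = 0"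
  shows "h \<in> C_c"
proof -
  have "closure {x. h x \<noteq> 0} \<subseteq> closure {x. f x \<noteq> 0} \<union> closure {x. g x \<noteq> 0}"
    unfolding closure_Un[symmetric] by (intro closure_mono) (use h(2) in auto)
  moreover have "compact (closure {x. f x \<noteq> 0} \<union> closure {x. g x \<noteq> 0})"
    using f g by (auto simp: C_c_def)
  ultimately have "compact (closure {x. h x \<noteq> 0})"
    by (metis closed_closure compact_Int_closed inf.absorb2)
  then show ?thesis using h(1) by (simp add: C_c_def)
qed

lemma C_c_cont: "f \<in> C_c \<Longrightarrow> continuous_on UNIV f" by (simp add: C_c_def)

lemma C_c_add: "f \<in> C_c \<Longrightarrow> g \<in> C_c \<Longrightarrow> (\<lambda>x. f x + g x) \<in> C_c"
  by (rule C_c_combine[of f g]) (auto intro!: continuous_intros dest: C_c_cont)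

lemma C_c_scale: "f \<in> C_c \<Longrightarrow> (\<lambda>x. a * f x) \<in> C_c"
  by (rule C_c_combine[of f f]) (auto intro!: continuous_intros dest: C_c_cont)

lemma C_c_max: "f \<in> C_c \<Longrightarrow> g \<in> C_c \<Longrightarrow> (\<lambda>x. max (f x) (g x)) \<in> C_c"
  by (rule C_c_combine[of f g]) (auto intro!: continuous_intros dest: C_c_cont)

lemma C_c_min: "f \<in> C_c \<Longrightarrow> g \<in> C_c \<Longrightarrow> (\<lambda>x. min (f x) (g x)) \<in> C_c"
  by (rule C_c_combine[of f g]) (auto intro!: continuous_intros dest: C_c_cont)

lemma C_c_pos_part: "f \<in> C_c \<Longrightarrow> c \<ge> 0 \<Longrightarrow> (\<lambda>x. max (f x - c) 0) \<in> C_c"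
  by (rule C_c_combine[of f f]) (auto intro!: continuous_intros dest: C_c_cont)

lemma C_c_min_const: "f \<in> C_c \<Longrightarrow> c \<ge> 0 \<Longrightarrow> (\<lambda>x. min (f x) c) \<in> C_c"
  by (rule C_c_combine[of f f]) (auto intro!: continuous_intros dest: C_c_cont)

section \<open>Existence of energy measures and reduction to test functions\<close>

context heat_space
begin

lemma C_c_bdd: "f \<in> C_c \<Longrightarrow> bdd f"
  using C_c_bounded bddI by metis

lemma C_c_bsupp: "f \<in> C_c \<Longrightarrow> bsupp f"
  unfolding C_c_def bsupp_def using compact_imp_bounded bounded_subset closure_subset by blast

lemma F_C_c_riesz:
  assumes f: "f \<in> F" "bdd f"
  shows "riesz_lattice (F \<inter> C_c) (Lf f)"
proof
  show "\<exists>k\<in>F \<inter> C_c. \<forall>x. \<bar>g x - k x\<bar> < \<epsilon>" if "g \<in> C_c" "\<epsilon> > 0" for g \<epsilon>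
    using regular_dense_C_c that by blast
qed (use relatively_compact_ball in \<open>auto intro: F_add F_scale F_max F_pos_part C_c_add C_c_scale C_c_max C_c_pos_part
      C_c_bdd Lf_add[OF f] Lf_scale[OF f] Lf_nonneg[OF f]\<close>)

text \<open>Representation and uniqueness over \<open>F \<inter> C_c\<close> turn the definite
  description into an actual measure.\<close>

lemma energy_measure_bounded_spec:
  assumes f: "f \<in> F" "bdd f"
  shows "sets (energy_measure_bounded E F f) = sets borel"
    and "\<And>g. g \<in> F \<inter> C_c \<Longrightarrow> integrable (energy_measure_bounded E F f) g"
    and "\<And>g. g \<in> F \<inter> C_c \<Longrightarrow> (\<integral>x. g x \<partial>energy_measure_bounded E F f) = Lf f g"
proof -
  interpret R: riesz_lattice "F \<inter> C_c" "Lf f" by (rule F_C_c_riesz[OF f])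
  let ?Q = "\<lambda>\<Gamma>. sets \<Gamma> = sets borel \<and> (\<forall>g\<in>F \<inter> C_c. integrable \<Gamma> g \<and>
    (\<integral>x. g x \<partial>\<Gamma>) = E f (\<lambda>x. f x * g x) - 1/2 * E (\<lambda>x. (f x)\<^sup>2) g)"
  have "\<exists>!\<Gamma>. ?Q \<Gamma>"
  proof (rule ex1I)
    show "?Q R.\<mu>" using R.sets_\<mu> R.representation_\<mu> by (auto simp: Lf_def)
    fix \<Gamma> assume "?Q \<Gamma>"
    then show "\<Gamma> = R.\<mu>"
      by (intro R.representation_unique) (use R.sets_\<mu> R.representation_\<mu> in \<open>auto simp: Lf_def\<close>)
  qed
  from theI'[OF this] have "?Q (energy_measure_bounded E F f)"
    unfolding energy_measure_bounded_def .
  then show "sets (energy_measure_bounded E F f) = sets borel"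
    and "\<And>g. g \<in> F \<inter> C_c \<Longrightarrow> integrable (energy_measure_bounded E F f) g"
    and "\<And>g. g \<in> F \<inter> C_c \<Longrightarrow> (\<integral>x. g x \<partial>energy_measure_bounded E F f) = Lf f g"
    by (auto simp: Lf_def)
qed

lemma energy_measure_compact_le:
  assumes f: "f \<in> F" "bdd f" and K: "compact K" and g: "g \<in> F \<inter> C_c" "\<And>x. g x \<ge> 0" "\<And>x. x \<in> K \<Longrightarrow> g x \<ge> 1"
  shows "emeasure (energy_measure_bounded E F f) K \<le> ennreal (Lf f g)"
proof -
  let ?\<Gamma> = "energy_measure_bounded E F f"
  note G = energy_measure_bounded_spec[OF f]
  have "emeasure ?\<Gamma> K = (\<integral>\<^sup>+x. indicator K x \<partial>?\<Gamma>)"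
    using K by (simp add: G(1) borel_compact)
  also have "\<dots> \<le> (\<integral>\<^sup>+x. ennreal (g x) \<partial>?\<Gamma>)"
    using g by (intro nn_integral_mono) (auto simp: indicator_def)
  also have "\<dots> = ennreal (Lf f g)" using G(2,3)[OF g(1)] g(2) by (simp add: nn_integral_eq_integral)
  finally show ?thesis .
qed

text \<open>Essential boundedness in \<open>energy_measure\<close> meets pointwise boundedness in
  \<open>bdd\<close>: an essentially bounded \<open>f\<close> is exchanged for a truncation, which
  has the same defining equations.\<close>

lemma energy_measure_bounded_cong:
  assumes f: "f \<in> F" and h: "h \<in> F" "bdd h" and ae: "AE x in m. f x = h x"
  shows "energy_measure_bounded E F f = energy_measure_bounded E F h"
proof -
  have "E f (\<lambda>x. f x * g x) - 1/2 * E (\<lambda>x. (f x)\<^sup>2) g = E h (\<lambda>x. h x * g x) - 1/2 * E (\<lambda>x. (h x)\<^sup>2) g"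
    if g: "g \<in> F \<inter> C_c" for g
  proof -
    have hg: "(\<lambda>x. h x * g x) \<in> F" using F_mult[OF h] g C_c_bdd by auto
    have hh: "(\<lambda>x. (h x)\<^sup>2) \<in> F" using F_sq[OF h] .
    have meas: "f \<in> borel_measurable m" "g \<in> borel_measurable m" using f g F_measurable by auto
    have fg: "(\<lambda>x. f x * g x) \<in> F" by (rule F_cong_AE[OF hg]) (use ae meas in auto)
    have ff: "(\<lambda>x. (f x)\<^sup>2) \<in> F" by (rule F_cong_AE[OF hh]) (use ae meas in auto)
    have "E f (\<lambda>x. f x * g x) = E h (\<lambda>x. f x * g x)" by (rule E_cong_AE[OF f h(1) fg ae])
    also have "\<dots> = E h (\<lambda>x. h x * g x)"
    proof -
      have "AE x in m. f x * g x = h x * g x" using ae by eventually_elim simp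
      from E_cong_AE[OF fg hg h(1) this] show ?thesis
        using E_sym[OF h(1) fg] E_sym[OF h(1) hg] by simp
    qed
    finally have 1: "E f (\<lambda>x. f x * g x) = E h (\<lambda>x. h x * g x)" .
    have 2: "E (\<lambda>x. (f x)\<^sup>2) g = E (\<lambda>x. (h x)\<^sup>2) g"
      by (rule E_cong_AE[OF ff hh]) (use g ae in auto)
    show ?thesis unfolding 1 2 ..
  qed
  then show ?thesis unfolding energy_measure_bounded_def by (metis (no_types, lifting))
qed

text \<open>A measure that vanishes on the compact pieces \<open>S \<inter> cball x0 n\<close>
  vanishes on \<open>S\<close>. If \<open>f\<close> is not essentially bounded, every truncation
  gives measure 0, so the limit in the definition is that of a constant sequence.\<close>

lemma energy_measure_zero:
  assumes S: "closed S"
    and small: "\<And>f K \<epsilon>. f \<in> F \<Longrightarrow> bdd f \<Longrightarrow> compact K \<Longrightarrow> K \<subseteq> S \<Longrightarrow> \<epsilon> > 0 \<Longrightarrow>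
      \<exists>g\<in>F \<inter> C_c. (\<forall>x. g x \<ge> 0) \<and> (\<forall>x\<in>K. g x \<ge> 1) \<and> Lf f g \<le> \<epsilon>"
    and f: "f \<in> F"
  shows "energy_measure m E F f S = 0"
proof -
  have zero: "emeasure (energy_measure_bounded E F h) S = 0" if h: "h \<in> F" "bdd h" for h
  proof -
    fix x0 :: 'a
    have "emeasure (energy_measure_bounded E F h) (S \<inter> cball x0 (real n)) = 0" for n :: nat
    proof -
      have K: "compact (S \<inter> cball x0 (real n))"
        by (rule compact_bounded_closed) (use S in \<open>auto simp: closed_Int bounded_Int\<close>)
      have "emeasure (energy_measure_bounded E F h) (S \<inter> cball x0 (real n)) \<le> ennreal \<epsilon>" if e: "\<epsilon> > 0" for \<epsilon>
      proof -
        obtain g where g: "g \<in> F \<inter> C_c" "\<And>x. g x \<ge> 0" "\<And>x. x \<in> S \<inter> cball x0 (real n) \<Longrightarrow> g x \<ge> 1" "Lf h g \<le> \<epsilon>"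
          using small[OF h K Int_lower1 e] by blast
        from energy_measure_compact_le[OF h K g(1-3)] show ?thesis
          using ennreal_leI[OF g(4)] by (rule order_trans)
      qed
      then show ?thesis
        using ennreal_le_epsilon[of 0 "emeasure (energy_measure_bounded E F h) (S \<inter> cball x0 (real n))"] by simp
    qed
    moreover have "S = (\<Union>n. S \<inter> cball x0 (real n))"
      using real_arch_simple by auto
    moreover have "range (\<lambda>n. S \<inter> cball x0 (real n)) \<subseteq> sets (energy_measure_bounded E F h)"
      unfolding energy_measure_bounded_spec(1)[OF h] using S by (auto intro!: borel_closed closed_Int)
    ultimately show ?thesis
      using emeasure_UN_eq_0[of "energy_measure_bounded E F h" "\<lambda>n. S \<inter> cball x0 (real n)"] by simp
  qed
  show ?thesis
  proof (cases "f \<in> Linfty m")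
    case True
    then obtain C where C: "AE x in m. \<bar>f x\<bar> \<le> C" by (auto simp: Linfty_def)
    define h where "h x = max (- (max C 0)) (min (f x) (max C 0))" for x
    have h: "h \<in> F" unfolding h_def by (rule F_truncate[OF f]) simp
    have "bdd h" by (rule bddI[of _ "max C 0"]) (auto simp: h_def)
    moreover have "AE x in m. f x = h x" using C by eventually_elim (auto simp: h_def)
    ultimately show ?thesis
      using zero[OF h] energy_measure_bounded_cong[OF f h] True by (simp add: energy_measure_def)
  next
    case False
    have "emeasure (energy_measure_bounded E F (\<lambda>x. max (- real n) (min (f x) (real n)))) S = 0" for n :: nat
      by (rule zero[OF F_truncate[OF f]]) (auto intro!: bddI[of _ "real n"])
    then show ?thesis using False by (simp add: energy_measure_def limI)
  qed
qed

end

section \<open>Cutoff functions and the Poincare inequality\<close>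

text \<open>\<open>scale_Phi\<close> is a supremum of reals, which is meaningful for a set bounded
  above. For small \<open>r\<close> the lower growth exponent \<open>\<beta>1 > 1\<close> makes
  \<open>1 / \<Psi> r\<close> dominate \<open>s / r\<close>, and this bounds the set.\<close>

lemma scale_Phi_ge:
  assumes S: "scale_function \<Psi>" and s: "s \<ge> 0" and r: "r > 0"
  shows "s / r - 1 / \<Psi> r \<le> scale_Phi \<Psi> s"
proof -
  obtain \<beta>1 \<beta>2 C where b: "1 < \<beta>1" "C > 1"
    and lo: "\<And>r R. 0 < r \<Longrightarrow> r \<le> R \<Longrightarrow> inverse C * (R / r) powr \<beta>1 \<le> \<Psi> R / \<Psi> r"
    using S unfolding scale_function_def by blast
  have pos: "\<Psi> r > 0" if "r > 0" for r
    using S that unfolding scale_function_def bij_betw_def by (metis greaterThan_iff imageI)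
  define c where "c = inverse C / \<Psi> 1"
  have c: "c > 0" using b pos[of 1] by (simp add: c_def)
  \<comment> \<open>In terms of \<open>w = 1 / r\<close>: beyond \<open>w0\<close> the power
    \<open>c * w powr \<beta>1\<close> is at least \<open>s * w\<close>.\<close>
  define w0 where "w0 = max 1 ((s / c) powr (1 / (\<beta>1 - 1)))"
  have "x / r - 1 / \<Psi> r \<le> s * w0" if r: "r > 0" and x: "x = s" for r x
  proof (cases "r \<ge> 1 \<or> 1 / r \<le> w0")
    case True
    then have "1 / r \<le> w0" using r by (auto simp: w0_def le_max_iff_disj field_simps)
    then have "s * (1 / r) \<le> s * w0" using s by (rule mult_left_mono)
    moreover have "x / r = s * (1 / r)" using x by simp
    moreover have "1 / \<Psi> r > 0" using pos[OF r] by simp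
    ultimately show ?thesis by linarith
  next
    case False
    define w where "w = 1 / r"
    have w: "w > 1" "w > w0" using False r by (auto simp: w_def field_simps)
    have "inverse C * w powr \<beta>1 \<le> \<Psi> 1 / \<Psi> r" using lo[of r 1] r False by (simp add: w_def)
    then have "inverse C * w powr \<beta>1 / \<Psi> 1 \<le> \<Psi> 1 / \<Psi> r / \<Psi> 1"
      using pos[of 1] by (intro divide_right_mono) auto
    then have "c * w powr \<beta>1 \<le> 1 / \<Psi> r" using pos[of 1] by (simp add: c_def)
    moreover have "s * w \<le> c * w powr \<beta>1"
    proof -
      have "s / c = ((s / c) powr (1 / (\<beta>1 - 1))) powr (\<beta>1 - 1)"
        using b s c by (simp add: powr_powr)
      also have "\<dots> \<le> w powr (\<beta>1 - 1)"
        using w b by (intro powr_mono2) (auto simp: w0_def)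
      finally have "s \<le> c * w powr (\<beta>1 - 1)" using c by (simp add: field_simps)
      then have "s * w \<le> c * w powr (\<beta>1 - 1) * w" using w by simp
      also have "\<dots> = c * w powr \<beta>1" using w by (simp add: powr_diff)
      finally show ?thesis .
    qed
    ultimately have "s * w - 1 / \<Psi> r \<le> 0" by linarith
    also have "0 \<le> s * w0" using s by (simp add: w0_def)
    finally show ?thesis using x by (simp add: w_def)
  qed
  then have "bdd_above ((\<lambda>r. s / r - 1 / \<Psi> r) ` {0<..})" by (auto intro!: bdd_aboveI[of _ "s * w0"])
  then show ?thesis unfolding scale_Phi_def using r by (intro cSUP_upper) auto
qed

section \<open>Doubling, the scale function, and kernel bounds in integrated form\<close>

locale hke_space = heat_space m E F P p
  for m :: "'a::metric_space measure"
    and E :: "('a \<Rightarrow> real) \<Rightarrow> ('a \<Rightarrow> real) \<Rightarrow> real"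
    and F :: "('a \<Rightarrow> real) set"
    and P :: "real \<Rightarrow> ('a \<Rightarrow> real) \<Rightarrow> 'a \<Rightarrow> real"
    and p :: "real \<Rightarrow> 'a \<Rightarrow> 'a \<Rightarrow> real" +
  fixes \<Psi> :: "real \<Rightarrow> real" and C1 c1 c2 c3 \<delta> D0 :: real
  assumes scale: "scale_function \<Psi>"
    and params: "C1 > 0" "c1 > 0" "c2 > 0" "c3 > 0" "\<delta> > 0" "D0 \<ge> 1"
    and upper: "\<And>t. t > 0 \<Longrightarrow> AE x in m. AE y in m.
              p t x y \<le> C1 / measure m (ball x (scale_inv \<Psi> t)) *
                        exp (- c1 * t * scale_Phi \<Psi> (c2 * (dist x y / t)))"
    and lower: "\<And>t. t > 0 \<Longrightarrow> AE x in m. AE y in m. dist x y \<le> \<delta> * scale_inv \<Psi> t \<longrightarrow>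
              p t x y \<ge> c3 / measure m (ball x (scale_inv \<Psi> t))"
    and doubling: "\<And>x r. r > 0 \<Longrightarrow> emeasure m (ball x (2 * r)) \<le> ennreal D0 * emeasure m (ball x r)"
begin

abbreviation vol :: "'a \<Rightarrow> real \<Rightarrow> real" where "vol x r \<equiv> measure m (ball x r)"

lemma vol_pos: "r > 0 \<Longrightarrow> vol x r > 0" by (rule measure_ball_pos)

lemma vol_double: "r > 0 \<Longrightarrow> vol x (2 * r) \<le> D0 * vol x r"
  using doubling[of r x] params by (simp add: emeasure_ball ennreal_mult[symmetric])

lemma vol_mono: "ball x r \<subseteq> ball y R \<Longrightarrow> vol x r \<le> vol y R"
  by (rule measure_mono_bounded) auto

lemma vol_pow: "r > 0 \<Longrightarrow> vol x (2 ^ n * r) \<le> D0 ^ n * vol x r"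
proof (induction n)
  case (Suc n)
  have "vol x (2 ^ Suc n * r) \<le> D0 * vol x (2 ^ n * r)"
    using vol_double[of "2 ^ n * r" x] Suc by (simp add: mult.assoc)
  also have "\<dots> \<le> D0 * (D0 ^ n * vol x r)" using Suc params by (intro mult_left_mono) auto
  finally show ?case by (simp add: mult.assoc)
qed simp

lemma vol_compare: 
  assumes "K > 0"
  obtains D where "D \<ge> 1" "\<And>x y r. r > 0 \<Longrightarrow> dist x y \<le> K * r \<Longrightarrow> vol y (K * r) \<le> D * vol x r"
proof -
  obtain n :: nat where n: "2 * K < 2 ^ n" using real_arch_pow[of 2 "2 * K"] by auto
  show thesis
  proof (rule that[of "D0 ^ n"])
    show "D0 ^ n \<ge> 1" using params by simp
    fix x y :: 'a and r :: real assume r: "r > 0" and d: "dist x y \<le> K * r"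
    have "2 * K * r \<le> 2 ^ n * r" using n r by simp
    have "ball y (K * r) \<subseteq> ball x (2 ^ n * r)"
    proof
      fix z assume "z \<in> ball y (K * r)"
      then have "dist x z < K * r + K * r" using d dist_triangle[of x z y] by simp
      also have "\<dots> \<le> 2 ^ n * r" using \<open>2 * K * r \<le> 2 ^ n * r\<close> by simp
      finally show "z \<in> ball x (2 ^ n * r)" by simp
    qed
    from vol_mono[OF this] show "vol y (K * r) \<le> D0 ^ n * vol x r" using vol_pow[OF r, of x n] by linarith
  qed
qed

lemma \<Psi>_pos: "r > 0 \<Longrightarrow> \<Psi> r > 0"
  using scale unfolding scale_function_def bij_betw_def by (metis greaterThan_iff imageI)

lemma scale_inv_\<Psi>: "r > 0 \<Longrightarrow> scale_inv \<Psi> (\<Psi> r) = r"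
  using scale unfolding scale_function_def by (intro inv_into_f_f) (auto simp: bij_betw_def)

lemma \<Psi>_scale_inv: "t > 0 \<Longrightarrow> \<Psi> (scale_inv \<Psi> t) = t"
  using scale unfolding scale_function_def bij_betw_def by (intro f_inv_into_f) auto

lemma scale_inv_pos: "t > 0 \<Longrightarrow> scale_inv \<Psi> t > 0"
  using scale inv_into_into[of t \<Psi> "{0<..}"] unfolding scale_function_def bij_betw_def by auto

lemma \<Psi>_less_iff: "r > 0 \<Longrightarrow> R > 0 \<Longrightarrow> \<Psi> r < \<Psi> R \<longleftrightarrow> r < R"
  using scale unfolding scale_function_def
  by (metis greaterThan_iff linorder_neqE_linordered_idom not_less_iff_gr_or_eq strict_mono_onD)

lemma \<Psi>_mono: "r > 0 \<Longrightarrow> r \<le> R \<Longrightarrow> \<Psi> r \<le> \<Psi> R"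
  using \<Psi>_less_iff[of R r] by (cases "r = R") auto

lemma scale_inv_le: "u > 0 \<Longrightarrow> r > 0 \<Longrightarrow> u \<le> \<Psi> r \<Longrightarrow> scale_inv \<Psi> u \<le> r"
  using \<Psi>_less_iff[of r "scale_inv \<Psi> u"] scale_inv_pos[of u] \<Psi>_scale_inv[of u] by auto

lemma \<Psi>_compare:
  assumes K: "K \<ge> 1" obtains C where "C > 0" "\<And>r. r > 0 \<Longrightarrow> \<Psi> (K * r) \<le> C * \<Psi> r"
proof -
  obtain \<beta>2 C where b: "C > 1"
    and hi: "\<And>r R. 0 < r \<Longrightarrow> r \<le> R \<Longrightarrow> \<Psi> R / \<Psi> r \<le> C * (R / r) powr \<beta>2"
    using scale unfolding scale_function_def by blast
  show thesis
  proof (rule that[of "C * K powr \<beta>2"])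
    show "C * K powr \<beta>2 > 0" using b K by simp
    show "\<Psi> (K * r) \<le> C * K powr \<beta>2 * \<Psi> r" if r: "r > 0" for r
      using hi[of r "K * r"] r K \<Psi>_pos[OF r] by (simp add: field_simps)
  qed
qed

lemma L2_integrable_on_bounded:
  assumes f: "f \<in> L2 m" and A: "\<And>x. x \<notin> A \<Longrightarrow> f x = 0" "bounded A"
  shows "integrable m f"
proof -
  obtain x0 R where R: "A \<subseteq> cball x0 R" using A(2) bounded_subset_cball by blast
  have i: "indicat_real (cball x0 R) \<in> L2 m" by (rule L2_indicator) auto
  have "integrable m (\<lambda>x. f x * indicat_real (cball x0 R) x)" by (rule L2_mult_integrable[OF f i])
  moreover have "(\<lambda>x. f x * indicat_real (cball x0 R) x) = f" 
  proof
    fix x show "f x * indicat_real (cball x0 R) x = f x" using A(1)[of x] R by (cases "x \<in> A") auto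
  qed
  ultimately show ?thesis by simp
qed

lemma inner_P_nn:
  assumes t: "t > 0" and v: "v \<in> L2 m" "\<And>x. v x \<ge> 0" and w: "w \<in> L2 m" "\<And>x. w x \<ge> 0"
  shows "ennreal (L2_inner m (P t v) w) = (\<integral>\<^sup>+x. \<integral>\<^sup>+y. ennreal (p t x y) * ennreal (v x * w y) \<partial>m \<partial>m)"
proof -
  have vw: "v \<in> borel_measurable m" "w \<in> borel_measurable m" using v w L2_measurable by auto
  have "L2_inner m (P t v) w = L2_inner m (P t w) v"
    using P_sym[OF t v(1) w(1)] L2.B_sym[OF v(1) P_L2[OF t w(1)]] by simp
  then have "ennreal (L2_inner m (P t v) w) = ennreal (\<integral>z. v (fst z) * w (snd z) \<partial>M t)"
    using inner_P[OF t w(1) v(1)] by simp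
  also have "\<dots> = (\<integral>\<^sup>+z. ennreal (v (fst z) * w (snd z)) \<partial>M t)"
    using integrable_M_mult[OF t w(1) v(1)] v w by (intro nn_integral_eq_integral[symmetric]) auto
  also have "\<dots> = (\<integral>\<^sup>+x. \<integral>\<^sup>+y. ennreal (p t x y) * ennreal (v (fst (x, y)) * w (snd (x, y))) \<partial>m \<partial>m)"
    using vw by (intro nn_integral_M[OF t]) simp
  finally show ?thesis by simp
qed

lemma nn_integral_product_const:
  assumes v: "integrable m v" "\<And>x. v x \<ge> 0" and w: "integrable m w" "\<And>x. w x \<ge> 0" and c: "c \<ge> 0"
  shows "(\<integral>\<^sup>+x. \<integral>\<^sup>+y. ennreal c * ennreal (v x * w y) \<partial>m \<partial>m) = ennreal (c * ((\<integral>x. v x \<partial>m) * (\<integral>x. w x \<partial>m)))"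
proof -
  have "(\<integral>\<^sup>+x. \<integral>\<^sup>+y. ennreal c * ennreal (v x * w y) \<partial>m \<partial>m) = (\<integral>\<^sup>+x. \<integral>\<^sup>+y. ennreal (c * v x) * ennreal (w y) \<partial>m \<partial>m)"
    using v w c by (intro nn_integral_cong) (simp add: ennreal_mult[symmetric] mult.assoc)
  also have "\<dots> = (\<integral>\<^sup>+x. ennreal (c * v x) * ennreal (\<integral>y. w y \<partial>m) \<partial>m)"
    using w by (intro nn_integral_cong) (simp add: nn_integral_cmult nn_integral_eq_integral)
  also have "\<dots> = ennreal (\<integral>x. c * v x \<partial>m) * ennreal (\<integral>y. w y \<partial>m)"
    using v c by (simp add: nn_integral_multc nn_integral_eq_integral)
  also have "\<dots> = ennreal (c * ((\<integral>x. v x \<partial>m) * (\<integral>x. w x \<partial>m)))"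
    using v w c by (simp add: ennreal_mult[symmetric] mult.assoc)
  finally show ?thesis .
qed

text \<open>Let \<open>\<rho> = scale_inv \<Psi> u\<close> and \<open>q = r / \<rho>\<close>.
  Evaluating the supremum in \<open>scale_Phi\<close> at \<open>\<rho>\<close> gives, up to a
  constant, decay like \<open>exp (- c1 * c2 * (l - 1) * q)\<close>, while the volume ratio between
  the radii \<open>r\<close> and \<open>\<rho>\<close> grows at most exponentially in
  \<open>q\<close>. A large \<open>l\<close> wins uniformly in all times
  \<open>u \<le> \<Psi> r\<close>.\<close>

lemma kernel_upper_pointwise:
  assumes th: "\<theta> > 0"
  obtains l where "l \<ge> 2" "\<And>x r u y d. r > 0 \<Longrightarrow> 0 < u \<Longrightarrow> u \<le> \<Psi> r \<Longrightarrow> dist x y < r \<Longrightarrow> d \<ge> (l - 1) * r \<Longrightarrow>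
    C1 / vol y (scale_inv \<Psi> u) * exp (- c1 * u * scale_Phi \<Psi> (c2 * (d / u))) \<le> \<theta> / vol x r"
proof -
  define Lg where "Lg = ln D0"
  have Lg: "Lg \<ge> 0" "D0 = exp Lg" using params by (auto simp: Lg_def)
  define K where "K = max 0 (c1 + ln (C1 * D0 / \<theta>))"
  have K0: "K \<ge> 0" by (simp add: K_def)
  have CD: "C1 * D0 / \<theta> > 0" using th params by (simp add: divide_pos_pos)
  have "C1 * D0 / \<theta> * exp c1 \<le> exp K"
  proof -
    have "C1 * D0 / \<theta> * exp c1 = exp (c1 + ln (C1 * D0 / \<theta>))" using CD by (simp add: exp_add)
    also have "\<dots> \<le> exp K" by (simp add: K_def)
    finally show ?thesis .
  qed
  then have K: "C1 * D0 * exp (c1 - K) \<le> \<theta>"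
    using th by (simp add: exp_diff field_simps)
  \<comment> \<open>\<open>2 * Lg\<close> pays for the volume growth
    \<open>exp (2 * Lg * q)\<close>, and \<open>K\<close> for the remaining constants together with
    \<open>\<theta>\<close>.\<close>
  define l where "l = 2 + (2 * Lg + K) / (c1 * c2)"
  have l2: "l \<ge> 2" using Lg K0 params by (simp add: l_def)
  show thesis
  proof (rule that[OF l2])
    fix x y :: 'a and r u d :: real
    assume r: "r > 0" and u: "0 < u" "u \<le> \<Psi> r" and y: "dist x y < r" and d: "d \<ge> (l - 1) * r"
    define \<rho> where "\<rho> = scale_inv \<Psi> u"
    have rho: "\<rho> > 0" "\<rho> \<le> r" "\<Psi> \<rho> = u"
      using scale_inv_pos[OF u(1)] scale_inv_le[OF u(1) r u(2)] \<Psi>_scale_inv[OF u(1)] by (auto simp: \<rho>_def)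
    define q where "q = r / \<rho>"
    have q: "q \<ge> 1" using rho by (simp add: q_def)
    \<comment> \<open>The crude \<open>q \<le> 2 ^ n\<close> with \<open>n\<close> about
      \<open>q\<close>, instead of about its logarithm, is good enough against exponential
      decay.\<close>
    define n where "n = nat \<lceil>q\<rceil>"
    have n: "real n \<ge> q" "real n \<le> q + 1" using q by (auto simp: n_def)
    have "r = q * \<rho>" using rho by (simp add: q_def)
    also have "\<dots> \<le> 2 ^ n * \<rho>"
    proof (rule mult_right_mono)
      have "real n < 2 ^ n" by (rule of_nat_less_two_power)
      then show "q \<le> 2 ^ n" using n by linarith
    qed (use rho in auto)
    finally have rn: "r \<le> 2 ^ n * \<rho>" .
    have "ball x r \<subseteq> ball y (2 * r)"
    proof
      fix z assume "z \<in> ball x r"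
      then show "z \<in> ball y (2 * r)" using y dist_triangle[of y z x] by (simp add: dist_commute)
    qed
    then have "vol x r \<le> vol y (2 * r)" by (rule vol_mono)
    also have "\<dots> \<le> D0 * vol y r" by (rule vol_double[OF r])
    also have "\<dots> \<le> D0 * vol y (2 ^ n * \<rho>)"
      using params rn by (intro mult_left_mono vol_mono) auto
    also have "\<dots> \<le> D0 * (D0 ^ n * vol y \<rho>)"
      using params by (intro mult_left_mono vol_pow rho) auto
    also have "D0 ^ n = exp (Lg * real n)" unfolding Lg(2) by (metis exp_of_nat_mult mult.commute)
    also have "D0 * (exp (Lg * real n) * vol y \<rho>) \<le> D0 * (exp (2 * Lg * q) * vol y \<rho>)"
    proof -
      have "Lg * real n \<le> Lg * (2 * q)" using n q Lg by (intro mult_left_mono) auto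
      then show ?thesis using params by (intro mult_left_mono mult_right_mono) auto
    qed
    finally have V: "vol x r \<le> D0 * exp (2 * Lg * q) * vol y \<rho>" by (simp add: mult.assoc)
    have d0: "d \<ge> 0" using d l2 r by (meson mult_nonneg_nonneg diff_ge_0_iff_ge less_imp_le order_trans one_le_numeral)
    have "c2 * (d / u) / \<rho> - 1 / \<Psi> \<rho> \<le> scale_Phi \<Psi> (c2 * (d / u))"
      by (rule scale_Phi_ge[OF scale _ rho(1)]) (use params d0 u in auto)
    then have "u * (c2 * (d / u) / \<rho> - 1 / u) \<le> u * scale_Phi \<Psi> (c2 * (d / u))"
      using u rho by (intro mult_left_mono) auto
    moreover have "u * (c2 * (d / u) / \<rho> - 1 / u) = c2 * d / \<rho> - 1"
      using u by (simp add: right_diff_distrib)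
    ultimately have ph: "c2 * d / \<rho> - 1 \<le> u * scale_Phi \<Psi> (c2 * (d / u))" by simp
    have "c2 * (l - 1) * q = c2 * ((l - 1) * r) / \<rho>" by (simp add: q_def)
    also have "\<dots> \<le> c2 * d / \<rho>"
      using d rho params by (intro divide_right_mono mult_left_mono) auto
    finally have "c2 * (l - 1) * q \<le> c2 * d / \<rho>" .
    then have "c2 * (l - 1) * q - 1 \<le> u * scale_Phi \<Psi> (c2 * (d / u))" using ph by linarith
    then have e1: "c1 * (c2 * (l - 1) * q - 1) \<le> c1 * (u * scale_Phi \<Psi> (c2 * (d / u)))"
      using params by (intro mult_left_mono) auto
    have "c1 * c2 * (l - 1) = c1 * c2 + 2 * Lg + K" using params by (simp add: l_def field_simps)
    then have "c1 * c2 * (l - 1) * q = (c1 * c2 + 2 * Lg + K) * q" by simp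
    also have "\<dots> \<ge> 2 * Lg * q + K"
    proof -
      have "K \<le> K * q" using q K0 by (simp add: mult_le_cancel_left1)
      moreover have "0 \<le> c1 * c2 * q" using params q by simp
      ultimately show ?thesis by (simp add: distrib_right)
    qed
    finally have "- c1 * u * scale_Phi \<Psi> (c2 * (d / u)) \<le> c1 - K - 2 * Lg * q"
      using e1 by (simp add: algebra_simps)
    then have ex: "exp (- c1 * u * scale_Phi \<Psi> (c2 * (d / u))) \<le> exp (c1 - K - 2 * Lg * q)" by simp
    have vy: "vol y \<rho> > 0" "vol x r > 0" using vol_pos rho r by auto
    have "C1 / vol y \<rho> * exp (- c1 * u * scale_Phi \<Psi> (c2 * (d / u))) \<le> C1 / vol y \<rho> * exp (c1 - K - 2 * Lg * q)"
      using ex params vy by (intro mult_left_mono) auto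
    also have "\<dots> = C1 * exp (c1 - K) * (1 / (exp (2 * Lg * q) * vol y \<rho>))"
      by (simp add: exp_diff)
    also have "\<dots> \<le> C1 * exp (c1 - K) * (D0 / vol x r)"
      using V vy params by (intro mult_left_mono) (auto simp: field_simps)
    also have "\<dots> \<le> \<theta> / vol x r" using K vy by (simp add: field_simps)
    finally show "C1 / vol y (scale_inv \<Psi> u) * exp (- c1 * u * scale_Phi \<Psi> (c2 * (d / u))) \<le> \<theta> / vol x r"
      by (simp add: \<rho>_def)
  qed
qed

text \<open>The kernel bounds hold for almost all pairs only, so they are used after integration.
  Where \<open>v y * w z\<close> is nonzero, \<open>y\<close> and \<open>z\<close> are at distance
  at least \<open>(l - 1) * r\<close>.\<close>

lemma off_diagonal_upper:
  assumes th: "\<theta> > 0"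
  obtains l where "l \<ge> 2" "\<And>x r u v w. r > 0 \<Longrightarrow> 0 < u \<Longrightarrow> u \<le> \<Psi> r \<Longrightarrow>
    v \<in> L2 m \<Longrightarrow> (\<And>y. v y \<ge> 0) \<Longrightarrow> (\<And>y. y \<notin> ball x r \<Longrightarrow> v y = 0) \<Longrightarrow>
    w \<in> L2 m \<Longrightarrow> (\<And>y. w y \<ge> 0) \<Longrightarrow> (\<And>y. y \<in> ball x (l * r) \<Longrightarrow> w y = 0) \<Longrightarrow> integrable m w \<Longrightarrow>
    L2_inner m (P u v) w \<le> \<theta> / vol x r * ((\<integral>y. v y \<partial>m) * (\<integral>y. w y \<partial>m))"
proof -
  obtain l where l2: "l \<ge> 2" and l: "\<And>x r u y d. r > 0 \<Longrightarrow> 0 < u \<Longrightarrow> u \<le> \<Psi> r \<Longrightarrow> dist x y < r \<Longrightarrow> d \<ge> (l - 1) * r \<Longrightarrow>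
    C1 / vol y (scale_inv \<Psi> u) * exp (- c1 * u * scale_Phi \<Psi> (c2 * (d / u))) \<le> \<theta> / vol x r"
    using kernel_upper_pointwise[OF th] by blast
  show thesis
  proof (rule that[OF l2])
    fix x r u v w assume r: "r > 0" and u: "0 < u" "u \<le> \<Psi> r"
      and v: "v \<in> L2 m" "\<And>y. v y \<ge> 0" "\<And>y. y \<notin> ball x r \<Longrightarrow> v y = 0"
      and w: "w \<in> L2 m" "\<And>y. w y \<ge> 0" "\<And>y. y \<in> ball x (l * r) \<Longrightarrow> w y = 0" "integrable m w"
    have iv: "integrable m v" by (rule L2_integrable_on_bounded[OF v(1,3) bounded_ball])
    have c: "\<theta> / vol x r \<ge> 0" using th vol_pos[OF r, of x] by simp
    have "ennreal (L2_inner m (P u v) w) = (\<integral>\<^sup>+y. \<integral>\<^sup>+z. ennreal (p u y z) * ennreal (v y * w z) \<partial>m \<partial>m)"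
      by (rule inner_P_nn[OF u(1) v(1,2) w(1,2)])
    also have "\<dots> \<le> (\<integral>\<^sup>+y. \<integral>\<^sup>+z. ennreal (\<theta> / vol x r) * ennreal (v y * w z) \<partial>m \<partial>m)"
    proof (rule nn_integral_mono_AE)
      show "AE y in m. (\<integral>\<^sup>+z. ennreal (p u y z) * ennreal (v y * w z) \<partial>m)
          \<le> (\<integral>\<^sup>+z. ennreal (\<theta> / vol x r) * ennreal (v y * w z) \<partial>m)"
        using upper[OF u(1)]
      proof eventually_elim
        case (elim y)
        show ?case
        proof (rule nn_integral_mono_AE)
          show "AE z in m. ennreal (p u y z) * ennreal (v y * w z) \<le> ennreal (\<theta> / vol x r) * ennreal (v y * w z)"
            using elim
          proof eventually_elim
            case (elim z)
            show ?case
            proof (cases "y \<in> ball x r \<and> z \<notin> ball x (l * r)")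
              case True
              then have "dist x y < r" "dist x z \<ge> l * r" by auto
              moreover have "dist x z \<le> dist x y + dist y z" by (rule dist_triangle)
              ultimately have "dist y z \<ge> (l - 1) * r" by (simp add: algebra_simps)
              with True have "p u y z \<le> \<theta> / vol x r" using l[OF r u, of x y "dist y z"] elim by auto
              then show ?thesis by (intro mult_right_mono ennreal_leI) auto
            next
              case False
              then have "v y * w z = 0" using v(3) w(3) by auto
              then show ?thesis by (simp only: ennreal_0 mult_zero_right order_refl)
            qed
          qed
        qed
      qed
    qed
    also have "\<dots> = ennreal (\<theta> / vol x r * ((\<integral>y. v y \<partial>m) * (\<integral>y. w y \<partial>m)))"
      by (rule nn_integral_product_const[OF iv v(2) w(4,2) c])
    finally show "L2_inner m (P u v) w \<le> \<theta> / vol x r * ((\<integral>y. v y \<partial>m) * (\<integral>y. w y \<partial>m))"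
      by (subst (asm) ennreal_le_iff) (intro mult_nonneg_nonneg c Bochner_Integration.integral_nonneg v w)
  qed
qed

text \<open>Two points of \<open>ball x (\<eta> * r)\<close> are within \<open>\<delta> * r\<close>,
  the range of the lower bound at time \<open>\<Psi> r\<close>; the minimum with 1 keeps this ball
  inside \<open>ball x r\<close>.\<close>

definition \<eta> :: real where "\<eta> = min \<delta> 1 / 2"

lemma \<eta>_bounds: "0 < \<eta>" "\<eta> \<le> 1/2" "2 * \<eta> \<le> \<delta>"
  using params by (auto simp: \<eta>_def)

text \<open>The division by \<open>D0\<close> pays for moving the centre of the volume in the lower
  kernel bound.\<close>

definition c4 :: real where "c4 = c3 / D0"

lemma c4_pos: "c4 > 0" using params by (simp add: c4_def)

lemma near_diagonal_lower:
  assumes r: "r > 0" and v: "v \<in> L2 m" "\<And>y. v y \<ge> 0" "\<And>y. y \<notin> ball x (\<eta> * r) \<Longrightarrow> v y = 0"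
    and w: "w \<in> L2 m" "\<And>y. w y \<ge> 0" "\<And>y. y \<notin> ball x (\<eta> * r) \<Longrightarrow> w y = 0"
  shows "c4 / vol x r * ((\<integral>y. v y \<partial>m) * (\<integral>y. w y \<partial>m)) \<le> L2_inner m (P (\<Psi> r) v) w"
proof -
  have t: "\<Psi> r > 0" by (rule \<Psi>_pos[OF r])
  have iv: "integrable m v" by (rule L2_integrable_on_bounded[OF v(1,3) bounded_ball])
  have iw: "integrable m w" by (rule L2_integrable_on_bounded[OF w(1,3) bounded_ball])
  have c: "c4 / vol x r \<ge> 0" using c4_pos vol_pos[OF r, of x] by simp
  have "ennreal (c4 / vol x r * ((\<integral>y. v y \<partial>m) * (\<integral>y. w y \<partial>m)))
      = (\<integral>\<^sup>+y. \<integral>\<^sup>+z. ennreal (c4 / vol x r) * ennreal (v y * w z) \<partial>m \<partial>m)"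
    by (rule nn_integral_product_const[OF iv v(2) iw w(2) c, symmetric])
  also have "\<dots> \<le> (\<integral>\<^sup>+y. \<integral>\<^sup>+z. ennreal (p (\<Psi> r) y z) * ennreal (v y * w z) \<partial>m \<partial>m)"
  proof (rule nn_integral_mono_AE)
    show "AE y in m. (\<integral>\<^sup>+z. ennreal (c4 / vol x r) * ennreal (v y * w z) \<partial>m)
        \<le> (\<integral>\<^sup>+z. ennreal (p (\<Psi> r) y z) * ennreal (v y * w z) \<partial>m)"
      using lower[OF t]
    proof eventually_elim
      case (elim y)
      show ?case
      proof (rule nn_integral_mono_AE)
        show "AE z in m. ennreal (c4 / vol x r) * ennreal (v y * w z) \<le> ennreal (p (\<Psi> r) y z) * ennreal (v y * w z)"
          using elim
        proof eventually_elim
          case (elim z)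
          show ?case
          proof (cases "y \<in> ball x (\<eta> * r) \<and> z \<in> ball x (\<eta> * r)")
            case True
            then have yz: "dist x y < \<eta> * r" "dist x z < \<eta> * r" by auto
            have "dist y z \<le> dist x y + dist x z" by (metis dist_commute dist_triangle)
            also have "\<dots> \<le> (2 * \<eta>) * r" using yz by simp
            also have "\<dots> \<le> \<delta> * r" using \<eta>_bounds r by (intro mult_right_mono) auto
            finally have "p (\<Psi> r) y z \<ge> c3 / vol y r" using elim by (simp add: scale_inv_\<Psi>[OF r])
            moreover have "c4 / vol x r \<le> c3 / vol y r"
            proof -
              have "\<eta> * r \<le> r" using \<eta>_bounds r by simp
              then have "dist x y < r" using yz by linarith
              have "ball y r \<subseteq> ball x (2 * r)"
              proof
                fix z assume "z \<in> ball y r"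
                then show "z \<in> ball x (2 * r)" using \<open>dist x y < r\<close> dist_triangle[of x z y] by simp
              qed
              then have "vol y r \<le> D0 * vol x r" using vol_mono[of y r x "2 * r"] vol_double[OF r, of x] by linarith
              then show ?thesis using vol_pos[OF r, of x] vol_pos[OF r, of y] params
                by (simp add: c4_def field_simps)
            qed
            ultimately show ?thesis by (intro mult_right_mono ennreal_leI) auto
          next
            case False
            then have "v y * w z = 0" using v(3) w(3) by auto
            then show ?thesis by (simp only: ennreal_0 mult_zero_right order_refl)
          qed
        qed
      qed
    qed
  qed
  also have "\<dots> = ennreal (L2_inner m (P (\<Psi> r) v) w)"
    by (rule inner_P_nn[OF t v(1,2) w(1,2), symmetric])
  finally have *: "ennreal (c4 / vol x r * ((\<integral>y. v y \<partial>m) * (\<integral>y. w y \<partial>m))) \<le> ennreal (L2_inner m (P (\<Psi> r) v) w)" .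
  have "0 \<le> L2_inner m (P (\<Psi> r) v) w"
    unfolding L2_inner_def using P_positive[OF t v(1)] v(2) w(2) by (intro integral_nonneg_AE) auto
  with * show ?thesis by (simp add: ennreal_le_iff)
qed

end

lemma (in heat_space) AE_le_from_inner:
  assumes h: "h \<in> L2 m" and S: "S \<in> sets borel"
    and le: "\<And>A. A \<in> sets borel \<Longrightarrow> bounded A \<Longrightarrow> A \<subseteq> S \<Longrightarrow> L2_inner m h (indicat_real A) \<le> c * measure m A"
  shows "AE x in m. x \<in> S \<longrightarrow> h x \<le> c"
proof -
  fix x0 :: 'a
  have hm: "h \<in> borel_measurable m" using h by (rule L2_measurable)
  have "AE x in m. x \<in> S \<longrightarrow> x \<in> ball x0 (real n) \<longrightarrow> h x \<le> c" for n :: nat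
  proof -
    define A where "A = S \<inter> ball x0 (real n) \<inter> {x. h x > c}"
    have "{x \<in> space m. h x > c} \<in> sets m" using hm by measurable
    then have A: "A \<in> sets borel" "bounded A" "A \<subseteq> S"
      using S by (auto simp: A_def sets_m space_m bounded_Int)
    have i: "integrable m (\<lambda>x. h x * indicat_real A x)" by (rule L2_mult_integrable[OF h L2_indicator[OF A(1,2)]])
    have i2: "integrable m (\<lambda>x. c * indicat_real A x)" using integrable_indicator_bounded[OF A(1,2)] by simp
    have nn: "h x * indicat_real A x - c * indicat_real A x \<ge> 0" for x by (auto simp: A_def indicator_def)
    have "(\<integral>x. h x * indicat_real A x - c * indicat_real A x \<partial>m) = L2_inner m h (indicat_real A) - c * measure m A"
      using i i2 A by (simp add: L2_inner_def space_m)
    also have "\<dots> \<le> 0" using le[OF A] by simp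
    finally have "(\<integral>x. h x * indicat_real A x - c * indicat_real A x \<partial>m) = 0"
      using Bochner_Integration.integral_nonneg[of m "\<lambda>x. h x * indicat_real A x - c * indicat_real A x"] nn by (metis (no_types, lifting) antisym)
    then have "AE x in m. h x * indicat_real A x - c * indicat_real A x = 0"
      using integral_nonneg_eq_0_iff_AE[of m "\<lambda>x. h x * indicat_real A x - c * indicat_real A x"] i i2 nn by auto
    then show ?thesis
      by eventually_elim (auto simp: A_def indicator_def split: if_splits)
  qed
  then have "AE x in m. \<forall>n. x \<in> S \<longrightarrow> x \<in> ball x0 (real n) \<longrightarrow> h x \<le> c"
    unfolding AE_all_countable by (rule allI)
  then show ?thesis
  proof eventually_elim
    case (elim x)
    obtain n :: nat where "dist x0 x < real n" using reals_Archimedean2 by blast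
    then show ?case using elim by auto
  qed
qed

lemma (in heat_space) AE_ge_from_inner:
  assumes h: "h \<in> L2 m" and S: "S \<in> sets borel"
    and le: "\<And>A. A \<in> sets borel \<Longrightarrow> bounded A \<Longrightarrow> A \<subseteq> S \<Longrightarrow> c * measure m A \<le> L2_inner m h (indicat_real A)"
  shows "AE x in m. x \<in> S \<longrightarrow> c \<le> h x"
proof -
  have "AE x in m. x \<in> S \<longrightarrow> - h x \<le> - c"
  proof (rule AE_le_from_inner[OF L2.V_uminus[OF h] S])
    fix A :: "'a set" assume A: "A \<in> sets borel" "bounded A" "A \<subseteq> S"
    show "L2_inner m (\<lambda>x. - h x) (indicat_real A) \<le> - c * measure m A"
      using le[OF A] L2.B_uminus[OF h L2_indicator[OF A(1,2)]] by simp
  qed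
  then show ?thesis by simp
qed

lemma (in dirichlet_form) E_quad_cong_AE:
  assumes "f \<in> F" "g \<in> F" "AE x in m. f x = g x" shows "E f f = E g g"
  using E_cong_AE[OF assms(1,2,1,3)] E_cong_AE[OF assms(1,2,2,3)] E_sym[OF assms(1,2)] by simp

context hke_space
begin

text \<open>Diffuse the indicator of a small ball for time \<open>\<Psi> r\<close>. The lower and
  upper kernel bounds leave a factor 2 between the values on that ball and those outside
  \<open>ball x (l * r)\<close>; rescaling and truncating across this gap gives the cutoff, and
  \<open>P_energy\<close> bounds its energy.\<close>

lemma cutoff:
  obtains l C where "l \<ge> 2" "C > 0" "\<And>x r. r > 0 \<Longrightarrow> \<exists>\<psi>\<in>F. (\<forall>y. 0 \<le> \<psi> y \<and> \<psi> y \<le> 1) \<and>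
    (\<forall>y\<in>ball x (\<eta> * r). \<psi> y = 1) \<and> (\<forall>y. y \<notin> ball x (l * r) \<longrightarrow> \<psi> y = 0) \<and> E \<psi> \<psi> \<le> C * (vol x r / \<Psi> r)"
proof -
  define \<theta> where "\<theta> = c4 / 2"
  have th: "\<theta> > 0" using c4_pos by (simp add: \<theta>_def)
  obtain l where l2: "l \<ge> 2" and l: "\<And>x r u v w. r > 0 \<Longrightarrow> 0 < u \<Longrightarrow> u \<le> \<Psi> r \<Longrightarrow>
    v \<in> L2 m \<Longrightarrow> (\<And>y. v y \<ge> 0) \<Longrightarrow> (\<And>y. y \<notin> ball x r \<Longrightarrow> v y = 0) \<Longrightarrow>
    w \<in> L2 m \<Longrightarrow> (\<And>y. w y \<ge> 0) \<Longrightarrow> (\<And>y. y \<in> ball x (l * r) \<Longrightarrow> w y = 0) \<Longrightarrow> integrable m w \<Longrightarrow>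
    L2_inner m (P u v) w \<le> \<theta> / vol x r * ((\<integral>y. v y \<partial>m) * (\<integral>y. w y \<partial>m))"
    using off_diagonal_upper[OF th] by blast
  obtain D where D: "D \<ge> 1" "\<And>x y r. r > 0 \<Longrightarrow> dist x y \<le> 1 / \<eta> * r \<Longrightarrow> vol y (1 / \<eta> * r) \<le> D * vol x r"
    using vol_compare[of "1 / \<eta>"] \<eta>_bounds by auto
  define C where "C = 2 * D / c4\<^sup>2"
  have C: "C > 0" using D c4_pos by (simp add: C_def)
  show thesis
  proof (rule that[OF l2 C])
    fix x :: 'a and r :: real assume r: "r > 0"
    have t: "\<Psi> r > 0" by (rule \<Psi>_pos[OF r])
    define B where "B = ball x (\<eta> * r)"
    have eta_r: "\<eta> * r > 0" "\<eta> * r \<le> r" using \<eta>_bounds r by auto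
    have iB: "indicat_real B \<in> L2 m" unfolding B_def by (rule L2_indicator) auto
    define v where "v = P (\<Psi> r) (indicat_real B)"
    have vF: "v \<in> F" and vE: "E v v \<le> L2_inner m (indicat_real B) (indicat_real B) / (2 * \<Psi> r)"
      unfolding v_def using P_energy[OF t iB] by auto
    have vB: "vol x (\<eta> * r) > 0" "vol x r > 0" using vol_pos eta_r r by auto
    define b where "b = vol x (\<eta> * r) / vol x r"
    have b: "b > 0" using vB by (simp add: b_def)
    have bD: "1 \<le> D * b"
    proof -
      have "vol x (1 / \<eta> * (\<eta> * r)) \<le> D * vol x (\<eta> * r)"
        using eta_r \<eta>_bounds by (intro D(2)) auto
      moreover have "1 / \<eta> * (\<eta> * r) = r" using \<eta>_bounds by simp
      ultimately show ?thesis using vB by (simp add: b_def field_simps)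
    qed
    have mB: "(\<integral>y. indicat_real B y \<partial>m) = vol x (\<eta> * r)" by (simp add: B_def space_m)
    have innB: "L2_inner m (indicat_real B) (indicat_real B) = vol x (\<eta> * r)"
    proof -
      have "(\<lambda>y. indicat_real B y * indicat_real B y) = indicat_real B" by (auto simp: indicator_def)
      then show ?thesis using mB by (simp add: L2_inner_def)
    qed
    have lo: "AE y in m. y \<in> B \<longrightarrow> c4 * b \<le> v y"
    proof (rule AE_ge_from_inner[OF F_L2[OF vF]])
      fix A :: "'a set" assume A: "A \<in> sets borel" "bounded A" "A \<subseteq> B"
      have "c4 / vol x r * ((\<integral>y. indicat_real B y \<partial>m) * (\<integral>y. indicat_real A y \<partial>m)) \<le> L2_inner m v (indicat_real A)"
        unfolding v_def by (rule near_diagonal_lower[OF r iB _ _ L2_indicator[OF A(1,2)]]) (use A in \<open>auto simp: B_def indicator_def\<close>)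
      then show "c4 * b * measure m A \<le> L2_inner m v (indicat_real A)"
        using A unfolding mB by (simp add: b_def space_m)
    qed (simp add: B_def)
    have hi: "AE y in m. y \<in> - ball x (l * r) \<longrightarrow> v y \<le> \<theta> * b"
    proof (rule AE_le_from_inner[OF F_L2[OF vF]])
      fix A :: "'a set" assume A: "A \<in> sets borel" "bounded A" "A \<subseteq> - ball x (l * r)"
      have "L2_inner m v (indicat_real A) \<le> \<theta> / vol x r * ((\<integral>y. indicat_real B y \<partial>m) * (\<integral>y. indicat_real A y \<partial>m))"
        unfolding v_def
        by (rule l[OF r t order_refl iB _ _ L2_indicator[OF A(1,2)] _ _ integrable_indicator_bounded[OF A(1,2)]])
          (use A eta_r in \<open>auto simp: B_def indicator_def\<close>)
      then show "L2_inner m v (indicat_real A) \<le> \<theta> * b * measure m A"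
        using A unfolding mB by (simp add: b_def space_m)
    qed simp
    \<comment> \<open>After scaling by \<open>k\<close> the values are at least 2 on
      \<open>B\<close> and at most 1 outside \<open>ball x (l * r)\<close>, so subtracting 1 and
      clipping to the unit interval gives 1 and 0.\<close>
    define k where "k = 2 / (c4 * b)"
    have k: "k > 0" using c4_pos b by (simp add: k_def)
    define g where "g y = min (max (k * v y - 1) 0) 1" for y
    have gF: "g \<in> F" and gE: "E g g \<le> k\<^sup>2 * E v v"
    proof -
      have kv: "(\<lambda>y. k * v y) \<in> F" by (rule F_scale[OF vF])
      have gm: "g \<in> borel_measurable m" unfolding g_def using F_measurable[OF vF] by measurable
      have 1: "\<bar>g y - g z\<bar> \<le> \<bar>k * v y - k * v z\<bar>" for y z by (auto simp: g_def)
      have 2: "\<bar>g y\<bar> \<le> \<bar>k * v y\<bar>" for y by (auto simp: g_def)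
      show "g \<in> F" "E g g \<le> k\<^sup>2 * E v v"
        using F_contraction1[OF kv gm 1 2] E.B_quad_scale[OF vF, of k] by auto
    qed
    \<comment> \<open>Changes \<open>g\<close> on a null set so that the values 1 and 0 are taken
      everywhere.\<close>
    define \<psi> where "\<psi> y = (if y \<in> B then 1 else if y \<in> ball x (l * r) then g y else 0)" for y
    have ae: "AE y in m. g y = \<psi> y"
      using lo hi
    proof eventually_elim
      case (elim y)
      have "k * (c4 * b) = 2" using c4_pos b by (simp add: k_def)
      moreover have "k * (\<theta> * b) = 1" using c4_pos b by (simp add: k_def \<theta>_def)
      ultimately have "y \<in> B \<Longrightarrow> k * v y \<ge> 2" "y \<in> - ball x (l * r) \<Longrightarrow> k * v y \<le> 1"
        using elim k by (metis mult_le_cancel_left_pos)+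
      then show ?case by (auto simp: \<psi>_def g_def)
    qed
    have "\<psi> = (\<lambda>y. indicat_real B y + (1 - indicat_real B y) * indicat_real (ball x (l * r)) y * g y)"
      by (auto simp: \<psi>_def fun_eq_iff)
    moreover have "B \<in> sets m" unfolding B_def by (rule ball_sets)
    ultimately have "\<psi> \<in> borel_measurable m"
      using F_measurable[OF gF] ball_sets by (auto intro!: borel_measurable_add borel_measurable_times
        borel_measurable_diff borel_measurable_indicator)
    then have pF: "\<psi> \<in> F" by (rule F_cong_AE[OF gF _ ae])
    have "E \<psi> \<psi> = E g g" by (rule E_quad_cong_AE[OF gF pF ae, symmetric])
    also have "\<dots> \<le> k\<^sup>2 * (vol x (\<eta> * r) / (2 * \<Psi> r))"
      using gE vE unfolding innB by (meson mult_left_mono order_trans zero_le_power2)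
    also have "\<dots> = 2 / (c4\<^sup>2 * b) * (vol x r / \<Psi> r)"
      using vB b c4_pos t by (simp add: k_def b_def power2_eq_square field_simps)
    also have "\<dots> \<le> C * (vol x r / \<Psi> r)"
      using bD b c4_pos vB t unfolding C_def by (intro mult_right_mono) (auto simp: field_simps)
    finally have "E \<psi> \<psi> \<le> C * (vol x r / \<Psi> r)" .
    moreover have "\<forall>y\<in>ball x (\<eta> * r). \<psi> y = 1" by (simp add: \<psi>_def B_def)
    moreover have "y \<notin> ball x (l * r) \<longrightarrow> \<psi> y = 0" for y
    proof -
      have "\<eta> * r \<le> l * r" using \<eta>_bounds l2 r by (intro mult_right_mono) auto
      then show ?thesis by (auto simp: \<psi>_def B_def)
    qed
    moreover have "0 \<le> \<psi> y \<and> \<psi> y \<le> 1" for y by (auto simp: \<psi>_def g_def)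
    ultimately show "\<exists>\<psi>\<in>F. (\<forall>y. 0 \<le> \<psi> y \<and> \<psi> y \<le> 1) \<and>
      (\<forall>y\<in>ball x (\<eta> * r). \<psi> y = 1) \<and> (\<forall>y. y \<notin> ball x (l * r) \<longrightarrow> \<psi> y = 0) \<and> E \<psi> \<psi> \<le> C * (vol x r / \<Psi> r)"
      using pF by blast
  qed
qed

end

section \<open>Positive symmetric operators and a variance inequality\<close>

context heat_space
begin

definition posop :: "(('a \<Rightarrow> real) \<Rightarrow> 'a \<Rightarrow> real) \<Rightarrow> bool" where
  "posop S \<longleftrightarrow> (\<forall>u\<in>L2 m. S u \<in> L2 m) \<and>
    (\<forall>u\<in>L2 m. \<forall>v\<in>L2 m. L2_inner m (S u) v = L2_inner m u (S v)) \<and>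
    (\<forall>u\<in>L2 m. (AE x in m. 0 \<le> u x) \<longrightarrow> (AE x in m. 0 \<le> S u x)) \<and>
    (\<forall>u\<in>L2 m. \<forall>v\<in>L2 m. \<forall>a b. AE x in m. S (\<lambda>z. a * u z + b * v z) x = a * S u x + b * S v x)"

lemma posop_L2: "posop S \<Longrightarrow> u \<in> L2 m \<Longrightarrow> S u \<in> L2 m"
  and posop_sym: "posop S \<Longrightarrow> u \<in> L2 m \<Longrightarrow> v \<in> L2 m \<Longrightarrow> L2_inner m (S u) v = L2_inner m u (S v)"
  and posop_pos: "posop S \<Longrightarrow> u \<in> L2 m \<Longrightarrow> AE x in m. 0 \<le> u x \<Longrightarrow> AE x in m. 0 \<le> S u x"
  and posop_lin: "posop S \<Longrightarrow> u \<in> L2 m \<Longrightarrow> v \<in> L2 m \<Longrightarrow> AE x in m. S (\<lambda>z. a * u z + b * v z) x = a * S u x + b * S v x"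
  unfolding posop_def by simp_all

lemma posop_mono:
  assumes S: "posop S" and u: "u \<in> L2 m" and v: "v \<in> L2 m" and le: "AE x in m. u x \<le> v x"
  shows "AE x in m. S u x \<le> S v x"
proof -
  have w: "(\<lambda>z. 1 * v z + (- 1) * u z) \<in> L2 m" by (intro L2_add L2_scale u v)
  have "AE x in m. 0 \<le> S (\<lambda>z. 1 * v z + (- 1) * u z) x"
    by (rule posop_pos[OF S w]) (use le in auto)
  with posop_lin[OF S v u, of 1 "-1"] show ?thesis by eventually_elim simp
qed

lemma posop_cong:
  assumes S: "posop S" and u: "u \<in> L2 m" and v: "v \<in> L2 m" and eq: "AE x in m. u x = v x"
  shows "AE x in m. S u x = S v x"
proof -
  have "AE x in m. S u x \<le> S v x" by (rule posop_mono[OF S u v]) (use eq in auto)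
  moreover have "AE x in m. S v x \<le> S u x" by (rule posop_mono[OF S v u]) (use eq in auto)
  ultimately show ?thesis by eventually_elim simp
qed

lemma posop_funpow:
  assumes S: "posop S" shows "posop (S ^^ n)"
proof (induction n)
  case 0
  then show ?case by (simp add: posop_def)
next
  case (Suc n)
  show ?case
    unfolding posop_def funpow.simps o_def
  proof (intro conjI ballI impI allI)
    fix u v :: "'a \<Rightarrow> real" and a b :: real assume u: "u \<in> L2 m"
    note Su = posop_L2[OF Suc u]
    show "S ((S ^^ n) u) \<in> L2 m" by (rule posop_L2[OF S Su])
    show "AE x in m. 0 \<le> S ((S ^^ n) u) x" if "AE x in m. 0 \<le> u x"
      by (rule posop_pos[OF S Su posop_pos[OF Suc u that]])
    assume v: "v \<in> L2 m"
    note Sv = posop_L2[OF Suc v]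
    show "L2_inner m (S ((S ^^ n) u)) v = L2_inner m u (S ((S ^^ n) v))"
      using posop_sym[OF S Su v] posop_sym[OF Suc u posop_L2[OF S v]] funpow_swap1[of S n v] by simp
    have "AE x in m. S ((S ^^ n) (\<lambda>z. a * u z + b * v z)) x = S (\<lambda>z. a * (S ^^ n) u z + b * (S ^^ n) v z) x"
      by (rule posop_cong[OF S posop_L2[OF Suc L2_add[OF L2_scale[OF u] L2_scale[OF v]]]
            L2_add[OF L2_scale[OF Su] L2_scale[OF Sv]] posop_lin[OF Suc u v]])
    with posop_lin[OF S Su Sv, of a b]
    show "AE x in m. S ((S ^^ n) (\<lambda>z. a * u z + b * v z)) x = a * S ((S ^^ n) u) x + b * S ((S ^^ n) v) x"
      by eventually_elim simp
  qed
qed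

lemma posop_fixed:
  assumes S: "posop S" and u: "u \<in> L2 m" and eq: "AE x in m. S u x = u x"
  shows "AE x in m. (S ^^ n) u x = u x"
proof (induction n)
  case (Suc n)
  have "AE x in m. S ((S ^^ n) u) x = S u x"
    by (rule posop_cong[OF S posop_L2[OF posop_funpow[OF S] u] u Suc])
  with eq show ?case by (simp, eventually_elim) simp
qed simp

text \<open>For symmetric operators \<open>1 - x\<^sup>2 \<le> 2 * (1 - x)\<close> holds in the form sense; only this
  instance of Bernoulli's inequality is needed as the number of steps is a power of two.\<close>

lemma posop_dyadic_energy:
  assumes S: "posop S" and g: "g \<in> L2 m"
  shows "L2_inner m g g - L2_inner m ((S ^^ (2 ^ n)) g) g \<le> 2 ^ n * (L2_inner m g g - L2_inner m (S g) g)"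
proof (induction n)
  case (Suc n)
  let ?R = "S ^^ (2 ^ n)"
  have R: "posop ?R" by (rule posop_funpow[OF S])
  have Rg: "?R g \<in> L2 m" by (rule posop_L2[OF R g])
  have "(S ^^ (2 ^ Suc n)) g = ?R (?R g)" by (simp add: mult_2 funpow_add)
  then have "L2_inner m ((S ^^ (2 ^ Suc n)) g) g = L2_inner m (?R g) (?R g)"
    using posop_sym[OF R Rg g] by simp
  moreover have "0 \<le> L2_inner m g g - 2 * L2_inner m g (?R g) + L2_inner m (?R g) (?R g)"
    using L2.B_quad_diff[OF g Rg] L2_inner_self_nonneg[of m "\<lambda>x. g x - ?R g x"] by simp
  moreover have "L2_inner m g (?R g) = L2_inner m (?R g) g" by (rule L2.B_sym[OF g Rg])
  ultimately show ?case using Suc by simp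
qed simp

text \<open>\<open>R\<close> applied to the square of \<open>a - g\<close>, with \<open>a\<close>
  then set to \<open>g x\<close>, is nonnegative. Formally this integrates the square of
  \<open>g x - g y\<close> against a kernel of \<open>R\<close>; as no kernel of \<open>R\<close> is
  at hand, the operator itself is used.\<close>

lemma posop_quadratic:
  assumes R: "posop R" and B: "B' \<in> sets borel" "bounded B'"
    and g: "g \<in> L2 m" "bdd g" "\<And>x. x \<notin> B' \<Longrightarrow> g x = 0"
  shows "L2_inner m (R g) g \<le> L2_inner m (R (indicator B')) (\<lambda>x. (g x)\<^sup>2)"
proof -
  let ?i = "indicat_real B'"
  let ?g2 = "\<lambda>x. (g x)\<^sup>2"
  have i: "?i \<in> L2 m" by (rule L2_indicator[OF B])
  have g2: "?g2 \<in> L2 m"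
    using L2_mult_bdd[OF g(1) L2_measurable[OF g(1)] g(2)] by (simp add: power2_eq_square)
  have "AE x in m. 0 \<le> a\<^sup>2 * R ?i x - 2 * a * R g x + R ?g2 x" for a
  proof -
    have h1: "(\<lambda>z. a\<^sup>2 * ?i z + (- 2 * a) * g z) \<in> L2 m" by (intro L2_add L2_scale i g)
    have h2: "(\<lambda>z. 1 * (a\<^sup>2 * ?i z + (- 2 * a) * g z) + 1 * ?g2 z) \<in> L2 m" by (intro L2_add L2_scale i g g2)
    have "0 \<le> 1 * (a\<^sup>2 * ?i z + (- 2 * a) * g z) + 1 * ?g2 z" for z
    proof (cases "z \<in> B'")
      case True
      then have "1 * (a\<^sup>2 * ?i z + (- 2 * a) * g z) + 1 * ?g2 z = (a - g z)\<^sup>2" by (simp add: power2_diff)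
      then show ?thesis by simp
    qed (use g(3) in simp)
    then have "AE x in m. 0 \<le> R (\<lambda>z. 1 * (a\<^sup>2 * ?i z + (- 2 * a) * g z) + 1 * ?g2 z) x"
      by (intro posop_pos[OF R h2]) auto
    with posop_lin[OF R h1 g2, of 1 1] posop_lin[OF R i g(1), of "a\<^sup>2" "-2 * a"] show ?thesis
      by eventually_elim simp
  qed
  \<comment> \<open>The exceptional null set depends on \<open>a\<close>. Rational \<open>a\<close>
    leave a single null set, and continuity in \<open>a\<close> then allows
    \<open>a = g x\<close>.\<close>
  then have "AE x in m. \<forall>a\<in>\<rat>. 0 \<le> a\<^sup>2 * R ?i x - 2 * a * R g x + R ?g2 x"
    by (intro AE_ball_countable') (auto simp: countable_rat)
  then have ae: "AE x in m. 0 \<le> ?i x * ((g x)\<^sup>2 * R ?i x - 2 * g x * R g x + R ?g2 x)"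
  proof eventually_elim
    case (elim x)
    have "closed {a. 0 \<le> a\<^sup>2 * R ?i x - 2 * a * R g x + R ?g2 x}"
      by (intro closed_Collect_le continuous_intros)
    then have "closure \<rat> \<subseteq> {a. 0 \<le> a\<^sup>2 * R ?i x - 2 * a * R g x + R ?g2 x}"
      by (rule closure_minimal[rotated]) (use elim in auto)
    then have "0 \<le> (g x)\<^sup>2 * R ?i x - 2 * g x * R g x + R ?g2 x" by (auto simp: Rats_closure_real)
    then show ?case by simp
  qed
  have RL: "R ?i \<in> L2 m" "R g \<in> L2 m" "R ?g2 \<in> L2 m" using posop_L2[OF R] i g g2 by auto
  have gi: "?i x * g x = g x" for x using g(3)[of x] by (cases "x \<in> B'") auto
  have eq: "?i x * ((g x)\<^sup>2 * R ?i x - 2 * g x * R g x + R ?g2 x) = R ?i x * ?g2 x - 2 * (R g x * g x) + R ?g2 x * ?i x" for x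
    using g(3)[of x] by (cases "x \<in> B'") (auto simp: algebra_simps)
  have "0 \<le> (\<integral>x. R ?i x * ?g2 x - 2 * (R g x * g x) + R ?g2 x * ?i x \<partial>m)"
    using ae unfolding eq by (rule integral_nonneg_AE)
  also have "\<dots> = L2_inner m (R ?i) ?g2 - 2 * L2_inner m (R g) g + L2_inner m (R ?g2) ?i"
    using L2_mult_integrable[OF RL(1) g2] L2_mult_integrable[OF RL(2) g(1)] L2_mult_integrable[OF RL(3) i]
    by (simp add: L2_inner_def)
  also have "L2_inner m (R ?g2) ?i = L2_inner m (R ?i) ?g2"
    using posop_sym[OF R g2 i] L2.B_sym[OF g2 RL(1)] by simp
  finally show ?thesis by simp
qed

text \<open>Subtract from \<open>S\<close> the rank-one operator with kernel \<open>\<kappa>\<close>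
  on \<open>B \<times> B\<close>; by \<open>lower\<close> the remainder \<open>R\<close> is still
  positive. Then \<open>posop_quadratic\<close> for \<open>R\<close> is the claim: \<open>S\<close>
  fixes the indicator of \<open>B'\<close>, and the rank-one part contributes the variance on
  \<open>B\<close>.\<close>

lemma posop_variance:
  assumes S: "posop S" and B': "B' \<in> sets borel" "bounded B'" and B: "B \<in> sets borel" "B \<subseteq> B'"
    and S1: "AE x in m. S (indicator B') x = indicator B' x" and k: "\<kappa> \<ge> 0"
    and lower: "\<And>u v. u \<in> L2 m \<Longrightarrow> (\<And>x. u x \<ge> 0) \<Longrightarrow> (\<And>x. x \<notin> B \<Longrightarrow> u x = 0) \<Longrightarrow>
      v \<in> L2 m \<Longrightarrow> (\<And>x. v x \<ge> 0) \<Longrightarrow> (\<And>x. x \<notin> B \<Longrightarrow> v x = 0) \<Longrightarrow>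
      \<kappa> * ((\<integral>x. u x \<partial>m) * (\<integral>x. v x \<partial>m)) \<le> L2_inner m (S u) v"
    and g: "g \<in> L2 m" "bdd g" "\<And>x. x \<notin> B' \<Longrightarrow> g x = 0"
  shows "\<kappa> * (measure m B * (\<integral>x. (g x)\<^sup>2 * indicator B x \<partial>m) - (\<integral>x. g x * indicator B x \<partial>m)\<^sup>2)
    \<le> L2_inner m g g - L2_inner m (S g) g"
proof -
  let ?i = "indicat_real B" and ?i' = "indicat_real B'"
  have bB: "bounded B" using B B' bounded_subset by blast
  have i: "?i \<in> L2 m" "?i' \<in> L2 m" using L2_indicator B B' bB by auto
  define R where "R h x = S h x - \<kappa> * L2_inner m h ?i * ?i x" for h x
  have R_inner: "L2_inner m (R u) v = L2_inner m (S u) v - \<kappa> * L2_inner m u ?i * L2_inner m ?i v"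
    if "u \<in> L2 m" "v \<in> L2 m" for u v
    unfolding R_def using L2.B_diff[OF posop_L2[OF S that(1)] L2_scale[OF i(1)] that(2)] L2.B_scale[OF i(1) that(2)] by simp
  have RL: "R u \<in> L2 m" if "u \<in> L2 m" for u
    unfolding R_def by (intro L2.V_diff posop_L2[OF S that] L2_scale i)
  have R: "posop R"
    unfolding posop_def
  proof (intro conjI ballI impI allI)
    fix u v :: "'a \<Rightarrow> real" and a b :: real assume u: "u \<in> L2 m"
    show "R u \<in> L2 m" by (rule RL[OF u])
    show "AE x in m. 0 \<le> R u x" if pos: "AE x in m. 0 \<le> u x"
    proof -
      \<comment> \<open>\<open>lower\<close> asks for functions that are nonnegative everywhere and
        vanish off \<open>B\<close>.\<close>
      define w where "w x = max (u x) 0 * ?i x" for x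
      have um: "u \<in> borel_measurable m" using u by (rule L2_measurable)
      have wm: "w \<in> borel_measurable m" unfolding w_def using um B by (auto simp: sets_m)
      have w: "w \<in> L2 m" by (rule L2_bound[OF u wm]) (auto simp: w_def indicator_def)
      have wi: "(\<integral>x. w x \<partial>m) = L2_inner m u ?i"
        unfolding L2_inner_def
      proof (rule integral_cong_AE)
        show "AE x in m. w x = u x * ?i x" using pos by eventually_elim (simp add: w_def)
      qed (use wm um L2_measurable[OF i(1)] in auto)
      have le: "AE x in m. S w x \<le> S u x"
        by (rule posop_mono[OF S w u]) (use pos in eventually_elim, auto simp: w_def indicator_def)
      have "AE x in m. 0 \<le> S u x" by (rule posop_pos[OF S u pos])
      moreover have "AE x in m. x \<in> B \<longrightarrow> \<kappa> * (\<integral>x. w x \<partial>m) \<le> S w x"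
      proof (rule AE_ge_from_inner[OF posop_L2[OF S w] B(1)])
        fix A :: "'a set" assume A: "A \<in> sets borel" "bounded A" "A \<subseteq> B"
        have "\<kappa> * ((\<integral>x. w x \<partial>m) * (\<integral>x. indicat_real A x \<partial>m)) \<le> L2_inner m (S w) (indicat_real A)"
          by (rule lower[OF w _ _ L2_indicator[OF A(1,2)]]) (use A in \<open>auto simp: w_def indicator_def\<close>)
        then show "\<kappa> * (\<integral>x. w x \<partial>m) * measure m A \<le> L2_inner m (S w) (indicat_real A)"
          by (simp add: space_m mult.assoc)
      qed
      ultimately show ?thesis using le
        by eventually_elim (auto simp: R_def wi indicator_def)
    qed
    assume v: "v \<in> L2 m"
    show "L2_inner m (R u) v = L2_inner m u (R v)"
      using R_inner[OF u v] R_inner[OF v u] posop_sym[OF S u v] L2.B_sym[OF u posop_L2[OF S v]]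
        L2.B_sym[OF v i(1)] L2.B_sym[OF u i(1)] L2.B_sym[OF u RL[OF v]] by simp
    have "L2_inner m (\<lambda>z. a * u z + b * v z) ?i = a * L2_inner m u ?i + b * L2_inner m v ?i"
      using L2.B_add[OF L2_scale[OF u] L2_scale[OF v] i(1)] L2.B_scale[OF u i(1)] L2.B_scale[OF v i(1)] by simp
    then show "AE x in m. R (\<lambda>z. a * u z + b * v z) x = a * R u x + b * R v x"
      using posop_lin[OF S u v, of a b] by (elim eventually_mono) (simp add: R_def algebra_simps)
  qed
  have g2: "(\<lambda>x. (g x)\<^sup>2) \<in> L2 m"
    using L2_mult_bdd[OF g(1) L2_measurable[OF g(1)] g(2)] by (simp add: power2_eq_square)
  have "L2_inner m (R g) g \<le> L2_inner m (R ?i') (\<lambda>x. (g x)\<^sup>2)"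
    by (rule posop_quadratic[OF R B' g])
  moreover have "L2_inner m (S ?i') (\<lambda>x. (g x)\<^sup>2) = L2_inner m g g"
  proof -
    have "L2_inner m (S ?i') (\<lambda>x. (g x)\<^sup>2) = L2_inner m ?i' (\<lambda>x. (g x)\<^sup>2)"
      by (rule L2_inner_cong_AE) (use S1 posop_L2[OF S i(2)] i g2 in \<open>auto intro!: L2_measurable\<close>)
    also have "\<dots> = L2_inner m g g"
      unfolding L2_inner_def
      by (rule Bochner_Integration.integral_cong) (use g(3) in \<open>auto simp: power2_eq_square indicator_def\<close>)
    finally show ?thesis .
  qed
  moreover have "L2_inner m ?i' ?i = measure m B"
  proof -
    have "(\<lambda>x. ?i' x * ?i x) = ?i" using B by (auto simp: indicator_def fun_eq_iff)
    then show ?thesis using B by (simp add: L2_inner_def space_m)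
  qed
  ultimately have H: "L2_inner m (S g) g - \<kappa> * L2_inner m g ?i * L2_inner m ?i g
      \<le> L2_inner m g g - \<kappa> * measure m B * L2_inner m ?i (\<lambda>x. (g x)\<^sup>2)"
    using R_inner[OF g(1,1)] R_inner[OF i(2) g2] by simp
  have gen: "\<kappa> * (M * c - a\<^sup>2) \<le> gg - sg" if "sg - \<kappa> * a * b \<le> gg - \<kappa> * M * c" "b = a"
    for sg a b gg M c :: real
  proof -
    have "\<kappa> * (M * c - a\<^sup>2) = \<kappa> * M * c - \<kappa> * a * a"
      by (simp only: right_diff_distrib power2_eq_square mult.assoc)
    then show ?thesis using that by simp
  qed
  have e1: "(\<integral>x. (g x)\<^sup>2 * ?i x \<partial>m) = L2_inner m ?i (\<lambda>x. (g x)\<^sup>2)"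
    by (simp add: L2_inner_def mult.commute)
  have e2: "(\<integral>x. g x * ?i x \<partial>m) = L2_inner m g ?i" by (simp add: L2_inner_def)
  show ?thesis unfolding e1 e2 by (rule gen[OF H L2.B_sym[OF i(1) g(1)]])
qed

text \<open>Symmetry of \<open>M t\<close> exchanges its marginals, and the first marginal is at
  most \<open>m\<close>.\<close>

lemma P_L1_contraction:
  assumes t: "t > 0" and u: "u \<in> L2 m" "integrable m u" "AE x in m. u x \<ge> 0"
  shows "integrable m (P t u)" "(\<integral>x. P t u x \<partial>m) \<le> (\<integral>x. u x \<partial>m)"
proof -
  define w where "w x = max (u x) 0" for x
  have um: "u \<in> borel_measurable m" using u(1) by (rule L2_measurable)
  have wm: "w \<in> borel_measurable m" unfolding w_def using um by simp
  have w0: "w x \<ge> 0" for x by (simp add: w_def)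
  have w: "w \<in> L2 m" by (rule L2_bound[OF u(1) wm]) (auto simp: w_def)
  have ae: "AE x in m. u x = w x" using u(3) by eventually_elim (simp add: w_def)
  have wi: "integrable m w" using integrable_cong_AE[OF um wm ae] u(2) by simp
  have Pae: "AE x in m. P t u x = P t w x" by (rule P_cong_AE[OF t u(1) w ae])
  have Pm: "P t u \<in> borel_measurable m" by (rule L2_measurable[OF P_L2[OF t u(1)]])
  have "(\<integral>\<^sup>+x. ennreal (P t u x) \<partial>m) = (\<integral>\<^sup>+x. \<integral>\<^sup>+y. ennreal (p t x y) * ennreal (w y) \<partial>m \<partial>m)"
  proof (rule nn_integral_cong_AE)
    show "AE x in m. ennreal (P t u x) = (\<integral>\<^sup>+y. ennreal (p t x y) * ennreal (w y) \<partial>m)"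
      using Pae P_nn_integral[OF t w w0]
      by eventually_elim (simp add: ennreal_mult'[OF p_nonneg[OF t]])
  qed
  also have "\<dots> = (\<integral>\<^sup>+x. \<integral>\<^sup>+y. ennreal (p t x y) * ennreal (w (snd (x, y))) \<partial>m \<partial>m)" by simp
  also have "\<dots> = (\<integral>\<^sup>+z. ennreal (w (snd z)) \<partial>M t)"
    using wm by (intro nn_integral_M[OF t, symmetric]) simp
  also have "\<dots> = (\<integral>\<^sup>+z. ennreal (w (fst z)) \<partial>M t)"
    using nn_integral_M_swap[OF t, of "\<lambda>z. ennreal (w (fst z))"] wm by simp
  also have "\<dots> \<le> (\<integral>\<^sup>+x. ennreal (w x) \<partial>m)"
    using wm by (intro nn_integral_M_fst_le[OF t]) simp
  also have "\<dots> = ennreal (\<integral>x. w x \<partial>m)"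
    by (rule nn_integral_eq_integral[OF wi]) (simp add: w_def)
  also have "(\<integral>x. w x \<partial>m) = (\<integral>x. u x \<partial>m)"
    by (rule integral_cong_AE) (use um wm ae in auto)
  finally have le: "(\<integral>\<^sup>+x. ennreal (P t u x) \<partial>m) \<le> ennreal (\<integral>x. u x \<partial>m)" .
  have pos: "AE x in m. 0 \<le> P t u x" by (rule P_positive[OF t u(1,3)])
  show i: "integrable m (P t u)"
    by (rule integrableI_nonneg[OF Pm pos]) (use le in \<open>auto simp: top_unique less_top[symmetric]\<close>)
  have "0 \<le> (\<integral>x. u x \<partial>m)" by (rule integral_nonneg_AE[OF u(3)])
  with le show "(\<integral>x. P t u x \<partial>m) \<le> (\<integral>x. u x \<partial>m)"
    using nn_integral_eq_integral[OF i pos] by (simp add: ennreal_le_iff)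
qed

section \<open>Killed and reflected walks in a bounded set\<close>

definition killed_step :: "real \<Rightarrow> 'a set \<Rightarrow> ('a \<Rightarrow> real) \<Rightarrow> 'a \<Rightarrow> real" where
  "killed_step s B u = (\<lambda>x. indicator B x * P s (\<lambda>y. indicator B y * u y) x)"

text \<open>The probability that a step from a point of \<open>B\<close> leaves \<open>B\<close> or
  is lost. Clipping to the unit interval changes nothing almost everywhere, see
  \<open>holding_AE\<close>, and gives the bounds at every point.\<close>

definition holding :: "real \<Rightarrow> 'a set \<Rightarrow> 'a \<Rightarrow> real" where
  "holding s B x = max 0 (min 1 (indicator B x - killed_step s B (indicator B) x))"

text \<open>Killing the walk with step distribution \<open>p s\<close> when it leaves \<open>B\<close> gives \<open>AA\<close>; in \<open>TT\<close>
  a walk that tries to leave \<open>B\<close> stays where it is, so that no mass is lost.\<close>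

definition reflected_step :: "real \<Rightarrow> 'a set \<Rightarrow> ('a \<Rightarrow> real) \<Rightarrow> 'a \<Rightarrow> real" where
  "reflected_step s B u = (\<lambda>x. killed_step s B u x + holding s B x * u x)"

text \<open>\<open>jumpW s B f / s\<close> is a discrete energy of \<open>f\<close> in \<open>B\<close> at time \<open>s\<close>.\<close>

definition jumpW :: "real \<Rightarrow> 'a set \<Rightarrow> ('a \<Rightarrow> real) \<Rightarrow> real" where
  "jumpW s B f = (\<integral>z. indicator B (fst z) * indicator B (snd z) * (f (fst z) - f (snd z))\<^sup>2 \<partial>M s) / 2"

lemma L2_indicator_mult:
  assumes "u \<in> L2 m" "B \<in> sets borel" shows "(\<lambda>x. indicat_real B x * u x) \<in> L2 m"
  by (rule L2_bound[OF assms(1) borel_measurable_times[OF borel_measurable_indicator L2_measurable[OF assms(1)]]])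
    (use assms(2) in \<open>auto simp: indicator_def sets_m\<close>)

lemma killed_step_posop:
  assumes s: "s > 0" and B: "B \<in> sets borel" shows "posop (killed_step s B)"
  unfolding posop_def
proof (intro conjI ballI impI allI)
  fix u v :: "'a \<Rightarrow> real" and a b :: real assume u: "u \<in> L2 m"
  let ?i = "indicat_real B"
  note iu = L2_indicator_mult[OF u B]
  show "killed_step s B u \<in> L2 m" unfolding killed_step_def by (rule L2_indicator_mult[OF P_L2[OF s iu] B])
  show "AE x in m. 0 \<le> killed_step s B u x" if "AE x in m. 0 \<le> u x"
  proof -
    have "AE x in m. 0 \<le> P s (\<lambda>y. ?i y * u y) x"
      by (rule P_positive[OF s iu]) (use that in eventually_elim, auto)
    then show ?thesis by eventually_elim (simp add: killed_step_def)
  qed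
  assume v: "v \<in> L2 m"
  note iv = L2_indicator_mult[OF v B]
  have "L2_inner m (killed_step s B u) v = L2_inner m (P s (\<lambda>y. ?i y * u y)) (\<lambda>y. ?i y * v y)"
    by (simp add: L2_inner_def killed_step_def ac_simps)
  also have "\<dots> = L2_inner m (\<lambda>y. ?i y * u y) (P s (\<lambda>y. ?i y * v y))" by (rule P_sym[OF s iu iv])
  also have "\<dots> = L2_inner m u (killed_step s B v)" by (simp add: L2_inner_def killed_step_def ac_simps)
  finally show "L2_inner m (killed_step s B u) v = L2_inner m u (killed_step s B v)" .
  have "(\<lambda>y. ?i y * (a * u y + b * v y)) = (\<lambda>y. a * (?i y * u y) + b * (?i y * v y))" by (simp add: algebra_simps)
  with P_lin[OF s iu iv, of a b]
  show "AE x in m. killed_step s B (\<lambda>z. a * u z + b * v z) x = a * killed_step s B u x + b * killed_step s B v x"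
    by (auto simp: killed_step_def algebra_simps elim!: eventually_mono)
qed

lemma holding_bounds: "0 \<le> holding s B x" "holding s B x \<le> 1" by (auto simp: holding_def)

lemma holding_measurable:
  assumes "s > 0" "B \<in> sets borel" "bounded B" shows "holding s B \<in> borel_measurable m"
proof -
  have i: "indicat_real B \<in> L2 m" by (rule L2_indicator) fact+
  have [measurable]: "killed_step s B (indicat_real B) \<in> borel_measurable m" "indicat_real B \<in> borel_measurable m"
    using posop_L2[OF killed_step_posop[OF assms(1,2)] i] i L2_measurable by auto
  show ?thesis unfolding holding_def by measurable
qed

lemma holding_mult_L2:
  assumes "s > 0" "B \<in> sets borel" "bounded B" "u \<in> L2 m" shows "(\<lambda>x. holding s B x * u x) \<in> L2 m"
  by (rule L2_bound[OF assms(4) borel_measurable_times[OF holding_measurable[OF assms(1-3)] L2_measurable[OF assms(4)]]])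
    (auto simp: abs_mult holding_bounds intro!: mult_left_le_one_le)

lemma reflected_step_posop:
  assumes s: "s > 0" and B: "B \<in> sets borel" "bounded B" shows "posop (reflected_step s B)"
  unfolding posop_def
proof (intro conjI ballI impI allI)
  fix u v :: "'a \<Rightarrow> real" and a b :: real assume u: "u \<in> L2 m"
  note A = killed_step_posop[OF s B(1)]
  note Au = posop_L2[OF A u] and ku = holding_mult_L2[OF s B u]
  show "reflected_step s B u \<in> L2 m" unfolding reflected_step_def by (rule L2_add[OF Au ku])
  show "AE x in m. 0 \<le> reflected_step s B u x" if "AE x in m. 0 \<le> u x"
    using posop_pos[OF A u that] that by eventually_elim (simp add: reflected_step_def holding_bounds)
  assume v: "v \<in> L2 m"
  note Av = posop_L2[OF A v] and kv = holding_mult_L2[OF s B v]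
  have "L2_inner m (\<lambda>x. holding s B x * u x) v = L2_inner m u (\<lambda>x. holding s B x * v x)"
    by (simp add: L2_inner_def ac_simps)
  then show "L2_inner m (reflected_step s B u) v = L2_inner m u (reflected_step s B v)"
    unfolding reflected_step_def using L2.B_add[OF Au ku v] L2.B_add_right[OF Av kv u] posop_sym[OF A u v] by simp
  show "AE x in m. reflected_step s B (\<lambda>z. a * u z + b * v z) x = a * reflected_step s B u x + b * reflected_step s B v x"
    using posop_lin[OF A u v, of a b] by eventually_elim (simp add: reflected_step_def algebra_simps)
qed

lemma holding_AE:
  assumes s: "s > 0" and B: "B \<in> sets borel" "bounded B"
  shows "AE x in m. holding s B x = indicator B x - killed_step s B (indicator B) x"
proof -
  have i: "indicat_real B \<in> L2 m" by (rule L2_indicator[OF B])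
  have ii: "(\<lambda>y. indicat_real B y * indicat_real B y) = indicat_real B" by (auto simp: indicator_def)
  have "AE x in m. 0 \<le> P s (indicat_real B) x \<and> P s (indicat_real B) x \<le> 1"
    by (rule P_Markov[OF s i]) (auto simp: indicator_def)
  then show ?thesis
  proof eventually_elim
    case (elim x)
    have "killed_step s B (indicator B) x = indicator B x * P s (indicat_real B) x" by (simp add: killed_step_def ii)
    then show ?case using elim by (cases "x \<in> B") (auto simp: holding_def)
  qed
qed

lemma reflected_step_fixed:
  assumes s: "s > 0" and B: "B \<in> sets borel" "bounded B"
  shows "AE x in m. reflected_step s B (indicator B) x = indicator B x"
  using holding_AE[OF assms] by eventually_elim (auto simp: reflected_step_def killed_step_def indicator_def)

lemma reflected_step_ge_killed:
  assumes s: "s > 0" and B: "B \<in> sets borel" "bounded B" and u: "u \<in> L2 m" "AE x in m. 0 \<le> u x"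
  shows "AE x in m. (killed_step s B ^^ k) u x \<le> (reflected_step s B ^^ k) u x"
proof (induction k)
  case (Suc k)
  note A = killed_step_posop[OF s B(1)] and T = reflected_step_posop[OF s B]
  note Ak = posop_L2[OF posop_funpow[OF A] u(1)] and Tk = posop_L2[OF posop_funpow[OF T] u(1)]
  have "AE x in m. 0 \<le> (killed_step s B ^^ k) u x" by (rule posop_pos[OF posop_funpow[OF A] u])
  moreover have "AE x in m. reflected_step s B ((killed_step s B ^^ k) u) x \<le> reflected_step s B ((reflected_step s B ^^ k) u) x"
    by (rule posop_mono[OF T Ak Tk Suc])
  ultimately show ?case
  proof eventually_elim
    case (elim x)
    have "0 \<le> holding s B x * (killed_step s B ^^ k) u x" using elim(1) holding_bounds by simp
    then have "killed_step s B ((killed_step s B ^^ k) u) x \<le> reflected_step s B ((killed_step s B ^^ k) u) x"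
      by (simp add: reflected_step_def[of s B "(killed_step s B ^^ k) u"])
    then show ?case using elim(2) unfolding funpow.simps o_def by (rule order_trans)
  qed
qed simp

text \<open>The reflected walk keeps all mass in \<open>B\<close>, so its energy has no killing term
  and consists of the jumps inside \<open>B\<close> alone.\<close>

lemma reflected_step_energy:
  assumes s: "s > 0" and B: "B \<in> sets borel" "bounded B"
    and g: "g \<in> L2 m" "bdd g" "\<And>x. x \<notin> B \<Longrightarrow> g x = 0"
  shows "L2_inner m g g - L2_inner m (reflected_step s B g) g = jumpW s B g"
proof -
  let ?i = "indicat_real B" and ?g2 = "\<lambda>x. (g x)\<^sup>2"
  have i: "?i \<in> L2 m" by (rule L2_indicator[OF B])
  have g2: "?g2 \<in> L2 m"
    using L2_mult_bdd[OF g(1) L2_measurable[OF g(1)] g(2)] by (simp add: power2_eq_square)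
  have ig: "(\<lambda>y. ?i y * g y) = g" using g(3) by (auto simp: indicator_def fun_eq_iff)
  have ii: "(\<lambda>y. ?i y * ?i y) = ?i" by (auto simp: indicator_def)
  note A = killed_step_posop[OF s B(1)]
  have 1: "L2_inner m (killed_step s B g) g = L2_inner m (P s g) g"
    unfolding L2_inner_def killed_step_def ig
    by (rule Bochner_Integration.integral_cong) (use g(3) in \<open>auto simp: indicator_def\<close>)
  have 2: "L2_inner m (killed_step s B ?i) ?g2 = L2_inner m (P s ?i) ?g2"
    unfolding L2_inner_def killed_step_def ii
    by (rule Bochner_Integration.integral_cong) (use g(3) in \<open>auto simp: indicator_def\<close>)
  have 3: "L2_inner m (\<lambda>x. holding s B x * g x) g = L2_inner m g g - L2_inner m (P s ?i) ?g2"
  proof -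
    have "L2_inner m (\<lambda>x. holding s B x * g x) g = L2_inner m (\<lambda>x. ?i x - killed_step s B ?i x) ?g2"
      unfolding L2_inner_def
    proof (rule integral_cong_AE)
      show "AE x in m. holding s B x * g x * g x = (?i x - killed_step s B ?i x) * (g x)\<^sup>2"
        using holding_AE[OF s B] by eventually_elim (simp add: power2_eq_square)
    qed (use holding_measurable[OF s B] L2_measurable[OF g(1)] L2_measurable[OF i] L2_measurable[OF posop_L2[OF A i]] in auto)
    also have "\<dots> = L2_inner m ?i ?g2 - L2_inner m (killed_step s B ?i) ?g2"
      by (rule L2.B_diff[OF i posop_L2[OF A i] g2])
    also have "L2_inner m ?i ?g2 = L2_inner m g g"
      unfolding L2_inner_def by (rule Bochner_Integration.integral_cong) (use g(3) in \<open>auto simp: indicator_def power2_eq_square\<close>)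
    finally show ?thesis unfolding 2 .
  qed
  have 4: "L2_inner m g g - L2_inner m (reflected_step s B g) g = L2_inner m (P s ?i) ?g2 - L2_inner m (P s g) g"
    unfolding reflected_step_def using L2.B_add[OF posop_L2[OF A g(1)] holding_mult_L2[OF s B g(1)] g(1)] 1 3 by simp
  have i1: "integrable (M s) (\<lambda>z. (g (fst z))\<^sup>2 * ?i (snd z))" by (rule integrable_M_mult[OF s i g2])
  have i2: "integrable (M s) (\<lambda>z. ?i (fst z) * (g (snd z))\<^sup>2)" by (rule integrable_M_mult[OF s g2 i])
  have i3: "integrable (M s) (\<lambda>z. g (fst z) * g (snd z))" by (rule integrable_M_mult[OF s g(1) g(1)])
  have "2 * jumpW s B g = (\<integral>z. (g (fst z))\<^sup>2 * ?i (snd z) + ?i (fst z) * (g (snd z))\<^sup>2 - 2 * (g (fst z) * g (snd z)) \<partial>M s)"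
    unfolding jumpW_def
    by (simp, rule Bochner_Integration.integral_cong) (use g(3) in \<open>auto simp: indicator_def power2_eq_square algebra_simps\<close>)
  also have "\<dots> = L2_inner m (P s ?i) ?g2 + L2_inner m (P s ?g2) ?i - 2 * L2_inner m (P s g) g"
    using i1 i2 i3 by (simp add: inner_P[OF s i g2] inner_P[OF s g2 i] inner_P[OF s g(1) g(1)])
  also have "L2_inner m (P s ?g2) ?i = L2_inner m (P s ?i) ?g2"
    using P_sym[OF s g2 i] L2.B_sym[OF g2 P_L2[OF s i]] by simp
  finally show ?thesis unfolding 4 by simp
qed

end

section \<open>The Poincare inequality with discrete energies\<close>

context hke_space
begin

text \<open>Decompose according to the step at which the walk first leaves
  \<open>ball x (l * r)\<close>. Mass that has left returns to \<open>ball x r\<close> with density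
  at most \<open>\<theta> / vol x r\<close>, whatever the remaining time is, and the total mass that
  leaves is at most the mass lost by the killed walk.\<close>

lemma exit_estimate:
  assumes l2: "l \<ge> 2" and th: "\<theta> \<ge> 0"
    and l: "\<And>x r u v w. r > 0 \<Longrightarrow> 0 < u \<Longrightarrow> u \<le> \<Psi> r \<Longrightarrow>
    v \<in> L2 m \<Longrightarrow> (\<And>y. v y \<ge> 0) \<Longrightarrow> (\<And>y. y \<notin> ball x r \<Longrightarrow> v y = 0) \<Longrightarrow>
    w \<in> L2 m \<Longrightarrow> (\<And>y. w y \<ge> 0) \<Longrightarrow> (\<And>y. y \<in> ball x (l * r) \<Longrightarrow> w y = 0) \<Longrightarrow> integrable m w \<Longrightarrow>
    L2_inner m (P u v) w \<le> \<theta> / vol x r * ((\<integral>y. v y \<partial>m) * (\<integral>y. w y \<partial>m))"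
    and r: "r > 0" and s: "s > 0"
    and v: "v \<in> L2 m" "\<And>y. v y \<ge> 0" "\<And>y. y \<notin> ball x r \<Longrightarrow> v y = 0"
    and k: "k \<ge> 1" "real k * s \<le> \<Psi> r"
    and u: "u \<in> L2 m" "AE y in m. u y \<ge> 0" "\<And>y. y \<notin> ball x (l * r) \<Longrightarrow> u y = 0"
  shows "L2_inner m (P (real k * s) u) v \<le> L2_inner m ((killed_step s (ball x (l * r)) ^^ k) u) v +
    \<theta> / vol x r * (\<integral>y. v y \<partial>m) * ((\<integral>y. u y \<partial>m) - (\<integral>y. (killed_step s (ball x (l * r)) ^^ k) u y \<partial>m))"
  using k u
proof (induction k arbitrary: u rule: nat_induct_at_least)
  define B where "B = ball x (l * r)"
  define A where "A = killed_step s B"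
  define V where "V = \<theta> / vol x r * (\<integral>y. v y \<partial>m)"
  have V0: "V \<ge> 0" unfolding V_def using th vol_pos[OF r, of x] v(2)
    by (intro mult_nonneg_nonneg Bochner_Integration.integral_nonneg) auto
  have B: "B \<in> sets borel" "bounded B" by (auto simp: B_def)
  have Apos: "posop A" unfolding A_def by (rule killed_step_posop[OF s B(1)])
  have rl: "ball x r \<subseteq> B" using l2 r by (auto simp: B_def) (smt (verit) mult_le_cancel_right1)
  \<comment> \<open>One step: \<open>q\<close> is the part of \<open>P s u\<close> that lands
    outside \<open>B\<close>; its mass is at most what killing removes.\<close>
  have split: "\<exists>q. q \<in> L2 m \<and> (\<forall>y. q y \<ge> 0) \<and> (\<forall>y\<in>B. q y = 0) \<and> integrable m q \<and>
      (AE y in m. P s u y = A u y + q y) \<and> (\<integral>y. q y \<partial>m) + (\<integral>y. A u y \<partial>m) \<le> (\<integral>y. u y \<partial>m)"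
    if u: "u \<in> L2 m" "AE y in m. u y \<ge> 0" "\<And>y. y \<notin> B \<Longrightarrow> u y = 0" for u
  proof -
    have iu: "integrable m u" by (rule L2_integrable_on_bounded[OF u(1,3) B(2)])
    have Pu: "P s u \<in> L2 m" by (rule P_L2[OF s u(1)])
    have Pi: "integrable m (P s u)" "(\<integral>y. P s u y \<partial>m) \<le> (\<integral>y. u y \<partial>m)"
      using P_L1_contraction[OF s u(1) iu u(2)] by auto
    have Pp: "AE y in m. 0 \<le> P s u y" by (rule P_positive[OF s u(1,2)])
    have iu_eq: "(\<lambda>y. indicator B y * u y) = u" using u(3) by (auto simp: indicator_def fun_eq_iff)
    have Aeq: "A u y = indicator B y * P s u y" for y by (simp add: A_def killed_step_def iu_eq)
    define q where "q y = max 0 ((1 - indicat_real B y) * P s u y)" for y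
    have qm: "q \<in> borel_measurable m" unfolding q_def using L2_measurable[OF Pu] B by (simp add: sets_m)
    have q: "q \<in> L2 m" by (rule L2_bound[OF Pu qm]) (auto simp: q_def indicator_def)
    have qi: "integrable m q"
      by (rule Bochner_Integration.integrable_bound[OF Pi(1) qm]) (auto simp: q_def indicator_def)
    have AL: "A u \<in> L2 m" by (rule posop_L2[OF Apos u(1)])
    have Ai: "integrable m (A u)"
      by (rule Bochner_Integration.integrable_bound[OF Pi(1) L2_measurable[OF AL]]) (auto simp: Aeq indicator_def)
    have ae: "AE y in m. P s u y = A u y + q y"
      using Pp by eventually_elim (auto simp: Aeq q_def indicator_def)
    have "(\<integral>y. P s u y \<partial>m) = (\<integral>y. A u y + q y \<partial>m)"
      by (rule integral_cong_AE) (use ae L2_measurable[OF Pu] L2_measurable[OF AL] qm in auto)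
    then have "(\<integral>y. q y \<partial>m) + (\<integral>y. A u y \<partial>m) \<le> (\<integral>y. u y \<partial>m)" using Pi(2) Ai qi by simp
    then show ?thesis using q qi ae by (intro exI[of _ q]) (auto simp: q_def)
  qed
  have Azero: "A w y = 0" if "y \<notin> B" for w y using that by (simp add: A_def killed_step_def)
  {
    case base
    obtain q where q: "q \<in> L2 m" "\<And>y. q y \<ge> 0" "\<And>y. y \<in> B \<Longrightarrow> q y = 0" "integrable m q"
      "AE y in m. P s u y = A u y + q y" "(\<integral>y. q y \<partial>m) + (\<integral>y. A u y \<partial>m) \<le> (\<integral>y. u y \<partial>m)"
      using split[OF base(2,3)] base(4) by (auto simp: B_def)
    have Au: "A u \<in> L2 m" by (rule posop_L2[OF Apos base(2)])
    have "L2_inner m (P s u) v = L2_inner m (A u) v"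
      unfolding L2_inner_def
    proof (rule integral_cong_AE)
      show "AE y in m. P s u y * v y = A u y * v y"
        using q(5)
      proof eventually_elim
        case (elim y)
        have "y \<in> B \<or> v y = 0" using rl v(3) by blast
        then show ?case using elim q(3)[of y] by auto
      qed
    qed (use L2_measurable[OF P_L2[OF s base(2)]] L2_measurable[OF Au] L2_measurable[OF v(1)] in auto)
    moreover have "0 \<le> V * ((\<integral>y. u y \<partial>m) - (\<integral>y. A u y \<partial>m))"
    proof -
      have "0 \<le> (\<integral>y. q y \<partial>m)" by (intro Bochner_Integration.integral_nonneg q(2))
      then show ?thesis using V0 q(6) by (intro mult_nonneg_nonneg) auto
    qed
    ultimately show ?case by (simp add: A_def B_def V_def)
  next
    case (Suc k)
    obtain q where q: "q \<in> L2 m" "\<And>y. q y \<ge> 0" "\<And>y. y \<in> B \<Longrightarrow> q y = 0" "integrable m q"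
      "AE y in m. P s u y = A u y + q y" "(\<integral>y. q y \<partial>m) + (\<integral>y. A u y \<partial>m) \<le> (\<integral>y. u y \<partial>m)"
      using split[OF Suc.prems(2,3)] Suc.prems(4) by (auto simp: B_def)
    have Au: "A u \<in> L2 m" by (rule posop_L2[OF Apos Suc.prems(2)])
    have ks: "real k * s > 0" "real k * s \<le> \<Psi> r"
      using Suc.hyps Suc.prems(1) s by (auto simp: distrib_right)
    have "L2_inner m (P (real (Suc k) * s) u) v = L2_inner m (P (real k * s) (\<lambda>y. A u y + q y)) v"
    proof (rule L2_inner_cong_AE)
      have "AE y in m. P (real k * s + s) u y = P (real k * s) (P s u) y"
        by (rule P_semigroup[OF ks(1) s Suc.prems(2)])
      moreover have "AE y in m. P (real k * s) (P s u) y = P (real k * s) (\<lambda>y. A u y + q y) y"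
        by (rule P_cong_AE[OF ks(1) P_L2[OF s Suc.prems(2)] L2_add[OF Au q(1)] q(5)])
      moreover have "real (Suc k) * s = real k * s + s" by (simp add: distrib_right)
      ultimately show "AE y in m. P (real (Suc k) * s) u y = P (real k * s) (\<lambda>y. A u y + q y) y"
        by auto
      show "P (real (Suc k) * s) u \<in> borel_measurable m"
        using s by (intro L2_measurable P_L2 Suc.prems) auto
      show "P (real k * s) (\<lambda>y. A u y + q y) \<in> borel_measurable m"
        by (intro L2_measurable P_L2 L2_add Au q ks)
    qed (use L2_measurable[OF v(1)] in auto)
    also have "\<dots> = L2_inner m (P (real k * s) (A u)) v + L2_inner m (P (real k * s) q) v"
      by (rule P_add[OF ks(1) Au q(1) v(1)])
    \<comment> \<open>\<open>q\<close> evolves for the remaining \<open>k\<close> steps and falls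
      under the off-diagonal bound, \<open>A u\<close> under the induction hypothesis; the lost
      masses telescope.\<close>
    also have "\<dots> \<le> (L2_inner m ((A ^^ k) (A u)) v + V * ((\<integral>y. A u y \<partial>m) - (\<integral>y. (A ^^ k) (A u) y \<partial>m))) + V * (\<integral>y. q y \<partial>m)"
    proof (rule add_mono)
      show "L2_inner m (P (real k * s) (A u)) v
          \<le> L2_inner m ((A ^^ k) (A u)) v + V * ((\<integral>y. A u y \<partial>m) - (\<integral>y. (A ^^ k) (A u) y \<partial>m))"
        using Suc.IH[OF ks(2) Au posop_pos[OF Apos Suc.prems(2,3)]] Azero by (simp add: A_def B_def V_def)
      have "L2_inner m (P (real k * s) q) v = L2_inner m (P (real k * s) v) q"
        using P_sym[OF ks(1) q(1) v(1)] L2.B_sym[OF q(1) P_L2[OF ks(1) v(1)]] by simp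
      also have "\<dots> \<le> \<theta> / vol x r * ((\<integral>y. v y \<partial>m) * (\<integral>y. q y \<partial>m))"
        by (rule l[OF r ks v q(1,2) _ q(4)]) (use q(3) in \<open>auto simp: B_def\<close>)
      finally show "L2_inner m (P (real k * s) q) v \<le> V * (\<integral>y. q y \<partial>m)" by (simp add: V_def mult.assoc)
    qed
    also have "\<dots> \<le> L2_inner m ((A ^^ k) (A u)) v + V * ((\<integral>y. u y \<partial>m) - (\<integral>y. (A ^^ k) (A u) y \<partial>m))"
      using mult_left_mono[OF q(6) V0] by (simp add: distrib_left right_diff_distrib)
    also have "(A ^^ k) (A u) = (A ^^ Suc k) u" by (simp add: funpow_swap1)
    finally show ?case by (simp add: A_def B_def V_def)
  }
qed

text \<open>The lower bound at time \<open>\<Psi> r\<close> has constant \<open>c4\<close>, and by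
  \<open>exit_estimate\<close> at most half of it, \<open>\<theta> = c4 / 2\<close>, comes from
  paths that leave \<open>ball x (l * r)\<close>. So \<open>2 ^ n\<close> steps of the killed walk,
  and hence of the reflected one, keep the lower bound \<open>c4 / 2\<close> for every
  \<open>n\<close>; the variance is then bounded by \<open>2 ^ n\<close> times the energy of a
  single reflected step.\<close>

lemma poincare_raw:
  obtains l where "l \<ge> 2" "\<And>x r n f. r > 0 \<Longrightarrow> f \<in> L2 m \<Longrightarrow> bdd f \<Longrightarrow>
    c4 / (2 * vol x r) * (vol x (\<eta> * r) * (\<integral>y. (f y)\<^sup>2 * indicator (ball x (\<eta> * r)) y \<partial>m)
      - (\<integral>y. f y * indicator (ball x (\<eta> * r)) y \<partial>m)\<^sup>2) \<le> 2 ^ n * jumpW (\<Psi> r / 2 ^ n) (ball x (l * r)) f"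
proof -
  define \<theta> where "\<theta> = c4 / 2"
  have th: "\<theta> > 0" using c4_pos by (simp add: \<theta>_def)
  obtain l where l2: "l \<ge> 2" and l: "\<And>x r u v w. r > 0 \<Longrightarrow> 0 < u \<Longrightarrow> u \<le> \<Psi> r \<Longrightarrow>
    v \<in> L2 m \<Longrightarrow> (\<And>y. v y \<ge> 0) \<Longrightarrow> (\<And>y. y \<notin> ball x r \<Longrightarrow> v y = 0) \<Longrightarrow>
    w \<in> L2 m \<Longrightarrow> (\<And>y. w y \<ge> 0) \<Longrightarrow> (\<And>y. y \<in> ball x (l * r) \<Longrightarrow> w y = 0) \<Longrightarrow> integrable m w \<Longrightarrow>
    L2_inner m (P u v) w \<le> \<theta> / vol x r * ((\<integral>y. v y \<partial>m) * (\<integral>y. w y \<partial>m))"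
    using off_diagonal_upper[OF th] by blast
  show thesis
  proof (rule that[OF l2])
    fix x :: 'a and r :: real and n :: nat and f assume r: "r > 0" and f: "f \<in> L2 m" "bdd f"
    define B' where "B' = ball x (l * r)"
    define B where "B = ball x (\<eta> * r)"
    define s where "s = \<Psi> r / 2 ^ n"
    have s: "s > 0" using \<Psi>_pos[OF r] by (simp add: s_def)
    have B': "B' \<in> sets borel" "bounded B'" by (auto simp: B'_def)
    have sub: "\<eta> * r \<le> r" "r \<le> l * r" using \<eta>_bounds l2 r by auto
    have BB: "B \<subseteq> ball x r" "B \<subseteq> B'" using sub by (auto simp: B_def B'_def)
    have Bm: "B \<in> sets borel" "bounded B" by (auto simp: B_def)
    define S where "S = reflected_step s B' ^^ (2 ^ n)"
    note T = reflected_step_posop[OF s B']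
    note A = killed_step_posop[OF s B'(1)]
    have S: "posop S" unfolding S_def by (rule posop_funpow[OF T])
    have i': "indicat_real B' \<in> L2 m" by (rule L2_indicator[OF B'])
    have S1: "AE y in m. S (indicator B') y = indicator B' y"
      unfolding S_def by (rule posop_fixed[OF T i' reflected_step_fixed[OF s B']])
    have lower: "c4 / (2 * vol x r) * ((\<integral>y. u y \<partial>m) * (\<integral>y. v y \<partial>m)) \<le> L2_inner m (S u) v"
      if u: "u \<in> L2 m" "\<And>y. u y \<ge> 0" "\<And>y. y \<notin> B \<Longrightarrow> u y = 0"
        and v: "v \<in> L2 m" "\<And>y. v y \<ge> 0" "\<And>y. y \<notin> B \<Longrightarrow> v y = 0" for u v
    proof -
      have up: "AE y in m. 0 \<le> u y" using u(2) by simp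
      have vr: "v y = 0" if "y \<notin> ball x r" for y using v(3) BB(1) that by blast
      have ul: "u y = 0" if "y \<notin> ball x (l * r)" for y using u(3) BB(2) that unfolding B'_def by blast
      have N: "(1::nat) \<le> 2 ^ n" "real (2 ^ n) * s \<le> \<Psi> r" by (auto simp: s_def)
      have Ns: "real (2 ^ n) * s = \<Psi> r" by (simp add: s_def)
      have AN: "(killed_step s B' ^^ (2 ^ n)) u \<in> L2 m" by (rule posop_L2[OF posop_funpow[OF A] u(1)])
      have "c4 / vol x r * ((\<integral>y. u y \<partial>m) * (\<integral>y. v y \<partial>m)) \<le> L2_inner m (P (\<Psi> r) u) v"
        by (rule near_diagonal_lower[OF r u(1,2) _ v(1,2)]) (use u(3) v(3) in \<open>auto simp: B_def\<close>)
      also have "\<dots> \<le> L2_inner m ((killed_step s B' ^^ (2 ^ n)) u) v + \<theta> / vol x r * (\<integral>y. v y \<partial>m) *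
          ((\<integral>y. u y \<partial>m) - (\<integral>y. (killed_step s B' ^^ (2 ^ n)) u y \<partial>m))"
        unfolding B'_def Ns[symmetric]
        by (rule exit_estimate[OF l2 less_imp_le[OF th] l r s v(1,2) vr N u(1) up ul])
      also have "\<dots> \<le> L2_inner m ((killed_step s B' ^^ (2 ^ n)) u) v + \<theta> / vol x r * (\<integral>y. v y \<partial>m) * (\<integral>y. u y \<partial>m)"
      proof -
        have "0 \<le> (\<integral>y. (killed_step s B' ^^ (2 ^ n)) u y \<partial>m)"
          by (rule integral_nonneg_AE[OF posop_pos[OF posop_funpow[OF A] u(1) up]])
        moreover have "0 \<le> \<theta> / vol x r * (\<integral>y. v y \<partial>m)"
          using th vol_pos[OF r, of x] v(2) by (intro mult_nonneg_nonneg Bochner_Integration.integral_nonneg) auto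
        ultimately show ?thesis by (intro add_left_mono mult_left_mono) auto
      qed
      finally have 1: "c4 / vol x r * ((\<integral>y. u y \<partial>m) * (\<integral>y. v y \<partial>m))
          \<le> L2_inner m ((killed_step s B' ^^ (2 ^ n)) u) v + \<theta> / vol x r * (\<integral>y. v y \<partial>m) * (\<integral>y. u y \<partial>m)" .
      have "L2_inner m ((killed_step s B' ^^ (2 ^ n)) u) v \<le> L2_inner m (S u) v"
        unfolding L2_inner_def
      proof (rule integral_mono_AE[OF L2_mult_integrable[OF AN v(1)] L2_mult_integrable[OF posop_L2[OF S u(1)] v(1)]])
        show "AE y in m. (killed_step s B' ^^ (2 ^ n)) u y * v y \<le> S u y * v y"
          using reflected_step_ge_killed[OF s B' u(1) up, of "2 ^ n"] v(2) unfolding S_def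
          by (elim eventually_mono) (rule mult_right_mono)
      qed
      from order_trans[OF 1 add_right_mono[OF this]]
      have *: "c4 / vol x r * ((\<integral>y. u y \<partial>m) * (\<integral>y. v y \<partial>m))
          \<le> L2_inner m (S u) v + \<theta> / vol x r * (\<integral>y. v y \<partial>m) * (\<integral>y. u y \<partial>m)" .
      have "c4 / (2 * V) * (a * b) \<le> c" if "c4 / V * (a * b) \<le> c + \<theta> / V * b * a" for V a b c :: real
      proof -
        have e1: "c4 / V * (a * b) = 2 * (c4 / (2 * V) * (a * b))" by simp
        have e2: "\<theta> / V * b * a = c4 / (2 * V) * (a * b)" unfolding \<theta>_def by (simp only: divide_divide_eq_left times_divide_eq_left ac_simps)
        show ?thesis using that unfolding e1 e2 by (simp only: mult_2 add_le_cancel_right)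
      qed
      from this[OF *] show ?thesis .
    qed
    \<comment> \<open>Cutting \<open>f\<close> to \<open>B'\<close> affects neither the variance on
      \<open>B\<close> nor the jumps inside \<open>B'\<close>.\<close>
    define g where "g y = indicat_real B' y * f y" for y
    have g: "g \<in> L2 m" "bdd g" "\<And>y. y \<notin> B' \<Longrightarrow> g y = 0"
      unfolding g_def using L2_indicator_mult[OF f(1) B'(1)] bdd_mult[OF bddI[of "indicat_real B'" 1] f(2)]
      by (auto simp: indicator_def)
    have "c4 / (2 * vol x r) * (measure m B * (\<integral>y. (g y)\<^sup>2 * indicator B y \<partial>m) - (\<integral>y. g y * indicator B y \<partial>m)\<^sup>2)
        \<le> L2_inner m g g - L2_inner m (S g) g"
      using c4_pos vol_pos[OF r, of x]
      by (intro posop_variance[OF S B' Bm(1) BB(2) S1 _ lower g]) auto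
    also have "\<dots> \<le> 2 ^ n * (L2_inner m g g - L2_inner m (reflected_step s B' g) g)"
      unfolding S_def by (rule posop_dyadic_energy[OF T g(1)])
    also have "L2_inner m g g - L2_inner m (reflected_step s B' g) g = jumpW s B' g" by (rule reflected_step_energy[OF s B' g])
    also have "jumpW s B' g = jumpW s B' f"
      unfolding jumpW_def by (intro arg_cong[of _ _ "\<lambda>x. x / 2"] Bochner_Integration.integral_cong) (auto simp: g_def indicator_def)
    also have "(\<integral>y. (g y)\<^sup>2 * indicator B y \<partial>m) = (\<integral>y. (f y)\<^sup>2 * indicator B y \<partial>m)"
      by (rule Bochner_Integration.integral_cong) (use BB in \<open>auto simp: g_def indicator_def\<close>)
    also have "(\<integral>y. g y * indicator B y \<partial>m) = (\<integral>y. f y * indicator B y \<partial>m)"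
      by (rule Bochner_Integration.integral_cong) (use BB in \<open>auto simp: g_def indicator_def\<close>)
    finally show "c4 / (2 * vol x r) * (vol x (\<eta> * r) * (\<integral>y. (f y)\<^sup>2 * indicator (ball x (\<eta> * r)) y \<partial>m)
      - (\<integral>y. f y * indicator (ball x (\<eta> * r)) y \<partial>m)\<^sup>2) \<le> 2 ^ n * jumpW (\<Psi> r / 2 ^ n) (ball x (l * r)) f"
      by (simp add: B_def B'_def s_def)
  qed
qed

end

section \<open>Localised discrete energies and averages\<close>

context heat_space
begin

lemma jumpW_integrable:
  assumes s: "s > 0" and W: "W \<in> sets borel" and f: "f \<in> L2 m"
  shows "integrable (M s) (\<lambda>z. indicat_real W (fst z) * indicat_real W (snd z) * (f (fst z) - f (snd z))\<^sup>2)"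
proof (rule Bochner_Integration.integrable_bound[OF integrable_M_sq_diff[OF s f]])
  have i: "indicat_real W \<in> borel_measurable m" using W by (simp add: sets_m)
  have [measurable]: "(\<lambda>z. indicat_real W (fst z)) \<in> borel_measurable (m \<Otimes>\<^sub>M m)" "(\<lambda>z. indicat_real W (snd z)) \<in> borel_measurable (m \<Otimes>\<^sub>M m)"
    "(\<lambda>z. f (fst z)) \<in> borel_measurable (m \<Otimes>\<^sub>M m)" "(\<lambda>z. f (snd z)) \<in> borel_measurable (m \<Otimes>\<^sub>M m)"
    using i L2_measurable[OF f] by (auto intro: measurable_compose[OF measurable_fst] measurable_compose[OF measurable_snd])
  have "(\<lambda>z. indicat_real W (fst z) * indicat_real W (snd z) * (f (fst z) - f (snd z))\<^sup>2) \<in> borel_measurable (m \<Otimes>\<^sub>M m)"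
    by measurable
  then show "(\<lambda>z. indicat_real W (fst z) * indicat_real W (snd z) * (f (fst z) - f (snd z))\<^sup>2) \<in> borel_measurable (M s)"
    by (simp add: measurable_cong_sets[OF sets_M refl])
  show "AE z in M s. norm (indicat_real W (fst z) * indicat_real W (snd z) * (f (fst z) - f (snd z))\<^sup>2)
    \<le> norm ((f (fst z) - f (snd z))\<^sup>2)"
    by (rule AE_I2) (auto simp: indicator_def)
qed

lemma jumpW_nonneg: "jumpW s W f \<ge> 0"
  by (auto simp: jumpW_def intro!: Bochner_Integration.integral_nonneg)

text \<open>A pair of points is counted only by those \<open>j\<close> for which its first point
  lies in \<open>W j\<close>, at most \<open>N\<close> of them.\<close>

lemma jumpW_sum_le:
  assumes s: "s > 0" and f: "f \<in> L2 m" and J: "finite J" and W: "\<And>j. j \<in> J \<Longrightarrow> W j \<in> sets borel"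
    and W': "W' \<in> sets borel" and sub: "\<And>j. j \<in> J \<Longrightarrow> W j \<subseteq> W'" and N: "\<And>x. card {j\<in>J. x \<in> W j} \<le> N"
  shows "(\<Sum>j\<in>J. jumpW s (W j) f) \<le> real N * jumpW s W' f"
proof -
  let ?d = "\<lambda>z. (f (fst z) - f (snd z))\<^sup>2"
  have "(\<Sum>j\<in>J. jumpW s (W j) f) = (\<integral>z. (\<Sum>j\<in>J. indicat_real (W j) (fst z) * indicat_real (W j) (snd z) * ?d z) \<partial>M s) / 2"
    using jumpW_integrable[OF s W f] by (simp add: jumpW_def sum_divide_distrib)
  also have "\<dots> \<le> (\<integral>z. real N * (indicat_real W' (fst z) * indicat_real W' (snd z) * ?d z) \<partial>M s) / 2"
  proof (intro divide_right_mono integral_mono)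
    fix z
    have "(\<Sum>j\<in>J. indicat_real (W j) (fst z) * indicat_real (W j) (snd z)) \<le> real N * (indicat_real W' (fst z) * indicat_real W' (snd z))"
    proof (cases "fst z \<in> W' \<and> snd z \<in> W'")
      case True
      have "(\<Sum>j\<in>J. indicat_real (W j) (fst z) * indicat_real (W j) (snd z)) \<le> (\<Sum>j\<in>J. indicat_real (W j) (fst z))"
        by (intro sum_mono) (auto simp: indicator_def)
      also have "\<dots> = real (card {j\<in>J. fst z \<in> W j})"
        using J by (simp add: indicator_def sum.If_cases of_bool_def Int_def)
      also have "\<dots> \<le> real N" using N by simp
      finally show ?thesis using True by simp
    next
      case False
      have "indicat_real (W j) (fst z) * indicat_real (W j) (snd z) = 0" if "j \<in> J" for j
        using False sub[OF that] by (auto simp: indicator_def)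
      then have "(\<Sum>j\<in>J. indicat_real (W j) (fst z) * indicat_real (W j) (snd z)) = 0" by (intro sum.neutral) auto
      then show ?thesis by simp
    qed
    from mult_right_mono[OF this, of "?d z"]
    show "(\<Sum>j\<in>J. indicat_real (W j) (fst z) * indicat_real (W j) (snd z) * ?d z)
      \<le> real N * (indicat_real W' (fst z) * indicat_real W' (snd z) * ?d z)"
      by (simp add: sum_distrib_right mult.assoc)
  qed (use jumpW_integrable[OF s W f] jumpW_integrable[OF s W' f] in auto)
  also have "\<dots> = real N * jumpW s W' f" by (simp add: jumpW_def)
  finally show ?thesis .
qed

lemma jumpW_mono:
  assumes "s > 0" "f \<in> L2 m" "W \<in> sets borel" "W' \<in> sets borel" "W \<subseteq> W'"
  shows "jumpW s W f \<le> jumpW s W' f"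
  using jumpW_sum_le[of s f "{()}" "\<lambda>_. W" W' 1] assms by (simp add: Collect_conv_if)

lemma jumpW_le_E:
  assumes s: "s > 0" and f: "f \<in> F" and W: "W \<in> sets borel"
  shows "jumpW s W f \<le> s * E f f"
proof -
  have fL: "f \<in> L2 m" by (rule F_L2[OF f])
  have "jumpW s W f \<le> jumpW s UNIV f" by (rule jumpW_mono[OF s fL W]) auto
  also have "\<dots> = jump s f / 2" by (simp add: jumpW_def jump_def)
  also have "\<dots> \<le> jump s f / 2 + killing s (\<lambda>x. (f x)\<^sup>2)"
    using killing_nonneg[OF s L2_sq_integrable[OF fL]] by simp
  also have "\<dots> = s * step_form s f f" using step_form_jump[OF s fL] s by simp
  also have "\<dots> \<le> s * E f f" using step_form_le_E[OF f s] s by (intro mult_left_mono) auto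
  finally show ?thesis .
qed

definition avg :: "('a \<Rightarrow> real) \<Rightarrow> 'a set \<Rightarrow> real" where
  "avg f A = (\<integral>x. f x * indicator A x \<partial>m) / measure m A"

text \<open>Both averages are compared with the mean over \<open>B\<close> by Cauchy-Schwarz; the
  last bracket is the integral over \<open>B\<close> of the squared deviation from that
  mean.\<close>

lemma avg_diff_le:
  assumes f: "f \<in> L2 m" and B: "B \<in> sets borel" "bounded B"
    and A1: "A1 \<in> sets borel" "A1 \<subseteq> B" "measure m A1 > 0" and A2: "A2 \<in> sets borel" "A2 \<subseteq> B" "measure m A2 > 0"
  shows "(avg f A1 - avg f A2)\<^sup>2 \<le> 2 * (1 / measure m A1 + 1 / measure m A2) *
    ((\<integral>x. (f x)\<^sup>2 * indicator B x \<partial>m) - (\<integral>x. f x * indicator B x \<partial>m)\<^sup>2 / measure m B)"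
proof -
  let ?i = "indicat_real B"
  have i: "?i \<in> L2 m" by (rule L2_indicator[OF B])
  have mB: "measure m B > 0" using A1 measure_mono_bounded[OF A1(2) B(2,1)] by simp
  define c where "c = avg f B"
  define h where "h x = (f x - c) * ?i x" for x
  have hL: "h \<in> L2 m"
  proof -
    have "(\<lambda>x. ?i x * f x - c * ?i x) \<in> L2 m" by (intro L2.V_diff L2_indicator_mult[OF f B(1)] L2_scale i)
    moreover have "(\<lambda>x. ?i x * f x - c * ?i x) = h" by (auto simp: h_def algebra_simps)
    ultimately show ?thesis by simp
  qed
  define Var where "Var = (\<integral>x. (f x)\<^sup>2 * indicator B x \<partial>m) - (\<integral>x. f x * indicator B x \<partial>m)\<^sup>2 / measure m B"
  have hh: "L2_inner m h h = Var"
  proof -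
    have i1: "integrable m (\<lambda>x. (f x)\<^sup>2 * ?i x)"
      using L2_mult_integrable[OF f L2_indicator_mult[OF f B(1)]] by (simp add: power2_eq_square ac_simps)
    have i2: "integrable m (\<lambda>x. f x * ?i x)" by (rule L2_mult_integrable[OF f i])
    have "L2_inner m h h = (\<integral>x. (f x)\<^sup>2 * ?i x - 2 * c * (f x * ?i x) + c\<^sup>2 * ?i x \<partial>m)"
      unfolding L2_inner_def
      by (rule Bochner_Integration.integral_cong) (auto simp: h_def indicator_def power2_eq_square algebra_simps)
    also have "\<dots> = (\<integral>x. (f x)\<^sup>2 * ?i x \<partial>m) - 2 * c * (\<integral>x. f x * ?i x \<partial>m) + c\<^sup>2 * measure m B"
      using i1 i2 integrable_indicator_bounded[OF B] by (simp add: space_m)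
    also have "(\<integral>x. f x * ?i x \<partial>m) = c * measure m B" using mB by (simp add: c_def avg_def)
    finally show ?thesis using mB by (simp add: Var_def c_def avg_def power2_eq_square)
  qed
  have one: "(avg f A - c)\<^sup>2 \<le> 1 / measure m A * Var"
    if A: "A \<in> sets borel" "A \<subseteq> B" "measure m A > 0" for A
  proof -
    have bA: "bounded A" using A B bounded_subset by blast
    have iA: "indicat_real A \<in> L2 m" by (rule L2_indicator[OF A(1) bA])
    have "L2_inner m h (indicat_real A) = (\<integral>x. f x * indicat_real A x - c * indicat_real A x \<partial>m)"
      unfolding L2_inner_def
      by (rule Bochner_Integration.integral_cong) (use A(2) in \<open>auto simp: h_def indicator_def algebra_simps\<close>)
    also have "\<dots> = (avg f A - c) * measure m A"
      using L2_mult_integrable[OF f iA] integrable_indicator_bounded[OF A(1) bA] A(3)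
      by (simp add: space_m avg_def left_diff_distrib)
    finally have 1: "L2_inner m h (indicat_real A) = (avg f A - c) * measure m A" .
    have "(\<lambda>x. indicat_real A x * indicat_real A x) = indicat_real A" by (auto simp: indicator_def)
    then have 2: "L2_inner m (indicat_real A) (indicat_real A) = measure m A" by (simp add: L2_inner_def space_m)
    have "((avg f A - c) * measure m A)\<^sup>2 \<le> Var * measure m A"
      using L2.Cauchy_Schwarz[OF hL iA] unfolding 1 2 hh .
    then have "(avg f A - c)\<^sup>2 * (measure m A)\<^sup>2 / (measure m A)\<^sup>2 \<le> Var * measure m A / (measure m A)\<^sup>2"
      by (intro divide_right_mono) (auto simp: power_mult_distrib)
    then show ?thesis using A(3) by (simp add: power2_eq_square)
  qed
  have "(avg f A1 - avg f A2)\<^sup>2 = ((avg f A1 - c) - (avg f A2 - c))\<^sup>2" by simp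
  also have "\<dots> \<le> 2 * (avg f A1 - c)\<^sup>2 + 2 * (avg f A2 - c)\<^sup>2"
  proof -
    have "(x - y)\<^sup>2 \<le> 2 * x\<^sup>2 + 2 * y\<^sup>2" for x y :: real
      using zero_le_power2[of "x + y"] by (simp add: power2_eq_square algebra_simps)
    then show ?thesis .
  qed
  also have "\<dots> \<le> 2 * (1 / measure m A1 * Var) + 2 * (1 / measure m A2 * Var)"
    by (intro add_mono mult_left_mono one A1 A2) auto
  also have "\<dots> = 2 * (1 / measure m A1 + 1 / measure m A2) * Var"
    by (simp only: distrib_left distrib_right mult.assoc)
  finally show ?thesis unfolding Var_def .
qed

end

section \<open>Separated sets, nets and chains in a doubling space\<close>

definition sep :: "real \<Rightarrow> 'a::metric_space set \<Rightarrow> bool" where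
  "sep \<rho> S \<longleftrightarrow> (\<forall>x\<in>S. \<forall>y\<in>S. x \<noteq> y \<longrightarrow> \<rho> \<le> dist x y)"

context hke_space
begin

text \<open>Turns the variance into a difference of averages over two smaller balls.
  \<open>D\<close> carries the volume comparison, so the radius \<open>\<rho>\<close> stays
  free.\<close>

lemma poincare_avg:
  obtains l C where "l \<ge> 2" "C > 0" "\<And>x r n f w1 w2 \<rho> D. r > 0 \<Longrightarrow> f \<in> L2 m \<Longrightarrow> bdd f \<Longrightarrow> \<rho> > 0 \<Longrightarrow>
    ball w1 \<rho> \<subseteq> ball x (\<eta> * r) \<Longrightarrow> ball w2 \<rho> \<subseteq> ball x (\<eta> * r) \<Longrightarrow>
    vol x r \<le> D * vol w1 \<rho> \<Longrightarrow> vol x r \<le> D * vol w2 \<rho> \<Longrightarrow>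
    (avg f (ball w1 \<rho>) - avg f (ball w2 \<rho>))\<^sup>2 \<le> C * D / vol x r * (2 ^ n * jumpW (\<Psi> r / 2 ^ n) (ball x (l * r)) f)"
proof -
  obtain l where l2: "l \<ge> 2" and l: "\<And>x r n f. r > 0 \<Longrightarrow> f \<in> L2 m \<Longrightarrow> bdd f \<Longrightarrow>
    c4 / (2 * vol x r) * (vol x (\<eta> * r) * (\<integral>y. (f y)\<^sup>2 * indicator (ball x (\<eta> * r)) y \<partial>m)
      - (\<integral>y. f y * indicator (ball x (\<eta> * r)) y \<partial>m)\<^sup>2) \<le> 2 ^ n * jumpW (\<Psi> r / 2 ^ n) (ball x (l * r)) f"
    using poincare_raw by blast
  obtain D0 where D0: "D0 \<ge> 1" "\<And>x y r. r > 0 \<Longrightarrow> dist x y \<le> 1 / \<eta> * r \<Longrightarrow> vol y (1 / \<eta> * r) \<le> D0 * vol x r"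
    using vol_compare[of "1 / \<eta>"] \<eta>_bounds by auto
  define C where "C = 8 * D0 / c4"
  have C: "C > 0" using D0 c4_pos by (simp add: C_def)
  show thesis
  proof (rule that[OF l2 C])
    fix x w1 w2 :: 'a and r \<rho> D :: real and n :: nat and f
    assume r: "r > 0" and f: "f \<in> L2 m" "bdd f" and rho: "\<rho> > 0"
      and sub: "ball w1 \<rho> \<subseteq> ball x (\<eta> * r)" "ball w2 \<rho> \<subseteq> ball x (\<eta> * r)"
      and D: "vol x r \<le> D * vol w1 \<rho>" "vol x r \<le> D * vol w2 \<rho>"
    define J where "J = 2 ^ n * jumpW (\<Psi> r / 2 ^ n) (ball x (l * r)) f"
    define a where "a = (\<integral>y. (f y)\<^sup>2 * indicator (ball x (\<eta> * r)) y \<partial>m)"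
    define b where "b = (\<integral>y. f y * indicator (ball x (\<eta> * r)) y \<partial>m)"
    define v where "v = vol x (\<eta> * r)"
    define V where "V = vol x r"
    have eta_r: "\<eta> * r > 0" using \<eta>_bounds r by simp
    have v: "v > 0" "V > 0" using vol_pos eta_r r by (auto simp: v_def V_def)
    have w: "vol w1 \<rho> > 0" "vol w2 \<rho> > 0" using vol_pos rho by auto
    have vV: "V \<le> D0 * v"
    proof -
      have "vol x (1 / \<eta> * (\<eta> * r)) \<le> D0 * vol x (\<eta> * r)"
        using eta_r \<eta>_bounds r by (intro D0(2)) auto
      moreover have "1 / \<eta> * (\<eta> * r) = r" using \<eta>_bounds by simp
      ultimately show ?thesis by (simp add: v_def V_def)
    qed
    have "c4 / (2 * V) * (v * a - b\<^sup>2) \<le> J"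
      using l[OF r f, of x n] by (simp add: a_def b_def v_def V_def J_def)
    moreover have "v * a - b\<^sup>2 = v * (a - b\<^sup>2 / v)" using v by (simp add: right_diff_distrib)
    ultimately have "c4 / (2 * V) * (v * (a - b\<^sup>2 / v)) \<le> J" by simp
    then have "2 * V / (c4 * v) * (c4 / (2 * V) * (v * (a - b\<^sup>2 / v))) \<le> 2 * V / (c4 * v) * J"
      using v c4_pos by (intro mult_left_mono) auto
    moreover have "2 * V / (c4 * v) * (c4 / (2 * V) * (v * (a - b\<^sup>2 / v))) = a - b\<^sup>2 / v"
      using v c4_pos by simp
    ultimately have "a - b\<^sup>2 / v \<le> 2 * V / (c4 * v) * J" by simp
    also have "\<dots> \<le> 2 * D0 / c4 * J"
    proof (rule mult_right_mono)
      have "2 * V / (c4 * v) = 2 / c4 * (V / v)" by simp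
      also have "\<dots> \<le> 2 / c4 * D0" using vV v c4_pos by (intro mult_left_mono) (auto simp: field_simps)
      finally show "2 * V / (c4 * v) \<le> 2 * D0 / c4" by simp
    qed (simp add: J_def jumpW_nonneg)
    finally have Var: "a - b\<^sup>2 / v \<le> 2 * D0 / c4 * J" .
    have Dp: "D > 0" using D(1) v(2) w(1) unfolding V_def by (smt (verit) mult_nonpos_nonneg)
    have inv: "1 / vol w1 \<rho> + 1 / vol w2 \<rho> \<le> 2 * D / V"
    proof -
      have "1 / vol w1 \<rho> \<le> D / V" "1 / vol w2 \<rho> \<le> D / V"
        using D w v by (auto simp: V_def field_simps)
      then show ?thesis by simp
    qed
    have "(avg f (ball w1 \<rho>) - avg f (ball w2 \<rho>))\<^sup>2 \<le> 2 * (1 / vol w1 \<rho> + 1 / vol w2 \<rho>) * (a - b\<^sup>2 / v)"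
      unfolding a_def b_def v_def by (rule avg_diff_le[OF f(1)]) (use sub w in auto)
    also have "\<dots> \<le> 2 * (1 / vol w1 \<rho> + 1 / vol w2 \<rho>) * (2 * D0 / c4 * J)"
      using Var w by (intro mult_left_mono) auto
    also have "\<dots> \<le> 2 * (2 * D / V) * (2 * D0 / c4 * J)"
      using inv D0 c4_pos by (intro mult_right_mono mult_left_mono mult_nonneg_nonneg) (auto simp: J_def jumpW_nonneg)
    also have "\<dots> = C * D / V * J" by (simp add: C_def mult.commute mult.left_commute)
    finally show "(avg f (ball w1 \<rho>) - avg f (ball w2 \<rho>))\<^sup>2 \<le> C * D / vol x r * (2 ^ n * jumpW (\<Psi> r / 2 ^ n) (ball x (l * r)) f)"
      by (simp add: V_def J_def)
  qed
qed

text \<open>Balls of radius \<open>\<rho> / 2\<close> around the points are disjoint, lie in a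
  slightly larger ball, and each carries at least the fraction \<open>1 / D\<close> of its
  volume.\<close>

lemma sep_card:
  assumes K: "K > 0"
  obtains N :: nat where "\<And>(x::'a) \<rho> S. \<rho> > 0 \<Longrightarrow> S \<subseteq> ball x (K * \<rho>) \<Longrightarrow> sep \<rho> S \<Longrightarrow> finite S \<and> card S \<le> N"
proof -
  obtain D where D: "D \<ge> 1" "\<And>x y r. r > 0 \<Longrightarrow> dist x y \<le> (2 * (K + 1)) * r \<Longrightarrow> vol y ((2 * (K + 1)) * r) \<le> D * vol x r"
    using vol_compare[of "2 * (K + 1)"] K by auto
  show thesis
  proof (rule that[of "nat \<lfloor>D\<rfloor>"])
    fix x :: 'a and \<rho> and S :: "'a set" assume rho: "\<rho> > 0" and S: "S \<subseteq> ball x (K * \<rho>)" "sep \<rho> S"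
    show "finite S \<and> card S \<le> nat \<lfloor>D\<rfloor>"
    proof (rule finite_if_finite_subsets_card_bdd)
      fix T assume T: "T \<subseteq> S" "finite T"
      have disj: "disjoint_family_on (\<lambda>y. ball y (\<rho> / 2)) T"
        unfolding disjoint_family_on_def
      proof (intro ballI impI)
        fix y z assume yz: "y \<in> T" "z \<in> T" "y \<noteq> z"
        then have "\<rho> \<le> dist y z" using S(2) T by (auto simp: sep_def)
        then show "ball y (\<rho> / 2) \<inter> ball z (\<rho> / 2) = {}"
          using dist_triangle_half_l[of y _ \<rho> z] by (auto simp: dist_commute) (metis dist_commute dist_triangle_half_r not_le)
      qed
      have sub: "(\<Union>y\<in>T. ball y (\<rho> / 2)) \<subseteq> ball x ((K + 1) * \<rho>)"
      proof
        fix z assume "z \<in> (\<Union>y\<in>T. ball y (\<rho> / 2))"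
        then obtain y where "y \<in> T" "dist y z < \<rho> / 2" by auto
        moreover have "dist x y < K * \<rho>" using \<open>y \<in> T\<close> T S by auto
        ultimately have "dist x z < K * \<rho> + \<rho> / 2" using dist_triangle[of x z y] by linarith
        also have "\<dots> \<le> (K + 1) * \<rho>" using rho by (simp add: algebra_simps)
        finally show "z \<in> ball x ((K + 1) * \<rho>)" by simp
      qed
      define V where "V = vol x ((K + 1) * \<rho>)"
      have V: "V > 0" unfolding V_def using K rho by (intro vol_pos) auto
      have each: "V \<le> D * vol y (\<rho> / 2)" if "y \<in> T" for y
      proof -
        have "dist x y < K * \<rho>" using that T S by auto
        then have "dist y x \<le> (2 * (K + 1)) * (\<rho> / 2)" using rho by (simp add: dist_commute algebra_simps)
        then have "vol x ((2 * (K + 1)) * (\<rho> / 2)) \<le> D * vol y (\<rho> / 2)" using rho by (intro D(2)) auto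
        moreover have "(2 * (K + 1)) * (\<rho> / 2) = (K + 1) * \<rho>" by (simp add: field_simps)
        ultimately show ?thesis by (simp only: V_def)
      qed
      have "real (card T) * V = (\<Sum>y\<in>T. V)" by simp
      also have "\<dots> \<le> (\<Sum>y\<in>T. D * vol y (\<rho> / 2))" by (intro sum_mono each)
      also have "\<dots> = D * measure m (\<Union>y\<in>T. ball y (\<rho> / 2))"
      proof -
        have "measure m (\<Union>y\<in>T. ball y (\<rho> / 2)) = (\<Sum>y\<in>T. vol y (\<rho> / 2))"
          using T(2) disj ball_sets emeasure_bounded[OF bounded_ball]
          by (intro measure_finite_Union) (auto simp: less_top)
        then show ?thesis by (simp add: sum_distrib_left)
      qed
      also have "\<dots> \<le> D * V"
        unfolding V_def using D(1) sub by (intro mult_left_mono measure_mono_bounded) auto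
      finally have "real (card T) \<le> D" using V by simp
      then show "card T \<le> nat \<lfloor>D\<rfloor>" by (simp add: le_nat_floor)
    qed
  qed
qed

text \<open>Separated subsets have bounded cardinality, so one of maximal cardinality exists, and
  maximality makes it a net.\<close>

lemma maximal_net:
  assumes K: "K > 0"
  obtains N :: nat where "\<And>(x::'a) \<rho> Y. \<rho> > 0 \<Longrightarrow> Y \<subseteq> ball x (K * \<rho>) \<Longrightarrow>
    \<exists>S. S \<subseteq> Y \<and> finite S \<and> card S \<le> N \<and> sep \<rho> S \<and> Y \<subseteq> (\<Union>s\<in>S. ball s \<rho>)"
proof -
  obtain N where N: "\<And>(x::'a) \<rho> S. \<rho> > 0 \<Longrightarrow> S \<subseteq> ball x (K * \<rho>) \<Longrightarrow> sep \<rho> S \<Longrightarrow> finite S \<and> card S \<le> N"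
    using sep_card[OF K] by blast
  show thesis
  proof (rule that)
    fix x :: 'a and \<rho> and Y :: "'a set" assume rho: "\<rho> > 0" and Y: "Y \<subseteq> ball x (K * \<rho>)"
    have ex: "\<exists>S. S \<subseteq> Y \<and> sep \<rho> S \<and> card S = 0" by (intro exI[of _ "{}"]) (auto simp: sep_def)
    have "\<exists>n. (\<exists>S. S \<subseteq> Y \<and> sep \<rho> S \<and> card S = n) \<and> (\<forall>k. (\<exists>S. S \<subseteq> Y \<and> sep \<rho> S \<and> card S = k) \<longrightarrow> k \<le> n)"
    proof (rule Nat.ex_has_greatest_nat[where P = "\<lambda>n. \<exists>S. S \<subseteq> Y \<and> sep \<rho> S \<and> card S = n" and k = 0 and b = N, OF ex])
      show "\<forall>k. (\<exists>S. S \<subseteq> Y \<and> sep \<rho> S \<and> card S = k) \<longrightarrow> k \<le> N"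
        using N[OF rho subset_trans[OF _ Y]] by blast
    qed
    then obtain S where S: "S \<subseteq> Y" "sep \<rho> S" and max: "\<And>T. T \<subseteq> Y \<Longrightarrow> sep \<rho> T \<Longrightarrow> card T \<le> card S" by blast
    have fin: "finite S" "card S \<le> N" using N[OF rho _ S(2)] S(1) Y by auto
    have "y \<in> (\<Union>s\<in>S. ball s \<rho>)" if y: "y \<in> Y" for y
    proof (rule ccontr)
      assume "y \<notin> (\<Union>s\<in>S. ball s \<rho>)"
      then have far: "\<rho> \<le> dist s y" if "s \<in> S" for s using that by auto
      then have "y \<notin> S" using rho by force
      moreover have "sep \<rho> (insert y S)" using S(2) far by (auto simp: sep_def dist_commute)
      ultimately show False using max[of "insert y S"] S(1) y fin by simp
    qed
    then show "\<exists>S. S \<subseteq> Y \<and> finite S \<and> card S \<le> N \<and> sep \<rho> S \<and> Y \<subseteq> (\<Union>s\<in>S. ball s \<rho>)"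
      using S fin by blast
  qed
qed

text \<open>Cover the connected set by few balls of radius \<open>\<rho> / 3\<close> around its own
  points and join centres at distance below \<open>\<rho>\<close>. A component of this graph would
  split the set into two open parts, so any two centres are joined by a path, along which
  \<open>a\<close> changes by at most \<open>\<Delta>\<close> per edge.\<close>

lemma chain_bound:
  assumes K: "K > 0"
  obtains N :: nat where "\<And>(x::'a) \<rho> \<gamma> a \<Delta> z z'. \<rho> > 0 \<Longrightarrow> connected \<gamma> \<Longrightarrow> \<gamma> \<subseteq> ball x (K * \<rho>) \<Longrightarrow> z \<in> \<gamma> \<Longrightarrow> z' \<in> \<gamma> \<Longrightarrow>
    (\<And>w w'. w \<in> \<gamma> \<Longrightarrow> w' \<in> \<gamma> \<Longrightarrow> dist w w' < \<rho> \<Longrightarrow> \<bar>a w - a w'\<bar> \<le> (\<Delta>::real)) \<Longrightarrow> \<bar>a z - a z'\<bar> \<le> real N * \<Delta>"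
proof -
  have "3 * K > 0" using K by simp
  from maximal_net[OF this] obtain N where N: "\<And>(x::'a) \<rho> Y. \<rho> > 0 \<Longrightarrow> Y \<subseteq> ball x (3 * K * \<rho>) \<Longrightarrow>
    \<exists>S. S \<subseteq> Y \<and> finite S \<and> card S \<le> N \<and> sep \<rho> S \<and> Y \<subseteq> (\<Union>s\<in>S. ball s \<rho>)"
    by blast
  show thesis
  \<comment> \<open>A path needs at most as many edges as the relation has pairs, and two more steps
    join the end points to their centres.\<close>
  proof (rule that[of "N * N + 2"])
    fix x :: 'a and \<rho> :: real and \<gamma> :: "'a set" and a :: "'a \<Rightarrow> real" and \<Delta> z z'
    assume rho: "\<rho> > 0" and con: "connected \<gamma>" and sub: "\<gamma> \<subseteq> ball x (K * \<rho>)" and z: "z \<in> \<gamma>" "z' \<in> \<gamma>"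
      and step: "\<And>w w'. w \<in> \<gamma> \<Longrightarrow> w' \<in> \<gamma> \<Longrightarrow> dist w w' < \<rho> \<Longrightarrow> \<bar>a w - a w'\<bar> \<le> \<Delta>"
    have D0: "\<Delta> \<ge> 0" using step[OF z(1) z(1)] rho by simp
    obtain S where S: "S \<subseteq> \<gamma>" "finite S" "card S \<le> N" "\<gamma> \<subseteq> (\<Union>s\<in>S. ball s (\<rho> / 3))"
      using N[of "\<rho> / 3" \<gamma> x] rho sub by auto
    define R where "R = {(s, s'). s \<in> S \<and> s' \<in> S \<and> dist s s' < \<rho>}"
    have RS: "R \<subseteq> S \<times> S" by (auto simp: R_def)
    then have fR: "finite R" using S(2) finite_subset by blast
    have "card R \<le> card (S \<times> S)" using RS S(2) by (intro card_mono) auto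
    also have "\<dots> \<le> N * N" using S(3) by (simp add: card_cartesian_product mult_le_mono)
    finally have cR: "card R \<le> N * N" .
    obtain s0 where s0: "s0 \<in> S" "dist s0 z < \<rho> / 3" using S(4) z(1) by auto
    obtain s1 where s1: "s1 \<in> S" "dist s1 z' < \<rho> / 3" using S(4) z(2) by auto
    have reach: "(s0, s1) \<in> R\<^sup>*"
    proof (rule ccontr)
      assume no: "(s0, s1) \<notin> R\<^sup>*"
      define X1 where "X1 = (\<Union>s\<in>{s\<in>S. (s0, s) \<in> R\<^sup>*}. ball s (\<rho> / 3))"
      define X2 where "X2 = (\<Union>s\<in>{s\<in>S. (s0, s) \<notin> R\<^sup>*}. ball s (\<rho> / 3))"
      have "X1 \<inter> X2 = {}"
      proof (rule ccontr)
        assume "X1 \<inter> X2 \<noteq> {}"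
        then obtain y s s' where y: "s \<in> S" "(s0, s) \<in> R\<^sup>*" "dist s y < \<rho> / 3" "s' \<in> S" "(s0, s') \<notin> R\<^sup>*" "dist s' y < \<rho> / 3"
          by (auto simp: X1_def X2_def)
        have "dist s s' < \<rho>" using y dist_triangle[of s s' y] rho by (simp add: dist_commute)
        then have "(s, s') \<in> R" using y by (simp add: R_def)
        with y show False by (meson rtrancl.rtrancl_into_rtrancl)
      qed
      moreover have "\<gamma> \<subseteq> X1 \<union> X2" using S(4) by (auto simp: X1_def X2_def)
      moreover have "open X1" "open X2" by (auto simp: X1_def X2_def)
      moreover have "z \<in> X1" using s0 by (auto simp: X1_def)
      moreover have "z' \<in> X2" using s1 no by (auto simp: X2_def)
      ultimately show False using connectedD[OF con, of X1 X2] z by blast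
    qed
    then obtain n where n: "n \<le> card R" "(s0, s1) \<in> R ^^ n"
      using rtrancl_finite_eq_relpow[OF fR] by auto
    have path: "\<bar>a s0 - a t\<bar> \<le> real k * \<Delta>" if "(s0, t) \<in> R ^^ k" for k t
      using that
    proof (induction k arbitrary: t)
      case (Suc k)
      then obtain y where y: "(s0, y) \<in> R ^^ k" "(y, t) \<in> R" by auto
      have "\<bar>a y - a t\<bar> \<le> \<Delta>" using y(2) S(1) by (intro step) (auto simp: R_def)
      then show ?case using Suc.IH[OF y(1)] by (simp add: distrib_right)
    qed simp
    have "real n \<le> real (N * N)" using n cR by (meson le_trans of_nat_mono)
    then have "real n * \<Delta> \<le> real (N * N) * \<Delta>" using D0 by (rule mult_right_mono)
    moreover have "\<bar>a s0 - a z\<bar> \<le> \<Delta>" "\<bar>a s1 - a z'\<bar> \<le> \<Delta>"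
      using s0 s1 S(1) z rho by (auto intro!: step)
    ultimately have "\<bar>a z - a z'\<bar> \<le> \<Delta> + real (N * N) * \<Delta> + \<Delta>" using path[OF n(2)] by linarith
    then show "\<bar>a z - a z'\<bar> \<le> real (N * N + 2) * \<Delta>" by (simp add: algebra_simps)
  qed
qed

end

section \<open>Approximation in uniform domains\<close>

lemma infdist_lipschitz: "infdist x S \<ge> infdist y S - dist x (y::'a::metric_space)"
  using infdist_triangle[of y S x] by (simp add: dist_commute)

text \<open>Within \<open>h / 2\<close> of an end point the depth is inherited, as
  \<open>infdist\<close> is 1-Lipschitz; elsewhere the uniform condition gives \<open>h / 2\<close>
  divided by \<open>A\<close>.\<close>

lemma uniform_curve:
  assumes U: "A_uniform_domain A U" "A \<ge> 1" and z: "z1 \<in> U" "z2 \<in> U" and h: "h \<ge> 0" "infdist z1 (- U) \<ge> h" "infdist z2 (- U) \<ge> h"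
  obtains \<gamma> where "connected \<gamma>" "z1 \<in> \<gamma>" "z2 \<in> \<gamma>" "\<gamma> \<subseteq> U"
    "\<And>w. w \<in> \<gamma> \<Longrightarrow> dist z1 w \<le> A * dist z1 z2" "\<And>w. w \<in> \<gamma> \<Longrightarrow> infdist w (- U) \<ge> h / (2 * A)"
proof -
  obtain g where g: "path g" "path_image g \<subseteq> U" "pathstart g = z1" "pathfinish g = z2"
    "diameter (path_image g) \<le> A * dist z1 z2"
    "\<And>w. w \<in> path_image g \<Longrightarrow> infdist w (- U) \<ge> inverse A * min (dist z1 w) (dist z2 w)"
    using U(1) z unfolding A_uniform_domain_def by blast
  have zg: "z1 \<in> path_image g" "z2 \<in> path_image g" using g(3,4) by auto
  show thesis
  proof (rule that[of "path_image g"])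
    show "dist z1 w \<le> A * dist z1 z2" if "w \<in> path_image g" for w
      using diameter_bounded_bound[OF bounded_path_image[OF g(1)] zg(1) that] g(5) by simp
    show "infdist w (- U) \<ge> h / (2 * A)" if w: "w \<in> path_image g" for w
    proof -
      have "h * 1 \<le> h * A" using h U(2) by (intro mult_left_mono) auto
      then have hA: "h / (2 * A) \<le> h / 2" using U(2) by (simp add: field_simps)
      consider "dist z1 w \<le> h / 2" | "dist z2 w \<le> h / 2" | "min (dist z1 w) (dist z2 w) \<ge> h / 2" by linarith
      then show ?thesis
      proof cases
        case 1
        then show ?thesis using infdist_lipschitz[of z1 "- U" w] h hA by (simp add: dist_commute)
      next
        case 2
        then show ?thesis using infdist_lipschitz[of z2 "- U" w] h hA by (simp add: dist_commute)
      next
        case 3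
        then have "inverse A * (h / 2) \<le> inverse A * min (dist z1 w) (dist z2 w)"
          using U(2) by (intro mult_left_mono) auto
        also have "inverse A * (h / 2) = h / (2 * A)" by (simp add: field_simps)
        finally show ?thesis using g(6)[OF w] by linarith
      qed
    qed
  qed (use g zg connected_path_image in auto)
qed

text \<open>A curve from a point of \<open>U\<close> near \<open>\<xi>\<close> to one far from it
  crosses the sphere of radius \<open>r\<close> around its start. There both end points are at
  distance at least \<open>r\<close>, so the uniform condition gives depth
  \<open>r / A\<close>.\<close>

lemma corkscrew:
  assumes U: "A_uniform_domain A U" "A \<ge> 1" and ne: "frontier U \<noteq> {}"
  obtains R0 where "R0 > 0" "\<And>\<xi> r. \<xi> \<in> frontier U \<Longrightarrow> 0 < r \<Longrightarrow> r \<le> R0 \<Longrightarrow>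
    \<exists>z\<in>U. dist \<xi> z \<le> 2 * r \<and> infdist z (- U) \<ge> r / A"
proof -
  have op: "open U" using U(1) by (simp add: A_uniform_domain_def)
  have fr: "\<xi> \<notin> U" "\<And>e. e > 0 \<Longrightarrow> \<exists>y\<in>U. dist y \<xi> < e" if "\<xi> \<in> frontier U" for \<xi>
  proof -
    show "\<xi> \<notin> U" using that op by (simp add: frontier_def interior_open)
    show "\<exists>y\<in>U. dist y \<xi> < e" if "e > 0" for e
      using \<open>\<xi> \<in> frontier U\<close> that closure_approachable[of \<xi> U] by (auto simp: frontier_def)
  qed
  obtain \<xi>0 where x0: "\<xi>0 \<in> frontier U" using ne by blast
  obtain a where a: "a \<in> U" using fr(2)[OF x0, of 1] by auto
  have "dist a \<xi>0 > 0" using a fr(1)[OF x0] by auto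
  \<comment> \<open>\<open>b\<close> is strictly nearer to \<open>\<xi>0\<close> than
    \<open>a\<close>, so these are two distinct points of \<open>U\<close>, and every
    \<open>\<xi>\<close> is at distance at least \<open>L / 2\<close> from one of them.\<close>
  then obtain b where b: "b \<in> U" "dist b \<xi>0 < dist a \<xi>0" using fr(2)[OF x0] by blast
  define L where "L = dist a b"
  have L: "L > 0" using b(2) by (auto simp: L_def)
  show thesis
  proof (rule that[of "L / 8"])
    fix \<xi> :: 'a and r :: real assume xi: "\<xi> \<in> frontier U" and r: "0 < r" "r \<le> L / 8"
    have "\<exists>y\<in>U. dist \<xi> y \<ge> L / 2"
    proof (cases "dist \<xi> a \<ge> L / 2")
      case False
      then have "dist \<xi> b \<ge> L / 2" using dist_triangle[of a b \<xi>] by (simp add: L_def dist_commute)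
      then show ?thesis using b by blast
    qed (use a in blast)
    then obtain y2 where y2: "y2 \<in> U" "dist \<xi> y2 \<ge> L / 2" by blast
    obtain y1 where y1: "y1 \<in> U" "dist y1 \<xi> < r" using fr(2)[OF xi r(1)] by blast
    have far: "dist y1 y2 \<ge> 3 * r" using y2 y1 r dist_triangle[of \<xi> y2 y1] by (simp add: dist_commute)
    obtain g where g: "path g" "path_image g \<subseteq> U" "pathstart g = y1" "pathfinish g = y2"
      "\<And>w. w \<in> path_image g \<Longrightarrow> infdist w (- U) \<ge> inverse A * min (dist y1 w) (dist y2 w)"
      using U(1) y1 y2 unfolding A_uniform_domain_def by blast
    have "continuous_on {0..1} (\<lambda>t. dist y1 (g t))"
      using g(1) unfolding path_def by (intro continuous_intros)
    moreover have "dist y1 (g 0) \<le> r" "r \<le> dist y1 (g 1)"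
      using g(3,4) far r by (auto simp: pathstart_def pathfinish_def)
    ultimately obtain t where t: "0 \<le> t" "t \<le> 1" "dist y1 (g t) = r"
      using IVT'[of "\<lambda>t. dist y1 (g t)" 0 r 1] by auto
    have w: "g t \<in> path_image g" using t by (auto simp: path_image_def)
    have "dist y2 (g t) \<ge> 2 * r" using far t(3) dist_triangle[of y1 y2 "g t"] by (simp add: dist_commute)
    then have "min (dist y1 (g t)) (dist y2 (g t)) = r" using t(3) r by simp
    then have "infdist (g t) (- U) \<ge> r / A" using g(5)[OF w] by (simp add: divide_inverse mult.commute)
    moreover have "dist \<xi> (g t) \<le> 2 * r" using y1(2) t(3) dist_triangle[of \<xi> "g t" y1] by (simp add: dist_commute)
    ultimately show "\<exists>z\<in>U. dist \<xi> z \<le> 2 * r \<and> infdist z (- U) \<ge> r / A" using w g(2) by blast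
  qed (use L in simp)
qed

context heat_space
begin

lemma C_c_I:
  assumes "continuous_on UNIV f" "bounded A" "\<And>x. x \<notin> A \<Longrightarrow> f x = 0"
  shows "(f :: 'a \<Rightarrow> real) \<in> C_c"
proof -
  have "bounded {x. f x \<noteq> 0}" using assms(2) by (rule bounded_subset) (use assms(3) in auto)
  then show ?thesis using assms(1) by (simp add: C_c_def compact_bounded_closed[OF bounded_closure])
qed

text \<open>Approximating a profile \<open>d\<close> of height 3 within 1, subtracting 1 and
  clipping to the unit interval restores the exact values 1 and 0.\<close>

lemma bump_F:
  assumes r: "r1 < r2"
  obtains g where "g \<in> F \<inter> C_c" "\<And>y. 0 \<le> g y" "\<And>y. g y \<le> 1" "\<And>y. y \<in> ball x r1 \<Longrightarrow> g y = 1" "\<And>y. y \<notin> cball x r2 \<Longrightarrow> g y = 0"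
proof -
  define d where "d y = max 0 (min 3 (3 * (r2 - dist x y) / (r2 - r1)))" for y
  have "continuous_on UNIV d" unfolding d_def using r by (intro continuous_intros) auto
  moreover have "d y = 0" if "y \<notin> cball x r2" for y
  proof -
    have "3 * (r2 - dist x y) / (r2 - r1) \<le> 0" using that r by (intro divide_nonpos_pos) auto
    then show ?thesis by (simp add: d_def)
  qed
  ultimately have "d \<in> C_c" by (rule C_c_I[OF _ bounded_cball])
  then obtain k where k: "k \<in> F \<inter> C_c" "\<And>y. \<bar>d y - k y\<bar> < 1" using regular_dense_C_c[of d 1] by auto
  show thesis
  proof (rule that[of "\<lambda>y. min (max (k y - 1) 0) 1"])
    show "(\<lambda>y. min (max (k y - 1) 0) 1) \<in> F \<inter> C_c"
      using k(1) by (auto intro!: F_min_const F_pos_part C_c_min_const C_c_pos_part)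
    show "min (max (k y - 1) 0) 1 = 1" if "y \<in> ball x r1" for y
    proof -
      have "3 * (r2 - dist x y) / (r2 - r1) \<ge> 3" using that r by (simp add: pos_le_divide_eq)
      then have "d y = 3" by (simp add: d_def)
      then show ?thesis using k(2)[of y] by auto
    qed
    show "min (max (k y - 1) 0) 1 = 0" if "y \<notin> cball x r2" for y
      using k(2)[of y] \<open>\<And>y. y \<notin> cball x r2 \<Longrightarrow> d y = 0\<close>[OF that] by auto
  qed auto
qed

lemma C_c_uniform:
  assumes f: "f \<in> C_c" and e: "\<epsilon> > 0"
  obtains d where "d > 0" "\<And>y z :: 'a. dist y z < d \<Longrightarrow> \<bar>f y - f z\<bar> \<le> \<epsilon>"
proof -
  obtain x0 R where R: "{x. f x \<noteq> 0} \<subseteq> ball x0 R"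
    using C_c_bsupp[OF f] unfolding bsupp_def by (metis bounded_subset_ballD)
  have cont: "continuous_on (cball x0 (R + 1)) f" using C_c_cont[OF f] continuous_on_subset by blast
  have "compact (cball x0 (R + 1))" by (rule compact_bounded_closed) auto
  then have "uniformly_continuous_on (cball x0 (R + 1)) f" using cont by (intro compact_uniformly_continuous)
  then obtain d where d: "d > 0" "\<And>y z. y \<in> cball x0 (R + 1) \<Longrightarrow> z \<in> cball x0 (R + 1) \<Longrightarrow> dist z y < d \<Longrightarrow> dist (f z) (f y) < \<epsilon>"
    using e unfolding uniformly_continuous_on_def by meson
  show thesis
  proof (rule that[of "min d 1"])
    fix y z :: 'a assume yz: "dist y z < min d 1"
    show "\<bar>f y - f z\<bar> \<le> \<epsilon>"
    proof (cases "y \<in> cball x0 (R + 1) \<and> z \<in> cball x0 (R + 1)")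
      case True
      then show ?thesis using d(2)[of z y] yz by (simp add: dist_real_def)
    next
      case False
      have "dist x0 y \<le> dist x0 z + dist y z" "dist x0 z \<le> dist x0 y + dist y z"
        by (metis dist_triangle dist_commute)+
      then have "y \<notin> ball x0 R" "z \<notin> ball x0 R" using False yz by auto
      then have "f y = 0" "f z = 0" using R by auto
      then show ?thesis using e by simp
    qed
  qed (use d in simp)
qed

lemma avg_close:
  assumes f: "f \<in> L2 m" and A: "A \<in> sets borel" "bounded A" "measure m A > 0" and c: "\<And>y. y \<in> A \<Longrightarrow> \<bar>f y - c\<bar> \<le> \<epsilon>"
  shows "\<bar>avg f A - c\<bar> \<le> \<epsilon>"
proof -
  let ?i = "indicat_real A"
  have i: "integrable m (\<lambda>x. f x * ?i x)" "integrable m ?i"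
    using L2_mult_integrable[OF f L2_indicator[OF A(1,2)]] integrable_indicator_bounded[OF A(1,2)] by auto
  have mi: "(\<integral>x. ?i x \<partial>m) = measure m A" using A by (simp add: space_m)
  have "(\<integral>x. f x * ?i x \<partial>m) \<le> (\<integral>x. (c + \<epsilon>) * ?i x \<partial>m)"
  proof (rule integral_mono)
    show "f x * ?i x \<le> (c + \<epsilon>) * ?i x" for x using c[of x] by (auto simp: indicator_def abs_le_iff)
  qed (use i in auto)
  moreover have "(\<integral>x. (c - \<epsilon>) * ?i x \<partial>m) \<le> (\<integral>x. f x * ?i x \<partial>m)"
  proof (rule integral_mono)
    show "(c - \<epsilon>) * ?i x \<le> f x * ?i x" for x using c[of x] by (auto simp: indicator_def abs_le_iff)
  qed (use i in auto)
  ultimately have "(\<integral>x. f x * ?i x \<partial>m) \<le> (c + \<epsilon>) * measure m A" "(c - \<epsilon>) * measure m A \<le> (\<integral>x. f x * ?i x \<partial>m)"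
    using mi by simp_all
  then have "avg f A \<le> c + \<epsilon>" "c - \<epsilon> \<le> avg f A" using A(3) by (simp_all add: avg_def pos_divide_le_eq pos_le_divide_eq)
  then show ?thesis by (simp add: abs_le_iff)
qed

end

section \<open>A partition of unity over a net\<close>

locale patching = hke_space +
  fixes lc Cc r :: real and n :: nat and x :: "nat \<Rightarrow> 'a" and \<psi> :: "nat \<Rightarrow> 'a \<Rightarrow> real" and Nb :: nat and Dv :: real
  assumes lc: "lc \<ge> 2" and Cc: "Cc > 0" and r: "r > 0"
    and psi: "\<And>k. k < n \<Longrightarrow> \<psi> k \<in> F" "\<And>k y. k < n \<Longrightarrow> 0 \<le> \<psi> k y" "\<And>k y. k < n \<Longrightarrow> \<psi> k y \<le> 1"
      "\<And>k y. k < n \<Longrightarrow> y \<in> ball (x k) (\<eta> * r) \<Longrightarrow> \<psi> k y = 1" "\<And>k y. k < n \<Longrightarrow> y \<notin> ball (x k) (lc * r) \<Longrightarrow> \<psi> k y = 0"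
      "\<And>k. k < n \<Longrightarrow> E (\<psi> k) (\<psi> k) \<le> Cc * (vol (x k) r / \<Psi> r)"
    and Nb: "\<And>k. k < n \<Longrightarrow> card {j. j < n \<and> dist (x j) (x k) < 4 * lc * r} \<le> Nb"
    and Dv: "Dv \<ge> 1" "\<And>y z. dist y z \<le> 4 * lc * r \<Longrightarrow> vol z r \<le> Dv * vol y r"
begin

definition nbr :: "nat \<Rightarrow> nat set" where "nbr k = {j. j < n \<and> dist (x j) (x k) < 2 * lc * r}"

text \<open>A partition of unity without division: \<open>\<phi> k\<close> is what
  \<open>\<psi> k\<close> takes from the remainder left by its predecessors. The sum is 1 wherever
  some \<open>\<psi> j\<close> is 1, and increments are controlled by those of the factors, which
  lie in the unit interval.\<close>

definition \<phi> :: "nat \<Rightarrow> 'a \<Rightarrow> real" where "\<phi> k y = \<psi> k y * (\<Prod>j<k. 1 - \<psi> j y)"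

lemma finite_nbr: "finite (nbr k)" by (simp add: nbr_def)

lemma self_nbr: "k < n \<Longrightarrow> k \<in> nbr k" using lc r by (simp add: nbr_def)

lemma \<phi>_sum: "(\<Sum>i<k. \<phi> i y) = 1 - (\<Prod>i<k. 1 - \<psi> i y)"
  by (induction k) (auto simp: \<phi>_def algebra_simps)

lemma \<phi>_sum_one: "k < n \<Longrightarrow> y \<in> ball (x k) (\<eta> * r) \<Longrightarrow> (\<Sum>i<n. \<phi> i y) = 1"
  unfolding \<phi>_sum using psi(4)[of k y] by (auto simp: prod_zero_iff intro: bexI[of _ k])

lemma \<phi>_bounds: assumes "k < n" shows "0 \<le> \<phi> k y" "\<phi> k y \<le> \<psi> k y"
proof -
  have "0 \<le> (\<Prod>j<k. 1 - \<psi> j y)" by (rule prod_nonneg) (use psi assms in auto)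
  moreover have "(\<Prod>j<k. 1 - \<psi> j y) \<le> 1" by (rule prod_le_1) (use psi assms in auto)
  ultimately show "0 \<le> \<phi> k y" "\<phi> k y \<le> \<psi> k y"
    using psi(2)[OF assms, of y] by (auto simp: \<phi>_def intro: mult_left_le)
qed

lemma \<phi>_zero: "k < n \<Longrightarrow> y \<notin> ball (x k) (lc * r) \<Longrightarrow> \<phi> k y = 0"
  using psi(5) by (simp add: \<phi>_def)

text \<open>Factors of indices that are not neighbours equal 1 wherever \<open>\<psi> k\<close> is
  nonzero, so only boundedly many remain.\<close>

lemma \<phi>_local:
  assumes k: "k < n"
  shows "\<phi> k y = (\<Prod>i\<in>nbr k \<inter> {..k}. if i = k then \<psi> k y else 1 - \<psi> i y)"
proof -
  have "(\<Prod>i\<in>nbr k \<inter> {..k}. if i = k then \<psi> k y else 1 - \<psi> i y)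
      = \<psi> k y * (\<Prod>i\<in>(nbr k \<inter> {..k}) - {k}. if i = k then \<psi> k y else 1 - \<psi> i y)"
    using self_nbr[OF k] by (subst prod.remove[of _ k]) (auto simp: finite_nbr)
  also have "(\<Prod>i\<in>(nbr k \<inter> {..k}) - {k}. if i = k then \<psi> k y else 1 - \<psi> i y) = (\<Prod>i\<in>nbr k \<inter> {..<k}. 1 - \<psi> i y)"
    by (rule prod.cong) auto
  also have "\<psi> k y * (\<Prod>i\<in>nbr k \<inter> {..<k}. 1 - \<psi> i y) = \<psi> k y * (\<Prod>j<k. 1 - \<psi> j y)"
  proof (cases "\<psi> k y = 0")
    case False
    then have y: "dist (x k) y < lc * r" using psi(5)[OF k] by auto
    have "(\<Prod>j<k. 1 - \<psi> j y) = (\<Prod>i\<in>nbr k \<inter> {..<k}. 1 - \<psi> i y)"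
    proof (rule prod.mono_neutral_right)
      show "\<forall>i\<in>{..<k} - nbr k \<inter> {..<k}. 1 - \<psi> i y = 1"
      proof
        fix i assume i: "i \<in> {..<k} - nbr k \<inter> {..<k}"
        then have "dist (x i) (x k) \<ge> 2 * lc * r" "i < n" using k by (auto simp: nbr_def)
        then have "y \<notin> ball (x i) (lc * r)" using y dist_triangle[of "x i" "x k" y] by (auto simp: dist_commute)
        then show "1 - \<psi> i y = 1" using psi(5) \<open>i < n\<close> by simp
      qed
    qed auto
    then show ?thesis by simp
  qed simp
  finally show ?thesis by (simp add: \<phi>_def)
qed

lemma \<phi>_lipschitz:
  assumes k: "k < n" shows "\<bar>\<phi> k y - \<phi> k z\<bar> \<le> (\<Sum>j\<in>nbr k. \<bar>\<psi> j y - \<psi> j z\<bar>)"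
proof -
  let ?I = "nbr k \<inter> {..k}"
  have b: "norm (if i = k then \<psi> k y else 1 - \<psi> i y) \<le> 1" if "i \<in> ?I" for i y
    using psi(2,3)[of i y] that by (auto simp: nbr_def abs_le_iff)
  have "norm (\<phi> k y - \<phi> k z) \<le> (\<Sum>i\<in>?I. norm ((if i = k then \<psi> k y else 1 - \<psi> i y) - (if i = k then \<psi> k z else 1 - \<psi> i z)))"
    unfolding \<phi>_local[OF k] by (rule norm_prod_diff[OF b b])
  also have "\<dots> = (\<Sum>i\<in>?I. \<bar>\<psi> i y - \<psi> i z\<bar>)" by (rule sum.cong) (auto simp: abs_minus_commute)
  also have "\<dots> \<le> (\<Sum>j\<in>nbr k. \<bar>\<psi> j y - \<psi> j z\<bar>)" by (rule sum_mono2) (auto simp: finite_nbr)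
  finally show ?thesis by simp
qed

lemma \<phi>_F: "k < n \<Longrightarrow> \<phi> k \<in> F"
proof (rule F_contraction(1)[OF finite_nbr[of k], of \<psi>])
  assume k: "k < n"
  show "\<phi> k \<in> borel_measurable m"
    unfolding \<phi>_def using psi(1) k F_measurable by (intro borel_measurable_times borel_measurable_prod borel_measurable_diff) auto
  show "\<bar>\<phi> k y - \<phi> k z\<bar> \<le> (\<Sum>j\<in>nbr k. \<bar>\<psi> j y - \<psi> j z\<bar>)" for y z by (rule \<phi>_lipschitz[OF k])
  show "\<bar>\<phi> k y\<bar> \<le> (\<Sum>j\<in>nbr k. \<bar>\<psi> j y\<bar>)" for y
  proof -
    have "\<bar>\<phi> k y\<bar> \<le> \<bar>\<psi> k y\<bar>" using \<phi>_bounds[OF k, of y] by auto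
    also have "\<dots> \<le> (\<Sum>j\<in>nbr k. \<bar>\<psi> j y\<bar>)"
      by (rule member_le_sum) (use self_nbr[OF k] finite_nbr in auto)
    finally show ?thesis .
  qed
qed (auto simp: nbr_def psi)

lemma \<phi>_bdd: "k < n \<Longrightarrow> bdd (\<phi> k)"
  using \<phi>_bounds[of k] psi(3)[of k] by (intro bddI[of _ 1]) (auto intro: order_trans)

lemma \<phi>_bsupp: assumes "k < n" shows "bsupp (\<phi> k)"
proof -
  have "{y. \<phi> k y \<noteq> 0} \<subseteq> ball (x k) (lc * r)" using \<phi>_zero[OF assms] by blast
  then show ?thesis unfolding bsupp_def by (rule bounded_subset[OF bounded_ball])
qed

definition patch :: "(nat \<Rightarrow> real) \<Rightarrow> 'a \<Rightarrow> real" where "patch a y = (\<Sum>k<n. a k * \<phi> k y)"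

lemma patch_F: "patch a \<in> F" and patch_bdd: "bdd (patch a)" and patch_bsupp: "bsupp (patch a)"
  unfolding patch_def
  by (auto intro!: E.V_sum F_scale \<phi>_F bdd_sum bdd_scale \<phi>_bdd bsupp_sum bsupp_mult(1) \<phi>_bsupp)

text \<open>What is left of \<open>patch a\<close> near \<open>x s\<close> after subtracting the
  constant \<open>a s\<close>, which \<open>Lf\<close> does not see.\<close>

definition osc :: "(nat \<Rightarrow> real) \<Rightarrow> nat \<Rightarrow> 'a \<Rightarrow> real" where
  "osc a s y = (\<Sum>i\<in>nbr s. (a i - a s) * \<phi> i y)"

lemma patch_osc:
  assumes s: "s < n" and y: "y \<in> ball (x s) (\<eta> * r)"
  shows "patch a y = osc a s y + a s"
proof -
  have far: "\<phi> i y = 0" if "i \<in> {..<n} - nbr s" for i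
  proof -
    have i: "i < n" "dist (x i) (x s) \<ge> 2 * lc * r" using that by (auto simp: nbr_def)
    have "\<eta> * r \<le> lc * r" using \<eta>_bounds lc r by (intro mult_right_mono) auto
    then have "y \<notin> ball (x i) (lc * r)" using y i dist_triangle[of "x i" "x s" y] by (auto simp: dist_commute)
    then show ?thesis using \<phi>_zero i by simp
  qed
  have "patch a y - a s = (\<Sum>k<n. a k * \<phi> k y) - a s * (\<Sum>k<n. \<phi> k y)"
    using \<phi>_sum_one[OF s y] by (simp add: patch_def)
  also have "\<dots> = (\<Sum>k<n. (a k - a s) * \<phi> k y)"
    by (simp add: sum_distrib_left sum_subtractf left_diff_distrib)
  also have "\<dots> = osc a s y"
    unfolding osc_def by (rule sum.mono_neutral_right) (use far in \<open>auto simp: nbr_def\<close>)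
  finally show ?thesis by simp
qed

lemma osc_F: "osc a s \<in> F" and osc_bdd: "bdd (osc a s)" and osc_bsupp: "bsupp (osc a s)"
  unfolding osc_def
  by (auto intro!: E.V_sum F_scale \<phi>_F bdd_sum bdd_scale \<phi>_bdd bsupp_sum bsupp_mult(1) \<phi>_bsupp simp: nbr_def)

text \<open>The power \<open>Nb ^ 4\<close> arises from two factors in \<open>F_contraction\<close>,
  the cardinality and the sum over \<open>N2\<close>, and from the square of the coefficient
  \<open>b * Nb\<close>.\<close>

lemma osc_energy:
  assumes s: "s < n" and B: "\<And>i. i \<in> nbr s \<Longrightarrow> (a i - a s)\<^sup>2 \<le> B"
  shows "E (osc a s) (osc a s) \<le> real Nb ^ 4 * Cc * Dv * (B * (vol (x s) r / \<Psi> r))"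
proof -
  define N2 where "N2 = {j. j < n \<and> dist (x j) (x s) < 4 * lc * r}"
  have fN2: "finite N2" by (simp add: N2_def)
  have cN2: "card N2 \<le> Nb" using Nb[OF s] by (simp add: N2_def)
  have "2 * lc * r \<le> 4 * lc * r" using lc r by simp
  then have "nbr s \<subseteq> N2" by (auto simp: nbr_def N2_def)
  then have cn: "card (nbr s) \<le> Nb" using cN2 card_mono[OF fN2] le_trans by blast
  have nn: "nbr i \<subseteq> N2" if "i \<in> nbr s" for i
  proof
    fix j assume "j \<in> nbr i"
    then show "j \<in> N2" using that dist_triangle[of "x j" "x s" "x i"] by (auto simp: nbr_def N2_def)
  qed
  have B0: "B \<ge> 0" using B[OF self_nbr[OF s]] by simp
  define b where "b = sqrt B"
  have b: "b \<ge> 0" "b\<^sup>2 = B" using B0 by (auto simp: b_def)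
  have ab: "\<bar>a i - a s\<bar> \<le> b" if "i \<in> nbr s" for i
    using B[OF that] b by (metis abs_le_square_iff abs_of_nonneg)
  \<comment> \<open>Each \<open>\<psi> j\<close> with \<open>j\<close> in \<open>N2\<close> occurs
    for at most \<open>Nb\<close> neighbours \<open>i\<close>, with a coefficient of size at most
    \<open>b\<close>.\<close>
  define u where "u j y = (b * real Nb) * \<psi> j y" for j y
  have key: "(\<Sum>i\<in>nbr s. b * (\<Sum>j\<in>nbr i. q j)) \<le> (\<Sum>j\<in>N2. b * real Nb * q j)" if q: "\<And>j. 0 \<le> q j" for q :: "nat \<Rightarrow> real"
  proof -
    have "(\<Sum>i\<in>nbr s. b * (\<Sum>j\<in>nbr i. q j)) \<le> (\<Sum>i\<in>nbr s. b * (\<Sum>j\<in>N2. q j))"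
      using nn q b fN2 by (intro sum_mono mult_left_mono sum_mono2) auto
    also have "\<dots> = real (card (nbr s)) * (b * (\<Sum>j\<in>N2. q j))" by simp
    also have "\<dots> \<le> real Nb * (b * (\<Sum>j\<in>N2. q j))"
      using cn b q by (intro mult_right_mono mult_nonneg_nonneg sum_nonneg) auto
    also have "\<dots> = (\<Sum>j\<in>N2. b * real Nb * q j)" by (simp add: sum_distrib_left ac_simps)
    finally show ?thesis .
  qed
  have uF: "u j \<in> F" if "j \<in> N2" for j unfolding u_def by (intro F_scale psi) (use that in \<open>auto simp: N2_def\<close>)
  have "E (osc a s) (osc a s) \<le> real (card N2) * (\<Sum>j\<in>N2. E (u j) (u j))"
  proof (rule F_contraction(2)[OF fN2 uF F_measurable[OF osc_F]])
    fix y z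
    have "\<bar>osc a s y - osc a s z\<bar> = \<bar>\<Sum>i\<in>nbr s. (a i - a s) * (\<phi> i y - \<phi> i z)\<bar>"
      by (simp add: osc_def sum_subtractf right_diff_distrib)
    also have "\<dots> \<le> (\<Sum>i\<in>nbr s. \<bar>(a i - a s) * (\<phi> i y - \<phi> i z)\<bar>)" by (rule sum_abs)
    also have "\<dots> \<le> (\<Sum>i\<in>nbr s. b * (\<Sum>j\<in>nbr i. \<bar>\<psi> j y - \<psi> j z\<bar>))"
      unfolding abs_mult using ab \<phi>_lipschitz b by (intro sum_mono mult_mono) (auto simp: nbr_def)
    also have "\<dots> \<le> (\<Sum>j\<in>N2. b * real Nb * \<bar>\<psi> j y - \<psi> j z\<bar>)" by (rule key) simp
    also have "\<dots> = (\<Sum>j\<in>N2. \<bar>u j y - u j z\<bar>)"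
      using b by (intro sum.cong) (auto simp: u_def right_diff_distrib[symmetric] abs_mult)
    finally show "\<bar>osc a s y - osc a s z\<bar> \<le> (\<Sum>j\<in>N2. \<bar>u j y - u j z\<bar>)" .
  next
    fix y
    have "\<bar>osc a s y\<bar> \<le> (\<Sum>i\<in>nbr s. \<bar>(a i - a s) * \<phi> i y\<bar>)" unfolding osc_def by (rule sum_abs)
    also have "\<dots> \<le> (\<Sum>i\<in>nbr s. b * (\<Sum>j\<in>nbr i. \<bar>\<psi> j y\<bar>))"
    proof (rule sum_mono)
      fix i assume i: "i \<in> nbr s"
      then have "i < n" by (simp add: nbr_def)
      have "\<bar>\<phi> i y\<bar> \<le> \<bar>\<psi> i y\<bar>" using \<phi>_bounds[OF \<open>i < n\<close>, of y] by auto
      also have "\<dots> \<le> (\<Sum>j\<in>nbr i. \<bar>\<psi> j y\<bar>)"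
        by (rule member_le_sum) (use self_nbr[OF \<open>i < n\<close>] finite_nbr in auto)
      finally show "\<bar>(a i - a s) * \<phi> i y\<bar> \<le> b * (\<Sum>j\<in>nbr i. \<bar>\<psi> j y\<bar>)"
        unfolding abs_mult using ab[OF i] b by (intro mult_mono) auto
    qed
    also have "\<dots> \<le> (\<Sum>j\<in>N2. b * real Nb * \<bar>\<psi> j y\<bar>)" by (rule key) simp
    also have "\<dots> = (\<Sum>j\<in>N2. \<bar>u j y\<bar>)" using b by (intro sum.cong) (auto simp: u_def abs_mult)
    finally show "\<bar>osc a s y\<bar> \<le> (\<Sum>j\<in>N2. \<bar>u j y\<bar>)" .
  qed
  also have "\<dots> \<le> real Nb * (\<Sum>j\<in>N2. (b * real Nb)\<^sup>2 * (Cc * (Dv * vol (x s) r / \<Psi> r)))"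
  proof (intro mult_mono sum_mono)
    fix j assume j: "j \<in> N2"
    have "E (u j) (u j) = (b * real Nb)\<^sup>2 * E (\<psi> j) (\<psi> j)"
      unfolding u_def using j psi(1) by (intro E.B_quad_scale) (auto simp: N2_def)
    also have "\<dots> \<le> (b * real Nb)\<^sup>2 * (Cc * (vol (x j) r / \<Psi> r))"
      using j psi(6) by (intro mult_left_mono) (auto simp: N2_def)
    also have "\<dots> \<le> (b * real Nb)\<^sup>2 * (Cc * (Dv * vol (x s) r / \<Psi> r))"
      using j Cc \<Psi>_pos[OF r] Dv(2)[of "x s" "x j"] by (intro mult_left_mono divide_right_mono) (auto simp: N2_def dist_commute)
    finally show "E (u j) (u j) \<le> (b * real Nb)\<^sup>2 * (Cc * (Dv * vol (x s) r / \<Psi> r))" .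
  qed (use cN2 uF E_nonneg in \<open>auto intro: sum_nonneg\<close>)
  also have "\<dots> = real Nb * (real (card N2) * ((b * real Nb)\<^sup>2 * (Cc * (Dv * vol (x s) r / \<Psi> r))))" by simp
  also have "\<dots> \<le> real Nb * (real Nb * ((b * real Nb)\<^sup>2 * (Cc * (Dv * vol (x s) r / \<Psi> r))))"
    using cN2 Cc Dv(1) vol_pos[OF r, of "x s"] \<Psi>_pos[OF r]
    by (intro mult_left_mono mult_right_mono mult_nonneg_nonneg) auto
  also have "\<dots> = real Nb ^ 4 * Cc * Dv * (B * (vol (x s) r / \<Psi> r))"
    unfolding b(2)[symmetric] by (simp add: power_mult_distrib power2_eq_square power4_eq_xxxx)
  finally show ?thesis .
qed

text \<open>\<open>g\<close> lives in a closed ball inside the open ball where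
  \<open>patch a\<close> and \<open>osc a s\<close> differ by a constant, so \<open>Lf_local\<close>
  exchanges them and the total energy of \<open>osc a s\<close> is an upper bound.\<close>

lemma Lf_patch:
  assumes s: "s < n" and B: "\<And>i. i \<in> nbr s \<Longrightarrow> (a i - a s)\<^sup>2 \<le> B"
    and g: "g \<in> F" "bdd g" "bsupp g" "\<And>y. g y \<le> 1" "\<And>y. y \<notin> cball (x s) q \<Longrightarrow> g y = 0" and q: "q < \<eta> * r"
  shows "Lf (patch a) g \<le> real Nb ^ 4 * Cc * Dv * (B * (vol (x s) r / \<Psi> r))"
proof -
  have "Lf (patch a) g = Lf (osc a s) g"
  proof (rule Lf_local[where V = "ball (x s) (\<eta> * r)" and C = "cball (x s) q" and a = "a s", OF patch_F patch_bdd patch_bsupp osc_F osc_bdd osc_bsupp g(1-3)])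
    show "patch a y = osc a s y + a s" if "y \<in> ball (x s) (\<eta> * r)" for y by (rule patch_osc[OF s that])
  qed (use g q in auto)
  also have "\<dots> \<le> 1 * E (osc a s) (osc a s)"
    by (rule Lf_le[OF osc_F osc_bdd g(1,2,4)]) simp
  finally show ?thesis using osc_energy[where a = a, OF s B] by simp
qed

end

section \<open>Comparison of averages at a common scale\<close>

context hke_space
begin

lemma step_volume:
  assumes K: "K \<ge> 1" and \<tau>: "\<tau> > 0"
  obtains D where "D \<ge> 1" "\<And>x y r. r > 0 \<Longrightarrow> dist x y \<le> K * r \<Longrightarrow> vol y (K * r) \<le> D * vol x (\<tau> * r)"
proof -
  obtain D where D: "D \<ge> 1" "\<And>x y r. r > 0 \<Longrightarrow> dist x y \<le> (K / \<tau>) * r \<Longrightarrow> vol y ((K / \<tau>) * r) \<le> D * vol x r"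
    using vol_compare[of "K / \<tau>"] K \<tau> by auto
  show thesis
  proof (rule that[OF D(1)])
    fix x y :: 'a and r :: real assume "r > 0" "dist x y \<le> K * r"
    then show "vol y (K * r) \<le> D * vol x (\<tau> * r)" using D(2)[of "\<tau> * r" x y] \<tau> by simp
  qed
qed

text \<open>Serves the bound on the total energy: \<open>\<kappa>\<close> is so large that one ball
  contains both averaging balls, and a single Poincare inequality without subdivision of time
  suffices.\<close>

lemma global_avg:
  assumes L: "L > 0" and \<tau>: "\<tau> > 0"
  obtains \<kappa> K C where "\<kappa> \<ge> 1" "K > 0" "C > 0" "\<And>r f x z1 z2. r > 0 \<Longrightarrow> f \<in> L2 m \<Longrightarrow> bdd f \<Longrightarrow>
    dist x z1 \<le> L * r \<Longrightarrow> dist x z2 \<le> L * r \<Longrightarrow>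
    (avg f (ball z1 (\<tau> * r)) - avg f (ball z2 (\<tau> * r)))\<^sup>2 \<le> C / vol x r * jumpW (\<Psi> (\<kappa> * r)) (ball x (K * r)) f"
proof -
  obtain l C where l: "l \<ge> 2" and C: "C > 0" and poi: "\<And>x r n f w1 w2 \<rho> D. r > 0 \<Longrightarrow> f \<in> L2 m \<Longrightarrow> bdd f \<Longrightarrow> \<rho> > 0 \<Longrightarrow>
    ball w1 \<rho> \<subseteq> ball x (\<eta> * r) \<Longrightarrow> ball w2 \<rho> \<subseteq> ball x (\<eta> * r) \<Longrightarrow>
    vol x r \<le> D * vol w1 \<rho> \<Longrightarrow> vol x r \<le> D * vol w2 \<rho> \<Longrightarrow>
    (avg f (ball w1 \<rho>) - avg f (ball w2 \<rho>))\<^sup>2 \<le> C * D / vol x r * (2 ^ n * jumpW (\<Psi> r / 2 ^ n) (ball x (l * r)) f)"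
    using poincare_avg by metis
  define \<kappa> where "\<kappa> = (L + \<tau> + 1) / \<eta>"
  have e: "0 < \<eta>" "\<eta> \<le> 1" using \<eta>_bounds by auto
  have "(L + \<tau> + 1) * 1 \<le> (L + \<tau> + 1) / \<eta>" using e L \<tau> by (simp add: pos_le_divide_eq mult_left_le)
  then have k: "L + \<tau> + 1 \<le> \<kappa>" by (simp add: \<kappa>_def)
  have k1: "\<kappa> \<ge> 1" using k L \<tau> by simp
  have ek: "\<eta> * \<kappa> = L + \<tau> + 1" using e by (simp add: \<kappa>_def)
  obtain D where D: "D \<ge> 1" "\<And>x y r. r > 0 \<Longrightarrow> dist x y \<le> \<kappa> * r \<Longrightarrow> vol y (\<kappa> * r) \<le> D * vol x (\<tau> * r)"
    using step_volume[OF k1 \<tau>] by blast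
  show thesis
  proof (rule that[of \<kappa> "l * \<kappa>" "C * D"])
    fix r f and x z1 z2 :: 'a
    assume r: "r > 0" and f: "f \<in> L2 m" "bdd f" and z: "dist x z1 \<le> L * r" "dist x z2 \<le> L * r"
    have "\<eta> * (\<kappa> * r) = (\<eta> * \<kappa>) * r" by simp
    then have er: "\<eta> * (\<kappa> * r) = L * r + \<tau> * r + r" unfolding ek by (simp add: algebra_simps)
    have kr: "\<kappa> * r > 0" "\<tau> * r > 0" using k1 r \<tau> by auto
    have sub: "ball z (\<tau> * r) \<subseteq> ball x (\<eta> * (\<kappa> * r))" if z: "dist x z \<le> L * r" for z
    proof
      fix y assume y: "y \<in> ball z (\<tau> * r)"
      then show "y \<in> ball x (\<eta> * (\<kappa> * r))" unfolding er using z r dist_triangle[of x y z] by (simp add: dist_commute)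
    qed
    have "L * r \<le> \<kappa> * r" using k \<tau> r by (intro mult_right_mono) auto
    then have v: "vol x (\<kappa> * r) \<le> D * vol z (\<tau> * r)" if "dist x z \<le> L * r" for z
      using D(2)[OF r, of z x] that by (simp add: dist_commute)
    have "(avg f (ball z1 (\<tau> * r)) - avg f (ball z2 (\<tau> * r)))\<^sup>2
      \<le> C * D / vol x (\<kappa> * r) * (2 ^ 0 * jumpW (\<Psi> (\<kappa> * r) / 2 ^ 0) (ball x (l * (\<kappa> * r))) f)"
      by (rule poi[OF kr(1) f kr(2) sub[OF z(1)] sub[OF z(2)] v[OF z(1)] v[OF z(2)]])
    also have "\<dots> = C * D / vol x (\<kappa> * r) * jumpW (\<Psi> (\<kappa> * r)) (ball x (l * \<kappa> * r)) f" by (simp add: mult.assoc)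
    also have "\<dots> \<le> C * D / vol x r * jumpW (\<Psi> (\<kappa> * r)) (ball x (l * \<kappa> * r)) f"
    proof (intro mult_right_mono divide_left_mono jumpW_nonneg)
      have "1 * r \<le> \<kappa> * r" using k1 r by (intro mult_right_mono) auto
      then show "vol x r \<le> vol x (\<kappa> * r)" by (intro vol_mono subset_ball) simp
      show "0 < vol x (\<kappa> * r) * vol x r" using vol_pos[OF kr(1), of x] vol_pos[OF r, of x] by simp
    qed (use C D in simp)
    finally show "(avg f (ball z1 (\<tau> * r)) - avg f (ball z2 (\<tau> * r)))\<^sup>2
      \<le> C * D / vol x r * jumpW (\<Psi> (\<kappa> * r)) (ball x (l * \<kappa> * r)) f" .
  qed (use k1 l C D in auto)
qed

text \<open>Joins \<open>z1\<close> to \<open>z2\<close> along a uniform curve by small balls and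
  applies the Poincare inequality to each. The balls and their enlargements stay at depth at least
  \<open>r / (4 * A\<^sup>2)\<close>, so only values of \<open>f\<close> there enter.\<close>

lemma uniform_avg:
  assumes U: "A_uniform_domain A U" "A \<ge> 1" and L: "L > 0"
  obtains \<tau> K C where "0 < \<tau>" "\<tau> \<le> 1" "K > 0" "C > 0" "\<And>r n f x z1 z2. r > 0 \<Longrightarrow> f \<in> L2 m \<Longrightarrow> bdd f \<Longrightarrow>
    z1 \<in> U \<Longrightarrow> z2 \<in> U \<Longrightarrow> r / A \<le> infdist z1 (- U) \<Longrightarrow> r / A \<le> infdist z2 (- U) \<Longrightarrow>
    dist x z1 \<le> L * r \<Longrightarrow> dist x z2 \<le> L * r \<Longrightarrow>
    (avg f (ball z1 (\<eta> * \<tau> / 2 * r)) - avg f (ball z2 (\<eta> * \<tau> / 2 * r)))\<^sup>2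
      \<le> C / vol x r * (2 ^ n * jumpW (\<Psi> (\<tau> * r) / 2 ^ n) ({y. r / (4 * A\<^sup>2) \<le> infdist y (- U)} \<inter> ball x (K * r)) f)"
proof -
  obtain l C where l: "l \<ge> 2" and C: "C > 0" and poi: "\<And>x r n f w1 w2 \<rho> D. r > 0 \<Longrightarrow> f \<in> L2 m \<Longrightarrow> bdd f \<Longrightarrow> \<rho> > 0 \<Longrightarrow>
    ball w1 \<rho> \<subseteq> ball x (\<eta> * r) \<Longrightarrow> ball w2 \<rho> \<subseteq> ball x (\<eta> * r) \<Longrightarrow>
    vol x r \<le> D * vol w1 \<rho> \<Longrightarrow> vol x r \<le> D * vol w2 \<rho> \<Longrightarrow>
    (avg f (ball w1 \<rho>) - avg f (ball w2 \<rho>))\<^sup>2 \<le> C * D / vol x r * (2 ^ n * jumpW (\<Psi> r / 2 ^ n) (ball x (l * r)) f)"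
    using poincare_avg by metis
  have e: "0 < \<eta>" "\<eta> \<le> 1" using \<eta>_bounds by auto
  have A2: "A\<^sup>2 \<ge> 1" using U(2) by simp
  have A4: "1 / (4 * A\<^sup>2) \<le> 1" using A2 by (subst pos_divide_le_eq) auto
  \<comment> \<open>The curve has depth \<open>r / (2 * A\<^sup>2)\<close>; the enlarged balls have
    radius \<open>l * \<tau> * r\<close>, half of that, and so keep depth
    \<open>r / (4 * A\<^sup>2)\<close>.\<close>
  define \<tau> where "\<tau> = 1 / (4 * A\<^sup>2 * l)"
  have "4 * A\<^sup>2 * l > 0" using A2 l by (intro mult_pos_pos) auto
  then have t0: "\<tau> > 0" unfolding \<tau>_def by (rule divide_pos_pos[OF zero_less_one])
  have lt: "l * \<tau> = 1 / (4 * A\<^sup>2)" using l by (simp add: \<tau>_def)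
  have lt1: "l * \<tau> \<le> 1" unfolding lt by (rule A4)
  have "1 * \<tau> \<le> l * \<tau>" using l t0 by (intro mult_right_mono) auto
  then have t1: "\<tau> \<le> 1" using lt1 by simp
  define K where "K = L + 2 * A * L + 2"
  have AL: "A * L > 0" using U(2) L by simp
  have K: "K \<ge> 1" using L AL by (simp add: K_def)
  obtain D where D: "D \<ge> 1" "\<And>x y r. r > 0 \<Longrightarrow> dist x y \<le> 1 * r \<Longrightarrow> vol y (1 * r) \<le> D * vol x (\<eta> / 2 * r)"
    using step_volume[of 1 "\<eta> / 2"] e by auto
  obtain D2 where D2: "D2 \<ge> 1" "\<And>x y r. r > 0 \<Longrightarrow> dist x y \<le> K * r \<Longrightarrow> vol y (K * r) \<le> D2 * vol x (\<tau> * r)"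
    using step_volume[OF K t0] by blast
  \<comment> \<open>Averaging balls of radius \<open>\<sigma> * r\<close> with centres within
    \<open>\<sigma> * r\<close> of \<open>w\<close> fit into
    \<open>ball w (\<eta> * (\<tau> * r))\<close>, the ball on which the variance is
    bounded.\<close>
  define \<sigma> where "\<sigma> = \<eta> * \<tau> / 2"
  have s0: "\<sigma> > 0" using e t0 by (simp add: \<sigma>_def)
  have Ks: "K / \<sigma> > 0" using K s0 by simp
  from chain_bound[OF Ks] obtain N :: nat where N: "\<And>(x::'a) \<rho> \<gamma> a \<Delta> z z'. \<rho> > 0 \<Longrightarrow> connected \<gamma> \<Longrightarrow> \<gamma> \<subseteq> ball x (K / \<sigma> * \<rho>) \<Longrightarrow> z \<in> \<gamma> \<Longrightarrow> z' \<in> \<gamma> \<Longrightarrow>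
    (\<And>w w'. w \<in> \<gamma> \<Longrightarrow> w' \<in> \<gamma> \<Longrightarrow> dist w w' < \<rho> \<Longrightarrow> \<bar>a w - a w'\<bar> \<le> (\<Delta>::real)) \<Longrightarrow> \<bar>a z - a z'\<bar> \<le> real N * \<Delta>"
    by blast
  show thesis
  \<comment> \<open>Adding 1 makes the constant positive even if \<open>N\<close> is 0.\<close>
  proof (rule that[of \<tau> K "(real N)\<^sup>2 * (C * D * D2) + 1"])
    fix r n f and x z1 z2 :: 'a
    assume r: "r > 0" and f: "f \<in> L2 m" "bdd f" and zU: "z1 \<in> U" "z2 \<in> U"
      and zi: "r / A \<le> infdist z1 (- U)" "r / A \<le> infdist z2 (- U)" and z: "dist x z1 \<le> L * r" "dist x z2 \<le> L * r"
    define W where "W = {y. r / (4 * A\<^sup>2) \<le> infdist y (- U)} \<inter> ball x (K * r)"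
    define Q where "Q = 2 ^ n * jumpW (\<Psi> (\<tau> * r) / 2 ^ n) W f"
    define \<Delta> where "\<Delta> = sqrt (C * D * D2 / vol x r * Q)"
    have tr: "\<tau> * r > 0" using t0 r by simp
    have sr: "\<sigma> * r > 0" using s0 r by simp
    have vx: "vol x r > 0" by (rule vol_pos[OF r])
    have sn: "\<Psi> (\<tau> * r) / 2 ^ n > 0" using \<Psi>_pos[OF tr] by simp
    have "closed {y. r / (4 * A\<^sup>2) \<le> infdist y (- U)}" by (intro closed_Collect_le continuous_intros)
    then have Wb: "W \<in> sets borel" unfolding W_def by (intro sets.Int borel_closed borel_open) auto
    have Q0: "Q \<ge> 0" by (simp add: Q_def jumpW_nonneg)
    have rA: "r / A \<ge> 0" using r U by simp
    obtain \<gamma> where \<gamma>: "connected \<gamma>" "z1 \<in> \<gamma>" "z2 \<in> \<gamma>" "\<gamma> \<subseteq> U"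
      "\<And>w. w \<in> \<gamma> \<Longrightarrow> dist z1 w \<le> A * dist z1 z2" "\<And>w. w \<in> \<gamma> \<Longrightarrow> infdist w (- U) \<ge> r / A / (2 * A)"
      using uniform_curve[OF U zU rA zi] by metis
    have zz: "dist z1 z2 \<le> 2 * L * r" using z dist_triangle[of z1 z2 x] by (simp add: dist_commute)
    have near: "dist x w \<le> (K - 2) * r" if "w \<in> \<gamma>" for w
    proof -
      have "A * dist z1 z2 \<le> A * (2 * L * r)" using zz U(2) by (intro mult_left_mono) auto
      then have "dist x w \<le> L * r + A * (2 * L * r)" using \<gamma>(5)[OF that] z(1) dist_triangle[of x w z1] by linarith
      also have "\<dots> = (K - 2) * r" by (simp add: K_def algebra_simps)
      finally show ?thesis .
    qed
    have Kr: "(K - 2) * r < K * r" using r by (simp add: algebra_simps)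
    have step: "\<bar>avg f (ball w (\<sigma> * r)) - avg f (ball w' (\<sigma> * r))\<bar> \<le> \<Delta>"
      if w: "w \<in> \<gamma>" "w' \<in> \<gamma>" "dist w w' < \<sigma> * r" for w w'
    proof -
      have s2: "\<eta> * (\<tau> * r) = \<sigma> * r + \<sigma> * r" by (simp add: \<sigma>_def)
      have sub: "ball w'' (\<sigma> * r) \<subseteq> ball w (\<eta> * (\<tau> * r))" if "dist w w'' < \<sigma> * r" for w''
      proof
        fix y assume y: "y \<in> ball w'' (\<sigma> * r)"
        then show "y \<in> ball w (\<eta> * (\<tau> * r))" unfolding s2 using that dist_triangle[of w y w''] by simp
      qed
      have "\<sigma> * r \<le> 1 * (\<tau> * r)"
        using mult_right_mono[of \<eta> 2 "\<tau> * r"] e tr by (simp add: \<sigma>_def)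
      then have v: "vol w (\<tau> * r) \<le> D * vol w'' (\<sigma> * r)" if "dist w w'' < \<sigma> * r" for w''
        using D(2)[OF tr, of w'' w] that by (simp add: dist_commute \<sigma>_def ac_simps)
      have ww: "dist w w < \<sigma> * r" using sr by simp
      have "(avg f (ball w (\<sigma> * r)) - avg f (ball w' (\<sigma> * r)))\<^sup>2
        \<le> C * D / vol w (\<tau> * r) * (2 ^ n * jumpW (\<Psi> (\<tau> * r) / 2 ^ n) (ball w (l * (\<tau> * r))) f)"
        by (rule poi[OF tr f sr sub[OF ww] sub[OF w(3)] v[OF ww] v[OF w(3)]])
      also have "\<dots> \<le> C * D * D2 / vol x r * Q"
      proof (rule mult_mono)
        have "vol x r \<le> vol x (K * r)" using K r mult_right_mono[OF K, of r] by (intro vol_mono subset_ball) simp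
        also have "\<dots> \<le> D2 * vol w (\<tau> * r)" using D2(2)[OF r, of w x] near[OF w(1)] Kr by (simp add: dist_commute)
        finally have "C * D * vol x r \<le> C * D * (D2 * vol w (\<tau> * r))" using C D by (intro mult_left_mono) auto
        then show "C * D / vol w (\<tau> * r) \<le> C * D * D2 / vol x r"
          using vx vol_pos[OF tr, of w] by (simp add: divide_simps ac_simps)
        have "ball w (l * (\<tau> * r)) \<subseteq> W"
        proof
          fix y assume "y \<in> ball w (l * (\<tau> * r))"
          then have y: "dist w y < 1 / (4 * A\<^sup>2) * r" unfolding lt[symmetric] by (simp add: mult.assoc)
          have "1 / (4 * A\<^sup>2) * r \<le> 1 * r" using A4 r by (intro mult_right_mono) auto
          then have "dist x y < (K - 2) * r + r" using y near[OF w(1)] dist_triangle[of x y w] by linarith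
          then have 1: "y \<in> ball x (K * r)" using r by (simp add: algebra_simps)
          have "r / A / (2 * A) = 1 / (4 * A\<^sup>2) * r + r / (4 * A\<^sup>2)" by (simp add: power2_eq_square)
          then have "r / (4 * A\<^sup>2) \<le> infdist y (- U)"
            using \<gamma>(6)[OF w(1)] y infdist_lipschitz[of w "- U" y] unfolding dist_commute[of y w] by linarith
          then show "y \<in> W" using 1 by (simp add: W_def)
        qed
        then have "jumpW (\<Psi> (\<tau> * r) / 2 ^ n) (ball w (l * (\<tau> * r))) f \<le> jumpW (\<Psi> (\<tau> * r) / 2 ^ n) W f"
          by (intro jumpW_mono[OF sn f(1) _ Wb]) auto
        then show "2 ^ n * jumpW (\<Psi> (\<tau> * r) / 2 ^ n) (ball w (l * (\<tau> * r))) f \<le> Q"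
          unfolding Q_def by (rule mult_left_mono) simp
      qed (use C D D2 vx jumpW_nonneg in auto)
      finally show ?thesis unfolding \<Delta>_def by (metis real_sqrt_abs real_sqrt_le_mono)
    qed
    have sub: "\<gamma> \<subseteq> ball x (K / \<sigma> * (\<sigma> * r))"
    proof
      fix w assume "w \<in> \<gamma>"
      then have "dist x w < K * r" using near[of w] Kr by linarith
      then show "w \<in> ball x (K / \<sigma> * (\<sigma> * r))" using s0 by simp
    qed
    have "\<bar>avg f (ball z1 (\<sigma> * r)) - avg f (ball z2 (\<sigma> * r))\<bar> \<le> real N * \<Delta>"
      by (rule N[OF sr \<gamma>(1) sub \<gamma>(2,3), of "\<lambda>w. avg f (ball w (\<sigma> * r))"]) (rule step)
    then have "(avg f (ball z1 (\<sigma> * r)) - avg f (ball z2 (\<sigma> * r)))\<^sup>2 \<le> (real N * \<Delta>)\<^sup>2"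
      by (rule power2_le_iff_abs_le[THEN iffD2, rotated]) (simp add: \<Delta>_def Q0 C D D2 vx less_imp_le order.trans[OF zero_le_one])
    also have "\<dots> = (real N)\<^sup>2 * (C * D * D2) / vol x r * Q"
    proof -
      have "C * D * D2 / vol x r * Q \<ge> 0" using C D D2 vx Q0 by simp
      then show ?thesis by (simp add: power_mult_distrib \<Delta>_def)
    qed
    also have "\<dots> \<le> ((real N)\<^sup>2 * (C * D * D2) + 1) / vol x r * Q"
      using vx Q0 by (intro mult_right_mono divide_right_mono) auto
    finally show "(avg f (ball z1 (\<eta> * \<tau> / 2 * r)) - avg f (ball z2 (\<eta> * \<tau> / 2 * r)))\<^sup>2
      \<le> ((real N)\<^sup>2 * (C * D * D2) + 1) / vol x r * (2 ^ n * jumpW (\<Psi> (\<tau> * r) / 2 ^ n) ({y. r / (4 * A\<^sup>2) \<le> infdist y (- U)} \<inter> ball x (K * r)) f)"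
      by (simp add: \<sigma>_def Q_def W_def)
  qed (use t0 t1 K C D D2 in \<open>auto intro!: add_nonneg_pos\<close>)
qed

lemma finite_net:
  assumes r: "r > 0" and R: "R > 0"
  obtains n and x :: "nat \<Rightarrow> 'a" where "inj_on x {..<n}" "sep r (x ` {..<n})" "ball x0 R \<subseteq> (\<Union>k<n. ball (x k) r)"
proof -
  have "R / r > 0" using r R by simp
  from maximal_net[OF this] obtain N where N: "\<And>(x::'a) \<rho> Y. \<rho> > 0 \<Longrightarrow> Y \<subseteq> ball x (R / r * \<rho>) \<Longrightarrow>
    \<exists>S. S \<subseteq> Y \<and> finite S \<and> card S \<le> N \<and> sep \<rho> S \<and> Y \<subseteq> (\<Union>s\<in>S. ball s \<rho>)" by blast
  have "ball x0 R \<subseteq> ball x0 (R / r * r)" using r by simp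
  from N[OF r this] obtain S where S: "finite S" "sep r S" "ball x0 R \<subseteq> (\<Union>s\<in>S. ball s r)" by blast
  obtain x where x: "bij_betw x {0..<card S} S" using ex_bij_betw_nat_finite[OF S(1)] by blast
  then have "inj_on x {..<card S}" "x ` {..<card S} = S" by (simp_all add: bij_betw_def atLeast0LessThan)
  then show thesis 
  proof (intro that[of x "card S"])
    have "(\<Union>k<card S. ball (x k) r) = (\<Union>s\<in>x ` {..<card S}. ball s r)" by simp
    then show "ball x0 R \<subseteq> (\<Union>k<card S. ball (x k) r)" using \<open>x ` {..<card S} = S\<close> S(3) by simp
  qed (use S in simp_all)
qed

lemma sep_multiplicity:
  assumes K: "K > 0" and \<sigma>: "\<sigma> > 0"
  obtains N :: nat where "\<And>r n (x :: nat \<Rightarrow> 'a) y. r > 0 \<Longrightarrow> inj_on x {..<n} \<Longrightarrow> sep (\<sigma> * r) (x ` {..<n}) \<Longrightarrow>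
    card {j. j < n \<and> dist (x j) y < K * r} \<le> N"
proof -
  have "K / \<sigma> > 0" using K \<sigma> by simp
  from sep_card[OF this] obtain N :: nat where N: "\<And>(x::'a) \<rho> S. \<rho> > 0 \<Longrightarrow> S \<subseteq> ball x (K / \<sigma> * \<rho>) \<Longrightarrow> sep \<rho> S \<Longrightarrow> finite S \<and> card S \<le> N"
    by blast
  show thesis
  proof (rule that[of N])
    fix r n and x :: "nat \<Rightarrow> 'a" and y
    assume r: "r > 0" and x: "inj_on x {..<n}" "sep (\<sigma> * r) (x ` {..<n})"
    let ?J = "{j. j < n \<and> dist (x j) y < K * r}"
    have "x ` ?J \<subseteq> ball y (K / \<sigma> * (\<sigma> * r))" using \<sigma> by (auto simp: dist_commute)
    moreover have "sep (\<sigma> * r) (x ` ?J)" using x(2) by (auto simp: sep_def)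
    ultimately have "card (x ` ?J) \<le> N" using N[of "\<sigma> * r"] \<sigma> r by auto
    moreover have "inj_on x ?J" using x(1) by (rule inj_on_subset) auto
    ultimately show "card ?J \<le> N" by (simp add: card_image)
  qed
qed

end

context patching
begin

text \<open>The volume in the bound for the coefficients cancels against the one in the energy of
  the cutoffs.\<close>

lemma Lf_patch_sum:
  assumes J: "J \<subseteq> {..<n}" and a: "\<And>s i. s \<in> J \<Longrightarrow> i \<in> nbr s \<Longrightarrow> (a i - a s)\<^sup>2 \<le> c / vol (x s) r * Q s"
    and g: "\<And>s. s \<in> J \<Longrightarrow> g s \<in> F" "\<And>s. s \<in> J \<Longrightarrow> bdd (g s)" "\<And>s. s \<in> J \<Longrightarrow> bsupp (g s)" "\<And>s y. s \<in> J \<Longrightarrow> g s y \<le> 1"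
      "\<And>s y. s \<in> J \<Longrightarrow> y \<notin> cball (x s) q \<Longrightarrow> g s y = 0" and q: "q < \<eta> * r"
  shows "Lf (patch a) (\<lambda>y. \<Sum>s\<in>J. g s y) \<le> real Nb ^ 4 * Cc * Dv * c / \<Psi> r * (\<Sum>s\<in>J. Q s)"
proof -
  have "Lf (patch a) (\<lambda>y. \<Sum>s\<in>J. g s y) = (\<Sum>s\<in>J. Lf (patch a) (g s))"
    by (rule Lf_sum[OF patch_F patch_bdd g(1,2)])
  also have "\<dots> \<le> (\<Sum>s\<in>J. real Nb ^ 4 * Cc * Dv * c / \<Psi> r * Q s)"
  proof (rule sum_mono)
    fix s assume s: "s \<in> J"
    then have "s < n" using J by auto
    have "Lf (patch a) (g s) \<le> real Nb ^ 4 * Cc * Dv * (c / vol (x s) r * Q s * (vol (x s) r / \<Psi> r))"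
      by (rule Lf_patch[where a = a, OF \<open>s < n\<close> a[OF s] g(1-3)[OF s] g(4)[OF s] g(5)[OF s] q])
    also have "\<dots> = real Nb ^ 4 * Cc * Dv * c / \<Psi> r * Q s" using vol_pos[OF r, of "x s"] by simp
    finally show "Lf (patch a) (g s) \<le> real Nb ^ 4 * Cc * Dv * c / \<Psi> r * Q s" .
  qed
  finally show ?thesis by (simp add: sum_distrib_left)
qed

text \<open>\<open>patch a y\<close> is a convex combination of the coefficients of nearby
  indices.\<close>

lemma patch_close:
  assumes k: "k < n" "y \<in> ball (x k) (\<eta> * r)" and a: "\<And>i. i < n \<Longrightarrow> dist (x i) y < lc * r \<Longrightarrow> \<bar>a i - c\<bar> \<le> \<epsilon>"
  shows "\<bar>patch a y - c\<bar> \<le> \<epsilon>"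
proof -
  have "patch a y - c = (\<Sum>i<n. (a i - c) * \<phi> i y)"
    using \<phi>_sum_one[OF k] by (simp add: patch_def left_diff_distrib sum_subtractf flip: sum_distrib_left)
  also have "\<bar>\<dots>\<bar> \<le> (\<Sum>i<n. \<bar>(a i - c) * \<phi> i y\<bar>)" by (rule sum_abs)
  also have "\<dots> \<le> (\<Sum>i<n. \<epsilon> * \<phi> i y)"
  proof (rule sum_mono)
    fix i assume "i \<in> {..<n}"
    then have i: "i < n" by simp
    show "\<bar>(a i - c) * \<phi> i y\<bar> \<le> \<epsilon> * \<phi> i y"
    proof (cases "dist (x i) y < lc * r")
      case True
      then show ?thesis using a[OF i True] \<phi>_bounds(1)[OF i, of y] by (simp add: abs_mult mult_right_mono)
    next
      case False
      then show ?thesis using \<phi>_zero[OF i, of y] by simp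
    qed
  qed
  also have "\<dots> = \<epsilon>" using \<phi>_sum_one[OF k] by (simp flip: sum_distrib_left)
  finally show ?thesis .
qed

lemma patch_zero:
  assumes "\<And>i. i < n \<Longrightarrow> dist (x i) y < lc * r \<Longrightarrow> a i = 0"
  shows "patch a y = 0"
  unfolding patch_def
proof (rule sum.neutral, intro ballI)
  fix i assume "i \<in> {..<n}"
  then have i: "i < n" by simp
  show "a i * \<phi> i y = 0"
  proof (cases "dist (x i) y < lc * r")
    case False
    then show ?thesis using \<phi>_zero[OF i, of y] by simp
  qed (use assms[OF i] in simp)
qed

end

section \<open>Approximation of a continuous function at one scale\<close>

context hke_space
begin

text \<open>The bound on \<open>Lf u g\<close> only sees \<open>f\<close> at depth comparable to \<open>r\<close>: near the boundary the coefficients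
  of \<open>u\<close> are averages around corkscrew points, joined by chains of balls along uniform curves.\<close>

lemma approximant:
  assumes U: "A_uniform_domain A U" "A \<ge> 1" and ne: "frontier U \<noteq> {}"
  obtains \<tau> c q C R0 where "0 < \<tau>" "0 < c" "0 < q" "0 < C" "0 < R0"
    "\<And>f K r \<omega> x0 R. f \<in> F \<inter> C_c \<Longrightarrow> K \<subseteq> frontier U \<Longrightarrow> K \<subseteq> ball x0 R \<Longrightarrow> R > 0 \<Longrightarrow>
      (\<And>y. y \<notin> ball x0 R \<Longrightarrow> f y = 0) \<Longrightarrow> 0 < r \<Longrightarrow> r \<le> R0 \<Longrightarrow> r \<le> 1 \<Longrightarrow>
      (\<And>y z. dist y z < c * r \<Longrightarrow> \<bar>f y - f z\<bar> \<le> \<omega>) \<Longrightarrow>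
      \<exists>u\<in>F. \<exists>g\<in>F \<inter> C_c. bdd u \<and> E u u \<le> C * E f f \<and> (\<forall>y. \<bar>u y - f y\<bar> \<le> \<omega>) \<and> (\<forall>y. y \<notin> ball x0 (R + c) \<longrightarrow> u y = 0) \<and>
        (\<forall>y. 0 \<le> g y) \<and> (\<forall>y\<in>K. 1 \<le> g y) \<and>
        (\<forall>n. Lf u g \<le> C * (jumpW (\<Psi> (\<tau> * r) / 2 ^ n) {y. r / (4 * A\<^sup>2) \<le> infdist y (- U) \<and> infdist y (- U) \<le> q * r} f / (\<Psi> (\<tau> * r) / 2 ^ n)))"
proof -
  obtain lc Cc where lc: "lc \<ge> 2" and Cc: "Cc > 0" and cut: "\<And>x r. r > 0 \<Longrightarrow> \<exists>\<psi>\<in>F. (\<forall>y. 0 \<le> \<psi> y \<and> \<psi> y \<le> 1) \<and>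
      (\<forall>y\<in>ball x (\<eta> * r). \<psi> y = 1) \<and> (\<forall>y. y \<notin> ball x (lc * r) \<longrightarrow> \<psi> y = 0) \<and> E \<psi> \<psi> \<le> Cc * (vol x r / \<Psi> r)"
    using cutoff by metis
  obtain R0 where R0: "R0 > 0" and cork: "\<And>\<xi> r. \<xi> \<in> frontier U \<Longrightarrow> 0 < r \<Longrightarrow> r \<le> R0 \<Longrightarrow> \<exists>z\<in>U. dist \<xi> z \<le> 2 * r \<and> infdist z (- U) \<ge> r / A"
    using corkscrew[OF U ne] by metis
  have e: "0 < \<eta>" "\<eta> \<le> 1" using \<eta>_bounds by auto
  \<comment> \<open>A net point within \<open>3 * lc * r\<close> of the boundary has a corkscrew
    point within another \<open>2 * r\<close>; \<open>L\<close> adds the distance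
    \<open>2 * lc * r\<close> between neighbours.\<close>
  define K1 where "K1 = 3 * lc + 2"
  define L where "L = 2 * lc + K1"
  have L: "L > 0" using lc by (simp add: L_def K1_def)
  obtain \<tau> Kl Cl where t: "0 < \<tau>" "\<tau> \<le> 1" and Kl: "Kl > 0" and Cl: "Cl > 0"
    and loc: "\<And>r n f x z1 z2. r > 0 \<Longrightarrow> f \<in> L2 m \<Longrightarrow> bdd f \<Longrightarrow>
      z1 \<in> U \<Longrightarrow> z2 \<in> U \<Longrightarrow> r / A \<le> infdist z1 (- U) \<Longrightarrow> r / A \<le> infdist z2 (- U) \<Longrightarrow>
      dist x z1 \<le> L * r \<Longrightarrow> dist x z2 \<le> L * r \<Longrightarrow>
      (avg f (ball z1 (\<eta> * \<tau> / 2 * r)) - avg f (ball z2 (\<eta> * \<tau> / 2 * r)))\<^sup>2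
        \<le> Cl / vol x r * (2 ^ n * jumpW (\<Psi> (\<tau> * r) / 2 ^ n) ({y. r / (4 * A\<^sup>2) \<le> infdist y (- U)} \<inter> ball x (Kl * r)) f)"
    using uniform_avg[OF U L] by metis
  define \<sigma> where "\<sigma> = \<eta> * \<tau> / 2"
  have s0: "\<sigma> > 0" using e t by (simp add: \<sigma>_def)
  have "\<eta> * \<tau> \<le> 1 * 1" using e t by (intro mult_mono) auto
  then have s1: "\<sigma> \<le> 1" by (simp add: \<sigma>_def)
  obtain \<kappa> Kg Cg where k1: "\<kappa> \<ge> 1" and Kg: "Kg > 0" and Cg: "Cg > 0" 
    and glo: "\<And>r f x z1 z2. r > 0 \<Longrightarrow> f \<in> L2 m \<Longrightarrow> bdd f \<Longrightarrow> dist x z1 \<le> L * r \<Longrightarrow> dist x z2 \<le> L * r \<Longrightarrow>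
      (avg f (ball z1 (\<sigma> * r)) - avg f (ball z2 (\<sigma> * r)))\<^sup>2 \<le> Cg / vol x r * jumpW (\<Psi> (\<kappa> * r)) (ball x (Kg * r)) f"
    using global_avg[OF L s0] by metis
  have eh: "\<eta> / 2 > 0" using e by simp
  have lc4: "4 * lc > 0" using lc by simp
  from sep_multiplicity[OF lc4 eh] obtain Nb :: nat where Nb: "\<And>r n (x :: nat \<Rightarrow> 'a) y. r > 0 \<Longrightarrow> inj_on x {..<n} \<Longrightarrow> sep (\<eta> / 2 * r) (x ` {..<n}) \<Longrightarrow>
    card {j. j < n \<and> dist (x j) y < 4 * lc * r} \<le> Nb" by blast
  from sep_multiplicity[OF Kl eh] obtain Nl :: nat where Nl: "\<And>r n (x :: nat \<Rightarrow> 'a) y. r > 0 \<Longrightarrow> inj_on x {..<n} \<Longrightarrow> sep (\<eta> / 2 * r) (x ` {..<n}) \<Longrightarrow>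
    card {j. j < n \<and> dist (x j) y < Kl * r} \<le> Nl" by blast
  from sep_multiplicity[OF Kg eh] obtain Ng :: nat where Ng: "\<And>r n (x :: nat \<Rightarrow> 'a) y. r > 0 \<Longrightarrow> inj_on x {..<n} \<Longrightarrow> sep (\<eta> / 2 * r) (x ` {..<n}) \<Longrightarrow>
    card {j. j < n \<and> dist (x j) y < Kg * r} \<le> Ng" by blast
  have lc41: "4 * lc \<ge> 1" using lc by simp
  obtain Dv where Dv: "Dv \<ge> 1" "\<And>x y r. r > 0 \<Longrightarrow> dist x y \<le> 4 * lc * r \<Longrightarrow> vol y (4 * lc * r) \<le> Dv * vol x (1 * r)"
    using step_volume[OF lc41 zero_less_one] by metis
  obtain C\<Psi> where C\<Psi>: "C\<Psi> > 0" "\<And>r. r > 0 \<Longrightarrow> \<Psi> (\<kappa> * r) \<le> C\<Psi> * \<Psi> r" using \<Psi>_compare[OF k1] by metis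
  \<comment> \<open>The reach of a coefficient at \<open>y\<close>: from \<open>y\<close> to the net
    point, \<open>lc * r\<close>, on to the centre \<open>z i\<close>, \<open>K1 * r\<close>, and
    across an averaging ball of radius at most \<open>r\<close>.\<close>
  define c where "c = lc + K1 + 1"
  define C3 where "C3 = real Nb ^ 4 * Cc * Dv"
  have C3: "C3 \<ge> 0" using Cc Dv by (simp add: C3_def)
  define C where "C = C3 * Cg * (real Ng * C\<Psi>) + C3 * Cl * real Nl + 1"
  show thesis
  proof (rule that[of \<tau> c "Kl + 3 * lc" C R0])
    show "0 < c" "0 < Kl + 3 * lc" using lc Kl by (simp_all add: c_def K1_def)
    show "0 < C" using C3 Cg Cl C\<Psi> by (auto simp: C_def intro!: add_nonneg_pos add_nonneg_nonneg mult_nonneg_nonneg)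
    fix f K r \<omega> x0 R
    assume fF: "f \<in> F \<inter> C_c" and K: "K \<subseteq> frontier U" "K \<subseteq> ball x0 R" and R: "R > 0" and f0: "\<And>y. y \<notin> ball x0 R \<Longrightarrow> f y = 0"
      and r: "0 < r" "r \<le> R0" "r \<le> 1" and \<omega>: "\<And>y z. dist y z < c * r \<Longrightarrow> \<bar>f y - f z\<bar> \<le> \<omega>"
    define R1 where "R1 = R + c + 1"
    have c0: "c > 0" using lc by (simp add: c_def K1_def)
    have R1: "R1 > 0" using R c0 by (simp add: R1_def)
    have er: "\<eta> / 2 * r > 0" using e r by simp
    \<comment> \<open>The net is finer than the balls of radius \<open>\<eta> * r\<close> on which
      the cutoffs are 1, so test functions equal to 1 on \<open>ball (x k) (\<eta> / 2 * r)\<close>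
      can be supported strictly inside those balls.\<close>
    obtain n and x :: "nat \<Rightarrow> 'a" where x: "inj_on x {..<n}" "sep (\<eta> / 2 * r) (x ` {..<n})"
      and cov: "ball x0 R1 \<subseteq> (\<Union>k<n. ball (x k) (\<eta> / 2 * r))"
      by (rule finite_net[OF er R1])
    have "\<forall>k. \<exists>\<psi>. \<psi> \<in> F \<and> (\<forall>y. 0 \<le> \<psi> y \<and> \<psi> y \<le> 1) \<and> (\<forall>y\<in>ball (x k) (\<eta> * r). \<psi> y = 1) \<and>
        (\<forall>y. y \<notin> ball (x k) (lc * r) \<longrightarrow> \<psi> y = 0) \<and> E \<psi> \<psi> \<le> Cc * (vol (x k) r / \<Psi> r)"
      using cut[OF r(1)] by blast
    from choice[OF this] obtain \<psi> where psi: "\<And>k. \<psi> k \<in> F" "\<And>k y. 0 \<le> \<psi> k y" "\<And>k y. \<psi> k y \<le> 1" "\<And>k y. y \<in> ball (x k) (\<eta> * r) \<Longrightarrow> \<psi> k y = 1"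
      "\<And>k y. y \<notin> ball (x k) (lc * r) \<Longrightarrow> \<psi> k y = 0" "\<And>k. E (\<psi> k) (\<psi> k) \<le> Cc * (vol (x k) r / \<Psi> r)" by blast
    have Dv': "vol z r \<le> Dv * vol y r" if "dist y z \<le> 4 * lc * r" for y z
    proof -
      have "vol z r \<le> vol z (4 * lc * r)" using lc41 r mult_right_mono[OF lc41, of r] by (intro vol_mono subset_ball) simp
      then show ?thesis using Dv(2)[OF r(1) that] by simp
    qed
    interpret pat: patching m E F P p \<Psi> C1 c1 c2 c3 \<delta> D0 lc Cc r n x \<psi> Nb Dv
      by unfold_locales (use lc Cc r psi Nb[OF r(1) x] Dv(1) Dv' in auto)
    have f2: "f \<in> F" "f \<in> L2 m" "bdd f" using fF F_L2 C_c_bdd by auto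
    \<comment> \<open>Near the boundary the centre of averaging is moved to a corkscrew point in
      \<open>U\<close>, also for net points outside \<open>U\<close>; elsewhere the net point itself
      serves.\<close>
    have "\<forall>i. \<exists>z. dist (x i) z \<le> K1 * r \<and> ((\<exists>\<xi>\<in>frontier U. dist (x i) \<xi> < 3 * lc * r) \<longrightarrow> z \<in> U \<and> r / A \<le> infdist z (- U))"
    proof
      fix i
      show "\<exists>z. dist (x i) z \<le> K1 * r \<and> ((\<exists>\<xi>\<in>frontier U. dist (x i) \<xi> < 3 * lc * r) \<longrightarrow> z \<in> U \<and> r / A \<le> infdist z (- U))"
      proof (cases "\<exists>\<xi>\<in>frontier U. dist (x i) \<xi> < 3 * lc * r")
        case True
        then obtain \<xi> where xi: "\<xi> \<in> frontier U" "dist (x i) \<xi> < 3 * lc * r" by blast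
        obtain z where z: "z \<in> U" "dist \<xi> z \<le> 2 * r" "infdist z (- U) \<ge> r / A" using cork[OF xi(1) r(1,2)] by blast
        have "dist (x i) z \<le> 3 * lc * r + 2 * r" using dist_triangle[of "x i" z \<xi>] xi(2) z(2) by linarith
        then have "dist (x i) z \<le> K1 * r" by (simp add: K1_def algebra_simps)
        then show ?thesis using z by blast
      next
        case False
        have "dist (x i) (x i) \<le> K1 * r" using lc r by (simp add: K1_def)
        then show ?thesis using False by blast
      qed
    qed
    from choice[OF this] obtain z where z: "\<And>i. dist (x i) (z i) \<le> K1 * r"
      and zU: "\<And>i \<xi>. \<xi> \<in> frontier U \<Longrightarrow> dist (x i) \<xi> < 3 * lc * r \<Longrightarrow> z i \<in> U \<and> r / A \<le> infdist (z i) (- U)" by blast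
    define a where "a i = avg f (ball (z i) (\<sigma> * r))" for i
    have sr: "\<sigma> * r > 0" "\<sigma> * r \<le> r" using s0 s1 r by (auto simp: mult_le_cancel_right1)
    have cr: "c * r = lc * r + K1 * r + r" "c * r \<le> c" using mult_left_mono[OF r(3), of c] c0 by (simp_all add: c_def distrib_right)
    have znear: "dist (x s) (z i) \<le> L * r" if "i \<in> pat.nbr s" for i s
    proof -
      have "dist (x s) (z i) \<le> dist (x i) (x s) + dist (x i) (z i)" by (metis dist_triangle dist_commute)
      also have "\<dots> \<le> 2 * lc * r + K1 * r" using that z[of i] by (intro add_mono) (auto simp: pat.nbr_def)
      finally show ?thesis by (simp add: L_def algebra_simps)
    qed
    have acl: "\<bar>a i - b\<bar> \<le> \<epsilon>" if "dist (x i) y < lc * r" "\<And>w. dist y w < c * r \<Longrightarrow> \<bar>f w - b\<bar> \<le> \<epsilon>" for i y b \<epsilon>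
      unfolding a_def
    proof (rule avg_close[OF f2(2)])
      show "measure m (ball (z i) (\<sigma> * r)) > 0" by (rule measure_ball_pos[OF sr(1)])
      fix w assume w: "w \<in> ball (z i) (\<sigma> * r)"
      have "dist y w \<le> dist (x i) y + dist (x i) (z i) + dist (z i) w"
        using dist_triangle[of y w "x i"] dist_triangle[of "x i" w "z i"] by (simp add: dist_commute)
      then have "dist y w < c * r" using that(1) z[of i] w sr cr(1) by simp
      then show "\<bar>f w - b\<bar> \<le> \<epsilon>" by (rule that(2))
    qed simp_all
    define u where "u = pat.patch a"
    have uF: "u \<in> F" "bdd u" "bsupp u" unfolding u_def by (rule pat.patch_F pat.patch_bdd pat.patch_bsupp)+
    have uz: "u y = 0" if "y \<notin> ball x0 (R + c)" for y
      unfolding u_def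
    proof (rule pat.patch_zero)
      fix i assume i: "dist (x i) y < lc * r"
      have "\<bar>a i - 0\<bar> \<le> 0"
      proof (rule acl[OF i])
        fix w assume w: "dist y w < c * r"
        have "w \<notin> ball x0 R" using that w cr(2) dist_triangle[of x0 y w] by (simp add: dist_commute)
        then show "\<bar>f w - 0\<bar> \<le> 0" using f0 by simp
      qed
      then show "a i = 0" by simp
    qed
    have cov1: "\<exists>k<n. y \<in> ball (x k) (\<eta> / 2 * r)" if "y \<in> ball x0 R1" for y using cov that by blast
    have bb: "ball (x k) (\<eta> / 2 * r) \<subseteq> ball (x k) (\<eta> * r)" for k using e r by (intro subset_ball) simp
    have ucl: "\<bar>u y - f y\<bar> \<le> \<omega>" for y
    proof (cases "y \<in> ball x0 R1")
      case True
      then obtain k where k: "k < n" "y \<in> ball (x k) (\<eta> * r)" using cov1 bb by blast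
      show ?thesis unfolding u_def
      proof (rule pat.patch_close[OF k])
        fix i assume "dist (x i) y < lc * r"
        then show "\<bar>a i - f y\<bar> \<le> \<omega>" by (rule acl) (use \<omega> in \<open>simp add: dist_commute\<close>)
      qed
    next
      case False
      then have "u y = 0" "f y = 0" using uz[of y] f0[of y] c0 by (auto simp: R1_def)
      moreover have "\<omega> \<ge> 0" using \<omega>[of y y] c0 r by simp
      ultimately show ?thesis by simp
    qed
    define q where "q = 3 * \<eta> / 4 * r"
    have q: "\<eta> / 2 * r < q" "q < \<eta> * r" using e r by (auto simp: q_def)
    have "\<forall>s. \<exists>g. g \<in> F \<inter> C_c \<and> (\<forall>y. 0 \<le> g y) \<and> (\<forall>y. g y \<le> 1) \<and> (\<forall>y\<in>ball (x s) (\<eta> / 2 * r). g y = 1) \<and> (\<forall>y. y \<notin> cball (x s) q \<longrightarrow> g y = 0)"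
      using bump_F[OF q(1)] by metis
    from choice[OF this] obtain g where g: "\<And>s. g s \<in> F \<inter> C_c" "\<And>s y. 0 \<le> g s y" "\<And>s y. g s y \<le> 1" "\<And>s y. y \<in> ball (x s) (\<eta> / 2 * r) \<Longrightarrow> g s y = 1"
      "\<And>s y. y \<notin> cball (x s) q \<Longrightarrow> g s y = 0" by blast
    have gF: "g s \<in> F" "bdd (g s)" "bsupp (g s)" for s using g(1)[of s] C_c_bdd C_c_bsupp by auto
    define G where "G J y = (\<Sum>s\<in>J. g s y)" for J y
    have GF: "G J \<in> F \<inter> C_c" "bdd (G J)" "bsupp (G J)" if "finite J" for J
    proof -
      have "G J \<in> C_c" using that unfolding G_def
      proof (induction J)
        case empty
        have "(\<lambda>x. 0 * g 0 x) \<in> C_c" using g(1)[of 0] by (intro C_c_scale) auto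
        then show ?case by simp
      next
        case (insert s J)
        then have "(\<lambda>y. g s y + (\<Sum>s\<in>J. g s y)) \<in> C_c" using g(1)[of s] by (intro C_c_add) auto
        then show ?case using insert.hyps by simp
      qed
      then show "G J \<in> F \<inter> C_c" "bdd (G J)" "bsupp (G J)"
        using gF unfolding G_def by (auto intro: E.V_sum C_c_bdd C_c_bsupp)
    qed
    have Gge: "G J y \<ge> 1" if J: "finite J" "s \<in> J" "y \<in> ball (x s) (\<eta> / 2 * r)" for J s y
      unfolding G_def using member_le_sum[OF J(2) _ J(1), of "\<lambda>s. g s y"] g(2) g(4)[OF J(3)] by simp
    have kr: "\<Psi> (\<kappa> * r) > 0" using k1 r by (intro \<Psi>_pos) auto
    have Pr: "\<Psi> r > 0" by (rule \<Psi>_pos[OF r(1)])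
    \<comment> \<open>The function \<open>w\<close> is 1 on a neighbourhood of the support of
      \<open>u\<close>, so the whole energy is \<open>Lf u w\<close>. It is estimated by the bumps
      of all net points, with \<open>global_avg\<close> at the single time
      \<open>\<Psi> (\<kappa> * r)\<close>.\<close>
    have Eu: "E u u \<le> C3 * Cg * (real Ng * C\<Psi>) * E f f"
    proof -
      define w where "w y = min (G {..<n} y) 1" for y
      have wF: "w \<in> F" "bdd w" "bsupp w"
        using GF[of "{..<n}"] unfolding w_def by (auto intro!: F_min_const C_c_bdd C_c_bsupp C_c_min_const)
      have "E u u = Lf u w"
      proof (rule E_eq_Lf[OF uF wF, of "ball x0 R1" "cball x0 (R + c)"])
        show "w y = 1" if "y \<in> ball x0 R1" for y using cov1[OF that] Gge[of "{..<n}" _ y] by (fastforce simp: w_def)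
        show "u y = 0" if "y \<notin> cball x0 (R + c)" for y using uz[of y] that by simp
      qed (auto simp: R1_def)
      also have "\<dots> \<le> Lf u (G {..<n})" by (rule Lf_mono[OF uF(1,2) wF(1,2)]) (use GF[of "{..<n}"] in \<open>auto simp: w_def\<close>)
      also have "\<dots> \<le> real Nb ^ 4 * Cc * Dv * Cg / \<Psi> r * (\<Sum>s<n. jumpW (\<Psi> (\<kappa> * r)) (ball (x s) (Kg * r)) f)"
        unfolding u_def G_def
      proof (rule pat.Lf_patch_sum[OF _ _ gF(1) gF(2) gF(3) g(3) g(5) q(2)])
        fix s i assume "s \<in> {..<n}" and i: "i \<in> pat.nbr s"
        then have s: "s \<in> pat.nbr s" by (intro pat.self_nbr) simp
        show "(a i - a s)\<^sup>2 \<le> Cg / vol (x s) r * jumpW (\<Psi> (\<kappa> * r)) (ball (x s) (Kg * r)) f"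
          unfolding a_def by (rule glo[OF r(1) f2(2,3) znear[OF i] znear[OF s]])
      qed auto
      also have "\<dots> \<le> C3 * Cg / \<Psi> r * (real Ng * (C\<Psi> * \<Psi> r * E f f))"
        unfolding C3_def[symmetric]
      proof (rule mult_left_mono)
        have "(\<Sum>s<n. jumpW (\<Psi> (\<kappa> * r)) (ball (x s) (Kg * r)) f) \<le> real Ng * jumpW (\<Psi> (\<kappa> * r)) UNIV f"
        proof (rule jumpW_sum_le[OF kr f2(2)])
          show "card {j \<in> {..<n}. y \<in> ball (x j) (Kg * r)} \<le> Ng" for y using Ng[OF r(1) x, of y] by simp
        qed auto
        also have "\<dots> \<le> real Ng * (\<Psi> (\<kappa> * r) * E f f)" by (intro mult_left_mono jumpW_le_E[OF kr f2(1)]) auto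
        also have "\<dots> \<le> real Ng * (C\<Psi> * \<Psi> r * E f f)"
          using C\<Psi>(2)[OF r(1)] E_nonneg[OF f2(1)] by (intro mult_left_mono mult_right_mono) auto
        finally show "(\<Sum>s<n. jumpW (\<Psi> (\<kappa> * r)) (ball (x s) (Kg * r)) f) \<le> real Ng * (C\<Psi> * \<Psi> r * E f f)" .
      qed (use C3 Cg Pr in simp)
      also have "\<dots> = C3 * Cg * (real Ng * C\<Psi>) * E f f" using Pr by simp
      finally show ?thesis .
    qed
    \<comment> \<open>The net points whose small ball meets \<open>K\<close>; their bumps add up to
      a test function that is at least 1 on \<open>K\<close>.\<close>
    define J where "J = {s. s < n \<and> (\<exists>\<xi>\<in>K. \<xi> \<in> ball (x s) (\<eta> / 2 * r))}"
    have J: "J \<subseteq> {..<n}" "finite J" by (auto simp: J_def)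
    define W where "W = {y. r / (4 * A\<^sup>2) \<le> infdist y (- U) \<and> infdist y (- U) \<le> (Kl + 3 * lc) * r}"
    have "closed W" unfolding W_def by (intro closed_Collect_conj closed_Collect_le continuous_intros)
    then have Wb: "W \<in> sets borel" by simp
    have Lu: "Lf u (G J) \<le> C3 * Cl * real Nl * (jumpW (\<Psi> (\<tau> * r) / 2 ^ k) W f / (\<Psi> (\<tau> * r) / 2 ^ k))" for k
    proof -
      let ?s = "\<Psi> (\<tau> * r) / 2 ^ k"
      have tr: "\<tau> * r > 0" using t r by simp
      have s: "?s > 0" using \<Psi>_pos[OF tr] by simp
      define Ws where "Ws s = {y. r / (4 * A\<^sup>2) \<le> infdist y (- U)} \<inter> ball (x s) (Kl * r)" for s
      have "closed {y. r / (4 * A\<^sup>2) \<le> infdist y (- U)}" by (intro closed_Collect_le continuous_intros)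
      then have Wsb: "Ws s \<in> sets borel" for s unfolding Ws_def by (intro sets.Int borel_closed borel_open) auto
      have WsW: "Ws s \<subseteq> W" if sJ: "s \<in> J" for s
      proof
        fix y assume y: "y \<in> Ws s"
        obtain \<xi> where xi: "\<xi> \<in> K" "dist (x s) \<xi> < \<eta> / 2 * r" using sJ by (auto simp: J_def)
        have "open U" using U(1) by (simp add: A_uniform_domain_def)
        then have "\<xi> \<in> - U" using xi K by (auto simp: frontier_def interior_open)
        then have "infdist y (- U) \<le> dist y \<xi>" by (rule infdist_le)
        also have "\<dots> \<le> dist (x s) y + dist (x s) \<xi>" by (metis dist_triangle2 dist_commute)
        also have "\<dots> \<le> Kl * r + 3 * lc * r"
        proof (rule add_mono)
          have "\<eta> / 2 * r \<le> 3 * lc * r" using e lc r by (intro mult_right_mono) auto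
          then show "dist (x s) \<xi> \<le> 3 * lc * r" using xi by simp
        qed (use y in \<open>simp add: Ws_def\<close>)
        finally show "y \<in> W" using y by (simp add: W_def Ws_def algebra_simps)
      qed
      have "Lf u (G J) \<le> real Nb ^ 4 * Cc * Dv * Cl / \<Psi> r * (\<Sum>s\<in>J. 2 ^ k * jumpW ?s (Ws s) f)"
        unfolding u_def G_def
      proof (rule pat.Lf_patch_sum[OF J(1) _ gF(1) gF(2) gF(3) g(3) g(5) q(2)])
        fix s i assume sJ: "s \<in> J" and i: "i \<in> pat.nbr s"
        then have s: "s \<in> pat.nbr s" by (intro pat.self_nbr) (auto simp: J_def)
        obtain \<xi> where xi: "\<xi> \<in> frontier U" "dist (x s) \<xi> < \<eta> / 2 * r" using sJ K(1) by (auto simp: J_def)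
        \<comment> \<open>Neighbours of a net point close to \<open>K\<close> are still within
          \<open>3 * lc * r\<close> of the boundary, so all averages compared here are taken at
          corkscrew points.\<close>
        have zz: "z j \<in> U \<and> r / A \<le> infdist (z j) (- U)" if "j \<in> pat.nbr s" for j
        proof (rule zU[OF xi(1)])
          have "dist (x j) \<xi> < 2 * lc * r + \<eta> / 2 * r"
            using that xi(2) dist_triangle[of "x j" \<xi> "x s"] by (simp add: pat.nbr_def)
          also have "\<dots> \<le> 2 * lc * r + lc * r" using e lc r by (intro add_left_mono mult_right_mono) auto
          finally show "dist (x j) \<xi> < 3 * lc * r" by simp
        qed
        show "(a i - a s)\<^sup>2 \<le> Cl / vol (x s) r * (2 ^ k * jumpW ?s (Ws s) f)"
          unfolding a_def \<sigma>_def Ws_def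
          using loc[OF r(1) f2(2,3) _ _ _ _ znear[OF i] znear[OF s], of k] zz[OF i] zz[OF s] by blast
      qed
      also have "\<dots> = C3 * Cl / \<Psi> r * 2 ^ k * (\<Sum>s\<in>J. jumpW ?s (Ws s) f)"
        by (simp add: C3_def sum_distrib_left[symmetric] del: times_divide_eq_left)
      also have "\<dots> \<le> C3 * Cl / \<Psi> r * 2 ^ k * (real Nl * jumpW ?s W f)"
      proof (rule mult_left_mono)
        show "(\<Sum>s\<in>J. jumpW ?s (Ws s) f) \<le> real Nl * jumpW ?s W f"
        proof (rule jumpW_sum_le[OF s f2(2) J(2) Wsb Wb WsW])
          fix y
          have "card {j \<in> J. y \<in> Ws j} \<le> card {j. j < n \<and> dist (x j) y < Kl * r}"
            by (rule card_mono) (auto simp: J_def Ws_def)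
          then show "card {j \<in> J. y \<in> Ws j} \<le> Nl" using Nl[OF r(1) x, of y] by simp
        qed
      qed (use C3 Cl Pr in simp)
      \<comment> \<open>\<open>2 ^ k / \<Psi> r\<close> equals \<open>1 / ?s\<close> times
        \<open>\<Psi> (\<tau> * r) / \<Psi> r\<close>, and the last quotient is at most 1 because
        \<open>\<tau> \<le> 1\<close>.\<close>
      also have "\<dots> = C3 * Cl * real Nl * (\<Psi> (\<tau> * r) / \<Psi> r * (jumpW ?s W f / ?s))"
        using \<Psi>_pos[OF tr] Pr by (simp add: field_simps)
      also have "\<dots> \<le> C3 * Cl * real Nl * (1 * (jumpW ?s W f / ?s))"
      proof (intro mult_left_mono mult_right_mono)
        have "\<tau> * r \<le> r" using t r by simp
        then show "\<Psi> (\<tau> * r) / \<Psi> r \<le> 1" using \<Psi>_mono[OF tr] Pr by simp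
        show "0 \<le> jumpW ?s W f / ?s" using s by (intro divide_nonneg_pos jumpW_nonneg)
      qed (use C3 Cl in simp)
      finally show ?thesis by simp
    qed
    have CE: "C3 * Cg * (real Ng * C\<Psi>) \<le> C" "C3 * Cl * real Nl \<le> C" using C3 Cg Cl C\<Psi> by (simp_all add: C_def)
    have res1: "E u u \<le> C * E f f" using Eu mult_right_mono[OF CE(1) E_nonneg[OF f2(1)]] by linarith
    have res2: "Lf u (G J) \<le> C * (jumpW (\<Psi> (\<tau> * r) / 2 ^ k) W f / (\<Psi> (\<tau> * r) / 2 ^ k))" for k
    proof -
      have "\<Psi> (\<tau> * r) / 2 ^ k > 0" using \<Psi>_pos[of "\<tau> * r"] t r by simp
      then have "jumpW (\<Psi> (\<tau> * r) / 2 ^ k) W f / (\<Psi> (\<tau> * r) / 2 ^ k) \<ge> 0" by (intro divide_nonneg_pos jumpW_nonneg)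
      then show ?thesis using Lu[of k] mult_right_mono[OF CE(2)] order_trans by blast
    qed
    have "1 \<le> G J y" if y: "y \<in> K" for y
    proof -
      have "c \<ge> 0" using c0 by simp
      then have "y \<in> ball x0 R1" using y K(2) by (auto simp: R1_def)
      then obtain s where "s < n" "y \<in> ball (x s) (\<eta> / 2 * r)" using cov1 by blast
      moreover from this have "s \<in> J" using y unfolding J_def by blast
      ultimately show ?thesis using Gge[OF J(2)] by blast
    qed
    moreover have "0 \<le> G J y" for y unfolding G_def by (intro sum_nonneg g(2))
    ultimately show "\<exists>u\<in>F. \<exists>g\<in>F \<inter> C_c. bdd u \<and> E u u \<le> C * E f f \<and> (\<forall>y. \<bar>u y - f y\<bar> \<le> \<omega>) \<and> (\<forall>y. y \<notin> ball x0 (R + c) \<longrightarrow> u y = 0) \<and>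
        (\<forall>y. 0 \<le> g y) \<and> (\<forall>y\<in>K. 1 \<le> g y) \<and>
        (\<forall>n. Lf u g \<le> C * (jumpW (\<Psi> (\<tau> * r) / 2 ^ n) {y. r / (4 * A\<^sup>2) \<le> infdist y (- U) \<and> infdist y (- U) \<le> (Kl + 3 * lc) * r} f / (\<Psi> (\<tau> * r) / 2 ^ n)))"
      using uF(1,2) GF(1)[OF J(2)] res1 res2 ucl uz unfolding W_def by (intro bexI[of _ u] bexI[of _ "G J"]) auto
  qed (use t R0 in auto)
qed

end

section \<open>Sets of small energy, and the choice of a layer\<close>

context heat_space
begin

text \<open>Expresses through a test function that the energy measure of \<open>v\<close> gives
  \<open>K\<close> mass at most \<open>\<epsilon>\<close>. The normalisation
  \<open>g y \<le> 1\<close> allows \<open>Lf\<close> to be bounded by the full energy in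
  \<open>thin_perturb\<close>.\<close>

definition thin :: "'a set \<Rightarrow> ('a \<Rightarrow> real) \<Rightarrow> real \<Rightarrow> bool" where
  "thin K v \<epsilon> \<longleftrightarrow> (\<exists>g\<in>F \<inter> C_c. (\<forall>y. 0 \<le> g y) \<and> (\<forall>y. g y \<le> 1) \<and> (\<forall>y\<in>K. g y = 1) \<and> Lf v g \<le> \<epsilon>)"

lemma thin_I:
  assumes v: "v \<in> F" "bdd v" and g: "g \<in> F \<inter> C_c" "\<And>y. 0 \<le> g y" "\<And>y. y \<in> K \<Longrightarrow> 1 \<le> g y" "Lf v g \<le> \<epsilon>"
  shows "thin K v \<epsilon>"
  unfolding thin_def
proof (intro bexI conjI allI ballI)
  show h: "(\<lambda>y. min (g y) 1) \<in> F \<inter> C_c" using g(1) by (auto intro: F_min_const C_c_min_const)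
  have "Lf v (\<lambda>y. min (g y) 1) \<le> Lf v g" by (rule Lf_mono[OF v]) (use g(1) h C_c_bdd in auto)
  then show "Lf v (\<lambda>y. min (g y) 1) \<le> \<epsilon>" using g(4) by linarith
qed (use g(2,3) in auto)

lemma thin_mono: "thin K v \<epsilon> \<Longrightarrow> \<epsilon> \<le> \<epsilon>' \<Longrightarrow> thin K v \<epsilon>'"
  unfolding thin_def by (meson order_trans)

text \<open>The minimum of the two test functions works for both, by monotonicity of
  \<open>Lf\<close> in the test function and convexity in the other argument.\<close>

lemma thin_midpoint:
  assumes v: "v \<in> F" "bdd v" and w: "w \<in> F" "bdd w" and t: "thin K v \<epsilon>" "thin K w \<epsilon>"
  shows "thin K (\<lambda>x. (v x + w x) / 2) \<epsilon>"
proof -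
  obtain g where g: "g \<in> F \<inter> C_c" "\<And>y. 0 \<le> g y" "\<And>y. y \<in> K \<Longrightarrow> g y = 1" "Lf v g \<le> \<epsilon>" using t(1) unfolding thin_def by blast
  obtain h where h: "h \<in> F \<inter> C_c" "\<And>y. 0 \<le> h y" "\<And>y. y \<in> K \<Longrightarrow> h y = 1" "Lf w h \<le> \<epsilon>" using t(2) unfolding thin_def by blast
  let ?k = "\<lambda>y. min (g y) (h y)"
  have k: "?k \<in> F \<inter> C_c" using g(1) h(1) by (auto intro: F_min C_c_min)
  have b: "bdd g" "bdd h" "bdd ?k" using g(1) h(1) k C_c_bdd by auto
  have "bdd (\<lambda>x. (v x + w x) / 2)" using bdd_scale[OF bdd_add[OF v(2) w(2)], of "1/2"] by simp
  moreover have "Lf (\<lambda>x. (v x + w x) / 2) ?k \<le> Lf v ?k / 2 + Lf w ?k / 2"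
    by (rule Lf_midpoint[OF v w]) (use k b g h in auto)
  moreover have "Lf v ?k \<le> Lf v g" "Lf w ?k \<le> Lf w h"
    by (rule Lf_mono[OF v] Lf_mono[OF w], use g(1) h(1) k b in auto)+
  ultimately have "bdd (\<lambda>x. (v x + w x) / 2)" "Lf (\<lambda>x. (v x + w x) / 2) ?k \<le> \<epsilon>" using g(4) h(4) by linarith+
  then show ?thesis by (intro thin_I[OF E.V_midpoint[OF v(1) w(1)] _ k]) (use g h in auto)
qed

lemma thin_perturb:
  assumes f: "f \<in> F" "bdd f" and v: "v \<in> F" "bdd v" and t: "thin K v \<epsilon>"
  shows "thin K f (2 * \<epsilon> + 2 * E (\<lambda>x. f x - v x) (\<lambda>x. f x - v x))"
proof -
  obtain g where g: "g \<in> F \<inter> C_c" "\<And>y. 0 \<le> g y" "\<And>y. g y \<le> 1" "\<And>y. y \<in> K \<Longrightarrow> g y = 1" "Lf v g \<le> \<epsilon>" using t unfolding thin_def by blast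
  have gF: "g \<in> F" "bdd g" using g(1) C_c_bdd by auto
  have d: "(\<lambda>x. f x - v x) \<in> F" "bdd (\<lambda>x. f x - v x)" by (rule E.V_diff[OF f(1) v(1)] bdd_diff[OF f(2) v(2)])+
  have "Lf (\<lambda>x. v x + (f x - v x)) g \<le> 2 * Lf v g + 2 * Lf (\<lambda>x. f x - v x) g" by (rule Lf_add_le[OF v d gF g(2)])
  moreover have "Lf (\<lambda>x. f x - v x) g \<le> 1 * E (\<lambda>x. f x - v x) (\<lambda>x. f x - v x)" by (rule Lf_le[OF d gF g(3)]) simp
  moreover have "Lf f g = Lf (\<lambda>x. v x + (f x - v x)) g" by simp
  ultimately have "Lf f g \<le> 2 * \<epsilon> + 2 * E (\<lambda>x. f x - v x) (\<lambda>x. f x - v x)" using g(5) by linarith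
  then show ?thesis by (intro thin_I[OF f g(1,2)]) (use g(4) in auto)
qed

text \<open>The approximating sets are closed under midpoints, so weak convergence of the approximations can be
  improved to convergence in the form norm by \<open>weak_closure\<close>.\<close>

lemma thin_limit:
  assumes f: "f \<in> F" "bdd f" and e: "\<epsilon> > 0"
    and app: "\<And>\<epsilon>. \<epsilon> > 0 \<Longrightarrow> \<exists>v\<in>F. bdd v \<and> E v v \<le> C \<and> L2_inner m (\<lambda>x. v x - f x) (\<lambda>x. v x - f x) \<le> \<epsilon> \<and> thin K v \<epsilon>"
  shows "thin K f \<epsilon>"
proof -
  \<comment> \<open>The same \<open>1 / (n + 1)\<close> bounds the \<open>L2\<close> distance and
    the energy at \<open>K\<close>, so the sets shrink, and midpoints preserve every
    condition.\<close>
  define V where "V n = {v \<in> F. bdd v \<and> E v v \<le> C \<and> L2_inner m (\<lambda>x. v x - f x) (\<lambda>x. v x - f x) \<le> 1 / (real n + 1) \<and> thin K v (1 / (real n + 1))}"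
    for n :: nat
  have "f \<in> F \<and> (\<exists>v. (\<forall>n. v n \<in> V n) \<and> (\<lambda>n. E1 m E (\<lambda>x. v n x - f x) (\<lambda>x. v n x - f x)) \<longlonglongrightarrow> 0)"
  proof (rule weak_closure[OF F_L2[OF f(1)]])
    show "V (Suc n) \<subseteq> V n" for n
    proof -
      have "1 / (real (Suc n) + 1) \<le> 1 / (real n + 1)" by (simp add: field_simps)
      then show ?thesis unfolding V_def by (auto intro: thin_mono)
    qed
    show "V n \<noteq> {}" for n using app[of "1 / (real n + 1)"] unfolding V_def by auto
    show "(\<lambda>x. (v x + w x) / 2) \<in> V n" if vw: "v \<in> V n" "w \<in> V n" for n v w
    proof -
      have F2: "v \<in> F" "w \<in> F" "bdd v" "bdd w" using vw by (auto simp: V_def)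
      have "E (\<lambda>x. (v x + w x) / 2) (\<lambda>x. (v x + w x) / 2) \<le> C"
        using E.B_midpoint_le[OF F2(1,2)] vw by (auto simp: V_def)
      moreover have "L2_inner m (\<lambda>x. (v x + w x) / 2 - f x) (\<lambda>x. (v x + w x) / 2 - f x) \<le> 1 / (real n + 1)"
        by (rule L2_midpoint_near) (use vw F_L2 f in \<open>auto simp: V_def\<close>)
      moreover have "thin K (\<lambda>x. (v x + w x) / 2) (1 / (real n + 1))"
        by (rule thin_midpoint) (use vw F2 in \<open>auto simp: V_def\<close>)
      moreover have "bdd (\<lambda>x. (v x + w x) / 2)" using bdd_scale[OF bdd_add[OF F2(3,4)], of "1/2"] by simp
      ultimately show ?thesis using E.V_midpoint[OF F2(1,2)] by (simp add: V_def)
    qed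
  qed (auto simp: V_def)
  then obtain v where v: "\<And>n. v n \<in> V n" and lim: "(\<lambda>n. E1 m E (\<lambda>x. v n x - f x) (\<lambda>x. v n x - f x)) \<longlonglongrightarrow> 0" by blast
  have vF: "v n \<in> F" "bdd (v n)" "thin K (v n) (1 / (real n + 1))" for n using v[of n] by (auto simp: V_def)
  have "(\<lambda>n. 2 * (1 / (real n + 1)) + 2 * E (\<lambda>x. v n x - f x) (\<lambda>x. v n x - f x)) \<longlonglongrightarrow> 2 * 0 + 2 * 0"
    using LIMSEQ_inverse_real_of_nat
    by (intro tendsto_intros E1_convergence(1)[OF vF(1) f(1) lim]) (simp add: inverse_eq_divide add.commute)
  then have "\<forall>\<^sub>F n in sequentially. 2 * (1 / (real n + 1)) + 2 * E (\<lambda>x. v n x - f x) (\<lambda>x. v n x - f x) < \<epsilon>"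
    using e by (auto dest: order_tendstoD)
  then obtain n where n: "2 * (1 / (real n + 1)) + 2 * E (\<lambda>x. v n x - f x) (\<lambda>x. v n x - f x) < \<epsilon>"
    by (auto simp: eventually_sequentially)
  then have n': "2 * (1 / (real n + 1)) + 2 * E (\<lambda>x. f x - v n x) (\<lambda>x. f x - v n x) \<le> \<epsilon>"
    using E.B_diff_commute[OF f(1) vF(1)[of n]] by simp
  show ?thesis by (rule thin_mono[OF thin_perturb[OF f vF] n'])
qed

text \<open>Pigeonhole: at one common time \<open>s\<close> the discrete energies of disjoint layers
  add up to at most \<open>s * E f f\<close>, so among \<open>N > E f f / \<epsilon>\<close> layers
  one has at most \<open>\<epsilon> * s\<close>. This \<open>s\<close> is a dyadic fraction of
  \<open>1 / 2 ^ (k * b)\<close> for each \<open>k\<close> in question, and how large the exponent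
  \<open>n\<close> becomes is not controlled.\<close>

lemma jumpW_disjoint_small:
  assumes f: "f \<in> F" and S: "\<And>k. S k \<in> sets borel" "\<And>y k l. y \<in> S k \<Longrightarrow> y \<in> S l \<Longrightarrow> k = l" and e: "\<epsilon> > 0"
  obtains k n where "k \<ge> k0" "jumpW (1 / 2 ^ (k * b) / 2 ^ n) (S k) f / (1 / 2 ^ (k * b) / 2 ^ n) \<le> \<epsilon>"
proof -
  obtain N :: nat where N: "E f f < real N * \<epsilon>" using e by (metis reals_Archimedean3)
  define s where "s = (1 :: real) / 2 ^ ((k0 + N) * b)"
  have s: "s > 0" by (simp add: s_def)
  have "\<exists>k\<in>{k0..<k0 + N}. jumpW s (S k) f \<le> \<epsilon> * s"
  proof (rule ccontr)
    assume "\<not> ?thesis"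
    then have "\<epsilon> * s \<le> jumpW s (S k) f" if "k \<in> {k0..<k0 + N}" for k using that by force
    then have "(\<Sum>k\<in>{k0..<k0 + N}. \<epsilon> * s) \<le> (\<Sum>k\<in>{k0..<k0 + N}. jumpW s (S k) f)" by (rule sum_mono)
    also have "\<dots> \<le> real 1 * jumpW s UNIV f"
    proof (rule jumpW_sum_le[OF s F_L2[OF f]])
      fix y
      have "is_singleton {j \<in> {k0..<k0 + N}. y \<in> S j} \<or> {j \<in> {k0..<k0 + N}. y \<in> S j} = {}"
        unfolding is_singleton_def using S(2) by blast
      then show "card {j \<in> {k0..<k0 + N}. y \<in> S j} \<le> 1"
        by (elim disjE) (simp_all only: is_singleton_altdef card.empty order_refl zero_le)
    qed (use S in auto)
    also have "\<dots> \<le> s * E f f" using jumpW_le_E[OF s f, of UNIV] by simp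
    finally have "real N * \<epsilon> * s \<le> E f f * s" by (simp add: ac_simps)
    then show False using N s by simp
  qed
  then obtain k where k: "k0 \<le> k" "k < k0 + N" "jumpW s (S k) f \<le> \<epsilon> * s" by auto
  have "k * b + (k0 + N - k) * b = (k0 + N) * b" using k by (simp flip: add_mult_distrib)
  then have "(1 :: real) / 2 ^ (k * b) / 2 ^ ((k0 + N - k) * b) = s" by (simp add: s_def flip: power_add)
  then have "jumpW (1 / 2 ^ (k * b) / 2 ^ ((k0 + N - k) * b)) (S k) f / (1 / 2 ^ (k * b) / 2 ^ ((k0 + N - k) * b)) \<le> \<epsilon>"
    using k(3) s by (simp add: pos_divide_le_eq)
  then show thesis using that k(1) by blast
qed

end

section \<open>Vanishing of the energy on the boundary\<close>

context hke_space
begin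

lemma thin_boundary_C_c:
  assumes U: "A_uniform_domain A U" "A \<ge> 1" and ne: "frontier U \<noteq> {}"
    and f: "f \<in> F \<inter> C_c" and K: "compact K" "K \<subseteq> frontier U" and e: "\<epsilon> > 0"
  shows "thin K f \<epsilon>"
proof -
  obtain \<tau> c q C R0 where con: "0 < \<tau>" "0 < c" "0 < q" "0 < C" "0 < R0"
    and app: "\<And>f K r \<omega> x0 R. f \<in> F \<inter> C_c \<Longrightarrow> K \<subseteq> frontier U \<Longrightarrow> K \<subseteq> ball x0 R \<Longrightarrow> R > 0 \<Longrightarrow>
      (\<And>y. y \<notin> ball x0 R \<Longrightarrow> f y = 0) \<Longrightarrow> 0 < r \<Longrightarrow> r \<le> R0 \<Longrightarrow> r \<le> 1 \<Longrightarrow>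
      (\<And>y z. dist y z < c * r \<Longrightarrow> \<bar>f y - f z\<bar> \<le> \<omega>) \<Longrightarrow>
      \<exists>u\<in>F. \<exists>g\<in>F \<inter> C_c. bdd u \<and> E u u \<le> C * E f f \<and> (\<forall>y. \<bar>u y - f y\<bar> \<le> \<omega>) \<and> (\<forall>y. y \<notin> ball x0 (R + c) \<longrightarrow> u y = 0) \<and>
        (\<forall>y. 0 \<le> g y) \<and> (\<forall>y\<in>K. 1 \<le> g y) \<and>
        (\<forall>n. Lf u g \<le> C * (jumpW (\<Psi> (\<tau> * r) / 2 ^ n) {y. r / (4 * A\<^sup>2) \<le> infdist y (- U) \<and> infdist y (- U) \<le> q * r} f / (\<Psi> (\<tau> * r) / 2 ^ n)))"
  proof (rule approximant[OF U ne], goal_cases)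
    case (1 \<tau> c q C R0)
    show ?case by (rule 1(1)[OF 1(2-7)])
  qed
  have f2: "f \<in> F" "bdd f" "bsupp f" "f \<in> C_c" using f C_c_bdd C_c_bsupp by auto
  have A2: "4 * A\<^sup>2 > 0" using U(2) by simp
  \<comment> \<open>Layers at depths between \<open>r / (4 * A\<^sup>2)\<close> and
    \<open>q * r\<close> are disjoint for two radii whose quotient exceeds
    \<open>4 * A\<^sup>2 * q\<close>; adding 1 gives \<open>Q > 1\<close>.\<close>
  define Q where "Q = 4 * A\<^sup>2 * q + 1"
  have Q: "Q > 1" using A2 con(3) by (simp add: Q_def)
  obtain C\<Psi> where C\<Psi>: "C\<Psi> > 0" "\<And>r. r > 0 \<Longrightarrow> \<Psi> (Q * r) \<le> C\<Psi> * \<Psi> r" using \<Psi>_compare[of Q] Q by auto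
  obtain b :: nat where b: "C\<Psi> < 2 ^ b" using real_arch_pow[of 2 C\<Psi>] by auto
  define t where "t k = (1 :: real) / 2 ^ (k * b)" for k
  \<comment> \<open>The radii are defined through their times, so that
    \<open>\<Psi> (\<tau> * r k)\<close> is exactly \<open>1 / 2 ^ (k * b)\<close> and all layers
    share dyadic times; the choice of \<open>b\<close> makes consecutive radii drop by more than the
    factor \<open>Q\<close>.\<close>
  define r where "r k = scale_inv \<Psi> (t k) / \<tau>" for k
  have t0: "t k > 0" for k by (simp add: t_def)
  have si: "scale_inv \<Psi> (t k) > 0" for k by (rule scale_inv_pos[OF t0])
  have r0: "r k > 0" for k using si con(1) by (simp add: r_def)
  have tr: "\<Psi> (\<tau> * r k) = t k" for k using con(1) \<Psi>_scale_inv[OF t0] by (simp add: r_def)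
  have shrink: "Q * r (Suc k) < r k" for k
  proof -
    have "\<Psi> (Q * scale_inv \<Psi> (t (Suc k))) \<le> C\<Psi> * t (Suc k)" using C\<Psi>(2)[OF si[of "Suc k"]] \<Psi>_scale_inv[OF t0] by simp
    also have "\<dots> < 2 ^ b * t (Suc k)" using b t0 by (intro mult_strict_right_mono)
    also have "\<dots> = t k" by (simp add: t_def power_add)
    also have "\<dots> = \<Psi> (scale_inv \<Psi> (t k))" using \<Psi>_scale_inv[OF t0] by simp
    finally have "Q * scale_inv \<Psi> (t (Suc k)) < scale_inv \<Psi> (t k)"
      using \<Psi>_less_iff[of "Q * scale_inv \<Psi> (t (Suc k))" "scale_inv \<Psi> (t k)"] si Q by simp
    then show ?thesis using con(1) by (simp add: r_def divide_strict_right_mono)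
  qed
  have step: "r (Suc k) \<le> r k / Q" for k using shrink[of k] Q by (simp add: pos_le_divide_eq mult.commute)
  have "r (Suc k) \<le> r k" for k using shrink[of k] mult_right_mono[of 1 Q "r (Suc k)"] Q r0[of "Suc k"] by (simp only: mult_1_left) linarith
  then have dec: "r l \<le> r k" if "k \<le> l" for k l using that by (rule lift_Suc_antimono_le)
  have pow: "r k \<le> r 0 * (1 / Q) ^ k" for k
  proof (induction k)
    case (Suc k)
    have "r (Suc k) \<le> r k / Q" by (rule step)
    also have "\<dots> \<le> (r 0 * (1 / Q) ^ k) / Q" using Suc Q by (intro divide_right_mono) auto
    finally show ?case by simp
  qed simp
  have "(\<lambda>k. r 0 * (1 / Q) ^ k) \<longlonglongrightarrow> r 0 * 0" by (intro tendsto_intros LIMSEQ_realpow_zero) (use Q in auto)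
  then have rlim: "r \<longlonglongrightarrow> 0"
    by (intro tendsto_sandwich[OF _ _ tendsto_const, of 0 r]) (use pow r0 in \<open>auto intro!: always_eventually less_imp_le\<close>)
  define S where "S k = {y. r k / (4 * A\<^sup>2) \<le> infdist y (- U) \<and> infdist y (- U) \<le> q * r k}" for k
  have "closed (S k)" for k unfolding S_def by (intro closed_Collect_conj closed_Collect_le continuous_intros)
  then have Sb: "S k \<in> sets borel" for k by simp
  have apart: "False" if "k < l" "y \<in> S k" "y \<in> S l" for k l y
  proof -
    have "r k \<le> infdist y (- U) * (4 * A\<^sup>2)" using that(2) A2 unfolding S_def by (simp add: pos_divide_le_eq)
    also have "\<dots> \<le> q * r l * (4 * A\<^sup>2)" using that(3) A2 unfolding S_def by (intro mult_right_mono) auto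
    also have "\<dots> \<le> Q * r l" using r0[of l] by (simp add: Q_def algebra_simps)
    also have "\<dots> \<le> Q * r (Suc k)" using dec[of "Suc k" l] that(1) Q by (intro mult_left_mono) auto
    finally show False using shrink[of k] by simp
  qed
  have dis: "k = l" if "y \<in> S k" "y \<in> S l" for y k l using apart[of k l y] apart[of l k y] that by (cases k l rule: linorder_cases) auto
  have "bounded ({x. f x \<noteq> 0} \<union> K)" using f2(3) compact_imp_bounded[OF K(1)] by (simp add: bsupp_def)
  \<comment> \<open>\<open>undefined\<close> serves as an arbitrary centre.\<close>
  then obtain R where R: "R > 0" "{x. f x \<noteq> 0} \<union> K \<subseteq> ball undefined R" using bounded_subset_ballD by metis
  let ?B = "ball undefined (R + c)"
  define V where "V = measure m ?B"
  have V: "V \<ge> 0" by (simp add: V_def)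
  show ?thesis
  proof (rule thin_limit[OF f2(1,2) e])
    fix \<epsilon> :: real assume e: "\<epsilon> > 0"
    \<comment> \<open>A uniform error \<open>\<omega>\<close> on a ball of measure \<open>V\<close>
      has squared \<open>L2\<close> norm at most \<open>\<epsilon>\<close>; the added 1 keeps the
      denominator positive.\<close>
    define \<omega> where "\<omega> = sqrt (\<epsilon> / (V + 1))"
    have w: "\<omega> > 0" "\<omega>\<^sup>2 = \<epsilon> / (V + 1)" using e V by (simp_all add: \<omega>_def)
    obtain d where d: "d > 0" "\<And>y z. dist y z < d \<Longrightarrow> \<bar>f y - f z\<bar> \<le> \<omega>" using C_c_uniform[OF f2(4) w(1)] by metis
    have "\<forall>\<^sub>F k in sequentially. r k < min (min R0 1) (d / c)"
      by (rule order_tendstoD(2)[OF rlim]) (use con d in auto)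
    then obtain k0 where k0: "\<And>k. k \<ge> k0 \<Longrightarrow> r k < min (min R0 1) (d / c)" by (auto simp: eventually_sequentially)
    have eC: "\<epsilon> / C > 0" using e con by simp
    obtain k n where k: "k \<ge> k0" "jumpW (1 / 2 ^ (k * b) / 2 ^ n) (S k) f / (1 / 2 ^ (k * b) / 2 ^ n) \<le> \<epsilon> / C"
      by (rule jumpW_disjoint_small[where S = S, OF f2(1) Sb dis eC])
    have rk: "r k \<le> R0" "r k \<le> 1" "c * r k < d" using k0[OF k(1)] con by (auto simp: field_simps)
    have osc: "\<bar>f y - f z\<bar> \<le> \<omega>" if "dist y z < c * r k" for y z using d(2)[of y z] that rk(3) by simp
    have fz: "f y = 0" if "y \<notin> ball undefined R" for y using that R(2) by auto
    have KR: "K \<subseteq> ball undefined R" using R(2) by simp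
    obtain u g where u: "u \<in> F" "bdd u" "E u u \<le> C * E f f" "\<And>y. \<bar>u y - f y\<bar> \<le> \<omega>" "\<And>y. y \<notin> ?B \<Longrightarrow> u y = 0"
      and g: "g \<in> F \<inter> C_c" "\<And>y. 0 \<le> g y" "\<And>y. y \<in> K \<Longrightarrow> 1 \<le> g y"
      and Lu: "\<And>n. Lf u g \<le> C * (jumpW (\<Psi> (\<tau> * r k) / 2 ^ n) (S k) f / (\<Psi> (\<tau> * r k) / 2 ^ n))"
      using app[OF f K(2) KR R(1) fz r0 rk(1,2) osc] unfolding S_def by blast
    have "Lf u g \<le> C * (\<epsilon> / C)"
      using order_trans[OF Lu[of n, unfolded tr t_def] mult_left_mono[OF k(2)]] con by simp
    then have "thin K u \<epsilon>" using con by (intro thin_I[OF u(1,2) g]) auto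
    moreover have "L2_inner m (\<lambda>x. u x - f x) (\<lambda>x. u x - f x) \<le> \<epsilon>"
    proof -
      have ib: "integrable m (\<lambda>x. \<omega>\<^sup>2 * indicat_real ?B x)" by (intro integrable_mult_right integrable_indicator_bounded) auto
      have "L2_inner m (\<lambda>x. u x - f x) (\<lambda>x. u x - f x) \<le> (\<integral>x. \<omega>\<^sup>2 * indicat_real ?B x \<partial>m)"
        unfolding L2_inner_def
      proof (rule integral_mono[OF _ ib])
        show "integrable m (\<lambda>x. (u x - f x) * (u x - f x))"
          using L2_mult_integrable[OF F_L2 F_L2] E.V_diff[OF u(1) f2(1)] by blast
        fix y
        show "(u y - f y) * (u y - f y) \<le> \<omega>\<^sup>2 * indicat_real ?B y"
        proof (cases "y \<in> ?B")
          case True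
          have "(u y - f y)\<^sup>2 \<le> \<omega>\<^sup>2" using u(4)[of y] w(1) by (simp add: power2_le_iff_abs_le)
          then show ?thesis using True by (simp add: power2_eq_square)
        next
          case False
          then have "u y = 0" "f y = 0" using u(5)[of y] fz[of y] con(2) by auto
          then show ?thesis by simp
        qed
      qed
      also have "\<dots> = \<epsilon> / (V + 1) * V" by (simp add: w(2) V_def space_m)
      also have "\<dots> \<le> \<epsilon>" using e V by (simp add: field_simps)
      finally show ?thesis .
    qed
    ultimately show "\<exists>v\<in>F. bdd v \<and> E v v \<le> C * E f f \<and> L2_inner m (\<lambda>x. v x - f x) (\<lambda>x. v x - f x) \<le> \<epsilon> \<and> thin K v \<epsilon>"
      using u(1-3) by blast
  qed
qed

text \<open>Continuity enters through the uniform approximation at small scales;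
  \<open>F \<inter> C_c\<close> is dense in the form norm, and \<open>thin_perturb\<close> absorbs
  the difference.\<close>

lemma thin_boundary:
  assumes U: "A_uniform_domain A U" "A \<ge> 1" and ne: "frontier U \<noteq> {}"
    and f: "f \<in> F" "bdd f" and K: "compact K" "K \<subseteq> frontier U" and e: "\<epsilon> > 0"
  shows "thin K f \<epsilon>"
proof -
  have e4: "\<epsilon> / 4 > 0" using e by simp
  obtain v where v: "v \<in> F \<inter> C_c" "E1 m E (\<lambda>x. f x - v x) (\<lambda>x. f x - v x) < \<epsilon> / 4" using regular_dense_F[OF f(1) e4] by blast
  have d: "(\<lambda>x. f x - v x) \<in> F" using E.V_diff[OF f(1)] v(1) by auto
  have "E (\<lambda>x. f x - v x) (\<lambda>x. f x - v x) < \<epsilon> / 4"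
    using v(2) L2_inner_self_nonneg[of m "\<lambda>x. f x - v x"] by (simp add: E1_def)
  then have le: "2 * (\<epsilon> / 4) + 2 * E (\<lambda>x. f x - v x) (\<lambda>x. f x - v x) \<le> \<epsilon>" by simp
  have "thin K v (\<epsilon> / 4)" by (rule thin_boundary_C_c[OF U ne v(1) K e4])
  then show ?thesis using thin_mono[OF thin_perturb[OF f _ _] le] v(1) C_c_bdd by blast
qed

lemma energy_measure_boundary:
  assumes U: "A_uniform_domain A U" "A \<ge> 1" and f: "f \<in> F"
  shows "energy_measure m E F f (frontier U) = 0"
proof (rule energy_measure_zero[OF frontier_closed _ f])
  fix f K and \<epsilon> :: real
  assume f: "f \<in> F" "bdd f" and K: "compact K" "K \<subseteq> frontier U" and e: "\<epsilon> > 0"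
  show "\<exists>g\<in>F \<inter> C_c. (\<forall>x. g x \<ge> 0) \<and> (\<forall>x\<in>K. g x \<ge> 1) \<and> Lf f g \<le> \<epsilon>"
  \<comment> \<open>An empty boundary is treated apart, because the choice of scales in
    \<open>corkscrew\<close> starts from a boundary point.\<close>
  proof (cases "frontier U = {}")
    case True
    have "(\<lambda>x. 0 :: real) \<in> C_c" by (simp add: C_c_def)
    then show ?thesis using True K(2) e E.V_zero Lf_zero[OF f] by (intro bexI[of _ "\<lambda>x. 0"]) auto
  next
    case False
    obtain g where "g \<in> F \<inter> C_c" "\<And>y. 0 \<le> g y" "\<And>y. y \<in> K \<Longrightarrow> g y = 1" "Lf f g \<le> \<epsilon>"
      using thin_boundary[OF U False f K e] unfolding thin_def by blast
    then show ?thesis by (intro bexI[of _ g]) auto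
  qed
qed

end

theorem theorem2p9:
  fixes m :: "'a::metric_space measure"
    and E :: "('a \<Rightarrow> real) \<Rightarrow> ('a \<Rightarrow> real) \<Rightarrow> real"
    and F :: "('a \<Rightarrow> real) set"
    and \<Psi> :: "real \<Rightarrow> real"
    and U :: "'a set"
    and f :: "'a \<Rightarrow> real"
  assumes "mmd_space m E F"
    and "scale_function \<Psi>"
    and "HKE m E F \<Psi>"
    and "doubling m"
    and "uniform_domain U"
    and "f \<in> F"
  shows "energy_measure m E F f (frontier U) = 0"
proof -
  interpret mmd_space m E F by (rule assms(1))
  obtain C1 c1 c2 c3 \<delta> p where pos: "C1 > 0" "c1 > 0" "c2 > 0" "c3 > 0" "\<delta> > 0" and hk: "heat_kernel m E F p"
    and bounds: "\<And>t. t > 0 \<Longrightarrow> (AE x in m. AE y in m.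
              p t x y \<le> C1 / measure m (ball x (scale_inv \<Psi> t)) *
                        exp (- c1 * t * scale_Phi \<Psi> (c2 * (dist x y / t)))) \<and>
           (AE x in m. AE y in m. dist x y \<le> \<delta> * scale_inv \<Psi> t \<longrightarrow>
              p t x y \<ge> c3 / measure m (ball x (scale_inv \<Psi> t)))"
    using assms(3) unfolding HKE_def by blast
  obtain P where P: "associated_semigroup m E F P"
    "\<And>t f. t > 0 \<Longrightarrow> f \<in> L2 m \<Longrightarrow> AE x in m. integrable m (\<lambda>y. p t x y * f y) \<and> P t f x = (\<integral>y. p t x y * f y \<partial>m)"
    using hk unfolding heat_kernel_def by blast
  have p: "\<And>t. t > 0 \<Longrightarrow> (\<lambda>(x, y). p t x y) \<in> borel_measurable borel" "\<And>t x y. t > 0 \<Longrightarrow> p t x y \<ge> 0"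
    using hk unfolding heat_kernel_def by blast+
  obtain D0 :: real where D0: "D0 \<ge> 1" "\<And>x r. r > 0 \<Longrightarrow> emeasure m (ball x (2 * r)) \<le> ennreal D0 * emeasure m (ball x r)"
    using assms(4) unfolding doubling_def by blast
  obtain A where A: "A \<ge> 1" "A_uniform_domain A U" using assms(5) unfolding uniform_domain_def by blast
  interpret hke_space m E F P p \<Psi> C1 c1 c2 c3 \<delta> D0
  proof unfold_locales
    show "associated_semigroup m E F P" by (rule P(1))
    show "(\<lambda>(x, y). p t x y) \<in> borel_measurable borel" "p t x y \<ge> 0" if "t > 0" for t x y using p that by auto
    show "AE x in m. integrable m (\<lambda>y. p t x y * f y) \<and> P t f x = (\<integral>y. p t x y * f y \<partial>m)" if "t > 0" "f \<in> L2 m" for t f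
      by (rule P(2)[OF that])
    show "AE x in m. AE y in m. p t x y \<le> C1 / measure m (ball x (scale_inv \<Psi> t)) *
        exp (- c1 * t * scale_Phi \<Psi> (c2 * (dist x y / t)))" if "t > 0" for t by (rule conjunct1[OF bounds[OF that]])
    show "AE x in m. AE y in m. dist x y \<le> \<delta> * scale_inv \<Psi> t \<longrightarrow> p t x y \<ge> c3 / measure m (ball x (scale_inv \<Psi> t))" if "t > 0" for t
      by (rule conjunct2[OF bounds[OF that]])
    show "emeasure m (ball x (2 * r)) \<le> ennreal D0 * emeasure m (ball x r)" if "r > 0" for x r by (rule D0(2)[OF that])
  qed (use assms(2) pos D0(1) in auto)
  show ?thesis by (rule energy_measure_boundary[OF A(2,1) assms(6)])
qed

end
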